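(* Consider the functional linear model with individual functions $f_i(t)=\mathbf x_i^T\boldsymbol\beta(t)+v_i(t)$, $i=1,\dots,n$. Assume Conditions A and B hold, and the $p$-order local polynomial kernel (LPK) reconstructions $\hat f_i(t)$ use a bandwidth $h$ of exact order $n^{-\delta/(2p+3)}$. Let $\hat{\boldsymbol\beta}(t),\hat\gamma(s,t)$ be the estimators based on the reconstructions and $\tilde{\boldsymbol\beta}(t),\tilde\gamma(s,t)$ the "ideal" estimators based on the $f_i$ (all defined in the context). Then as $n\to\infty$, $$\hat{\boldsymbol\beta}(t)=\tilde{\boldsymbol\beta}(t)+n^{-(p+1)\delta/(2p+3)}O_{\mathrm{UP}}(1),\qquad \hat\gamma(s,t)=\tilde\gamma(s,t)+n^{-(p+1)\delta/(2p+3)}O_{\mathrm{UP}}(1).$$ In addition, assume $\delta>1+1/[2(p+1)]$. Then as $n\to\infty$, $$\sqrt n\{\hat{\boldsymbol\beta}(t)-\boldsymbol\beta(t)\}\sim\mathrm{AGP}(0,\boldsymbol\gamma_\beta),\qquad \boldsymbol\gamma_\beta(s,t)=\gamma(s,t)\boldsymbol\Omega^{-1}.$$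
   Context: Model. $\mathcal T=[a,b]$ with $-\infty<a<b<\infty$. Functional linear model: $y_i(t)=\mathbf x_i^T\boldsymbol\beta(t)+v_i(t)+\varepsilon_i(t)$, $i=1,\dots,n$, where $\mathbf x_i\in\mathbb R^q$ are time-independent covariate vectors, $\boldsymbol\beta(t)=[\beta_1(t),\dots,\beta_q(t)]^T$ is a vector of unknown smooth coefficient functions, the subject effects $v_i$ are i.i.d. copies of a stochastic process $v$ on $\mathcal T$ with mean $0$ and covariance function $\gamma(s,t)$, the $\varepsilon_i$ are i.i.d. copies of a process with mean $0$ and covariance function $\gamma_\varepsilon(s,t)=\sigma^2(t)1_{\{s=t\}}$, and $v_i$, $\varepsilon_i$ are independent. The individual functions are $f_i(t)=\mathbf x_i^T\boldsymbol\beta(t)+v_i(t)$. One observes $y_{ij}=f_i(t_{ij})+\varepsilon_{ij}$, $\varepsilon_{ij}=\varepsilon_i(t_{ij})$, at design time points $t_{ij}$, $j=1,\dots,n_i$, $i=1,\dots,n$. LPK reconstruction. $p$ is a fixed odd positive integer, $K$ a kernel, $h>0$ a bandwidth (common to all $i$), $K_h(\cdot)=K(\cdot/h)/h$. Put $\mathbf z_{ij}=[1,t_{ij}-t,\dots,(t_{ij}-t)^p]^T$, $\mathbf Z_i=[\mathbf z_{i1},\dots,\mathbf z_{in_i}]^T$, $\mathbf K_{ih}=\mathrm{diag}(K_h(t_{i1}-t),\dots,K_h(t_{in_i}-t))$, $\mathbf y_i=[y_{i1},\dots,y_{in_i}]^T$. Then $\hat f_i(t)=\mathbf e_{1,p+1}^T(\mathbf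 Z_i^T\mathbf K_{ih}\mathbf Z_i)^{-1}\mathbf Z_i^T\mathbf K_{ih}\mathbf y_i$, with $\mathbf e_{1,p+1}$ the first unit vector of $\mathbb R^{p+1}$. Estimators. $\mathbf X=[\mathbf x_1,\dots,\mathbf x_n]^T$ is assumed to have full rank; $\mathbf P=\mathbf X(\mathbf X^T\mathbf X)^{-1}\mathbf X^T$; $\hat{\mathbf f}=[\hat f_1,\dots,\hat f_n]^T$, $\mathbf f=[f_1,\dots,f_n]^T$. Then $\hat{\boldsymbol\beta}(t)=(\mathbf X^T\mathbf X)^{-1}\mathbf X^T\hat{\mathbf f}(t)$, $\hat\gamma(s,t)=(n-q)^{-1}\hat{\mathbf v}(s)^T\hat{\mathbf v}(t)$ with $\hat{\mathbf v}(t)=(\mathbf I_n-\mathbf P)\hat{\mathbf f}(t)$; and $\tilde{\boldsymbol\beta}(t)=(\mathbf X^T\mathbf X)^{-1}\mathbf X^T\mathbf f(t)$, $\tilde\gamma(s,t)=(n-q)^{-1}\tilde{\mathbf v}(s)^T\tilde{\mathbf v}(t)$ with $\tilde{\mathbf v}(t)=(\mathbf I_n-\mathbf P)\mathbf f(t)$. Notation. $O_{\mathrm{UP}}(1)$ means bounded in probability, as $n\to\infty$, uniformly for any $t$ (respectively $s,t$) within the interior of $\mathcal T$ and all $i=1,\dots,n$. $\mathrm{AGP}(\eta,\gamma)$ denotes an asymptotic (here vector-valued) Gaussian process with mean function $\eta$ and covariance function $\gamma$. Condition A. (1) The $t_{ij}$ are i.i.d. with p.d.f. $\pi$ with bounded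 support $\mathcal T$; for any $t$ in the interior of $\mathcal T$, $\pi'(t)$ exists and is continuous over $\mathcal T$. (2) For any interior points $s,t$ of $\mathcal T$: the individual functions $f_i$ and their mean function (here $\mathbf x_i^T\boldsymbol\beta(t)$) have up to $(p+1)$-times continuous derivatives; $\gamma(s,t)$ has up to $(p+1)$-times continuous derivatives for both $s$ and $t$; $\sigma^2$ is continuous at $t$. (3) $K$ is a bounded symmetric p.d.f. with bounded support $[-1,1]$. (4) There are constants $C,\delta>0$ with $n_i\ge Cn^\delta$ for all $i=1,\dots,n$; as $n\to\infty$, $h\to0$ and $n^\delta h\to\infty$. Condition B. (1) The covariate vectors $\mathbf x_i$ are i.i.d. with finite and invertible second moment $\mathrm E\,\mathbf x_1\mathbf x_1^T=\boldsymbol\Omega$; moreover they are uniformly bounded in probability, $\mathbf x_i=O_{\mathrm{UP}}(1)$. (2) The subject effects are uniformly bounded in probability, $v_i(t)=O_{\mathrm{UP}}(1)$.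
   Formalization: The two rates are uniform on compact subsets of the interior of T, or on all of it if smoothness and positivity of π extend to the end points (β(t)=√(t−a) refutes uniformity otherwise); π is taken positive in the interior. *)

theory Defs
  imports
    "HOL-Probability.Probability"
    "HOL-Library.Landau_Symbols"
    "Jordan_Normal_Form.Gauss_Jordan_Elimination"
begin

text \<open>Subjects and design points are numbered from 0: subject \<open>i\<close> runs over \<open>i < n\<close> and its
  design points over \<open>j < N n i\<close>.  The numbers of design points have to grow with \<open>n\<close>, so \<open>N\<close>,
  the design points and the measurement errors are triangular arrays.\<close>

section \<open>Smoothness\<close>

text \<open>\<open>D k\<close> is the \<open>k\<close>-th derivative relative to \<open>S\<close>; at an end point of a closed interval it is
  one-sided.\<close>

definition cont_diff_on :: "nat \<Rightarrow> real set \<Rightarrow> (real \<Rightarrow> real) \<Rightarrow> bool" where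
  "cont_diff_on m S g \<longleftrightarrow>
    (\<exists>D :: nat \<Rightarrow> real \<Rightarrow> real. D 0 = g \<and>
      (\<forall>k<m. \<forall>t\<in>S. (D k has_real_derivative D (Suc k) t) (at t within S)) \<and>
      (\<forall>k\<le>m. continuous_on S (D k)))"

text \<open>Up to \<open>m\<close> continuous derivatives in each of the two variables: \<open>D k l\<close> is the mixed
  derivative of order \<open>k\<close> in the first and \<open>l\<close> in the second variable, \<open>k, l \<le> m\<close>.\<close>

definition cont_diff2_on :: "nat \<Rightarrow> real set \<Rightarrow> (real \<Rightarrow> real \<Rightarrow> real) \<Rightarrow> bool" where
  "cont_diff2_on m S g \<longleftrightarrow>
    (\<exists>D :: nat \<Rightarrow> nat \<Rightarrow> real \<Rightarrow> real \<Rightarrow> real. D 0 0 = g \<and>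
      (\<forall>k<m. \<forall>l\<le>m. \<forall>s\<in>S. \<forall>t\<in>S.
        ((\<lambda>u. D k l u t) has_real_derivative D (Suc k) l s t) (at s within S)) \<and>
      (\<forall>k\<le>m. \<forall>l<m. \<forall>s\<in>S. \<forall>t\<in>S.
        ((\<lambda>u. D k l s u) has_real_derivative D k (Suc l) s t) (at t within S)) \<and>
      (\<forall>k\<le>m. \<forall>l\<le>m. continuous_on (S \<times> S) (\<lambda>(s, t). D k l s t)))"

section \<open>Uniform boundedness in probability\<close>

text \<open>Boundedness in probability with the same bound for all indices.  The supremum over the index
  set stands outside the probability.\<close>

definition O_UP ::
  "'a measure \<Rightarrow> (nat \<Rightarrow> 'i set) \<Rightarrow> (nat \<Rightarrow> 'i \<Rightarrow> 'a \<Rightarrow> 'b::real_normed_vector) \<Rightarrow> bool" where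
  "O_UP M I Z \<longleftrightarrow>
    (\<forall>\<epsilon>>0. \<exists>B. \<forall>\<^sub>F n in sequentially. \<forall>i\<in>I n.
      measure M {\<omega> \<in> space M. norm (Z n i \<omega>) > B} \<le> \<epsilon>)"

section \<open>Asymptotic Gaussian processes\<close>

text \<open>The law of a Gaussian family \<open>z 0, \<dots>, z (m - 1)\<close> of random vectors (possibly degenerate),
  padded with zeros to a sequence because the length \<open>m\<close> is a variable.\<close>

definition gaussian_law ::
  "nat \<Rightarrow> (nat \<Rightarrow> real^'q) \<Rightarrow> (nat \<Rightarrow> nat \<Rightarrow> real^'q^'q) \<Rightarrow> (nat \<Rightarrow> real^'q) measure \<Rightarrow> bool" where
  "gaussian_law m \<mu> \<Sigma> L \<longleftrightarrow>
    prob_space L \<and> sets L = sets borel \<and> (AE z in L. \<forall>k\<ge>m. z k = 0) \<and>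
    (\<forall>c :: nat \<Rightarrow> real^'q. \<exists>\<mu>' s. s \<ge> 0 \<and>
      distr L borel (\<lambda>z. \<Sum>k<m. inner (c k) (z k)) =
      distr std_normal_distribution borel (\<lambda>u. \<mu>' + s * u)) \<and>
    (\<forall>k<m. \<forall>i. (\<integral>z. vec_nth (z k) i \<partial>L) = vec_nth (\<mu> k) i) \<and>
    (\<forall>k<m. \<forall>l<m. \<forall>i j.
      (\<integral>z. (vec_nth (z k) i - vec_nth (\<mu> k) i) * (vec_nth (z l) j - vec_nth (\<mu> l) j) \<partial>L) =
      vec_nth (vec_nth (\<Sigma> k l) i) j)"

text \<open>Weak convergence of all finite-dimensional distributions with time points in \<open>I\<close> to those of
  a Gaussian process with mean function \<open>\<eta>\<close> and covariance function \<open>\<Gamma>\<close>.\<close>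

definition AGP ::
  "'a measure \<Rightarrow> real set \<Rightarrow> (nat \<Rightarrow> real \<Rightarrow> 'a \<Rightarrow> real^'q) \<Rightarrow>
   (real \<Rightarrow> real^'q) \<Rightarrow> (real \<Rightarrow> real \<Rightarrow> real^'q^'q) \<Rightarrow> bool" where
  "AGP M I X \<eta> \<Gamma> \<longleftrightarrow>
    (\<forall>m (\<tau> :: nat \<Rightarrow> real). (\<forall>k<m. \<tau> k \<in> I) \<longrightarrow>
      (\<exists>L. gaussian_law m (\<lambda>k. \<eta> (\<tau> k)) (\<lambda>k l. \<Gamma> (\<tau> k) (\<tau> l)) L \<and>
        (\<forall>g :: (nat \<Rightarrow> real^'q) \<Rightarrow> real. continuous_on UNIV g \<longrightarrow> bounded (range g) \<longrightarrow>
          (\<lambda>n. \<integral>\<omega>. g (\<lambda>k. if k < m then X n (\<tau> k) \<omega> else 0) \<partial>M)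
            \<longlonglongrightarrow> (\<integral>z. g z \<partial>L))))"

section \<open>Local polynomial kernel reconstruction\<close>

text \<open>\<open>ts j\<close> and \<open>ys j\<close>, \<open>j < m\<close>, are the design points and observations of one subject.  If
  \<open>Z\<^sup>T W Z\<close> is singular the value is unspecified.\<close>

definition lpk ::
  "nat \<Rightarrow> (real \<Rightarrow> real) \<Rightarrow> real \<Rightarrow> nat \<Rightarrow> (nat \<Rightarrow> real) \<Rightarrow> (nat \<Rightarrow> real) \<Rightarrow> real \<Rightarrow> real" where
  "lpk p K h m ts ys t =
    (let Z = Matrix.mat m (p + 1) (\<lambda>(j, k). (ts j - t) ^ k);
         W = mat_diag m (\<lambda>j. K ((ts j - t) / h) / h);
         y = Matrix.vec m ys
     in scalar_prod (unit_vec (p + 1) 0)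
          (mult_mat_vec (the (mat_inverse (transpose_mat Z * W * Z)) * transpose_mat Z * W) y))"

section \<open>Least squares\<close>

text \<open>With \<open>X\<close> the matrix with rows \<open>xs 0, \<dots>, xs (n - 1)\<close>, these are \<open>X\<^sup>T X\<close>,
  \<open>(X\<^sup>T X)\<^sup>-\<^sup>1 X\<^sup>T y\<close>, the entries of \<open>P = X (X\<^sup>T X)\<^sup>-\<^sup>1 X\<^sup>T\<close>, those of \<open>(I - P) y\<close>, and
  \<open>((I - P) y)\<^sup>T ((I - P) z) / (n - q)\<close>.\<close>

definition gram :: "nat \<Rightarrow> (nat \<Rightarrow> real^'q) \<Rightarrow> real^'q^'q" where
  "gram n xs = (\<chi> k l. \<Sum>i<n. vec_nth (xs i) k * vec_nth (xs i) l)"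

definition ls_coef :: "nat \<Rightarrow> (nat \<Rightarrow> real^'q) \<Rightarrow> (nat \<Rightarrow> real) \<Rightarrow> real^'q" where
  "ls_coef n xs y = matrix_inv (gram n xs) *v (\<Sum>i<n. y i *\<^sub>R xs i)"

definition hat_matrix :: "nat \<Rightarrow> (nat \<Rightarrow> real^'q) \<Rightarrow> nat \<Rightarrow> nat \<Rightarrow> real" where
  "hat_matrix n xs i j = inner (xs i) (matrix_inv (gram n xs) *v xs j)"

definition residual :: "nat \<Rightarrow> (nat \<Rightarrow> real^'q) \<Rightarrow> (nat \<Rightarrow> real) \<Rightarrow> nat \<Rightarrow> real" where
  "residual n xs y i = y i - (\<Sum>j<n. hat_matrix n xs i j * y j)"

definition cov_estimate ::
  "nat \<Rightarrow> (nat \<Rightarrow> real^'q) \<Rightarrow> (nat \<Rightarrow> real) \<Rightarrow> (nat \<Rightarrow> real) \<Rightarrow> real" where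
  "cov_estimate n xs y z =
    (\<Sum>i<n. residual n xs y i * residual n xs z i) / (real n - real CARD('q))"

section \<open>The sampling model\<close>

definition individual_fun ::
  "(nat \<Rightarrow> 'a \<Rightarrow> real^'q) \<Rightarrow> (real \<Rightarrow> real^'q) \<Rightarrow> (nat \<Rightarrow> real \<Rightarrow> 'a \<Rightarrow> real) \<Rightarrow>
   nat \<Rightarrow> real \<Rightarrow> 'a \<Rightarrow> real" where
  "individual_fun x \<beta> v i t \<omega> = inner (x i \<omega>) (\<beta> t) + v i t \<omega>"

definition observation ::
  "(nat \<Rightarrow> 'a \<Rightarrow> real^'q) \<Rightarrow> (real \<Rightarrow> real^'q) \<Rightarrow> (nat \<Rightarrow> real \<Rightarrow> 'a \<Rightarrow> real) \<Rightarrow>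
   (nat \<Rightarrow> nat \<Rightarrow> nat \<Rightarrow> 'a \<Rightarrow> real) \<Rightarrow> (nat \<Rightarrow> nat \<Rightarrow> nat \<Rightarrow> 'a \<Rightarrow> real) \<Rightarrow>
   nat \<Rightarrow> nat \<Rightarrow> nat \<Rightarrow> 'a \<Rightarrow> real" where
  "observation x \<beta> v T e n i j \<omega> = individual_fun x \<beta> v i (T n i j \<omega>) \<omega> + e n i j \<omega>"

datatype source = Covariate nat | Effect nat | Design nat nat

primrec source_events ::
  "'a measure \<Rightarrow> real \<Rightarrow> real \<Rightarrow> (nat \<Rightarrow> 'a \<Rightarrow> real^'q) \<Rightarrow> (nat \<Rightarrow> real \<Rightarrow> 'a \<Rightarrow> real) \<Rightarrow>
   (nat \<Rightarrow> nat \<Rightarrow> 'a \<Rightarrow> real) \<Rightarrow> source \<Rightarrow> 'a set set" where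
  "source_events M a b x v T (Covariate i) = sets (vimage_algebra (space M) (x i) borel)"
| "source_events M a b x v T (Effect i) =
     sets (vimage_algebra (space M) (\<lambda>\<omega>. \<lambda>t\<in>{a..b}. v i t \<omega>) (PiM {a..b} (\<lambda>_. borel)))"
| "source_events M a b x v T (Design i j) = sets (vimage_algebra (space M) (T i j) borel)"

definition sources :: "nat \<Rightarrow> (nat \<Rightarrow> nat) \<Rightarrow> source set" where
  "sources n Nn = range Covariate \<union> range Effect \<union> {Design i j | i j. i < n \<and> j < Nn i}"

definition source_algebra ::
  "'a measure \<Rightarrow> real \<Rightarrow> real \<Rightarrow> (nat \<Rightarrow> 'a \<Rightarrow> real^'q) \<Rightarrow> (nat \<Rightarrow> real \<Rightarrow> 'a \<Rightarrow> real) \<Rightarrow>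
   (nat \<Rightarrow> nat \<Rightarrow> 'a \<Rightarrow> real) \<Rightarrow> nat \<Rightarrow> (nat \<Rightarrow> nat) \<Rightarrow> 'a measure" where
  "source_algebra M a b x v T n Nn =
    sigma (space M) (\<Union>s\<in>sources n Nn. source_events M a b x v T s)"

text \<open>The subject effects are i.i.d. copies of a process on \<open>[a, b]\<close> with mean 0 and covariance
  function \<open>\<gamma>\<close>.\<close>

definition subject_effects ::
  "'a measure \<Rightarrow> real \<Rightarrow> real \<Rightarrow> (nat \<Rightarrow> real \<Rightarrow> 'a \<Rightarrow> real) \<Rightarrow> (real \<Rightarrow> real \<Rightarrow> real) \<Rightarrow> bool" where
  "subject_effects M a b v \<gamma> \<longleftrightarrow>
    (\<forall>i. (\<lambda>\<omega>. \<lambda>t\<in>{a..b}. v i t \<omega>) \<in> measurable M (PiM {a..b} (\<lambda>_. borel))) \<and>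
    (\<forall>i. distr M (PiM {a..b} (\<lambda>_. borel)) (\<lambda>\<omega>. \<lambda>t\<in>{a..b}. v i t \<omega>) =
         distr M (PiM {a..b} (\<lambda>_. borel)) (\<lambda>\<omega>. \<lambda>t\<in>{a..b}. v 0 t \<omega>)) \<and>
    (\<forall>i. \<forall>t\<in>{a..b}. integrable M (v i t) \<and> (\<integral>\<omega>. v i t \<omega> \<partial>M) = 0) \<and>
    (\<forall>i. \<forall>s\<in>{a..b}. \<forall>t\<in>{a..b}. integrable M (\<lambda>\<omega>. v i s \<omega> * v i t \<omega>) \<and>
         (\<integral>\<omega>. v i s \<omega> * v i t \<omega> \<partial>M) = \<gamma> s t)"

definition white_noise ::
  "'e measure \<Rightarrow> real \<Rightarrow> real \<Rightarrow> (real \<Rightarrow> 'e \<Rightarrow> real) \<Rightarrow> (real \<Rightarrow> real) \<Rightarrow> bool" where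
  "white_noise E a b \<epsilon> \<sigma>2 \<longleftrightarrow> prob_space E \<and>
    (\<forall>t\<in>{a..b}. integrable E (\<epsilon> t) \<and> (\<integral>w. \<epsilon> t w \<partial>E) = 0) \<and>
    (\<forall>s\<in>{a..b}. \<forall>t\<in>{a..b}. integrable E (\<lambda>w. \<epsilon> s w * \<epsilon> t w) \<and>
      (\<integral>w. \<epsilon> s w * \<epsilon> t w \<partial>E) = (if s = t then \<sigma>2 t else 0))"

text \<open>The errors \<open>\<epsilon>\<^sub>i(t\<^sub>i\<^sub>j)\<close> for i.i.d. copies \<open>\<epsilon>\<^sub>i\<close> of \<open>\<epsilon>\<close>, independent of covariates, effects and
  design, expressed through their law: given all of these, the vectors \<open>(e\<^sub>i\<^sub>j)\<^sub>j\<close> are independent and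
  distributed as \<open>\<epsilon>\<close> at the given design points.  Literally substituting random times into \<open>\<epsilon>\<close> is
  not possible: for times independent of \<open>\<epsilon>\<close> and having a density, joint measurability of the
  composite forces white noise to vanish almost everywhere.\<close>

definition measurement_errors ::
  "'a measure \<Rightarrow> 'e measure \<Rightarrow> real \<Rightarrow> real \<Rightarrow> (nat \<Rightarrow> 'a \<Rightarrow> real^'q) \<Rightarrow>
   (nat \<Rightarrow> real \<Rightarrow> 'a \<Rightarrow> real) \<Rightarrow> (real \<Rightarrow> 'e \<Rightarrow> real) \<Rightarrow> (nat \<Rightarrow> nat \<Rightarrow> nat) \<Rightarrow>
   (nat \<Rightarrow> nat \<Rightarrow> nat \<Rightarrow> 'a \<Rightarrow> real) \<Rightarrow> (nat \<Rightarrow> nat \<Rightarrow> nat \<Rightarrow> 'a \<Rightarrow> real) \<Rightarrow> bool" where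
  "measurement_errors M E a b x v \<epsilon> N T e \<longleftrightarrow>
    (\<forall>n. \<forall>i<n. \<forall>j<N n i. e n i j \<in> borel_measurable M) \<and>
    (\<forall>n. \<forall>B :: nat \<Rightarrow> nat \<Rightarrow> real set. (\<forall>i j. B i j \<in> sets borel) \<longrightarrow>
      (AE \<omega> in M.
        real_cond_exp M (source_algebra M a b x v (T n) n (N n))
          (indicator {\<omega> \<in> space M. \<forall>i<n. \<forall>j<N n i. e n i j \<omega> \<in> B i j}) \<omega> =
        (\<Prod>i<n. measure E {w \<in> space E. \<forall>j<N n i. \<epsilon> (T n i j \<omega>) w \<in> B i j})))"

definition functional_linear_model ::
  "'a measure \<Rightarrow> 'e measure \<Rightarrow> real \<Rightarrow> real \<Rightarrow> (nat \<Rightarrow> 'a \<Rightarrow> real^'q) \<Rightarrow>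
   (nat \<Rightarrow> real \<Rightarrow> 'a \<Rightarrow> real) \<Rightarrow> (real \<Rightarrow> real \<Rightarrow> real) \<Rightarrow> (real \<Rightarrow> 'e \<Rightarrow> real) \<Rightarrow> (real \<Rightarrow> real) \<Rightarrow>
   (nat \<Rightarrow> nat \<Rightarrow> nat) \<Rightarrow> (nat \<Rightarrow> nat \<Rightarrow> nat \<Rightarrow> 'a \<Rightarrow> real) \<Rightarrow>
   (nat \<Rightarrow> nat \<Rightarrow> nat \<Rightarrow> 'a \<Rightarrow> real) \<Rightarrow> bool" where
  "functional_linear_model M E a b x v \<gamma> \<epsilon> \<sigma>2 N T e \<longleftrightarrow>
    prob_space M \<and>
    (\<forall>i. x i \<in> borel_measurable M) \<and>
    subject_effects M a b v \<gamma> \<and>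
    (\<forall>n. \<forall>i<n. \<forall>j<N n i. T n i j \<in> borel_measurable M) \<and>
    (\<forall>n. prob_space.indep_sets M (source_events M a b x v (T n)) (sources n (N n))) \<and>
    white_noise E a b \<epsilon> \<sigma>2 \<and>
    measurement_errors M E a b x v \<epsilon> N T e"

section \<open>Conditions A and B\<close>

text \<open>Support \<open>[a, b]\<close> means that the density is positive in the interior and 0 outside; the end
  points are immaterial.\<close>

definition design_density :: "real \<Rightarrow> real \<Rightarrow> (real \<Rightarrow> real) \<Rightarrow> bool" where
  "design_density a b \<pi> \<longleftrightarrow>
    (\<forall>t. \<pi> t \<ge> 0) \<and> (\<forall>t\<in>{a<..<b}. \<pi> t > 0) \<and> (\<forall>t. t \<notin> {a..b} \<longrightarrow> \<pi> t = 0) \<and>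
    (\<exists>\<pi>'. continuous_on {a..b} \<pi>' \<and> (\<forall>t\<in>{a<..<b}. (\<pi> has_real_derivative \<pi>' t) (at t)))"

definition kernel_density :: "(real \<Rightarrow> real) \<Rightarrow> bool" where
  "kernel_density K \<longleftrightarrow>
    has_bochner_integral lborel K 1 \<and> (\<forall>u. K u \<ge> 0) \<and> (\<exists>B. \<forall>u. K u \<le> B) \<and>
    (\<forall>u. K (- u) = K u) \<and> (\<forall>u. u \<notin> {-1..1} \<longrightarrow> K u = 0)"

definition smooth_model_on ::
  "real set \<Rightarrow> nat \<Rightarrow> 'a measure \<Rightarrow> (nat \<Rightarrow> 'a \<Rightarrow> real^'q) \<Rightarrow> (real \<Rightarrow> real^'q) \<Rightarrow>
   (nat \<Rightarrow> real \<Rightarrow> 'a \<Rightarrow> real) \<Rightarrow> (real \<Rightarrow> real \<Rightarrow> real) \<Rightarrow> (real \<Rightarrow> real) \<Rightarrow> bool" where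
  "smooth_model_on S p M x \<beta> v \<gamma> \<sigma>2 \<longleftrightarrow>
    (\<forall>i. \<forall>\<omega>\<in>space M. cont_diff_on (p + 1) S (\<lambda>t. individual_fun x \<beta> v i t \<omega>)) \<and>
    (\<forall>i. \<forall>\<omega>\<in>space M. cont_diff_on (p + 1) S (\<lambda>t. inner (x i \<omega>) (\<beta> t))) \<and>
    cont_diff2_on (p + 1) S \<gamma> \<and>
    continuous_on S \<sigma>2"

definition condition_A ::
  "'a measure \<Rightarrow> real \<Rightarrow> real \<Rightarrow> nat \<Rightarrow> (nat \<Rightarrow> 'a \<Rightarrow> real^'q) \<Rightarrow> (real \<Rightarrow> real^'q) \<Rightarrow>
   (nat \<Rightarrow> real \<Rightarrow> 'a \<Rightarrow> real) \<Rightarrow> (real \<Rightarrow> real \<Rightarrow> real) \<Rightarrow> (real \<Rightarrow> real) \<Rightarrow>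
   (nat \<Rightarrow> nat \<Rightarrow> nat) \<Rightarrow> (nat \<Rightarrow> nat \<Rightarrow> nat \<Rightarrow> 'a \<Rightarrow> real) \<Rightarrow> (real \<Rightarrow> real) \<Rightarrow>
   (real \<Rightarrow> real) \<Rightarrow> (nat \<Rightarrow> real) \<Rightarrow> real \<Rightarrow> bool" where
  "condition_A M a b p x \<beta> v \<gamma> \<sigma>2 N T \<pi> K h \<delta> \<longleftrightarrow>
    design_density a b \<pi> \<and>
    (\<forall>n. \<forall>i<n. \<forall>j<N n i. (\<forall>\<omega>\<in>space M. T n i j \<omega> \<in> {a..b}) \<and>
      distributed M lborel (T n i j) (\<lambda>t. ennreal (\<pi> t))) \<and>
    smooth_model_on {a<..<b} p M x \<beta> v \<gamma> \<sigma>2 \<and>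
    kernel_density K \<and>
    \<delta> > 0 \<and> (\<exists>C>0. \<forall>n. \<forall>i<n. real (N n i) \<ge> C * real n powr \<delta>) \<and>
    (\<forall>n. h n > 0) \<and> h \<longlonglongrightarrow> 0 \<and> filterlim (\<lambda>n. real n powr \<delta> * h n) at_top sequentially"

definition condition_B ::
  "'a measure \<Rightarrow> real \<Rightarrow> real \<Rightarrow> (nat \<Rightarrow> 'a \<Rightarrow> real^'q) \<Rightarrow> (nat \<Rightarrow> real \<Rightarrow> 'a \<Rightarrow> real) \<Rightarrow>
   real^'q^'q \<Rightarrow> bool" where
  "condition_B M a b x v \<Omega> \<longleftrightarrow>
    (\<forall>i. distr M borel (x i) = distr M borel (x 0)) \<and>
    (\<forall>k l. integrable M (\<lambda>\<omega>. vec_nth (x 0 \<omega>) k * vec_nth (x 0 \<omega>) l) \<and>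
      (\<integral>\<omega>. vec_nth (x 0 \<omega>) k * vec_nth (x 0 \<omega>) l \<partial>M) = vec_nth (vec_nth \<Omega> k) l) \<and>
    invertible \<Omega> \<and>
    O_UP M (\<lambda>n. {..<n}) (\<lambda>n i. x i) \<and>
    O_UP M (\<lambda>n. {..<n} \<times> {a<..<b}) (\<lambda>n (i, t). v i t)"

text \<open>Condition A only concerns the open interval, where the smoothness and the positivity of the
  design density may degenerate towards the end points; this predicate says that they persist up
  to the end points.\<close>

definition regular_up_to_boundary ::
  "'a measure \<Rightarrow> real \<Rightarrow> real \<Rightarrow> nat \<Rightarrow> (nat \<Rightarrow> 'a \<Rightarrow> real^'q) \<Rightarrow> (real \<Rightarrow> real^'q) \<Rightarrow>
   (nat \<Rightarrow> real \<Rightarrow> 'a \<Rightarrow> real) \<Rightarrow> (real \<Rightarrow> real \<Rightarrow> real) \<Rightarrow> (real \<Rightarrow> real) \<Rightarrow> (real \<Rightarrow> real) \<Rightarrow> bool" where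
  "regular_up_to_boundary M a b p x \<beta> v \<gamma> \<sigma>2 \<pi> \<longleftrightarrow>
    smooth_model_on {a..b} p M x \<beta> v \<gamma> \<sigma>2 \<and> (\<exists>c>0. \<forall>t\<in>{a<..<b}. \<pi> t \<ge> c)"

section \<open>Estimators\<close>

definition reconstruction ::
  "nat \<Rightarrow> (real \<Rightarrow> real) \<Rightarrow> (nat \<Rightarrow> real) \<Rightarrow> (nat \<Rightarrow> nat \<Rightarrow> nat) \<Rightarrow>
   (nat \<Rightarrow> nat \<Rightarrow> nat \<Rightarrow> 'a \<Rightarrow> real) \<Rightarrow> (nat \<Rightarrow> nat \<Rightarrow> nat \<Rightarrow> 'a \<Rightarrow> real) \<Rightarrow>
   nat \<Rightarrow> nat \<Rightarrow> real \<Rightarrow> 'a \<Rightarrow> real" where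
  "reconstruction p K h N T y n i t \<omega> =
    lpk p K (h n) (N n i) (\<lambda>j. T n i j \<omega>) (\<lambda>j. y n i j \<omega>) t"

definition beta_estimator ::
  "(nat \<Rightarrow> 'a \<Rightarrow> real^'q) \<Rightarrow> (nat \<Rightarrow> nat \<Rightarrow> real \<Rightarrow> 'a \<Rightarrow> real) \<Rightarrow>
   nat \<Rightarrow> real \<Rightarrow> 'a \<Rightarrow> real^'q" where
  "beta_estimator x f n t \<omega> = ls_coef n (\<lambda>i. x i \<omega>) (\<lambda>i. f n i t \<omega>)"

definition gamma_estimator ::
  "(nat \<Rightarrow> 'a \<Rightarrow> real^'q) \<Rightarrow> (nat \<Rightarrow> nat \<Rightarrow> real \<Rightarrow> 'a \<Rightarrow> real) \<Rightarrow>
   nat \<Rightarrow> real \<Rightarrow> real \<Rightarrow> 'a \<Rightarrow> real" where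
  "gamma_estimator x f n s t \<omega> =
    cov_estimate n (\<lambda>i. x i \<omega>) (\<lambda>i. f n i s \<omega>) (\<lambda>i. f n i t \<omega>)"

end

theory Submission
  imports Defs "Jordan_Normal_Form.Determinant" "HOL-Real_Asymp.Real_Asymp"
begin

text \<open>
  The reconstruction error of one curve is split into bias and noise.  If the local moment matrix of
  the design of subject \<open>i\<close> around \<open>t\<close> is bounded below, then \<open>f_hat n i t\<close> is a weighted sum of the
  observations whose weights live in \<open>[t - h, t + h]\<close>, reproduce polynomials of degree \<open>p\<close>, have
  bounded absolute sum and square sum of order \<open>1 / (N h)\<close>.  Reproduction replaces the curve by its
  Taylor remainder of order \<open>h^(p + 1)\<close>, and the noise has second moment of order \<open>1 / (N h)\<close>
  because errors at distinct times are uncorrelated.  For \<open>h\<close> of order \<open>n powr (- \<delta> / (2 p + 3))\<close> both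
  squares are of order \<open>(rate n)\<^sup>2\<close>.

  The lower bound on the moment matrix holds with overwhelming probability: by Hoeffding's inequality
  its entries deviate from their expectations with probability \<open>exp (- \<kappa> N h\<^sup>2)\<close>, and \<open>N h\<^sup>2\<close> grows like
  a positive power of \<open>n\<close>, so that even the union over all \<open>n\<close> subjects is negligible.  The expected
  moment matrix is bounded below uniformly in \<open>t\<close>, because on at least one side of \<open>t\<close> the
  design density is bounded below on an interval of length \<open>h\<close>, and a symmetric kernel has mass on each
  side (\<open>kernel_energy_half_line\<close>, \<open>design_event\<close>).

  The covariance function has continuous mixed derivatives, but the hypotheses contain no moment bound on the
  derivatives of the paths.  The second moment of the derivative of order \<open>p + 1\<close> is
  obtained from finite differences: those of the covariance are controlled by its mixed derivative, those
  of the paths converge to the derivative, and Fatou's lemma compares the two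
  (\<open>smooth_process_derivative\<close>).  The coefficient functions are smooth because the covariates
  span the whole space.  The errors are given through their conditional law on rectangles, and their
  second moments are recovered by approximation with simple functions
  (\<open>conditional_noise_second_moment\<close>).

  Averaging over the subjects, Markov's inequality bounds the root mean square of the reconstruction
  errors by a multiple of \<open>rate n\<close> with probability close to 1, uniformly in \<open>t\<close>
  (\<open>reconstructions_likely_close\<close>).  Replacing the true curves by the reconstructions changes the least squares
  estimators by at most products of such root mean squares, with constants that are controlled as soon as the Gram matrix divided by \<open>n\<close> is
  close to \<open>\<Omega>\<close>, which the weak law of large numbers provides.  This gives both rates.

  If \<open>\<delta> > 1 + 1 / (2 (p + 1))\<close>, then \<open>sqrt n * rate n\<close> tends to 0.  Hence
  \<open>sqrt n (\<beta>_hat t - \<beta> t)\<close> differs from the normalized sum of the i.i.d. vectors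
  \<open>v\<^sub>i(t) \<Omega>\<^sup>-\<^sup>1 x\<^sub>i\<close> by a term that vanishes in probability (\<open>linearization\<close>), and these vectors have
  covariance \<open>\<gamma>(s, t) \<Omega>\<^sup>-\<^sup>1\<close>.  The finite-dimensional limits follow from the one-dimensional central
  limit theorem for linear functionals and the Cramer-Wold device (\<open>multivariate_central_limit\<close>).
\<close>

(* In what follows the dollar sign denotes the components of vectors of type real^'q. *)
no_notation vec_index (infixl "$" 100)

section \<open>Local polynomial weights\<close>

text \<open>The reconstruction is linear in the observations; the weight of observation \<open>j\<close> is its value at the
  \<open>j\<close>-th unit vector.\<close>

definition lpk_weight ::
  "nat \<Rightarrow> (real \<Rightarrow> real) \<Rightarrow> real \<Rightarrow> nat \<Rightarrow> (nat \<Rightarrow> real) \<Rightarrow> real \<Rightarrow> nat \<Rightarrow> real" where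
  "lpk_weight p K h m ts t j = lpk p K h m ts (\<lambda>k. if k = j then 1 else 0) t"

text \<open>With time measured in units of \<open>h\<close> from \<open>t\<close>, the matrix \<open>Z\<^sup>T W Z / m\<close> is the Hankel matrix of these moments.\<close>

definition design_moment ::
  "(real \<Rightarrow> real) \<Rightarrow> real \<Rightarrow> nat \<Rightarrow> (nat \<Rightarrow> real) \<Rightarrow> real \<Rightarrow> nat \<Rightarrow> real" where
  "design_moment K h m ts t l =
    (\<Sum>j<m. K ((ts j - t) / h) * ((ts j - t) / h) ^ l) / (real m * h)"

definition lpk_gram :: "nat \<Rightarrow> (real \<Rightarrow> real) \<Rightarrow> real \<Rightarrow> nat \<Rightarrow> (nat \<Rightarrow> real) \<Rightarrow> real \<Rightarrow> real mat" where
  "lpk_gram p K h m ts t = Matrix.mat (p + 1) (p + 1)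
    (\<lambda>(k, l). \<Sum>j<m. (ts j - t) ^ k * (K ((ts j - t) / h) / h) * (ts j - t) ^ l)"

lemma lpk_sum_form:
  "lpk p K h m ts ys t = (let Q = the (mat_inverse (lpk_gram p K h m ts t)) in
     (\<Sum>i<dim_row Q. vec_index (unit_vec (p + 1) 0) i *
        (\<Sum>j<m. (\<Sum>k<p + 1. vec_index (Matrix.row Q i) k * ((ts j - t) ^ k * (K ((ts j - t) / h) / h))) * ys j)))"
proof -
  define Z where "Z = Matrix.mat m (p + 1) (\<lambda>(j, k). (ts j - t) ^ k)"
  define W where "W = mat_diag m (\<lambda>j. K ((ts j - t) / h) / h)"
  have dZ: "dim_row Z = m" "dim_col Z = p + 1" by (auto simp: Z_def)
  have dW: "dim_row W = m" "dim_col W = m" by (auto simp: W_def mat_diag_def)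
  have Z: "Z $$ (j, k) = (ts j - t) ^ k" if "j < m" "k < p + 1" for j k
    using that by (simp add: Z_def)
  have W: "W $$ (j, k) = (if j = k then K ((ts j - t) / h) / h else 0)" if "j < m" "k < m" for j k
    using that by (simp add: W_def mat_diag_def)
  have ZW: "(transpose_mat Z * W) $$ (k, j) = (ts j - t) ^ k * (K ((ts j - t) / h) / h)"
    if "j < m" "k < p + 1" for j k
  proof -
    have "(transpose_mat Z * W) $$ (k, j) = (\<Sum>i<m. Z $$ (i, k) * W $$ (i, j))"
      using that by (simp add: scalar_prod_def dZ dW atLeast0LessThan)
    also have "\<dots> = (\<Sum>i<m. if i = j then (ts j - t) ^ k * (K ((ts j - t) / h) / h) else 0)"
      using that by (intro sum.cong) (auto simp: Z W)
    also have "\<dots> = (ts j - t) ^ k * (K ((ts j - t) / h) / h)" using that by simp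
    finally show ?thesis .
  qed
  have gram: "transpose_mat Z * W * Z = lpk_gram p K h m ts t"
  proof (rule eq_matI)
    fix k l assume "k < dim_row (lpk_gram p K h m ts t)" "l < dim_col (lpk_gram p K h m ts t)"
    then have kl: "k < p + 1" "l < p + 1" by (auto simp: lpk_gram_def)
    have "(transpose_mat Z * W * Z) $$ (k, l) =
        (\<Sum>j<m. (transpose_mat Z * W) $$ (k, j) * Z $$ (j, l))"
      using kl by (subst index_mult_mat(1)) (auto simp: scalar_prod_def dZ dW atLeast0LessThan)
    also have "\<dots> = lpk_gram p K h m ts t $$ (k, l)"
      unfolding lpk_gram_def using kl by (simp add: ZW Z)
    finally show "(transpose_mat Z * W * Z) $$ (k, l) = lpk_gram p K h m ts t $$ (k, l)" .
  qed (auto simp: dZ lpk_gram_def)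
  define Q where "Q = the (mat_inverse (lpk_gram p K h m ts t))"
  have assoc: "(Q * transpose_mat Z * W) $$ (i, j) =
      (\<Sum>k<p + 1. vec_index (Matrix.row Q i) k * ((ts j - t) ^ k * (K ((ts j - t) / h) / h)))"
    if "i < dim_row Q" "j < m" for i j
  proof -
    have QZ: "(Q * transpose_mat Z) $$ (i, l) = (\<Sum>k<p + 1. vec_index (Matrix.row Q i) k * (ts l - t) ^ k)" if "l < m" for l
      using that \<open>i < dim_row Q\<close>
      by (auto simp: scalar_prod_def dZ atLeast0LessThan Z simp del: row_def intro!: sum.cong)
    have "(Q * transpose_mat Z * W) $$ (i, j) = (\<Sum>l<m. (Q * transpose_mat Z) $$ (i, l) * W $$ (l, j))"
      using that by (subst index_mult_mat(1)) (auto simp: scalar_prod_def dZ dW atLeast0LessThan)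
    also have "\<dots> = (\<Sum>l<m. if l = j then (\<Sum>k<p + 1. vec_index (Matrix.row Q i) k * (ts l - t) ^ k) * (K ((ts j - t) / h) / h) else 0)"
      using that by (intro sum.cong) (auto simp: QZ W)
    also have "\<dots> = (\<Sum>k<p + 1. vec_index (Matrix.row Q i) k * (ts j - t) ^ k) * (K ((ts j - t) / h) / h)"
      using that by simp
    finally show ?thesis unfolding sum_distrib_right by (simp add: mult.assoc)
  qed
  have "lpk p K h m ts ys t =
      (\<Sum>i<dim_row Q. vec_index (unit_vec (p + 1) 0) i * (\<Sum>j<m. (Q * transpose_mat Z * W) $$ (i, j) * ys j))"
    unfolding lpk_def Let_def Z_def[symmetric] W_def[symmetric] gram Q_def[symmetric]
    by (simp add: scalar_prod_def dW atLeast0LessThan)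
  then show ?thesis
    unfolding Let_def Q_def[symmetric] by (simp add: assoc)
qed

lemma lpk_linear: "lpk p K h m ts ys t = (\<Sum>j<m. lpk_weight p K h m ts t j * ys j)"
proof -
  define Q where "Q = the (mat_inverse (lpk_gram p K h m ts t))"
  define F where "F i j = (\<Sum>k<p + 1. vec_index (Matrix.row Q i) k * ((ts j - t) ^ k * (K ((ts j - t) / h) / h)))" for i j
  have f: "lpk p K h m ts y t = (\<Sum>i<dim_row Q. vec_index (unit_vec (p + 1) 0) i * (\<Sum>j<m. F i j * y j))" for y
    unfolding lpk_sum_form Let_def Q_def[symmetric] F_def by simp
  have w: "lpk_weight p K h m ts t j = (\<Sum>i<dim_row Q. vec_index (unit_vec (p + 1) 0) i * F i j)" if "j < m" for j
  proof -
    have "(\<Sum>l<m. F i l * (if l = j then 1 else 0)) = F i j" for i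
    proof -
      have "(\<Sum>l<m. F i l * (if l = j then 1 else 0)) = (\<Sum>l<m. if l = j then F i l else 0)"
        by (intro sum.cong) auto
      then show ?thesis using that by simp
    qed
    then show ?thesis unfolding lpk_weight_def f by simp
  qed
  show ?thesis
    unfolding f sum_distrib_left
    by (subst sum.swap) (auto simp: w sum_distrib_right mult.assoc intro!: sum.cong)
qed

text \<open>With the moments as matrix entries, \<open>c\<close> is the first row of the inverse, so it solves
  \<open>(\<Sum>k\<le>p. c k * S (k + l)) = (if l = 0 then 1 else 0)\<close>.  Testing this with \<open>c\<close> itself gives
  \<open>lam * |c|\<^sup>2 \<le> c 0 \<le> |c|\<close>, hence the bound on \<open>c\<close>; the equation itself says that polynomials of
  degree at most \<open>p\<close> are reproduced.\<close>

lemma lpk_weight_coercive: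
  assumes h: "h > 0" and m: "m > 0" and lam0: "lam > 0"
    and coer: "\<And>c :: nat \<Rightarrow> real. lam * (\<Sum>k\<le>p. (c k)\<^sup>2) \<le>
      (\<Sum>k\<le>p. \<Sum>l\<le>p. c k * c l * design_moment K h m ts t (k + l))"
  shows "\<exists>c :: nat \<Rightarrow> real. (\<Sum>k\<le>p. (c k)\<^sup>2) \<le> (1 / lam)\<^sup>2 \<and>
    (\<forall>j<m. lpk_weight p K h m ts t j =
      K ((ts j - t) / h) / (real m * h) * (\<Sum>k\<le>p. c k * ((ts j - t) / h) ^ k)) \<and>
    (\<forall>l\<le>p. (\<Sum>j<m. lpk_weight p K h m ts t j * (ts j - t) ^ l) = (if l = 0 then 1 else 0))"
proof -
  define S where "S = design_moment K h m ts t"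
  define A where "A = lpk_gram p K h m ts t"
  have A: "A \<in> carrier_mat (p + 1) (p + 1)" by (simp add: A_def lpk_gram_def)
  have Aent: "A $$ (k, l) = real m * h ^ (k + l) * S (k + l)" if "k \<le> p" "l \<le> p" for k l
  proof -
    have "(ts j - t) ^ k * (K ((ts j - t) / h) / h) * (ts j - t) ^ l =
        h ^ (k + l) * (K ((ts j - t) / h) * ((ts j - t) / h) ^ (k + l)) / h" for j
      using h by (simp add: power_add power_divide)
    note e = this
    have "A $$ (k, l) = (\<Sum>j<m. (ts j - t) ^ k * (K ((ts j - t) / h) / h) * (ts j - t) ^ l)"
      unfolding A_def lpk_gram_def using that by simp
    also have "\<dots> = (\<Sum>j<m. h ^ (k + l) * (K ((ts j - t) / h) * ((ts j - t) / h) ^ (k + l)) / h)"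
      by (simp only: e)
    also have "\<dots> = real m * h ^ (k + l) * S (k + l)"
      unfolding S_def design_moment_def using h m
      by (simp add: sum_distrib_left sum_divide_distrib field_simps)
    finally show ?thesis .
  qed
  have det: "Determinant.det A \<noteq> 0"
  proof
    assume "Determinant.det A = 0"
    from iffD1[OF det_0_iff_vec_prod_zero_field[OF A] this] obtain v where v: "v \<in> carrier_vec (p + 1)" "v \<noteq> 0\<^sub>v (p + 1)" "A *\<^sub>v v = 0\<^sub>v (p + 1)"
      by auto
    have row: "(\<Sum>l\<le>p. A $$ (k, l) * vec_index v l) = 0" if "k \<le> p" for k
    proof -
      have "vec_index (A *\<^sub>v v) k = (\<Sum>l<p + 1. A $$ (k, l) * vec_index v l)"
        using that A v(1) by (auto simp: scalar_prod_def atLeast0LessThan intro!: sum.cong)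
      moreover have "vec_index (A *\<^sub>v v) k = 0" using v(3) that by simp
      ultimately show ?thesis by (simp add: lessThan_Suc_atMost)
    qed
    define c where "c k = h ^ k * vec_index v k" for k
    have "lam * (\<Sum>k\<le>p. (c k)\<^sup>2) \<le> (\<Sum>k\<le>p. \<Sum>l\<le>p. c k * c l * S (k + l))"
      unfolding S_def by (rule coer)
    also have "\<dots> = (\<Sum>k\<le>p. vec_index v k / real m * (\<Sum>l\<le>p. A $$ (k, l) * vec_index v l))"
      unfolding sum_distrib_left using m by (intro sum.cong refl) (simp add: Aent c_def power_add)
    also have "\<dots> = 0" by (simp add: row)
    finally have "(\<Sum>k\<le>p. (c k)\<^sup>2) \<le> 0" using lam0 by (simp add: mult_le_0_iff)
    then have "(\<Sum>k\<le>p. (c k)\<^sup>2) = 0" by (simp add: antisym sum_nonneg)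
    then have "\<forall>k\<le>p. c k = 0" by (simp add: sum_nonneg_eq_0_iff)
    then have "v = 0\<^sub>v (p + 1)" using h v(1) by (intro eq_vecI) (auto simp: c_def)
    then show False using v(2) by simp
  qed
  obtain Q where Q: "mat_inverse A = Some Q"
    using mat_inverse(1)[OF A, of "()"] det_non_zero_imp_unit[OF A det, of "()"]
    by (cases "mat_inverse A") blast+
  from mat_inverse(2)[OF A Q] have QA: "Q * A = 1\<^sub>m (p + 1)" and Qc: "Q \<in> carrier_mat (p + 1) (p + 1)" by auto
  define b where "b k = Q $$ (0, k)" for k
  define c where "c k = real m * h ^ k * b k" for k
  have w: "lpk_weight p K h m ts t j = (\<Sum>k\<le>p. b k * ((ts j - t) ^ k * (K ((ts j - t) / h) / h)))"
    if "j < m" for j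
  proof -
    have *: "(\<Sum>k<p + 1. vec_index (Matrix.row Q 0) k * ((ts i - t) ^ k * (K ((ts i - t) / h) / h))) =
      (\<Sum>k\<le>p. b k * ((ts i - t) ^ k * (K ((ts i - t) / h) / h)))" for i
      unfolding b_def using Qc by (simp add: lessThan_Suc_atMost)
    have "lpk_weight p K h m ts t j = (\<Sum>i<p + 1. vec_index (unit_vec (p + 1) 0) i *
        (\<Sum>j'<m. (\<Sum>k<p + 1. vec_index (Matrix.row Q i) k * ((ts j' - t) ^ k * (K ((ts j' - t) / h) / h))) * (if j' = j then 1 else 0)))"
      unfolding lpk_weight_def lpk_sum_form A_def[symmetric] Q Let_def using Qc by simp
    also have "\<dots> = (\<Sum>i<p + 1. if i = 0 then
        (\<Sum>j'<m. (\<Sum>k<p + 1. vec_index (Matrix.row Q 0) k * ((ts j' - t) ^ k * (K ((ts j' - t) / h) / h))) * (if j' = j then 1 else 0)) else 0)"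
      by (intro sum.cong) auto
    also have "\<dots> = (\<Sum>j'<m. (\<Sum>k<p + 1. vec_index (Matrix.row Q 0) k * ((ts j' - t) ^ k * (K ((ts j' - t) / h) / h))) * (if j' = j then 1 else 0))"
      by simp
    also have "\<dots> = (\<Sum>j'<m. if j' = j then (\<Sum>k\<le>p. b k * ((ts j' - t) ^ k * (K ((ts j' - t) / h) / h))) else 0)"
      unfolding * by (intro sum.cong) auto
    also have "\<dots> = (\<Sum>k\<le>p. b k * ((ts j - t) ^ k * (K ((ts j - t) / h) / h)))"
      using that by simp
    finally show ?thesis .
  qed
  have w': "lpk_weight p K h m ts t j =
      K ((ts j - t) / h) / (real m * h) * (\<Sum>k\<le>p. c k * ((ts j - t) / h) ^ k)" if "j < m" for j
    unfolding w[OF that] c_def sum_distrib_left using h m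
    by (intro sum.cong refl) (simp add: power_divide field_simps)
  have bA: "(\<Sum>k\<le>p. b k * A $$ (k, l)) = (if l = 0 then 1 else 0)" if "l \<le> p" for l
  proof -
    have "(Q * A) $$ (0, l) = (\<Sum>k<p + 1. Q $$ (0, k) * A $$ (k, l))"
      using that Qc A by (auto simp: scalar_prod_def atLeast0LessThan intro!: sum.cong)
    then show ?thesis using that unfolding QA b_def by (simp add: lessThan_Suc_atMost)
  qed
  have repr: "(\<Sum>j<m. lpk_weight p K h m ts t j * (ts j - t) ^ l) = (if l = 0 then 1 else 0)" if "l \<le> p" for l
  proof -
    have "(\<Sum>j<m. lpk_weight p K h m ts t j * (ts j - t) ^ l) =
        (\<Sum>j<m. \<Sum>k\<le>p. b k * ((ts j - t) ^ k * (K ((ts j - t) / h) / h) * (ts j - t) ^ l))"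
      by (intro sum.cong refl) (simp add: w sum_distrib_right mult.assoc)
    also have "\<dots> = (\<Sum>k\<le>p. b k * A $$ (k, l))"
      using that by (subst sum.swap, intro sum.cong refl) (simp add: A_def lpk_gram_def sum_distrib_left)
    finally show ?thesis using bA[OF that] by simp
  qed
  have cS: "(\<Sum>k\<le>p. c k * S (k + l)) = (if l = 0 then 1 else 0)" if "l \<le> p" for l
  proof -
    have "h ^ l * (\<Sum>k\<le>p. c k * S (k + l)) = (\<Sum>k\<le>p. b k * A $$ (k, l))"
      unfolding sum_distrib_left using that by (intro sum.cong refl) (simp add: c_def Aent power_add)
    also have "\<dots> = h ^ l * (if l = 0 then 1 else 0)" using bA[OF that] by simp
    finally show ?thesis using h by (simp split: if_splits)
  qed
  have "lam * (\<Sum>k\<le>p. (c k)\<^sup>2) \<le> (\<Sum>k\<le>p. \<Sum>l\<le>p. c k * c l * S (k + l))"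
    unfolding S_def by (rule coer)
  also have "\<dots> = (\<Sum>l\<le>p. c l * (\<Sum>k\<le>p. c k * S (k + l)))"
    by (subst sum.swap) (simp add: sum_distrib_left mult_ac)
  also have "\<dots> = (\<Sum>l\<le>p. if l = 0 then c 0 else 0)"
    by (intro sum.cong) (auto simp: cS)
  finally have le: "lam * (\<Sum>k\<le>p. (c k)\<^sup>2) \<le> c 0" by simp
  have "(c 0)\<^sup>2 \<le> (\<Sum>k\<le>p. (c k)\<^sup>2)" by (rule member_le_sum) auto
  moreover define r where "r = sqrt (\<Sum>k\<le>p. (c k)\<^sup>2)"
  ultimately have r: "r \<ge> 0" "r\<^sup>2 = (\<Sum>k\<le>p. (c k)\<^sup>2)" "c 0 \<le> r"
    by (auto simp: sum_nonneg intro: real_le_rsqrt)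
  then have "lam * r * r \<le> 1 * r" using le unfolding r(2)[symmetric] by (simp add: power2_eq_square)
  then have "r \<le> 1 / lam" using lam0 r(1)
    by (cases "r = 0") (auto simp: field_simps)
  then have "(\<Sum>k\<le>p. (c k)\<^sup>2) \<le> (1 / lam)\<^sup>2" unfolding r(2)[symmetric] using r(1) by (intro power_mono)
  then show ?thesis using w' repr by (intro exI[of _ c] conjI allI impI) blast+
qed

lemma borel_measurable_det:
  assumes "\<And>\<omega>. F \<omega> \<in> carrier_mat n n"
    and "\<And>i j. i < n \<Longrightarrow> j < n \<Longrightarrow> (\<lambda>\<omega>. F \<omega> $$ (i, j) :: real) \<in> borel_measurable M"
  shows "(\<lambda>\<omega>. Determinant.det (F \<omega>)) \<in> borel_measurable M"
proof -
  have "(\<lambda>\<omega>. \<Sum>q | q permutes {0..<n}. signof q * (\<Prod>i = 0..<n. F \<omega> $$ (i, q i))) \<in> borel_measurable M"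
  proof (intro borel_measurable_sum borel_measurable_times borel_measurable_const borel_measurable_prod assms(2))
    fix q i assume "q \<in> {q. q permutes {0..<n}}" "i \<in> {0..<n}"
    then show "i < n" "q i < n" using permutes_in_image[of q "{0..<n}" i] by auto
  qed
  then show ?thesis by (subst det_def'[OF assms(1)])
qed

text \<open>On singular designs the value depends on the design only through the fixed unspecified
  matrix \<open>the None\<close>; on the others Cramer's rule expresses the inverse by determinants.\<close>

lemma borel_measurable_lpk [measurable (raw)]:
  assumes K [measurable]: "K \<in> borel_measurable borel"
    and T [measurable]: "\<And>j. j < m \<Longrightarrow> (\<lambda>\<omega>. T j \<omega>) \<in> borel_measurable M"
    and Y [measurable]: "\<And>j. j < m \<Longrightarrow> (\<lambda>\<omega>. Y j \<omega>) \<in> borel_measurable M"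
  shows "(\<lambda>\<omega>. lpk p K h m (\<lambda>j. T j \<omega>) (\<lambda>j. Y j \<omega>) t) \<in> borel_measurable M"
proof -
  define A where "A \<omega> = lpk_gram p K h m (\<lambda>j. T j \<omega>) t" for \<omega>
  have A: "A \<omega> \<in> carrier_mat (p + 1) (p + 1)" for \<omega> by (simp add: A_def lpk_gram_def)
  have ent: "(\<lambda>\<omega>. A \<omega> $$ (k, l)) \<in> borel_measurable M" if "k < p + 1" "l < p + 1" for k l
    unfolding A_def lpk_gram_def using that by simp measurable
  have det [measurable]: "(\<lambda>\<omega>. Determinant.det (A \<omega>)) \<in> borel_measurable M"
    by (rule borel_measurable_det[OF A ent])
  have adj: "(\<lambda>\<omega>. adj_mat (A \<omega>) $$ (k, l)) \<in> borel_measurable M" if "k < p + 1" "l < p + 1" for k l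
  proof -
    have d: "(\<lambda>\<omega>. Determinant.det (mat_delete (A \<omega>) l k)) \<in> borel_measurable M"
    proof (rule borel_measurable_det[where n = p])
      show "mat_delete (A \<omega>) l k \<in> carrier_mat p p" for \<omega>
        using mat_delete_carrier[OF A, of \<omega> l k] by simp
      fix i j assume ij: "i < p" "j < p"
      then have "mat_delete (A \<omega>) l k $$ (i, j) = A \<omega> $$ (if i < l then i else Suc i, if j < k then j else Suc j)" for \<omega>
        using A[of \<omega>] unfolding mat_delete_def by simp
      then show "(\<lambda>\<omega>. mat_delete (A \<omega>) l k $$ (i, j)) \<in> borel_measurable M"
        using ent ij by simp
    qed
    have "adj_mat (A \<omega>) $$ (k, l) = (-1) ^ (l + k) * Determinant.det (mat_delete (A \<omega>) l k)" for \<omega>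
      using that A[of \<omega>] by (auto simp: adj_mat_def cofactor_def)
    with d show ?thesis by simp
  qed
  define G where "G B \<omega> = (\<Sum>i<p + 1. vec_index (unit_vec (p + 1) 0) i *
        (\<Sum>j<m. (\<Sum>k<p + 1. B i k * ((T j \<omega> - t) ^ k * (K ((T j \<omega> - t) / h) / h))) * Y j \<omega>))"
    for B :: "nat \<Rightarrow> nat \<Rightarrow> real" and \<omega>
  define Q0 where "Q0 = (the None :: real mat)"
  define G0 where "G0 \<omega> = (\<Sum>i<dim_row Q0. vec_index (unit_vec (p + 1) 0) i *
        (\<Sum>j<m. (\<Sum>k<p + 1. vec_index (Matrix.row Q0 i) k * ((T j \<omega> - t) ^ k * (K ((T j \<omega> - t) / h) / h))) * Y j \<omega>))" for \<omega>
  have eq: "lpk p K h m (\<lambda>j. T j \<omega>) (\<lambda>j. Y j \<omega>) t =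
    (if Determinant.det (A \<omega>) \<noteq> 0 then G (\<lambda>i k. adj_mat (A \<omega>) $$ (i, k) / Determinant.det (A \<omega>)) \<omega> else G0 \<omega>)" for \<omega>
  proof (cases "Determinant.det (A \<omega>) = 0")
    case True
    have "mat_inverse (A \<omega>) = None"
    proof (rule ccontr)
      assume "mat_inverse (A \<omega>) \<noteq> None"
      then obtain Q where "mat_inverse (A \<omega>) = Some Q" by auto
      from mat_inverse(2)[OF A this] have "A \<omega> * Q = 1\<^sub>m (p + 1)" "Q \<in> carrier_mat (p + 1) (p + 1)" by auto
      then have "Determinant.det (A \<omega>) * Determinant.det Q = 1" using det_mult[OF A, of Q \<omega>] by simp
      then show False using True by simp
    qed
    then show ?thesis using True unfolding lpk_sum_form A_def[symmetric] G0_def Q0_def Let_def by simp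
  next
    case False
    obtain Q where Q: "mat_inverse (A \<omega>) = Some Q"
      using mat_inverse(1)[OF A, where b = "()"] det_non_zero_imp_unit[OF A False, of "()"]
      by (cases "mat_inverse (A \<omega>)") blast+
    from mat_inverse(2)[OF A Q] have QA: "Q * A \<omega> = 1\<^sub>m (p + 1)" and Qc: "Q \<in> carrier_mat (p + 1) (p + 1)" by auto
    have adjc: "adj_mat (A \<omega>) \<in> carrier_mat (p + 1) (p + 1)"
      and adje: "A \<omega> * adj_mat (A \<omega>) = Determinant.det (A \<omega>) \<cdot>\<^sub>m 1\<^sub>m (p + 1)"
      using adj_mat[OF A] by auto
    have "adj_mat (A \<omega>) = Q * (A \<omega> * adj_mat (A \<omega>))"
      using QA adjc by (subst assoc_mult_mat[symmetric, OF Qc A adjc]) auto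
    also have "\<dots> = Determinant.det (A \<omega>) \<cdot>\<^sub>m Q" unfolding adje using Qc
      by (subst mult_smult_distrib[OF Qc one_carrier_mat]) (simp del: One_nat_def)
    finally have "adj_mat (A \<omega>) $$ (i, k) / Determinant.det (A \<omega>) = vec_index (Matrix.row Q i) k" if "i < p + 1" "k < p + 1" for i k
      using False Qc that by simp
    then show ?thesis using False Qc unfolding lpk_sum_form A_def[symmetric] Q Let_def G_def by simp
  qed
  have [measurable]: "G0 \<in> borel_measurable M" unfolding G0_def by measurable
  have [measurable]: "(\<lambda>\<omega>. G (\<lambda>i k. adj_mat (A \<omega>) $$ (i, k) / Determinant.det (A \<omega>)) \<omega>) \<in> borel_measurable M"
    unfolding G_def
    by (intro borel_measurable_sum borel_measurable_times borel_measurable_const borel_measurable_divide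
        det adj borel_measurable_power borel_measurable_diff T Y measurable_compose[OF _ K]) auto
  show ?thesis unfolding eq by measurable
qed

section \<open>Finite differences and Taylor remainders\<close>

primrec fdiff :: "nat \<Rightarrow> real \<Rightarrow> (real \<Rightarrow> real) \<Rightarrow> real \<Rightarrow> real" where
  "fdiff 0 \<eta> F u = F u"
| "fdiff (Suc m) \<eta> F u = fdiff m \<eta> (\<lambda>w. F (w + \<eta>) - F w) u"

lemma fdiff_sum:
  "\<exists>a. \<forall>\<eta> F u. fdiff m \<eta> F u = (\<Sum>k\<le>m. a k * F (u + real k * \<eta>))"
proof (induction m)
  case 0
  show ?case by (intro exI[of _ "\<lambda>_. 1"]) simp
next
  case (Suc m)
  then obtain a where a: "\<And>\<eta> F u. fdiff m \<eta> F u = (\<Sum>k\<le>m. a k * F (u + real k * \<eta>))" by metis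
  define b where "b k = (if k = 0 then 0 else a (k - 1)) - (if k \<le> m then a k else 0)" for k
  have "fdiff (Suc m) \<eta> F u = (\<Sum>k\<le>Suc m. b k * F (u + real k * \<eta>))" for \<eta> F u
  proof -
    have "(\<Sum>k\<le>Suc m. b k * F (u + real k * \<eta>)) =
        (\<Sum>k\<le>Suc m. (if k = 0 then 0 else a (k - 1)) * F (u + real k * \<eta>)) -
        (\<Sum>k\<le>Suc m. (if k \<le> m then a k else 0) * F (u + real k * \<eta>))"
      unfolding b_def by (simp only: left_diff_distrib sum_subtractf)
    also have "(\<Sum>k\<le>Suc m. (if k = 0 then 0 else a (k - 1)) * F (u + real k * \<eta>)) =
        (\<Sum>k\<le>m. a k * F (u + real (Suc k) * \<eta>))"
      by (subst sum.atMost_Suc_shift) simp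
    also have "(\<Sum>k\<le>Suc m. (if k \<le> m then a k else 0) * F (u + real k * \<eta>)) =
        (\<Sum>k\<le>m. a k * F (u + real k * \<eta>))"
      by simp
    finally show ?thesis
      by (simp add: a sum_subtractf[symmetric] algebra_simps)
  qed
  then show ?case by blast
qed

text \<open>Repeated mean value theorem: the inner difference of step \<open>\<eta>\<close> is itself a differentiable function
  with one derivative less to spend.\<close>

lemma fdiff_mean_value:
  assumes "\<And>k w. k < m \<Longrightarrow> c < w \<Longrightarrow> w < d \<Longrightarrow> (D k has_real_derivative D (Suc k) w) (at w)"
    and "0 < \<eta>" "c < u" "u + real m * \<eta> < d"
  shows "\<exists>\<xi>\<ge>u. \<xi> \<le> u + real m * \<eta> \<and> fdiff m \<eta> (D 0) u = \<eta> ^ m * D m \<xi>"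
  using assms
proof (induction m arbitrary: D d)
  case 0
  then show ?case by auto
next
  case (Suc m)
  define G where "G k w = D k (w + \<eta>) - D k w" for k w
  have bd: "u + real m * \<eta> < d - \<eta>" using Suc.prems(4) by (simp add: algebra_simps)
  have "\<exists>\<xi>\<ge>u. \<xi> \<le> u + real m * \<eta> \<and> fdiff m \<eta> (G 0) u = \<eta> ^ m * G m \<xi>"
  proof (rule Suc.IH)
    fix k w assume kw: "k < m" "c < w" "w < d - \<eta>"
    have 1: "(D k has_real_derivative D (Suc k) (w + \<eta>)) (at (w + \<eta>))"
      and 2: "(D k has_real_derivative D (Suc k) w) (at w)"
      using kw Suc.prems(2) by (auto intro!: Suc.prems(1))
    show "(G k has_real_derivative G (Suc k) w) (at w)"
      unfolding G_def[abs_def] using DERIV_diff[OF DERIV_shift[THEN iffD1, OF 1] 2] by simp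
  qed (use Suc.prems bd in auto)
  then obtain \<xi> where \<xi>: "u \<le> \<xi>" "\<xi> \<le> u + real m * \<eta>" "fdiff m \<eta> (G 0) u = \<eta> ^ m * G m \<xi>" by auto
  have "\<exists>z. \<xi> < z \<and> z < \<xi> + \<eta> \<and> D m (\<xi> + \<eta>) - D m \<xi> = (\<xi> + \<eta> - \<xi>) * D (Suc m) z"
    using \<xi> bd Suc.prems by (intro MVT2) (auto intro!: Suc.prems(1))
  then obtain z where z: "\<xi> < z" "z < \<xi> + \<eta>" "G m \<xi> = \<eta> * D (Suc m) z" by (auto simp: G_def)
  have "fdiff (Suc m) \<eta> (D 0) u = \<eta> ^ Suc m * D (Suc m) z"
    using \<xi>(3) z(3) by (simp add: G_def[abs_def] mult_ac)
  moreover have "u \<le> z" "z \<le> u + real (Suc m) * \<eta>" using \<xi> z by (auto simp: algebra_simps)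
  ultimately show ?case by blast
qed

lemma shrinking_step:
  shows "(\<lambda>n. u + real m * (1 / real (Suc n))) \<longlonglongrightarrow> u"
    and "u < d \<Longrightarrow> \<forall>\<^sub>F n in sequentially. u + real m * (1 / real (Suc n)) < d"
proof -
  show "(\<lambda>n. u + real m * (1 / real (Suc n))) \<longlonglongrightarrow> u"
    using tendsto_add[OF tendsto_const[of u] tendsto_mult[OF tendsto_const[of "real m"] LIMSEQ_inverse_real_of_nat]]
    by (simp add: inverse_eq_divide)
  from order_tendstoD(2)[OF this]
  show "u < d \<Longrightarrow> \<forall>\<^sub>F n in sequentially. u + real m * (1 / real (Suc n)) < d" .
qed

lemma fdiff_LIMSEQ:
  assumes D: "\<And>k w. k < m \<Longrightarrow> c < w \<Longrightarrow> w < d \<Longrightarrow> (D k has_real_derivative D (Suc k) w) (at w)"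
    and cont: "continuous_on {c<..<d} (D m)" and u: "c < u" "u < d"
  shows "(\<lambda>n. real (Suc n) ^ m * fdiff m (1 / real (Suc n)) (D 0) u) \<longlonglongrightarrow> D m u"
proof -
  note lim0 = shrinking_step(1)[of u m] and ev = shrinking_step(2)[OF u(2), of m]
  have ex: "\<exists>\<xi>. u \<le> \<xi> \<and> \<xi> \<le> u + real m * (1 / real (Suc n)) \<and>
      (u + real m * (1 / real (Suc n)) < d \<longrightarrow>
        real (Suc n) ^ m * fdiff m (1 / real (Suc n)) (D 0) u = D m \<xi>)" for n
  proof (cases "u + real m * (1 / real (Suc n)) < d")
    case True
    from fdiff_mean_value[of m c d D "1 / real (Suc n)" u, OF D _ u(1) True] obtain \<xi>
      where "u \<le> \<xi>" "\<xi> \<le> u + real m * (1 / real (Suc n))"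
        "fdiff m (1 / real (Suc n)) (D 0) u = (1 / real (Suc n)) ^ m * D m \<xi>" by auto
    then show ?thesis by (intro exI[of _ \<xi>]) (simp add: power_divide del: of_nat_Suc)
  next
    case False
    then show ?thesis by (intro exI[of _ u]) auto
  qed
  define \<xi> where "\<xi> n = (SOME \<xi>. u \<le> \<xi> \<and> \<xi> \<le> u + real m * (1 / real (Suc n)) \<and>
      (u + real m * (1 / real (Suc n)) < d \<longrightarrow>
        real (Suc n) ^ m * fdiff m (1 / real (Suc n)) (D 0) u = D m \<xi>))" for n
  have \<xi>: "u \<le> \<xi> n" "\<xi> n \<le> u + real m * (1 / real (Suc n))"
    "u + real m * (1 / real (Suc n)) < d \<Longrightarrow> real (Suc n) ^ m * fdiff m (1 / real (Suc n)) (D 0) u = D m (\<xi> n)" for n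
    using someI_ex[OF ex[of n]] unfolding \<xi>_def[symmetric] by blast+
  have lim\<xi>: "\<xi> \<longlonglongrightarrow> u"
    by (rule tendsto_sandwich[OF _ _ tendsto_const lim0]) (use \<xi> in auto)
  have "isCont (D m) u" using cont u by (simp add: continuous_on_eq_continuous_at)
  then have "(\<lambda>n. D m (\<xi> n)) \<longlonglongrightarrow> D m u" using lim\<xi> by (rule isCont_tendsto_compose)
  moreover have "\<forall>\<^sub>F n in sequentially. D m (\<xi> n) = real (Suc n) ^ m * fdiff m (1 / real (Suc n)) (D 0) u"
    using ev by eventually_elim (use \<xi>(3) in simp)
  ultimately show ?thesis by (rule Lim_transform_eventually)
qed

text \<open>Cauchy--Schwarz for the fundamental theorem of calculus.  The right-hand side stays
  meaningful when the integral is infinite, which makes it usable path by path.\<close>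

lemma increment_sq_le_nn_integral:
  fixes F f :: "real \<Rightarrow> real"
  assumes ab: "a \<le> b" and F: "\<And>x. a \<le> x \<Longrightarrow> x \<le> b \<Longrightarrow> (F has_real_derivative f x) (at x)"
    and cont: "continuous_on {a..b} f"
  shows "ennreal ((F b - F a)\<^sup>2) \<le> ennreal (b - a) * (\<integral>\<^sup>+u. ennreal ((f u)\<^sup>2) * indicator {a..b} u \<partial>lborel)"
proof -
  have hbi: "has_bochner_integral lborel (\<lambda>x. indicator {a..b} x *\<^sub>R f x) (F b - F a)"
    using F by (intro has_bochner_integral_FTC_Icc[OF ab _ cont])
      (auto simp: has_real_derivative_iff_has_vector_derivative[symmetric] intro: has_field_derivative_at_within)
  have meas [measurable]: "(\<lambda>x. indicator {a..b} x *\<^sub>R f x) \<in> borel_measurable lborel"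
    using hbi by (auto simp: has_bochner_integral_iff)
  have "ennreal \<bar>F b - F a\<bar> \<le> (\<integral>\<^sup>+x. ennreal (norm (indicator {a..b} x *\<^sub>R f x)) \<partial>lborel)"
    using integral_norm_bound_ennreal[of lborel "\<lambda>x. indicator {a..b} x *\<^sub>R f x"] hbi
    by (auto simp: has_bochner_integral_iff)
  also have "\<dots> = (\<integral>\<^sup>+x. ennreal (norm (indicator {a..b} x *\<^sub>R f x)) * indicator {a..b} x \<partial>lborel)"
    by (intro nn_integral_cong) (auto split: split_indicator)
  finally have 1: "ennreal \<bar>F b - F a\<bar> \<le> (\<integral>\<^sup>+x. ennreal (norm (indicator {a..b} x *\<^sub>R f x)) * indicator {a..b} x \<partial>lborel)" .
  have "ennreal ((F b - F a)\<^sup>2) = (ennreal \<bar>F b - F a\<bar>)\<^sup>2"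
    by (simp add: ennreal_power)
  also have "\<dots> \<le> (\<integral>\<^sup>+x. ennreal (norm (indicator {a..b} x *\<^sub>R f x)) * indicator {a..b} x \<partial>lborel)\<^sup>2"
    by (rule power_mono[OF 1]) auto
  also have "\<dots> \<le> (\<integral>\<^sup>+x. (ennreal (norm (indicator {a..b} x *\<^sub>R f x)))\<^sup>2 \<partial>lborel) *
      (\<integral>\<^sup>+x. (indicator {a..b} x)\<^sup>2 \<partial>lborel)"
    by (rule Cauchy_Schwarz_nn_integral) measurable
  also have "(\<integral>\<^sup>+x. (indicator {a..b} x :: ennreal)\<^sup>2 \<partial>lborel) = (\<integral>\<^sup>+x. indicator {a..b} x \<partial>lborel)"
    by (intro nn_integral_cong) (auto split: split_indicator)
  also have "\<dots> = ennreal (b - a)" using ab by simp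
  also have "(\<integral>\<^sup>+x. (ennreal (norm (indicator {a..b} x *\<^sub>R f x)))\<^sup>2 \<partial>lborel) =
      (\<integral>\<^sup>+u. ennreal ((f u)\<^sup>2) * indicator {a..b} u \<partial>lborel)"
    by (intro nn_integral_cong) (auto split: split_indicator simp: ennreal_power)
  finally show ?thesis by (simp add: mult.commute)
qed

text \<open>By the mean value form, the remainder is at most \<open>|s - t|^p\<close> times an increment of the derivative of
  order \<open>p\<close>, to which the previous lemma applies.  A bound by the integral of the squared derivative is
  needed, rather than by its supremum, because only its second moment at fixed times is controlled.\<close>

lemma taylor_remainder_sq:
  fixes D :: "nat \<Rightarrow> real \<Rightarrow> real"
  assumes D: "\<And>k w. k \<le> p \<Longrightarrow> c < w \<Longrightarrow> w < d \<Longrightarrow> (D k has_real_derivative D (Suc k) w) (at w)"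
    and cont: "continuous_on {c<..<d} (D (Suc p))"
    and p: "p > 0" and t: "c < t" "t < d" and s: "c < s" "s < d" and st: "\<bar>s - t\<bar> \<le> h"
  shows "ennreal ((D 0 s - (\<Sum>k\<le>p. D k t / fact k * (s - t) ^ k))\<^sup>2) \<le>
    ennreal (h ^ (2 * p + 1)) * (\<integral>\<^sup>+u. ennreal ((D (Suc p) u)\<^sup>2) * indicator ({t - h..t + h} \<inter> {c<..<d}) u \<partial>lborel)"
proof (cases "s = t")
  case True
  have "(\<Sum>k\<le>p. D k t / fact k * (t - t) ^ k) = (\<Sum>k\<le>p. if k = 0 then D 0 t else 0)"
    by (intro sum.cong) (auto simp: power_0_left)
  then show ?thesis using True by simp
next
  case False
  define lo hi where "lo = min s t" and "hi = max s t"
  have lh: "c < lo" "hi < d" "lo \<le> hi" using s t by (auto simp: lo_def hi_def)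
  have "\<exists>z. (if s < t then s < z \<and> z < t else t < z \<and> z < s) \<and>
      D 0 s = (\<Sum>m<p. (D m t / fact m) * (s - t) ^ m) + (D p z / fact p) * (s - t) ^ p"
    by (rule Taylor[where a = lo and b = hi]) (use p lh False D in \<open>auto simp: lo_def hi_def\<close>)
  then obtain z where z: "if s < t then s < z \<and> z < t else t < z \<and> z < s"
      "D 0 s = (\<Sum>m<p. (D m t / fact m) * (s - t) ^ m) + (D p z / fact p) * (s - t) ^ p" by blast
  have rem: "D 0 s - (\<Sum>k\<le>p. D k t / fact k * (s - t) ^ k) = (D p z - D p t) / fact p * (s - t) ^ p"
    unfolding z(2) by (simp add: lessThan_Suc_atMost[symmetric] diff_divide_distrib left_diff_distrib)
  define l r where "l = min z t" and "r = max z t"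
  have lr: "c < l" "r < d" "l \<le> r" "t - h \<le> l" "r \<le> t + h" "r - l \<le> h"
    using z(1) s t st by (auto simp: l_def r_def split: if_splits)
  have "ennreal ((D p z - D p t)\<^sup>2) = ennreal ((D p r - D p l)\<^sup>2)"
    by (auto simp: l_def r_def min_def max_def power2_commute)
  also have "\<dots> \<le> ennreal (r - l) * (\<integral>\<^sup>+u. ennreal ((D (Suc p) u)\<^sup>2) * indicator {l..r} u \<partial>lborel)"
    using lr by (intro increment_sq_le_nn_integral D continuous_on_subset[OF cont]) auto
  also have "\<dots> \<le> ennreal h * (\<integral>\<^sup>+u. ennreal ((D (Suc p) u)\<^sup>2) * indicator ({t - h..t + h} \<inter> {c<..<d}) u \<partial>lborel)"
    using lr by (intro mult_mono nn_integral_mono ennreal_leI) (auto split: split_indicator)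
  finally have inc: "ennreal ((D p z - D p t)\<^sup>2) \<le> \<dots>" .
  have h0: "h \<ge> 0" using st by auto
  have "((D p z - D p t) / fact p * (s - t) ^ p)\<^sup>2 = (D p z - D p t)\<^sup>2 * (\<bar>s - t\<bar> ^ (2 * p)) / (fact p)\<^sup>2"
    by (simp add: power_mult_distrib power_divide power_mult[symmetric] mult.commute[of p 2])
       (simp add: power_mult)
  also have "\<dots> \<le> (D p z - D p t)\<^sup>2 * h ^ (2 * p) / 1"
    by (intro frac_le mult_left_mono power_mono st) (auto simp: h0 fact_ge_1)
  finally have "ennreal (((D p z - D p t) / fact p * (s - t) ^ p)\<^sup>2) \<le> ennreal (h ^ (2 * p)) * ennreal ((D p z - D p t)\<^sup>2)"
    by (subst ennreal_mult'[symmetric]) (auto simp: h0 mult.commute intro!: ennreal_leI)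
  also have "\<dots> \<le> ennreal (h ^ (2 * p)) * (ennreal h * (\<integral>\<^sup>+u. ennreal ((D (Suc p) u)\<^sup>2) * indicator ({t - h..t + h} \<inter> {c<..<d}) u \<partial>lborel))"
    by (intro mult_left_mono inc) auto
  also have "\<dots> = ennreal (h ^ (2 * p + 1)) * (\<integral>\<^sup>+u. ennreal ((D (Suc p) u)\<^sup>2) * indicator ({t - h..t + h} \<inter> {c<..<d}) u \<partial>lborel)"
    using h0 by (simp add: mult.assoc[symmetric] ennreal_mult'[symmetric] mult.commute)
  finally show ?thesis unfolding rem .
qed

section \<open>Kernel moments of the design density\<close>

lemma compact_Pi_UNIV:
  fixes S :: "'i \<Rightarrow> 'b::topological_space set"
  assumes "\<And>i. compact (S i)"
  shows "compact {f. \<forall>i. f i \<in> S i}"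
proof -
  have "compactin (product_topology (\<lambda>i. euclidean) UNIV) (Pi\<^sub>E UNIV S)"
    using assms by (subst compactin_PiE) auto
  moreover have "Pi\<^sub>E UNIV S = {f. \<forall>i. f i \<in> S i}" by auto
  ultimately show ?thesis by (simp add: euclidean_product_topology)
qed

lemma kernel_densityD:
  assumes "kernel_density K"
  shows "K \<in> borel_measurable borel" "integrable lborel K" "(\<integral>u. K u \<partial>lborel) = 1"
    "\<And>u. K u \<ge> 0" "\<And>u. K (- u) = K u" "\<And>u. \<bar>u\<bar> > 1 \<Longrightarrow> K u = 0"
proof -
  show "K \<in> borel_measurable borel" "integrable lborel K" "(\<integral>u. K u \<partial>lborel) = 1"
    using assms by (auto simp: kernel_density_def has_bochner_integral_iff dest: borel_measurable_integrable)
  show "\<And>u. K u \<ge> 0" "\<And>u. K (- u) = K u"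
    using assms by (auto simp: kernel_density_def)
  show "K u = 0" if "\<bar>u\<bar> > 1" for u
  proof -
    have "u \<notin> {-1..1}" using that by auto
    then show ?thesis using assms unfolding kernel_density_def by blast
  qed
qed

text \<open>A Hankel form is the integral of a squared polynomial.\<close>

lemma quadratic_form_of_moments:
  fixes w :: "real \<Rightarrow> real"
  assumes "\<And>l. integrable lborel (\<lambda>u. w u * u ^ l)"
  shows "(\<Sum>k\<le>p. \<Sum>l\<le>p. c k * c l * (\<integral>u. w u * u ^ (k + l) \<partial>lborel)) =
      (\<integral>u. w u * (\<Sum>k\<le>p. c k * u ^ k)\<^sup>2 \<partial>lborel)"
    "integrable lborel (\<lambda>u. w u * (\<Sum>k\<le>p. c k * u ^ k)\<^sup>2)"
proof -
  have eq: "w u * (\<Sum>k\<le>p. c k * u ^ k)\<^sup>2 = (\<Sum>k\<le>p. \<Sum>l\<le>p. c k * c l * (w u * u ^ (k + l)))" for u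
    unfolding power2_eq_square sum_product unfolding sum_distrib_left
    by (intro sum.cong refl) (simp add: power_add mult_ac)
  show "(\<Sum>k\<le>p. \<Sum>l\<le>p. c k * c l * (\<integral>u. w u * u ^ (k + l) \<partial>lborel)) =
      (\<integral>u. w u * (\<Sum>k\<le>p. c k * u ^ k)\<^sup>2 \<partial>lborel)"
    unfolding eq using assms by simp
  show "integrable lborel (\<lambda>u. w u * (\<Sum>k\<le>p. c k * u ^ k)\<^sup>2)"
    unfolding eq using assms by simp
qed

lemma kernel_moment_integrable:
  assumes K: "kernel_density K" and w: "w \<in> borel_measurable borel" "\<And>u. \<bar>w u\<bar> \<le> 1"
  shows "integrable lborel (\<lambda>u. w u * K u * u ^ l)"
proof (rule Bochner_Integration.integrable_bound[OF kernel_densityD(2)[OF K]])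
  note kernel_densityD(1)[OF K, measurable] w(1)[measurable]
  show "(\<lambda>u. w u * K u * u ^ l) \<in> borel_measurable lborel" by measurable
  show "AE u in lborel. norm (w u * K u * u ^ l) \<le> norm (K u)"
  proof (intro AE_I2)
    fix u
    show "norm (w u * K u * u ^ l) \<le> norm (K u)"
    proof (cases "\<bar>u\<bar> > 1")
      case True
      then show ?thesis using kernel_densityD(6)[OF K] by simp
    next
      case False
      then have "\<bar>u\<bar> ^ l \<le> 1" by (intro power_le_one) auto
      then have "\<bar>w u\<bar> * \<bar>u\<bar> ^ l \<le> 1 * 1" using w(2) by (intro mult_mono) auto
      then have "(\<bar>w u\<bar> * \<bar>u\<bar> ^ l) * \<bar>K u\<bar> \<le> 1 * \<bar>K u\<bar>" by (intro mult_right_mono) auto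
      then show ?thesis by (simp add: abs_mult power_abs mult_ac)
    qed
  qed
qed

text \<open>By symmetry half of the mass of the kernel lies on \<open>[0, 1]\<close>, and a nonzero polynomial vanishes only on
  a finite set, so the quadratic form is positive definite; its minimum over the compact unit sphere of
  coefficient vectors is the constant.  One side suffices because close to an end point of the design
  interval only one side of the window contains design points.\<close>

lemma kernel_energy_half_line:
  assumes K: "kernel_density K"
  shows "\<exists>lam>0. \<forall>c. lam * (\<Sum>k\<le>p. (c k)\<^sup>2) \<le>
    (\<integral>u. indicator {0..1} u * K u * (\<Sum>k\<le>p. c k * u ^ k)\<^sup>2 \<partial>lborel)"
proof -
  note kernel_densityD(1)[OF K, measurable]
  define w where "w u = indicator {0..1} u * K u" for u :: real
  have wint: "integrable lborel (\<lambda>u. w u * u ^ l)" for l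
    unfolding w_def by (rule kernel_moment_integrable[OF K]) (auto split: split_indicator)
  define \<mu> where "\<mu> l = (\<integral>u. w u * u ^ l \<partial>lborel)" for l
  define Q where "Q c = (\<Sum>k\<le>p. \<Sum>l\<le>p. c k * c l * \<mu> (k + l))" for c :: "nat \<Rightarrow> real"
  have Q: "Q c = (\<integral>u. w u * (\<Sum>k\<le>p. c k * u ^ k)\<^sup>2 \<partial>lborel)" for c
    unfolding Q_def \<mu>_def by (rule quadratic_form_of_moments(1)[OF wint])
  have w0: "w u \<ge> 0" for u unfolding w_def using kernel_densityD(4)[OF K] by simp
  (* Reflected copies of w cover K, so w has at least half of its mass. *)
  have half: "(\<integral>u. w u \<partial>lborel) > 0"
  proof -
    have i0: "integrable lborel w" using wint[of 0] by simp
    have i1: "integrable lborel (\<lambda>u. w (- u))"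
      using lborel_integrable_real_affine[OF i0, of "-1" 0] by simp
    have "(\<integral>u. w (- u) \<partial>lborel) = (\<integral>u. w u \<partial>lborel)"
      using lborel_integral_real_affine[of "-1" w 0] by simp
    moreover have "(\<integral>u. K u \<partial>lborel) \<le> (\<integral>u. w u + w (- u) \<partial>lborel)"
    proof (rule integral_mono[OF kernel_densityD(2)[OF K]])
      show "integrable lborel (\<lambda>u. w u + w (- u))" using i0 i1 by simp
      show "K u \<le> w u + w (- u)" for u
        using kernel_densityD(4-6)[OF K, of u] unfolding w_def
        by (auto split: split_indicator simp: not_le)
    qed
    ultimately show ?thesis using kernel_densityD(3)[OF K] i0 i1 by simp
  qed
  have pos: "Q c > 0" if "k \<le> p" "c k \<noteq> 0" for c k
  proof (rule ccontr)
    assume "\<not> Q c > 0"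
    moreover have "Q c \<ge> 0" unfolding Q using w0 by (intro integral_nonneg_AE) auto
    ultimately have "(\<integral>u. w u * (\<Sum>k\<le>p. c k * u ^ k)\<^sup>2 \<partial>lborel) = 0" using Q[of c] by simp
    then have "AE u in lborel. w u * (\<Sum>k\<le>p. c k * u ^ k)\<^sup>2 = 0"
      using integral_nonneg_eq_0_iff_AE[OF quadratic_form_of_moments(2)[OF wint]] w0 by auto
    moreover have "finite {u. (\<Sum>k\<le>p. c k * u ^ k) = 0}"
      using that polyfun_finite_roots by blast
    then have "AE u in lborel. u \<notin> {u. (\<Sum>k\<le>p. c k * u ^ k) = 0}"
      by (intro AE_not_in finite_imp_null_set_lborel)
    ultimately have "AE u in lborel. w u = 0" by eventually_elim auto
    then have "(\<integral>u. w u \<partial>lborel) = 0" by (simp add: integral_eq_zero_AE)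
    then show False using half by simp
  qed
  (* The unit sphere of coefficient vectors, inside a compact box; coefficients beyond p are set to 0. *)
  define S where "S = {c :: nat \<Rightarrow> real. (\<forall>k. c k \<in> (if k \<le> p then {-1..1} else {0})) \<and> (\<Sum>k\<le>p. (c k)\<^sup>2) = 1}"
  have contc: "continuous_on UNIV (\<lambda>c :: nat \<Rightarrow> real. c k)" for k
    by (rule continuous_on_product_coordinates)
  have "compact {c :: nat \<Rightarrow> real. \<forall>k. c k \<in> (if k \<le> p then {-1..1} else {0})}"
    by (rule compact_Pi_UNIV) auto
  moreover have "closed {c :: nat \<Rightarrow> real. (\<Sum>k\<le>p. (c k)\<^sup>2) = 1}"
    by (intro closed_Collect_eq continuous_intros contc)
  ultimately have "compact ({c :: nat \<Rightarrow> real. \<forall>k. c k \<in> (if k \<le> p then {-1..1} else {0})} \<inter>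
      {c. (\<Sum>k\<le>p. (c k)\<^sup>2) = 1})"
    by (rule compact_Int_closed)
  then have "compact S" unfolding S_def by (simp add: Collect_conj_eq)
  moreover have "(\<lambda>k. if k = 0 then 1 else 0) \<in> S"
    by (auto simp: S_def if_distrib[of "\<lambda>x. x\<^sup>2"] cong: if_cong)
  moreover have "continuous_on S Q"
    unfolding Q_def by (intro continuous_intros continuous_on_subset[OF contc]) auto
  ultimately obtain c0 where c0: "c0 \<in> S" "\<And>c. c \<in> S \<Longrightarrow> Q c0 \<le> Q c"
    using continuous_attains_inf[of S Q] by blast
  have "\<exists>k\<le>p. c0 k \<noteq> 0"
  proof (rule ccontr)
    assume "\<not> ?thesis"
    then have "(\<Sum>k\<le>p. (c0 k)\<^sup>2) = 0" by simp
    then show False using c0(1) by (simp add: S_def)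
  qed
  then have lam: "Q c0 > 0" using pos by blast
  have "Q c0 * (\<Sum>k\<le>p. (c k)\<^sup>2) \<le> Q c" for c
  proof (cases "(\<Sum>k\<le>p. (c k)\<^sup>2) = 0")
    case True
    then show ?thesis unfolding Q[of c] using w0 by (auto intro!: integral_nonneg_AE)
  next
    case False
    define r where "r = sqrt (\<Sum>k\<le>p. (c k)\<^sup>2)"
    have r: "r > 0" "r\<^sup>2 = (\<Sum>k\<le>p. (c k)\<^sup>2)"
      using False sum_nonneg[of "{..p}" "\<lambda>k. (c k)\<^sup>2"] by (auto simp: r_def less_le)
    define d where "d k = (if k \<le> p then c k / r else 0)" for k
    have "(\<Sum>k\<le>p. (d k)\<^sup>2) = (\<Sum>k\<le>p. (c k)\<^sup>2 / r\<^sup>2)"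
      by (intro sum.cong) (auto simp: d_def power_divide)
    also have "\<dots> = 1" using r False by (simp add: sum_divide_distrib[symmetric])
    finally have d1: "(\<Sum>k\<le>p. (d k)\<^sup>2) = 1" .
    have "d k \<in> {-1..1}" if "k \<le> p" for k
    proof -
      have "(d k)\<^sup>2 \<le> (\<Sum>k\<le>p. (d k)\<^sup>2)" using that by (intro member_le_sum) auto
      then have "\<bar>d k\<bar> \<le> 1" unfolding d1 by (simp add: abs_square_le_1)
      then show ?thesis by auto
    qed
    then have "d \<in> S" using d1 by (auto simp: S_def d_def)
    then have "r\<^sup>2 * Q c0 \<le> r\<^sup>2 * Q d" using c0(2) by (intro mult_left_mono) auto
    also have "r\<^sup>2 * Q d = Q c"
      unfolding Q_def sum_distrib_left using r(1)
      by (intro sum.cong refl) (auto simp: d_def power2_eq_square)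
    finally show ?thesis using r by (simp add: mult.commute)
  qed
  then show ?thesis using lam unfolding Q w_def by (intro exI[of _ "\<integral>u. indicator {0..1} u * K u * (\<Sum>k\<le>p. c0 k * u ^ k)\<^sup>2 \<partial>lborel"] conjI allI)
qed

text \<open>For design points with density \<open>\<pi>\<close> this is the expectation of \<open>design_moment\<close>.\<close>

definition expected_moment :: "(real \<Rightarrow> real) \<Rightarrow> (real \<Rightarrow> real) \<Rightarrow> real \<Rightarrow> real \<Rightarrow> nat \<Rightarrow> real" where
  "expected_moment K \<pi> h t l = (\<integral>u. K u * u ^ l * \<pi> (t + h * u) \<partial>lborel)"

lemma expected_moment_integrable:
  assumes K: "kernel_density K" and pi: "integrable lborel \<pi>" and h: "h > 0"
  shows "integrable lborel (\<lambda>u. K u * u ^ l * \<pi> (t + h * u))"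
proof -
  note kernel_densityD(1)[OF K, measurable]
  obtain B where B: "\<And>u. K u \<le> B" using K by (auto simp: kernel_density_def)
  have i: "integrable lborel (\<lambda>u. \<pi> (t + h * u))"
    using h by (intro lborel_integrable_real_affine pi) auto
  then have "integrable lborel (\<lambda>u. B * \<pi> (t + h * u))" by simp
  then show ?thesis
  proof (rule Bochner_Integration.integrable_bound)
    show "(\<lambda>u. K u * u ^ l * \<pi> (t + h * u)) \<in> borel_measurable lborel"
      using i by measurable
    have "\<bar>K u * u ^ l\<bar> \<le> B" for u
    proof (cases "\<bar>u\<bar> > 1")
      case True
      then show ?thesis using kernel_densityD(4,6)[OF K] B order_trans by (auto intro: order_trans[OF _ B])
    next
      case False
      then have "\<bar>u\<bar> ^ l \<le> 1" by (intro power_le_one) auto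
      then have "K u * \<bar>u\<bar> ^ l \<le> B * 1" using B kernel_densityD(4)[OF K] order_trans
        by (intro mult_mono) (auto intro: order_trans[OF _ B])
      then show ?thesis using kernel_densityD(4)[OF K] by (simp add: abs_mult power_abs)
    qed
    then have "\<bar>K u * u ^ l\<bar> * \<bar>\<pi> (t + h * u)\<bar> \<le> B * \<bar>\<pi> (t + h * u)\<bar>" for u
      by (intro mult_right_mono) auto
    moreover have "B \<ge> 0" using B[of 0] kernel_densityD(4)[OF K, of 0] by linarith
    ultimately show "AE u in lborel. norm (K u * u ^ l * \<pi> (t + h * u)) \<le> norm (B * \<pi> (t + h * u))"
      by (auto simp: abs_mult)
  qed
qed

text \<open>The integrand is nonnegative, so the integral may be restricted to the side of \<open>t\<close> selected by
  the sign \<open>sg\<close>; reflecting \<open>u\<close> reduces \<open>sg = - 1\<close> to \<open>sg = 1\<close>.\<close>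

lemma expected_moment_coercive:
  assumes K: "kernel_density K" and pi: "integrable lborel \<pi>" "\<And>y. \<pi> y \<ge> 0" and h: "h > 0"
    and lam: "\<And>c. lam * (\<Sum>k\<le>p. (c k)\<^sup>2) \<le> (\<integral>u. indicator {0..1} u * K u * (\<Sum>k\<le>p. c k * u ^ k)\<^sup>2 \<partial>lborel)"
    and sg: "sg = 1 \<or> sg = - 1" and lower: "\<And>u. 0 < u \<Longrightarrow> u < 1 \<Longrightarrow> \<pi> (t + sg * h * u) \<ge> c1" and c1: "c1 \<ge> 0"
  shows "c1 * lam * (\<Sum>k\<le>p. (c k)\<^sup>2) \<le> (\<Sum>k\<le>p. \<Sum>l\<le>p. c k * c l * expected_moment K \<pi> h t (k + l))"
proof -
  define q where "q u = (\<Sum>k\<le>p. c k * u ^ k)" for u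
  define d where "d k = c k * sg ^ k" for k
  have sg2: "sg * sg = 1" "\<bar>sg\<bar> = 1" "sg \<noteq> 0" using sg by auto
  have "(sg ^ k)\<^sup>2 = 1" for k
    using sg2 by (simp add: power_mult[symmetric] power2_eq_square power_mult_distrib[symmetric] power_add[symmetric])
  then have dd: "(\<Sum>k\<le>p. (d k)\<^sup>2) = (\<Sum>k\<le>p. (c k)\<^sup>2)"
    unfolding d_def power_mult_distrib by simp
  have qd: "(\<Sum>k\<le>p. d k * u ^ k) = q (sg * u)" for u
    unfolding d_def q_def by (simp add: power_mult_distrib mult.assoc)
  have int: "integrable lborel (\<lambda>u. K u * \<pi> (t + h * u) * u ^ l)" for l
    using expected_moment_integrable[OF K pi(1) h, of l t] by (simp add: mult_ac)
  have "(\<Sum>k\<le>p. \<Sum>l\<le>p. c k * c l * expected_moment K \<pi> h t (k + l)) =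
      (\<Sum>k\<le>p. \<Sum>l\<le>p. c k * c l * (\<integral>u. K u * \<pi> (t + h * u) * u ^ (k + l) \<partial>lborel))"
    unfolding expected_moment_def by (simp add: mult_ac)
  also have "\<dots> = (\<integral>u. K u * \<pi> (t + h * u) * (q u)\<^sup>2 \<partial>lborel)"
    unfolding q_def by (rule quadratic_form_of_moments(1)[OF int])
  also have "\<dots> = (\<integral>u. K (sg * u) * \<pi> (t + h * (sg * u)) * (q (sg * u))\<^sup>2 \<partial>lborel)"
    using lborel_integral_real_affine[OF sg2(3), of "\<lambda>u. K u * \<pi> (t + h * u) * (q u)\<^sup>2" 0] sg2 by simp
  finally have eq: "(\<Sum>k\<le>p. \<Sum>l\<le>p. c k * c l * expected_moment K \<pi> h t (k + l)) = \<dots>" .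
  have int2: "integrable lborel (\<lambda>u. K (sg * u) * \<pi> (t + h * (sg * u)) * (q (sg * u))\<^sup>2)"
    using lborel_integrable_real_affine[OF quadratic_form_of_moments(2)[OF int, of c p], of sg 0] sg2
    unfolding q_def by simp
  have int3: "integrable lborel (\<lambda>u. indicator {0..1} u * K u * (\<Sum>k\<le>p. d k * u ^ k)\<^sup>2)"
    by (intro quadratic_form_of_moments(2) kernel_moment_integrable[OF K]) (auto split: split_indicator)
  have "c1 * (lam * (\<Sum>k\<le>p. (d k)\<^sup>2)) \<le> c1 * (\<integral>u. indicator {0..1} u * K u * (\<Sum>k\<le>p. d k * u ^ k)\<^sup>2 \<partial>lborel)"
    by (intro mult_left_mono lam c1)
  also have "\<dots> = (\<integral>u. c1 * (indicator {0..1} u * K u * (\<Sum>k\<le>p. d k * u ^ k)\<^sup>2) \<partial>lborel)"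
    by simp
  also have "\<dots> \<le> (\<integral>u. K (sg * u) * \<pi> (t + h * (sg * u)) * (q (sg * u))\<^sup>2 \<partial>lborel)"
  proof (rule integral_mono_AE)
    show "integrable lborel (\<lambda>u. c1 * (indicator {0..1} u * K u * (\<Sum>k\<le>p. d k * u ^ k)\<^sup>2))"
      using int3 by simp
    have "AE u in lborel. u \<notin> {0, 1 :: real}" by (intro AE_not_in finite_imp_null_set_lborel) simp
    then show "AE u in lborel. c1 * (indicator {0..1} u * K u * (\<Sum>k\<le>p. d k * u ^ k)\<^sup>2)
        \<le> K (sg * u) * \<pi> (t + h * (sg * u)) * (q (sg * u))\<^sup>2"
    proof eventually_elim
      case (elim u)
      have K': "K (sg * u) = K u" using sg kernel_densityD(5)[OF K] by auto
      have pos: "K u * (q (sg * u))\<^sup>2 \<ge> 0" using kernel_densityD(4)[OF K] by simp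
      show ?case
      proof (cases "0 < u \<and> u < 1")
        case True
        then have "c1 * (K u * (q (sg * u))\<^sup>2) \<le> \<pi> (t + sg * h * u) * (K u * (q (sg * u))\<^sup>2)"
          using lower[of u] by (intro mult_right_mono pos) auto
        then show ?thesis using True unfolding K' qd by (simp add: mult_ac)
      next
        case False
        then have "indicator {0..1} u = (0::real)" using elim by (auto split: split_indicator)
        then show ?thesis using pi(2) pos unfolding K' by (simp add: mult_ac kernel_densityD(4)[OF K])
      qed
    qed
  qed (rule int2)
  finally show ?thesis unfolding eq dd by (simp add: mult.assoc)
qed

text \<open>The two exceptional points \<open>a\<close> and \<open>b\<close> are the end points of the design interval, where the values of a
  density are arbitrary.\<close>

lemma expected_moment_0_le:
  assumes K: "kernel_density K" and pi: "integrable lborel \<pi>" and h: "h > 0"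
    and upper: "\<And>y. \<bar>y - t\<bar> \<le> h \<Longrightarrow> y \<noteq> a \<Longrightarrow> y \<noteq> b \<Longrightarrow> \<pi> y \<le> C"
  shows "expected_moment K \<pi> h t 0 \<le> C"
proof -
  have "expected_moment K \<pi> h t 0 \<le> (\<integral>u. C * K u \<partial>lborel)"
    unfolding expected_moment_def
  proof (rule integral_mono_AE[OF expected_moment_integrable[OF K pi h]])
    show "integrable lborel (\<lambda>u. C * K u)" using kernel_densityD(2)[OF K] by simp
    have "AE u in lborel. u \<notin> {(a - t) / h, (b - t) / h}"
      by (intro AE_not_in finite_imp_null_set_lborel) simp
    then show "AE u in lborel. K u * u ^ 0 * \<pi> (t + h * u) \<le> C * K u"
    proof eventually_elim
      case (elim u)
      show ?case
      proof (cases "\<bar>u\<bar> > 1")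
        case True
        then show ?thesis using kernel_densityD(6)[OF K] by simp
      next
        case False
        then have "\<bar>t + h * u - t\<bar> \<le> h" using h by (simp add: abs_mult)
        moreover have "t + h * u \<noteq> a" "t + h * u \<noteq> b" using elim h by auto
        ultimately have "\<pi> (t + h * u) \<le> C" by (rule upper)
        then have "K u * \<pi> (t + h * u) \<le> K u * C" by (intro mult_left_mono kernel_densityD(4)[OF K])
        then show ?thesis by (simp add: mult.commute)
      qed
    qed
  qed
  then show ?thesis using kernel_densityD(3)[OF K] by simp
qed

text \<open>The perturbation changes the form by at most \<open>\<eta> * (\<Sum>k\<le>p. \<bar>c k\<bar>)\<^sup>2\<close>, and Cauchy--Schwarz costs the
  factor \<open>p + 1\<close>.\<close>

lemma coercive_perturbation:
  fixes S S' :: "nat \<Rightarrow> real"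
  assumes S': "lam * (\<Sum>k\<le>p. (c k)\<^sup>2) \<le> (\<Sum>k\<le>p. \<Sum>l\<le>p. c k * c l * S' (k + l))"
    and close: "\<And>l. l \<le> 2 * p \<Longrightarrow> \<bar>S l - S' l\<bar> \<le> \<eta>"
  shows "(lam - \<eta> * (real p + 1)) * (\<Sum>k\<le>p. (c k)\<^sup>2) \<le> (\<Sum>k\<le>p. \<Sum>l\<le>p. c k * c l * S (k + l))"
proof -
  have eta: "\<eta> \<ge> 0" using close[of 0] by (smt (verit) le0)
  have "(\<Sum>k\<le>p. \<Sum>l\<le>p. c k * c l * S' (k + l)) - (\<Sum>k\<le>p. \<Sum>l\<le>p. c k * c l * S (k + l)) =
      (\<Sum>k\<le>p. \<Sum>l\<le>p. c k * c l * (S' (k + l) - S (k + l)))"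
    by (simp add: sum_subtractf[symmetric] right_diff_distrib)
  also have "\<dots> \<le> (\<Sum>k\<le>p. \<Sum>l\<le>p. \<bar>c k\<bar> * \<bar>c l\<bar> * \<eta>)"
  proof (intro sum_mono)
    fix k l assume "k \<in> {..p}" "l \<in> {..p}"
    then have "\<bar>S' (k + l) - S (k + l)\<bar> \<le> \<eta>" using close[of "k + l"] by auto
    then have "\<bar>c k * c l\<bar> * \<bar>S' (k + l) - S (k + l)\<bar> \<le> \<bar>c k * c l\<bar> * \<eta>" by (intro mult_left_mono) auto
    then show "c k * c l * (S' (k + l) - S (k + l)) \<le> \<bar>c k\<bar> * \<bar>c l\<bar> * \<eta>"
      unfolding abs_mult[symmetric] using abs_ge_self order_trans by (metis abs_mult)
  qed
  also have "\<dots> = (\<Sum>k\<le>p. \<bar>c k\<bar>)\<^sup>2 * \<eta>"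
    by (simp only: power2_eq_square sum_product) (simp only: sum_distrib_right)
  also have "\<dots> \<le> ((\<Sum>k\<le>p. \<bar>c k\<bar>\<^sup>2) * real (card {..p})) * \<eta>"
    by (intro mult_right_mono sum_squared_le_sum_of_squares eta)
  finally show ?thesis using S' by (simp add: algebra_simps)
qed

text \<open>Hoeffding's inequality for the bounded variables \<open>\<phi> ((T j - t) / h)\<close>.  It does not see that their
  variance is of order \<open>h\<close> and therefore has \<open>h\<^sup>2\<close> instead of \<open>h\<close> in the exponent; this is
  good enough whenever \<open>m h\<^sup>2\<close> grows like a power of the number of subjects.\<close>

lemma (in prob_space) kernel_average_concentration:
  fixes T :: "nat \<Rightarrow> 'a \<Rightarrow> real" and \<phi> :: "real \<Rightarrow> real"
  assumes ind: "indep_vars (\<lambda>_. borel) T {..<m}"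
    and dist: "\<And>j. j < m \<Longrightarrow> distributed M lborel (T j) (\<lambda>t. ennreal (\<pi> t))"
    and pi: "\<And>y. \<pi> y \<ge> 0"
    and \<phi> [measurable]: "\<phi> \<in> borel_measurable borel" and B: "\<And>u. \<bar>\<phi> u\<bar> \<le> B" "B > 0"
    and h: "h > 0" and eta: "\<eta> > 0" and m: "m > 0"
  shows "prob {\<omega> \<in> space M. \<eta> \<le> \<bar>(\<Sum>j<m. \<phi> ((T j \<omega> - t) / h)) / (real m * h) - (\<integral>u. \<phi> u * \<pi> (t + h * u) \<partial>lborel)\<bar>}
    \<le> 2 * exp (- (real m * h\<^sup>2 * \<eta>\<^sup>2 / (2 * B\<^sup>2)))"
proof -
  have Tm [measurable]: "T j \<in> borel_measurable M" if "j < m" for j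
    using ind that by (auto simp: indep_vars_def)
  have indX: "indep_vars (\<lambda>_. borel) (\<lambda>j \<omega>. \<phi> ((T j \<omega> - t) / h)) {..<m}"
    by (rule indep_vars_compose2[OF ind]) measurable
  interpret H: Hoeffding_ineq M "{..<m}" "\<lambda>j \<omega>. \<phi> ((T j \<omega> - t) / h)" "\<lambda>_. - B" "\<lambda>_. B"
    "\<Sum>j<m. expectation (\<lambda>\<omega>. \<phi> ((T j \<omega> - t) / h))"
  proof unfold_locales
    show "AE x in M. \<phi> ((T i x - t) / h) \<in> {- B..B}" for i
    proof (rule AE_I2)
      fix x
      show "\<phi> ((T i x - t) / h) \<in> {- B..B}" using B(1)[of "(T i x - t) / h"] by (simp add: abs_le_iff)
    qed
  qed (use indX in auto)
  define I where "I = (\<integral>u. \<phi> u * \<pi> (t + h * u) \<partial>lborel)"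
  have exp: "expectation (\<lambda>\<omega>. \<phi> ((T j \<omega> - t) / h)) = h * I" if "j < m" for j
  proof -
    have "expectation (\<lambda>\<omega>. \<phi> ((T j \<omega> - t) / h)) = (\<integral>y. \<pi> y * \<phi> ((y - t) / h) \<partial>lborel)"
      using distributed_integral[OF dist[OF that], of "\<lambda>y. \<phi> ((y - t) / h)"] pi by simp
    also have "\<dots> = h * (\<integral>u. \<pi> (t + h * u) * \<phi> u \<partial>lborel)"
      using lborel_integral_real_affine[of h "\<lambda>y. \<pi> y * \<phi> ((y - t) / h)" t] h by simp
    finally show ?thesis by (simp add: I_def mult.commute)
  qed
  have "prob {\<omega> \<in> space M. \<eta> * (real m * h) \<le> \<bar>(\<Sum>j<m. \<phi> ((T j \<omega> - t) / h)) -
      (\<Sum>j<m. expectation (\<lambda>\<omega>. \<phi> ((T j \<omega> - t) / h)))\<bar>}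
    \<le> 2 * exp (- 2 * (\<eta> * (real m * h))\<^sup>2 / (\<Sum>j<m. (B - - B)\<^sup>2))"
    using eta h m B by (intro H.Hoeffding_ineq_abs_ge) auto
  also have "- 2 * (\<eta> * (real m * h))\<^sup>2 / (\<Sum>j<m. (B - - B)\<^sup>2) = - (real m * h\<^sup>2 * \<eta>\<^sup>2 / (2 * B\<^sup>2))"
    using m B by (simp add: power2_eq_square field_simps)
  also have "{\<omega> \<in> space M. \<eta> * (real m * h) \<le> \<bar>(\<Sum>j<m. \<phi> ((T j \<omega> - t) / h)) -
      (\<Sum>j<m. expectation (\<lambda>\<omega>. \<phi> ((T j \<omega> - t) / h)))\<bar>} =
    {\<omega> \<in> space M. \<eta> \<le> \<bar>(\<Sum>j<m. \<phi> ((T j \<omega> - t) / h)) / (real m * h) - I\<bar>}"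
  proof (intro Collect_cong conj_cong refl)
    fix \<omega>
    have mh: "real m * h > 0" using m h by simp
    have "\<bar>(\<Sum>j<m. \<phi> ((T j \<omega> - t) / h)) / (real m * h) - I\<bar> =
        \<bar>(\<Sum>j<m. \<phi> ((T j \<omega> - t) / h)) - real m * h * I\<bar> / (real m * h)"
      using m h by (simp add: abs_div_pos diff_divide_distrib)
    then show "(\<eta> * (real m * h) \<le> \<bar>(\<Sum>j<m. \<phi> ((T j \<omega> - t) / h)) - (\<Sum>j<m. expectation (\<lambda>\<omega>. \<phi> ((T j \<omega> - t) / h)))\<bar>) =
      (\<eta> \<le> \<bar>(\<Sum>j<m. \<phi> ((T j \<omega> - t) / h)) / (real m * h) - I\<bar>)"
      using mh by (simp add: exp pos_le_divide_eq mult.assoc)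
  qed
  finally show ?thesis unfolding I_def .
qed

section \<open>Second moments of the measurement errors\<close>

text \<open>The diagonal is a null set for the product of any law with an absolutely continuous one.\<close>

lemma (in prob_space) indep_density_AE_neq:
  fixes X Y :: "'a \<Rightarrow> real"
  assumes ind: "indep_var borel X borel Y" and dist: "distributed M lborel Y f"
  shows "AE \<omega> in M. X \<omega> \<noteq> Y \<omega>"
proof -
  have rv [measurable]: "X \<in> borel_measurable M" "Y \<in> borel_measurable M"
    using ind by (auto dest: indep_var_rv1 indep_var_rv2)
  have dY: "distr M borel Y = density lborel f"
    using dist by (simp add: distributed_def cong: distr_cong)
  interpret P: pair_prob_space "distr M borel X" "distr M borel Y"
    by (simp add: pair_prob_space_def pair_sigma_finite_def prob_space_distr prob_space_imp_sigma_finite)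
  have f [measurable]: "f \<in> borel_measurable lborel" using dist by (simp add: distributed_def)
  have "AE y in distr M borel Y. x \<noteq> y" for x
  proof -
    have "AE y in lborel. y \<notin> {x}" by (intro AE_not_in finite_imp_null_set_lborel) simp
    then show ?thesis unfolding dY by (subst AE_density) auto
  qed
  then have ae: "AE z in distr M borel X \<Otimes>\<^sub>M distr M borel Y. fst z \<noteq> snd z"
  proof (intro P.AE_pair_measure)
    have "{z \<in> space (borel \<Otimes>\<^sub>M borel :: (real \<times> real) measure). fst z \<noteq> snd z} \<in> sets (borel \<Otimes>\<^sub>M borel)"
      by measurable
    then show "{z \<in> space (distr M borel X \<Otimes>\<^sub>M distr M borel Y). fst z \<noteq> snd z}
        \<in> sets (distr M borel X \<Otimes>\<^sub>M distr M borel Y)"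
      by (simp add: space_pair_measure cong: sets_pair_measure_cong)
  qed simp
  have eq: "distr M borel X \<Otimes>\<^sub>M distr M borel Y = distr M (borel \<Otimes>\<^sub>M borel) (\<lambda>\<omega>. (X \<omega>, Y \<omega>))"
    using ind by (simp add: indep_var_distribution_eq)
  have "AE z in distr M (borel \<Otimes>\<^sub>M borel) (\<lambda>\<omega>. (X \<omega>, Y \<omega>)). fst z \<noteq> snd z"
    using ae unfolding eq .
  then show ?thesis by (subst (asm) AE_distr_iff) auto
qed

lemma prob_space_imp_finite_subalgebra:
  assumes "prob_space M" "subalgebra M F"
  shows "finite_measure_subalgebra M F"
  using assms by (simp add: finite_measure_subalgebra_def finite_measure_subalgebra_axioms_def prob_space_def)

lemma simple_function_UNIV_expand:
  fixes q :: "real \<Rightarrow> real"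
  assumes "finite (range q)"
  shows "q x = (\<Sum>r\<in>range q. r * indicator (q -` {r}) x)"
proof -
  have "(\<Sum>r\<in>range q. r * indicator (q -` {r}) x) = (\<Sum>r\<in>range q. if r = q x then q x else 0)"
    by (intro sum.cong) (auto split: split_indicator)
  then show ?thesis using assms by simp
qed

text \<open>Given the weights and the design, the errors are uncorrelated with variances at most \<open>Cs\<close>, which
  would give \<open>Cs * \<kappa>\<close>.  The conditional law is only available on rectangles, so the identity is replaced by
  simple functions \<open>q N\<close>, for which conditional second moments are finite sums over rectangles,
  and Fatou's lemma is used for \<open>N \<longlongrightarrow> \<infinity>\<close>.  The factor 4 is the price for \<open>\<bar>q N x\<bar> \<le> 2 * \<bar>x\<bar>\<close>.  The off-diagonal terms vanish in the limit because the design points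
  are distinct.\<close>

lemma conditional_noise_second_moment:
  fixes M F :: "'a measure" and E :: "'e measure" and e W T :: "nat \<Rightarrow> 'a \<Rightarrow> real"
    and \<epsilon> :: "real \<Rightarrow> 'e \<Rightarrow> real" and \<sigma>2 :: "real \<Rightarrow> real"
  assumes M: "prob_space M" and F: "subalgebra M F" and E: "prob_space E"
    and e [measurable]: "\<And>j. j < m \<Longrightarrow> e j \<in> borel_measurable M"
    and cond: "\<And>j k A B. j < m \<Longrightarrow> k < m \<Longrightarrow> A \<in> sets borel \<Longrightarrow> B \<in> sets borel \<Longrightarrow>
      AE \<omega> in M. real_cond_exp M F (indicator {\<omega> \<in> space M. e j \<omega> \<in> A \<and> e k \<omega> \<in> B}) \<omega> =
        measure E {w \<in> space E. \<epsilon> (T j \<omega>) w \<in> A \<and> \<epsilon> (T k \<omega>) w \<in> B}"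
    and eps1: "\<And>t. t \<in> S \<Longrightarrow> \<epsilon> t \<in> borel_measurable E"
    and eps2: "\<And>s t. s \<in> S \<Longrightarrow> t \<in> S \<Longrightarrow> integrable E (\<lambda>w. \<epsilon> s w * \<epsilon> t w)"
    and eps3: "\<And>s t. s \<in> S \<Longrightarrow> t \<in> S \<Longrightarrow> (\<integral>w. \<epsilon> s w * \<epsilon> t w \<partial>E) = (if s = t then \<sigma>2 t else 0)"
    and TS: "\<And>j \<omega>. j < m \<Longrightarrow> \<omega> \<in> space M \<Longrightarrow> T j \<omega> \<in> S"
    and W: "\<And>j. j < m \<Longrightarrow> W j \<in> borel_measurable F"
    and Wb: "\<And>j \<omega>. j < m \<Longrightarrow> \<omega> \<in> space M \<Longrightarrow> \<bar>W j \<omega>\<bar> \<le> Cw"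
    and Ws: "\<And>j \<omega>. j < m \<Longrightarrow> \<omega> \<in> space M \<Longrightarrow> W j \<omega> \<noteq> 0 \<Longrightarrow> \<sigma>2 (T j \<omega>) \<le> Cs"
    and Cs: "Cs \<ge> 0"
    and distinct: "\<And>j k. j < m \<Longrightarrow> k < m \<Longrightarrow> j \<noteq> k \<Longrightarrow> AE \<omega> in M. T j \<omega> \<noteq> T k \<omega>"
    and kap: "\<And>\<omega>. \<omega> \<in> space M \<Longrightarrow> (\<Sum>j<m. (W j \<omega>)\<^sup>2) \<le> \<kappa>"
  shows "(\<integral>\<^sup>+\<omega>. ennreal ((\<Sum>j<m. W j \<omega> * e j \<omega>)\<^sup>2) \<partial>M) \<le> ennreal (4 * Cs * \<kappa>)"
proof -
  interpret M: prob_space M by fact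
  interpret E: prob_space E by fact
  interpret F: finite_measure_subalgebra M F using M F by (rule prob_space_imp_finite_subalgebra)
  have WM [measurable]: "W j \<in> borel_measurable M" if "j < m" for j
    using measurable_from_subalg[OF F W[OF that]] .
  (* Simple functions q N converge to the identity and satisfy |q N x| <= 2 |x|. *)
  have "\<exists>q. (\<forall>i. simple_function borel (q i)) \<and> (\<forall>x\<in>space borel. (\<lambda>i. q i x) \<longlonglongrightarrow> x) \<and>
    (\<forall>i. \<forall>x\<in>space borel. dist (q i x :: real) 0 \<le> 2 * dist x 0)"
    by (rule borel_measurable_implies_sequence_metric) simp
  then obtain q :: "nat \<Rightarrow> real \<Rightarrow> real" where q: "\<And>N. simple_function borel (q N)"
    "\<And>x. (\<lambda>N. q N x) \<longlonglongrightarrow> x" "\<And>N x. \<bar>q N x\<bar> \<le> 2 * \<bar>x\<bar>" by auto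
  have qf: "finite (range (q N))" for N using simple_functionD(1)[OF q(1), of N] by simp
  have qm [measurable]: "q N \<in> borel_measurable borel" for N
    by (rule borel_measurable_simple_function[OF q(1)])
  define Ev where "Ev j k A B = {\<omega> \<in> space M. e j \<omega> \<in> A \<and> e k \<omega> \<in> B}" for j k A B
  define L where "L N r = q N -` {r}" for N r
  have Lb [measurable]: "L N r \<in> sets borel" for N r
    using measurable_sets[OF qm, of "{r}" N] by (simp add: L_def)
  have Evm [measurable]: "Ev j k A B \<in> sets M" if "j < m" "k < m" "A \<in> sets borel" "B \<in> sets borel" for j k A B
    unfolding Ev_def using that by measurable
  define G where "G N j k \<omega> = (\<Sum>r\<in>range (q N). \<Sum>s\<in>range (q N).
      r * s * real_cond_exp M F (indicator (Ev j k (L N r) (L N s))) \<omega>)" for N j k \<omega>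
  have Gm [measurable]: "G N j k \<in> borel_measurable M" for N j k
    unfolding G_def by measurable
  define C where "C N s t = (\<integral>w. q N (\<epsilon> s w) * q N (\<epsilon> t w) \<partial>E)" for N s t
  have expand: "q N x * q N y = (\<Sum>r\<in>range (q N). \<Sum>s\<in>range (q N). r * s * (indicator (L N r) x * indicator (L N s) y))"
    for N x y
    by (subst (1 2) simple_function_UNIV_expand[OF qf]) (simp add: sum_product L_def mult_ac)
  have GC: "AE \<omega> in M. G N j k \<omega> = C N (T j \<omega>) (T k \<omega>)" if jk: "j < m" "k < m" for N j k
  proof -
    have "AE \<omega> in M. \<forall>r\<in>range (q N). \<forall>s\<in>range (q N).
        real_cond_exp M F (indicator (Ev j k (L N r) (L N s))) \<omega> =
        measure E {w \<in> space E. \<epsilon> (T j \<omega>) w \<in> L N r \<and> \<epsilon> (T k \<omega>) w \<in> L N s}"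
      unfolding Ev_def by (intro AE_finite_allI qf cond jk Lb)
    then show ?thesis
      using AE_space
    proof eventually_elim
      case (elim \<omega>)
      have [measurable]: "\<epsilon> (T j \<omega>) \<in> borel_measurable E" "\<epsilon> (T k \<omega>) \<in> borel_measurable E"
        using eps1 TS jk elim(2) by auto
      have "C N (T j \<omega>) (T k \<omega>) = (\<integral>w. (\<Sum>r\<in>range (q N). \<Sum>s\<in>range (q N).
          r * s * indicator {w \<in> space E. \<epsilon> (T j \<omega>) w \<in> L N r \<and> \<epsilon> (T k \<omega>) w \<in> L N s} w) \<partial>E)"
        unfolding C_def expand by (intro Bochner_Integration.integral_cong refl sum.cong) (auto split: split_indicator)
      also have "\<dots> = (\<Sum>r\<in>range (q N). \<Sum>s\<in>range (q N).
          r * s * measure E {w \<in> space E. \<epsilon> (T j \<omega>) w \<in> L N r \<and> \<epsilon> (T k \<omega>) w \<in> L N s})"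
        by (subst Bochner_Integration.integral_sum, simp add: less_top[symmetric])+ (simp add: less_top[symmetric] Int_absorb1)
      also have "\<dots> = G N j k \<omega>" unfolding G_def using elim(1) by (intro sum.cong refl) auto
      finally show ?case by simp
    qed
  qed
  have intW: "(\<integral>\<omega>. W j \<omega> * W k \<omega> * (q N (e j \<omega>) * q N (e k \<omega>)) \<partial>M) = (\<integral>\<omega>. W j \<omega> * W k \<omega> * G N j k \<omega> \<partial>M)"
    "integrable M (\<lambda>\<omega>. W j \<omega> * W k \<omega> * (q N (e j \<omega>) * q N (e k \<omega>)))"
    "integrable M (\<lambda>\<omega>. W j \<omega> * W k \<omega> * G N j k \<omega>)"
    if jk: "j < m" "k < m" for N j k
  proof -
    have WF: "(\<lambda>\<omega>. W j \<omega> * W k \<omega>) \<in> borel_measurable F" using W jk by simp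
    have ii: "integrable M (\<lambda>\<omega>. W j \<omega> * W k \<omega> * indicator (Ev j k (L N r) (L N s)) \<omega>)" for r s
    proof (rule M.integrable_const_bound)
      show "AE \<omega> in M. norm (W j \<omega> * W k \<omega> * indicator (Ev j k (L N r) (L N s)) \<omega>) \<le> Cw * Cw"
      proof (rule AE_I2)
        fix \<omega> assume "\<omega> \<in> space M"
        then have "\<bar>W j \<omega>\<bar> * \<bar>W k \<omega>\<bar> \<le> Cw * Cw" "0 \<le> Cw * Cw"
          using Wb[OF jk(1)] Wb[OF jk(2)] by (auto intro!: mult_mono intro: order_trans[OF abs_ge_zero])
        then show "norm (W j \<omega> * W k \<omega> * indicator (Ev j k (L N r) (L N s)) \<omega>) \<le> Cw * Cw"
          by (auto simp: abs_mult split: split_indicator)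
      qed
    qed (use jk in measurable)
    note ce = F.real_cond_exp_intg[OF ii WF]
    have eq1: "W j \<omega> * W k \<omega> * (q N (e j \<omega>) * q N (e k \<omega>)) =
        (\<Sum>r\<in>range (q N). \<Sum>s\<in>range (q N). r * s * (W j \<omega> * W k \<omega> * indicator (Ev j k (L N r) (L N s)) \<omega>))"
      if "\<omega> \<in> space M" for \<omega>
      unfolding expand sum_distrib_left using that
      by (intro sum.cong refl) (auto simp: Ev_def split: split_indicator)
    have eq2: "W j \<omega> * W k \<omega> * G N j k \<omega> =
        (\<Sum>r\<in>range (q N). \<Sum>s\<in>range (q N). r * s * (W j \<omega> * W k \<omega> * real_cond_exp M F (indicator (Ev j k (L N r) (L N s))) \<omega>))"
      for \<omega>
      unfolding G_def sum_distrib_left by (intro sum.cong refl) simp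
    have ind_m: "indicator (Ev j k (L N r) (L N s)) \<in> borel_measurable M" for r s
      using jk by measurable
    show "integrable M (\<lambda>\<omega>. W j \<omega> * W k \<omega> * (q N (e j \<omega>) * q N (e k \<omega>)))"
      using ii by (subst Bochner_Integration.integrable_cong[OF refl eq1]) auto
    show "integrable M (\<lambda>\<omega>. W j \<omega> * W k \<omega> * G N j k \<omega>)"
      unfolding eq2 using ce(1)[OF ind_m] by auto
    show "(\<integral>\<omega>. W j \<omega> * W k \<omega> * (q N (e j \<omega>) * q N (e k \<omega>)) \<partial>M) = (\<integral>\<omega>. W j \<omega> * W k \<omega> * G N j k \<omega> \<partial>M)"
      unfolding eq2 using ii ce[OF ind_m]
      by (subst Bochner_Integration.integral_cong[OF refl eq1]) auto
  qed
  have Cbound: "\<bar>C N s t\<bar> \<le> 2 * (\<sigma>2 s + \<sigma>2 t)" if st: "s \<in> S" "t \<in> S" for N s t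
  proof -
    note eps1[OF st(1), measurable] eps1[OF st(2), measurable]
    have i: "integrable E (\<lambda>w. (\<epsilon> s w)\<^sup>2)" "integrable E (\<lambda>w. (\<epsilon> t w)\<^sup>2)"
      using eps2[of s s] eps2[of t t] st by (auto simp: power2_eq_square)
    have "\<bar>C N s t\<bar> \<le> (\<integral>w. \<bar>q N (\<epsilon> s w) * q N (\<epsilon> t w)\<bar> \<partial>E)" unfolding C_def by (rule integral_abs_bound)
    also have "\<dots> \<le> (\<integral>w. 2 * (\<epsilon> s w)\<^sup>2 + 2 * (\<epsilon> t w)\<^sup>2 \<partial>E)"
    proof (rule integral_mono')
      show "integrable E (\<lambda>w. 2 * (\<epsilon> s w)\<^sup>2 + 2 * (\<epsilon> t w)\<^sup>2)" using i by simp
      fix w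
      have "\<bar>q N (\<epsilon> s w)\<bar> * \<bar>q N (\<epsilon> t w)\<bar> \<le> (2 * \<bar>\<epsilon> s w\<bar>) * (2 * \<bar>\<epsilon> t w\<bar>)"
        by (intro mult_mono q) auto
      also have "\<dots> \<le> 2 * (\<epsilon> s w)\<^sup>2 + 2 * (\<epsilon> t w)\<^sup>2"
        using sum_squares_bound[of "\<bar>\<epsilon> s w\<bar>" "\<bar>\<epsilon> t w\<bar>"] by simp
      finally show "\<bar>q N (\<epsilon> s w) * q N (\<epsilon> t w)\<bar> \<le> 2 * (\<epsilon> s w)\<^sup>2 + 2 * (\<epsilon> t w)\<^sup>2" by (simp add: abs_mult)
    qed simp
    also have "\<dots> = 2 * \<sigma>2 s + 2 * \<sigma>2 t"
      using i eps3[of s s] eps3[of t t] st by (simp add: power2_eq_square)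
    finally show ?thesis by simp
  qed
  have Clim: "(\<lambda>N. C N s t) \<longlonglongrightarrow> 0" if st: "s \<in> S" "t \<in> S" "s \<noteq> t" for s t
  proof -
    note eps1[OF st(1), measurable] eps1[OF st(2), measurable]
    have "(\<lambda>N. C N s t) \<longlonglongrightarrow> (\<integral>w. \<epsilon> s w * \<epsilon> t w \<partial>E)"
      unfolding C_def
    proof (rule integral_dominated_convergence[where w = "\<lambda>w. 4 * \<bar>\<epsilon> s w * \<epsilon> t w\<bar>"])
      show "integrable E (\<lambda>w. 4 * \<bar>\<epsilon> s w * \<epsilon> t w\<bar>)" using eps2[OF st(1,2)] by simp
      show "AE w in E. (\<lambda>N. q N (\<epsilon> s w) * q N (\<epsilon> t w)) \<longlonglongrightarrow> \<epsilon> s w * \<epsilon> t w"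
        by (intro AE_I2 tendsto_mult q)
      show "AE w in E. norm (q N (\<epsilon> s w) * q N (\<epsilon> t w)) \<le> 4 * \<bar>\<epsilon> s w * \<epsilon> t w\<bar>" for N
      proof (rule AE_I2)
        fix w
        have "\<bar>q N (\<epsilon> s w)\<bar> * \<bar>q N (\<epsilon> t w)\<bar> \<le> (2 * \<bar>\<epsilon> s w\<bar>) * (2 * \<bar>\<epsilon> t w\<bar>)"
          by (intro mult_mono q) auto
        then show "norm (q N (\<epsilon> s w) * q N (\<epsilon> t w)) \<le> 4 * \<bar>\<epsilon> s w * \<epsilon> t w\<bar>" by (simp add: abs_mult)
      qed
    qed auto
    then show ?thesis using eps3[OF st(1,2)] st(3) by simp
  qed
  (* The matrix of second moments of the truncated errors; only its diagonal survives in the limit. *)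
  define A where "A N j k = (\<integral>\<omega>. W j \<omega> * W k \<omega> * G N j k \<omega> \<partial>M)" for N j k
  have off: "(\<lambda>N. A N j k) \<longlonglongrightarrow> 0" if jk: "j < m" "k < m" "j \<noteq> k" for j k
  proof -
    have "(\<lambda>N. A N j k) \<longlonglongrightarrow> (\<integral>\<omega>. 0 \<partial>M)"
      unfolding A_def
    proof (rule integral_dominated_convergence[where w = "\<lambda>_. Cw * Cw * (4 * Cs)"])
      show "(\<lambda>\<omega>. W j \<omega> * W k \<omega> * G N j k \<omega>) \<in> borel_measurable M" for N using jk by measurable
      have "AE \<omega> in M. \<forall>N. G N j k \<omega> = C N (T j \<omega>) (T k \<omega>)"
        using GC[OF jk(1,2)] by (simp add: AE_all_countable)
      then show "AE \<omega> in M. (\<lambda>N. W j \<omega> * W k \<omega> * G N j k \<omega>) \<longlonglongrightarrow> 0"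
        using distinct[OF jk] AE_space
      proof eventually_elim
        case (elim \<omega>)
        have "(\<lambda>N. W j \<omega> * W k \<omega> * C N (T j \<omega>) (T k \<omega>)) \<longlonglongrightarrow> W j \<omega> * W k \<omega> * 0"
          using elim TS jk by (intro tendsto_intros Clim) auto
        then show ?case using elim(1) by simp
      qed
      show "AE \<omega> in M. norm (W j \<omega> * W k \<omega> * G N j k \<omega>) \<le> Cw * Cw * (4 * Cs)" for N
        using GC[OF jk(1,2), of N] AE_space
      proof eventually_elim
        case (elim \<omega>)
        have Cw: "Cw \<ge> 0" using Wb[OF jk(1) elim(2)] by simp
        show ?case
        proof (cases "W j \<omega> * W k \<omega> = 0")
          case True
          then have "\<bar>W j \<omega> * W k \<omega> * G N j k \<omega>\<bar> = 0" by (simp only: mult_zero_left abs_zero)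
          moreover have "0 \<le> Cw * Cw * (4 * Cs)" using Cw Cs by simp
          ultimately show ?thesis unfolding real_norm_def by linarith
        next
          case False
          then have "\<bar>G N j k \<omega>\<bar> \<le> 4 * Cs"
            using Cbound[of "T j \<omega>" "T k \<omega>" N] TS elim jk Ws[of j \<omega>] Ws[of k \<omega>] by auto
          then have "(\<bar>W j \<omega>\<bar> * \<bar>W k \<omega>\<bar>) * \<bar>G N j k \<omega>\<bar> \<le> (Cw * Cw) * (4 * Cs)"
            using Wb[OF jk(1) elim(2)] Wb[OF jk(2) elim(2)] Cw by (intro mult_mono) auto
          then show ?thesis by (simp add: abs_mult)
        qed
      qed
    qed auto
    then show ?thesis by simp
  qed
  have diag: "A N j j \<le> 4 * Cs * (\<integral>\<omega>. (W j \<omega>)\<^sup>2 \<partial>M)" and intW2: "integrable M (\<lambda>\<omega>. (W j \<omega>)\<^sup>2)"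
    if j: "j < m" for N j
  proof -
    show i2: "integrable M (\<lambda>\<omega>. (W j \<omega>)\<^sup>2)"
    proof (rule M.integrable_const_bound)
      show "AE \<omega> in M. norm ((W j \<omega>)\<^sup>2) \<le> Cw\<^sup>2"
        using Wb[OF j] by (intro AE_I2) (fastforce simp: abs_le_square_iff[symmetric])
    qed (use j in measurable)
    have "A N j j \<le> (\<integral>\<omega>. 4 * Cs * (W j \<omega>)\<^sup>2 \<partial>M)"
      unfolding A_def
    proof (rule integral_mono_AE)
      show "AE \<omega> in M. W j \<omega> * W j \<omega> * G N j j \<omega> \<le> 4 * Cs * (W j \<omega>)\<^sup>2"
        using GC[OF j j, of N] AE_space
      proof eventually_elim
        case (elim \<omega>)
        show ?case
        proof (cases "W j \<omega> = 0")
          case False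
          then have "G N j j \<omega> \<le> 4 * Cs"
            using Cbound[of "T j \<omega>" "T j \<omega>" N] TS elim j Ws[of j \<omega>] by auto
          then have "(W j \<omega>)\<^sup>2 * G N j j \<omega> \<le> (W j \<omega>)\<^sup>2 * (4 * Cs)" by (intro mult_left_mono) auto
          then show ?thesis by (simp add: power2_eq_square mult_ac)
        qed simp
      qed
    qed (use intW[OF j j] i2 in auto)
    then show "A N j j \<le> 4 * Cs * (\<integral>\<omega>. (W j \<omega>)\<^sup>2 \<partial>M)" by simp
  qed
  define R where "R N = (\<Sum>j<m. \<Sum>k\<in>{..<m} - {j}. A N j k)" for N
  have Rlim: "R \<longlonglongrightarrow> 0"
  proof -
    have "(\<lambda>N. R N) \<longlonglongrightarrow> (\<Sum>j<m. \<Sum>k\<in>{..<m} - {j}. 0)"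
      unfolding R_def by (intro tendsto_sum off) auto
    then show ?thesis by simp
  qed
  have total: "(\<integral>\<^sup>+\<omega>. ennreal ((\<Sum>j<m. W j \<omega> * q N (e j \<omega>))\<^sup>2) \<partial>M) \<le> ennreal (4 * Cs * \<kappa> + R N)" for N
  proof -
    have sq: "(\<Sum>j<m. W j \<omega> * q N (e j \<omega>))\<^sup>2 = (\<Sum>j<m. \<Sum>k<m. W j \<omega> * W k \<omega> * (q N (e j \<omega>) * q N (e k \<omega>)))" for \<omega>
      unfolding power2_eq_square sum_product by (intro sum.cong refl) simp
    have int: "integrable M (\<lambda>\<omega>. (\<Sum>j<m. W j \<omega> * q N (e j \<omega>))\<^sup>2)"
      unfolding sq by (intro Bochner_Integration.integrable_sum intW(2)) auto
    have "(\<integral>\<omega>. (\<Sum>j<m. W j \<omega> * q N (e j \<omega>))\<^sup>2 \<partial>M) = (\<Sum>j<m. \<Sum>k<m. A N j k)"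
      unfolding sq A_def
      by (subst Bochner_Integration.integral_sum, (intro Bochner_Integration.integrable_sum intW(2); simp))
        (auto simp: intW(1,2) Bochner_Integration.integral_sum intro!: sum.cong)
    also have "\<dots> = (\<Sum>j<m. A N j j) + R N"
      unfolding R_def sum.distrib[symmetric] by (intro sum.cong refl sum.remove) auto
    also have "(\<Sum>j<m. A N j j) \<le> (\<Sum>j<m. 4 * Cs * (\<integral>\<omega>. (W j \<omega>)\<^sup>2 \<partial>M))"
      by (intro sum_mono diag) auto
    also have "\<dots> = 4 * Cs * (\<integral>\<omega>. (\<Sum>j<m. (W j \<omega>)\<^sup>2) \<partial>M)"
      using intW2 by (simp add: sum_distrib_left)
    also have "\<dots> \<le> 4 * Cs * \<kappa>"
    proof -
      have "(\<integral>\<omega>. (\<Sum>j<m. (W j \<omega>)\<^sup>2) \<partial>M) \<le> (\<integral>\<omega>. \<kappa> \<partial>M)"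
        using intW2 kap by (intro integral_mono) auto
      then show ?thesis using Cs by (intro mult_left_mono) (auto simp: M.prob_space)
    qed
    finally show ?thesis
      using int by (subst nn_integral_eq_integral) (auto intro!: ennreal_leI)
  qed
  have "(\<integral>\<^sup>+\<omega>. ennreal ((\<Sum>j<m. W j \<omega> * e j \<omega>)\<^sup>2) \<partial>M) =
      (\<integral>\<^sup>+\<omega>. liminf (\<lambda>N. ennreal ((\<Sum>j<m. W j \<omega> * q N (e j \<omega>))\<^sup>2)) \<partial>M)"
  proof (intro nn_integral_cong)
    fix \<omega>
    have "(\<lambda>N. ennreal ((\<Sum>j<m. W j \<omega> * q N (e j \<omega>))\<^sup>2)) \<longlonglongrightarrow> ennreal ((\<Sum>j<m. W j \<omega> * e j \<omega>)\<^sup>2)"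
      by (intro tendsto_intros tendsto_ennrealI q)
    then show "ennreal ((\<Sum>j<m. W j \<omega> * e j \<omega>)\<^sup>2) = liminf (\<lambda>N. ennreal ((\<Sum>j<m. W j \<omega> * q N (e j \<omega>))\<^sup>2))"
      by (intro lim_imp_Liminf[symmetric]) auto
  qed
  also have "\<dots> \<le> liminf (\<lambda>N. \<integral>\<^sup>+\<omega>. ennreal ((\<Sum>j<m. W j \<omega> * q N (e j \<omega>))\<^sup>2) \<partial>M)"
    by (rule nn_integral_liminf) measurable
  also have "\<dots> \<le> liminf (\<lambda>N. ennreal (4 * Cs * \<kappa> + R N))"
    by (intro Liminf_mono always_eventually allI total)
  also have "\<dots> = ennreal (4 * Cs * \<kappa> + 0)"
    by (intro lim_imp_Liminf tendsto_ennrealI tendsto_intros Rlim) auto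
  finally show ?thesis by simp
qed

lemma subalgebra_source_algebra:
  assumes M: "prob_space M" and ind: "prob_space.indep_sets M (source_events M a b x v T) (sources n Nn)"
  shows "subalgebra M (source_algebra M a b x v T n Nn)"
proof -
  have sub: "source_events M a b x v T s \<subseteq> sets M" if "s \<in> sources n Nn" for s
    using ind that unfolding prob_space.indep_sets_def[OF M] by auto
  then have "sigma_sets (space M) (\<Union>s\<in>sources n Nn. source_events M a b x v T s) \<subseteq> sets M"
    by (intro sets.sigma_sets_subset) blast
  moreover have "sets (source_algebra M a b x v T n Nn) =
      sigma_sets (space M) (\<Union>s\<in>sources n Nn. source_events M a b x v T s)"
    unfolding source_algebra_def using sub
    by (intro sets_measure_of) (blast dest: sets.sets_into_space)
  ultimately show ?thesis
    unfolding subalgebra_def by (simp add: source_algebra_def space_measure_of_conv)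
qed

lemma design_point_source_measurable:
  assumes M: "prob_space M" and ind: "prob_space.indep_sets M (source_events M a b x v T) (sources n Nn)"
    and ij: "i < n" "j < Nn i"
  shows "T i j \<in> borel_measurable (source_algebra M a b x v T n Nn)"
proof -
  have sub: "source_events M a b x v T s \<subseteq> sets M" if "s \<in> sources n Nn" for s
    using ind that unfolding prob_space.indep_sets_def[OF M] by auto
  have sets: "sets (source_algebra M a b x v T n Nn) =
      sigma_sets (space M) (\<Union>s\<in>sources n Nn. source_events M a b x v T s)"
    unfolding source_algebra_def using sub
    by (intro sets_measure_of) (blast dest: sets.sets_into_space)
  have sp: "space (source_algebra M a b x v T n Nn) = space M"
    unfolding source_algebra_def by (simp add: space_measure_of_conv)
  show ?thesis
  proof (rule measurableI)
    fix B :: "real set" assume "B \<in> sets borel"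
    then have "T i j -` B \<inter> space M \<in> source_events M a b x v T (Design i j)"
      by (simp add: in_vimage_algebra)
    moreover have "Design i j \<in> sources n Nn" using ij by (auto simp: sources_def)
    ultimately show "T i j -` B \<inter> space (source_algebra M a b x v T n Nn) \<in> sets (source_algebra M a b x v T n Nn)"
      unfolding sets sp by (intro sigma_sets.Basic) blast
  qed simp
qed

text \<open>The marginal law of two errors of one subject: all other rectangle sides are the whole line, and the
  factors of the other subjects are 1.\<close>

lemma measurement_errors_pair:
  assumes me: "measurement_errors M E a b x v \<epsilon> N T e" and E: "prob_space E"
    and i: "i < n" and j: "j < N n i" "k < N n i" and A: "A \<in> sets borel" "B \<in> sets borel"
  shows "AE \<omega> in M. real_cond_exp M (source_algebra M a b x v (T n) n (N n))
      (indicator {\<omega> \<in> space M. e n i j \<omega> \<in> A \<and> e n i k \<omega> \<in> B}) \<omega> =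
      measure E {w \<in> space E. \<epsilon> (T n i j \<omega>) w \<in> A \<and> \<epsilon> (T n i k \<omega>) w \<in> B}"
proof -
  interpret E: prob_space E by fact
  define R where "R i' l = (if i' = i then (if l = j then A else UNIV) \<inter> (if l = k then B else UNIV) else UNIV)" for i' l
  have R: "R i' l \<in> sets borel" for i' l using A by (auto simp: R_def)
  have R1: "(\<forall>i'<n. \<forall>l<N n i'. f i' l \<in> R i' l) \<longleftrightarrow> f i j \<in> A \<and> f i k \<in> B" for f :: "nat \<Rightarrow> nat \<Rightarrow> real"
    using i j by (auto simp: R_def)
  have R2: "(\<Prod>i'<n. measure E {w \<in> space E. \<forall>l<N n i'. \<epsilon> (T n i' l \<omega>) w \<in> R i' l}) =
      measure E {w \<in> space E. \<epsilon> (T n i j \<omega>) w \<in> A \<and> \<epsilon> (T n i k \<omega>) w \<in> B}" for \<omega>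
  proof -
    have "measure E {w \<in> space E. \<forall>l<N n i'. \<epsilon> (T n i' l \<omega>) w \<in> R i' l} =
        (if i' = i then measure E {w \<in> space E. \<epsilon> (T n i j \<omega>) w \<in> A \<and> \<epsilon> (T n i k \<omega>) w \<in> B} else 1)" for i'
    proof (cases "i' = i")
      case True
      have "{w \<in> space E. \<forall>l<N n i. \<epsilon> (T n i l \<omega>) w \<in> R i l} =
          {w \<in> space E. \<epsilon> (T n i j \<omega>) w \<in> A \<and> \<epsilon> (T n i k \<omega>) w \<in> B}"
        using j by (auto simp: R_def)
      then show ?thesis using True by simp
    next
      case False
      then show ?thesis by (simp add: R_def E.prob_space)
    qed
    then show ?thesis using i by (simp add: prod.delta)
  qed
  have "AE \<omega> in M. real_cond_exp M (source_algebra M a b x v (T n) n (N n))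
          (indicator {\<omega> \<in> space M. \<forall>i'<n. \<forall>l<N n i'. e n i' l \<omega> \<in> R i' l}) \<omega> =
        (\<Prod>i'<n. measure E {w \<in> space E. \<forall>l<N n i'. \<epsilon> (T n i' l \<omega>) w \<in> R i' l})"
    using me R unfolding measurement_errors_def by blast
  then show ?thesis unfolding R1[of "\<lambda>i' l. e n i' l _"] R2 .
qed

section \<open>Smooth processes\<close>

text \<open>A function that is measurable in one and continuous in the other variable is jointly
  measurable, being the limit of its discretizations in time.\<close>

lemma caratheodory_measurable:
  fixes g :: "real \<Rightarrow> 'a \<Rightarrow> real"
  assumes meas: "\<And>t. c < t \<Longrightarrow> t < d \<Longrightarrow> g t \<in> borel_measurable M"
    and cont: "\<And>\<omega>. \<omega> \<in> space M \<Longrightarrow> continuous_on {c<..<d} (\<lambda>t. g t \<omega>)"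
  shows "(\<lambda>z. if fst z \<in> {c<..<d} then g (fst z) (snd z) else 0) \<in> borel_measurable (borel \<Otimes>\<^sub>M M)"
proof -
  define g' where "g' t \<omega> = (if t \<in> {c<..<d} then g t \<omega> else 0)" for t \<omega>
  have g' [measurable]: "g' t \<in> borel_measurable M" for t
    unfolding g'_def using meas[of t] by (cases "t \<in> {c<..<d}") auto
  define F where "F n z = indicator {c<..<d} (fst z) * g' (of_int \<lfloor>real (Suc n) * fst z\<rfloor> / real (Suc n)) (snd z)"
    for n and z :: "real \<times> 'a"
  have Fm: "F n \<in> borel_measurable (borel \<Otimes>\<^sub>M M)" for n
  proof -
    have "(\<lambda>z. (\<lambda>i z. g' (of_int i / real (Suc n)) (snd z)) \<lfloor>real (Suc n) * fst z\<rfloor> z)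
        \<in> borel_measurable (borel \<Otimes>\<^sub>M M)"
      by (rule measurable_compose_countable) measurable
    then show ?thesis unfolding F_def by measurable
  qed
  show ?thesis
  proof (rule borel_measurable_LIMSEQ_real[OF _ Fm])
    fix z :: "real \<times> 'a" assume "z \<in> space (borel \<Otimes>\<^sub>M M)"
    then obtain t \<omega> where z: "z = (t, \<omega>)" and \<omega>: "\<omega> \<in> space M" by (cases z) (auto simp: space_pair_measure)
    show "(\<lambda>n. F n z) \<longlonglongrightarrow> (if fst z \<in> {c<..<d} then g (fst z) (snd z) else 0)"
    proof (cases "t \<in> {c<..<d}")
      case True
      define s where "s n = of_int \<lfloor>real (Suc n) * t\<rfloor> / real (Suc n)" for n
      have lim: "s \<longlonglongrightarrow> t"
      proof (rule tendsto_sandwich[OF _ _ _ tendsto_const])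
        show "\<forall>\<^sub>F n in sequentially. t - 1 / real (Suc n) \<le> s n"
        proof (intro always_eventually allI)
          fix n
          have "real (Suc n) * t - 1 \<le> of_int \<lfloor>real (Suc n) * t\<rfloor>" by linarith
          then have "(real (Suc n) * t - 1) / real (Suc n) \<le> s n" unfolding s_def by (intro divide_right_mono) auto
          then show "t - 1 / real (Suc n) \<le> s n" by (simp add: diff_divide_distrib del: of_nat_Suc)
        qed
        show "\<forall>\<^sub>F n in sequentially. s n \<le> t"
        proof (intro always_eventually allI)
          fix n
          have "of_int \<lfloor>real (Suc n) * t\<rfloor> \<le> real (Suc n) * t" by linarith
          then show "s n \<le> t" unfolding s_def by (simp add: divide_le_eq mult.commute del: of_nat_Suc)
        qed
        show "(\<lambda>n. t - 1 / real (Suc n)) \<longlonglongrightarrow> t"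
          using tendsto_diff[OF tendsto_const[of t] LIMSEQ_inverse_real_of_nat] by (simp add: inverse_eq_divide)
      qed
      have ev: "\<forall>\<^sub>F n in sequentially. s n \<in> {c<..<d}"
        using True by (intro topological_tendstoD[OF lim]) auto
      have "isCont (\<lambda>t. g t \<omega>) t" using cont[OF \<omega>] True by (simp add: continuous_on_eq_continuous_at)
      then have "(\<lambda>n. g (s n) \<omega>) \<longlonglongrightarrow> g t \<omega>" using lim by (rule isCont_tendsto_compose)
      moreover have "\<forall>\<^sub>F n in sequentially. g (s n) \<omega> = F n z"
        using ev by eventually_elim (use True in \<open>simp add: F_def g'_def z s_def\<close>)
      ultimately show ?thesis using True z by (auto intro: Lim_transform_eventually)
    next
      case False
      then show ?thesis by (auto simp: F_def z)
    qed
  qed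
qed

text \<open>At the end points the paths may be discontinuous; there the time is constant.\<close>

lemma random_time_measurable:
  fixes g :: "real \<Rightarrow> 'a \<Rightarrow> real"
  assumes meas: "\<And>t. t \<in> {a..b} \<Longrightarrow> g t \<in> borel_measurable M"
    and cont: "\<And>\<omega>. \<omega> \<in> space M \<Longrightarrow> continuous_on {a<..<b} (\<lambda>t. g t \<omega>)"
    and T [measurable]: "T \<in> borel_measurable M" and Tab: "\<And>\<omega>. \<omega> \<in> space M \<Longrightarrow> T \<omega> \<in> {a..b}"
    and ab: "a \<le> b"
  shows "(\<lambda>\<omega>. g (T \<omega>) \<omega>) \<in> borel_measurable M"
proof -
  note [measurable] = caratheodory_measurable[of a b g M, OF meas cont, simplified]
  have [measurable]: "g a \<in> borel_measurable M" "g b \<in> borel_measurable M" using meas ab by auto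
  have "(\<lambda>\<omega>. (\<lambda>z. if fst z \<in> {a<..<b} then g (fst z) (snd z) else 0) (T \<omega>, \<omega>)) \<in> borel_measurable M"
    by (rule measurable_compose[OF _ caratheodory_measurable[of a b g M, OF meas cont]]) auto
  then have [measurable]: "(\<lambda>\<omega>. if T \<omega> \<in> {a<..<b} then g (T \<omega>) \<omega> else 0) \<in> borel_measurable M"
    unfolding fst_conv snd_conv .
  have "(\<lambda>\<omega>. if T \<omega> = a then g a \<omega> else if T \<omega> = b then g b \<omega> else if T \<omega> \<in> {a<..<b} then g (T \<omega>) \<omega> else 0)
    \<in> borel_measurable M"
    by measurable
  then show ?thesis
    by (rule measurable_cong[THEN iffD1, rotated]) (use Tab in force)
qed

lemma cont_diff_on_interiorD:
  assumes g: "cont_diff_on m S g" and sub: "{c<..<d} \<subseteq> S"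
  shows "\<exists>D. D 0 = g \<and>
    (\<forall>k w. k < m \<longrightarrow> c < w \<longrightarrow> w < d \<longrightarrow> (D k has_real_derivative D (Suc k) w) (at w)) \<and>
    (\<forall>k. k \<le> m \<longrightarrow> continuous_on S (D k))"
proof -
  from g[unfolded cont_diff_on_def] obtain D where D: "D 0 = g \<and>
      (\<forall>k<m. \<forall>t\<in>S. (D k has_real_derivative D (Suc k) t) (at t within S)) \<and>
      (\<forall>k\<le>m. continuous_on S (D k))"
    by (elim exE)
  have "(D k has_real_derivative D (Suc k) w) (at w)" if kw: "k < m" "c < w" "w < d" for k w
  proof -
    have "w \<in> S" using kw sub by auto
    then have "(D k has_real_derivative D (Suc k) w) (at w within S)" using D kw by simp
    then have "(D k has_real_derivative D (Suc k) w) (at w within {c<..<d})"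
      by (rule has_field_derivative_subset[OF _ sub])
    moreover have "at w within {c<..<d} = at w" using kw by (intro at_within_open) auto
    ultimately show "(D k has_real_derivative D (Suc k) w) (at w)" by (simp only:)
  qed
  then show ?thesis using D by (intro exI[of _ D]) simp
qed

lemma cont_diff_on_continuous: "cont_diff_on m S g \<Longrightarrow> continuous_on S g"
  unfolding cont_diff_on_def by (metis le0)

lemma cont_diff_on_add:
  assumes "cont_diff_on m S f" "cont_diff_on m S g"
  shows "cont_diff_on m S (\<lambda>t. f t + g t)"
proof -
  obtain D D' where "D 0 = f" "\<forall>k<m. \<forall>t\<in>S. (D k has_real_derivative D (Suc k) t) (at t within S)"
    "\<forall>k\<le>m. continuous_on S (D k)" "D' 0 = g" "\<forall>k<m. \<forall>t\<in>S. (D' k has_real_derivative D' (Suc k) t) (at t within S)"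
    "\<forall>k\<le>m. continuous_on S (D' k)"
    using assms unfolding cont_diff_on_def by blast
  then show ?thesis unfolding cont_diff_on_def
    by (intro exI[of _ "\<lambda>k t. D k t + D' k t"]) (auto intro!: DERIV_add continuous_intros)
qed

lemma cont_diff_on_cmult:
  assumes "cont_diff_on m S f"
  shows "cont_diff_on m S (\<lambda>t. r * f t)"
proof -
  obtain D where "D 0 = f" "\<forall>k<m. \<forall>t\<in>S. (D k has_real_derivative D (Suc k) t) (at t within S)"
    "\<forall>k\<le>m. continuous_on S (D k)"
    using assms unfolding cont_diff_on_def by blast
  then show ?thesis unfolding cont_diff_on_def
    by (intro exI[of _ "\<lambda>k t. r * D k t"]) (auto intro!: DERIV_cmult continuous_intros)
qed

lemma cont_diff_on_zero: "cont_diff_on m S (\<lambda>t. 0)"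
  unfolding cont_diff_on_def by (intro exI[of _ "\<lambda>k t. 0"]) auto

text \<open>The vectors \<open>w\<close> with \<open>inner w \<circ> \<beta>\<close> smooth form a subspace that contains all values of \<open>x\<close>.  A vector
  \<open>c\<close> orthogonal to it satisfies \<open>\<Omega> *v c = 0\<close>, so it is 0.\<close>

lemma invertible_second_moment_smooth_coefficients:
  fixes x :: "'a \<Rightarrow> real^'q" and \<Omega> :: "real^'q^'q"
  assumes int: "\<And>k l. integrable M (\<lambda>\<omega>. x \<omega> $ k * x \<omega> $ l)"
    and Om: "\<And>k l. (\<integral>\<omega>. x \<omega> $ k * x \<omega> $ l \<partial>M) = \<Omega> $ k $ l" and inv: "invertible \<Omega>"
    and smooth: "\<And>\<omega>. \<omega> \<in> space M \<Longrightarrow> cont_diff_on m S (\<lambda>t. inner (x \<omega>) (\<beta> t))"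
  shows "cont_diff_on m S (\<lambda>t. inner w (\<beta> t))"
proof -
  define V where "V = {w. cont_diff_on m S (\<lambda>t. inner w (\<beta> t))}"
  have sub: "subspace V"
    unfolding subspace_def V_def
    using cont_diff_on_zero cont_diff_on_add cont_diff_on_cmult by (auto simp: inner_add_left)
  have "V = UNIV"
  proof (rule ccontr)
    assume "V \<noteq> UNIV"
    then have "span V \<noteq> UNIV" using sub span_eq_iff by metis
    then obtain c where c: "c \<noteq> 0" "\<And>y. y \<in> span V \<Longrightarrow> inner c y = 0"
      using span_not_UNIV_orthogonal by blast
    have xc: "inner (x \<omega>) c = 0" if "\<omega> \<in> space M" for \<omega>
    proof -
      have "x \<omega> \<in> V" using smooth[OF that] by (simp add: V_def)
      then show ?thesis using c(2)[of "x \<omega>"] span_base by (auto simp: inner_commute)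
    qed
    have "(\<Omega> *v c) $ k = 0" for k
    proof -
      have "(\<Omega> *v c) $ k = (\<Sum>l\<in>UNIV. (\<integral>\<omega>. x \<omega> $ k * x \<omega> $ l \<partial>M) * c $ l)"
        by (simp add: matrix_vector_mult_def Om)
      also have "\<dots> = (\<integral>\<omega>. (\<Sum>l\<in>UNIV. x \<omega> $ k * x \<omega> $ l * c $ l) \<partial>M)"
        using int by simp
      also have "\<dots> = (\<integral>\<omega>. 0 \<partial>M)"
      proof (intro Bochner_Integration.integral_cong refl)
        fix \<omega> assume "\<omega> \<in> space M"
        have "(\<Sum>l\<in>UNIV. x \<omega> $ k * x \<omega> $ l * c $ l) = x \<omega> $ k * inner (x \<omega>) c"
          by (simp add: inner_vec_def sum_distrib_left mult.assoc)
        then show "(\<Sum>l\<in>UNIV. x \<omega> $ k * x \<omega> $ l * c $ l) = 0" using xc[OF \<open>\<omega> \<in> space M\<close>] by simp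
      qed
      finally show ?thesis by simp
    qed
    then have "\<Omega> *v c = 0" by (simp add: Finite_Cartesian_Product.vec_eq_iff)
    then show False using inv c(1) matrix_left_invertible_ker invertible_left_inverse by metis
  qed
  then show ?thesis by (auto simp: V_def)
qed

lemma fdiff_cont_diff_bound:
  assumes g: "cont_diff_on m S g" and sub: "{c..d} \<subseteq> S"
  shows "\<exists>C\<ge>0. \<forall>\<eta> u. 0 < \<eta> \<longrightarrow> c < u \<longrightarrow> u + real m * \<eta> < d \<longrightarrow> \<bar>fdiff m \<eta> g u\<bar> \<le> \<eta> ^ m * C"
proof -
  have sub': "{c<..<d} \<subseteq> S" using sub by auto
  from cont_diff_on_interiorD[OF g sub'] obtain D where D': "D 0 = g \<and>
      (\<forall>k w. k < m \<longrightarrow> c < w \<longrightarrow> w < d \<longrightarrow> (D k has_real_derivative D (Suc k) w) (at w)) \<and>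
      (\<forall>k. k \<le> m \<longrightarrow> continuous_on S (D k))"
    by (elim exE)
  have D: "D 0 = g"
    "\<And>k w. k < m \<Longrightarrow> c < w \<Longrightarrow> w < d \<Longrightarrow> (D k has_real_derivative D (Suc k) w) (at w)"
    "\<And>k. k \<le> m \<Longrightarrow> continuous_on S (D k)"
    using D' by simp_all
  have "compact (D m ` {c..d})"
    by (rule compact_continuous_image[OF continuous_on_subset[OF D(3)[OF order_refl] sub] compact_Icc])
  then obtain C where C: "\<And>w. w \<in> {c..d} \<Longrightarrow> \<bar>D m w\<bar> \<le> C"
    using compact_imp_bounded by (fastforce simp: bounded_iff)
  show ?thesis
  proof (intro exI[of _ "\<bar>C\<bar>"] conjI allI impI)
    fix \<eta> u assume *: "0 < \<eta>" "c < u" "u + real m * \<eta> < d"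
    from fdiff_mean_value[of m c d D \<eta> u, OF D(2) *] obtain z
      where z: "u \<le> z" "z \<le> u + real m * \<eta>" "fdiff m \<eta> g u = \<eta> ^ m * D m z" by (auto simp: D(1))
    have "\<bar>D m z\<bar> \<le> \<bar>C\<bar>" using C[of z] z * by auto
    then show "\<bar>fdiff m \<eta> g u\<bar> \<le> \<eta> ^ m * \<bar>C\<bar>"
      using * by (simp add: z(3) abs_mult mult_left_mono)
  qed simp
qed

text \<open>Two applications of the mean value form turn the iterated difference into \<open>\<eta>^(2m)\<close> times the
  mixed derivative of order \<open>(m, m)\<close> at some point, which is bounded on the square.\<close>

lemma fdiff2_cont_diff2_bound:
  assumes g: "cont_diff2_on m S \<gamma>" and sub: "{c..d} \<subseteq> S"
  shows "\<exists>C\<ge>0. \<forall>\<eta> u. 0 < \<eta> \<longrightarrow> c < u \<longrightarrow> u + real m * \<eta> < d \<longrightarrow>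
    fdiff m \<eta> (\<lambda>s. fdiff m \<eta> (\<lambda>t. \<gamma> s t) u) u \<le> \<eta> ^ (2 * m) * C"
proof -
  have sub': "{c<..<d} \<subseteq> S" using sub by auto
  from g[unfolded cont_diff2_on_def] obtain D where D': "D 0 0 = \<gamma> \<and>
      (\<forall>k<m. \<forall>l\<le>m. \<forall>s\<in>S. \<forall>t\<in>S.
        ((\<lambda>u. D k l u t) has_real_derivative D (Suc k) l s t) (at s within S)) \<and>
      (\<forall>k\<le>m. \<forall>l<m. \<forall>s\<in>S. \<forall>t\<in>S.
        ((\<lambda>u. D k l s u) has_real_derivative D k (Suc l) s t) (at t within S)) \<and>
      (\<forall>k\<le>m. \<forall>l\<le>m. continuous_on (S \<times> S) (\<lambda>(s, t). D k l s t))"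
    by (elim exE)
  have D: "D 0 0 = \<gamma>"
     "\<And>k l s t. k < m \<Longrightarrow> l \<le> m \<Longrightarrow> s \<in> S \<Longrightarrow> t \<in> S \<Longrightarrow> ((\<lambda>u. D k l u t) has_real_derivative D (Suc k) l s t) (at s within S)"
     "\<And>k l s t. k \<le> m \<Longrightarrow> l < m \<Longrightarrow> s \<in> S \<Longrightarrow> t \<in> S \<Longrightarrow> ((\<lambda>u. D k l s u) has_real_derivative D k (Suc l) s t) (at t within S)"
     "\<And>k l. k \<le> m \<Longrightarrow> l \<le> m \<Longrightarrow> continuous_on (S \<times> S) (\<lambda>(s, t). D k l s t)"
    using D' by simp_all
  have "compact ((\<lambda>(s, t). D m m s t) ` ({c..d} \<times> {c..d}))"
    using sub by (intro compact_continuous_image continuous_on_subset[OF D(4)] compact_Times) auto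
  then obtain C where C: "\<And>s t. s \<in> {c..d} \<Longrightarrow> t \<in> {c..d} \<Longrightarrow> \<bar>D m m s t\<bar> \<le> C"
    using compact_imp_bounded by (fastforce simp: bounded_iff)
  have dS: "((\<lambda>u. D k l u t) has_real_derivative D (Suc k) l s t) (at s)"
    if "k < m" "l \<le> m" "c < s" "s < d" "c < t" "t < d" for k l s t
  proof -
    have "((\<lambda>u. D k l u t) has_real_derivative D (Suc k) l s t) (at s within {c<..<d})"
      using that sub by (intro has_field_derivative_subset[OF D(2) sub']) auto
    moreover have "at s within {c<..<d} = at s" using that by (intro at_within_open) auto
    ultimately show ?thesis by (simp only:)
  qed
  have dT: "((\<lambda>u. D k l s u) has_real_derivative D k (Suc l) s t) (at t)"
    if "k \<le> m" "l < m" "c < s" "s < d" "c < t" "t < d" for k l s t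
  proof -
    have "((\<lambda>u. D k l s u) has_real_derivative D k (Suc l) s t) (at t within {c<..<d})"
      using that sub by (intro has_field_derivative_subset[OF D(3) sub']) auto
    moreover have "at t within {c<..<d} = at t" using that by (intro at_within_open) auto
    ultimately show ?thesis by (simp only:)
  qed
  obtain a where a: "\<And>\<eta> F u. fdiff m \<eta> F u = (\<Sum>k\<le>m. a k * F (u + real k * \<eta>))" using fdiff_sum by metis
  show ?thesis
  proof (intro exI[of _ "\<bar>C\<bar>"] conjI allI impI)
    fix \<eta> u assume *: "0 < \<eta>" "c < u" "u + real m * \<eta> < d"
    have uk: "c < u + real l * \<eta> \<and> u + real l * \<eta> < d" if "l \<le> m" for l
    proof -
      have "real l * \<eta> \<le> real m * \<eta>" using that * by (intro mult_right_mono) auto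
      moreover have "0 \<le> real l * \<eta>" using * by simp
      ultimately show ?thesis using * by linarith
    qed
    define F where "F k s = fdiff m \<eta> (\<lambda>t. D k 0 s t) u" for k s
    have "\<exists>z\<ge>u. z \<le> u + real m * \<eta> \<and> fdiff m \<eta> (F 0) u = \<eta> ^ m * F m z"
    proof (rule fdiff_mean_value[OF _ *])
      fix k w assume kw: "k < m" "c < w" "w < d"
      show "(F k has_real_derivative F (Suc k) w) (at w)"
        unfolding F_def a using kw uk by (intro DERIV_sum DERIV_cmult dS) auto
    qed
    then obtain z where z: "u \<le> z" "z \<le> u + real m * \<eta>" "fdiff m \<eta> (F 0) u = \<eta> ^ m * F m z" by blast
    have zb: "c < z" "z < d" using z * by auto
    have "\<exists>y\<ge>u. y \<le> u + real m * \<eta> \<and> fdiff m \<eta> (D m 0 z) u = \<eta> ^ m * D m m z y"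
      using fdiff_mean_value[of m c d "\<lambda>l. D m l z" \<eta> u, OF dT *] zb by auto
    then obtain y where y: "u \<le> y" "y \<le> u + real m * \<eta>" "fdiff m \<eta> (D m 0 z) u = \<eta> ^ m * D m m z y" by blast
    have "fdiff m \<eta> (\<lambda>s. fdiff m \<eta> (\<lambda>t. \<gamma> s t) u) u = \<eta> ^ m * (\<eta> ^ m * D m m z y)"
      using z(3) y(3) unfolding F_def D(1) by simp
    also have "\<dots> = \<eta> ^ (2 * m) * D m m z y" by (simp add: power_add[symmetric] mult_2 mult.assoc[symmetric])
    also have "\<dots> \<le> \<eta> ^ (2 * m) * \<bar>C\<bar>"
      using C[of z y] y zb * by (intro mult_left_mono) auto
    finally show "fdiff m \<eta> (\<lambda>s. fdiff m \<eta> (\<lambda>t. \<gamma> s t) u) u \<le> \<eta> ^ (2 * m) * \<bar>C\<bar>" .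
  qed simp
qed

text \<open>Bounds on the second moments of the finite differences carry over to the derivative of the
  paths by Fatou's lemma.  The derivative is jointly measurable as a limit of finite differences, so Tonelli's
  theorem integrates the bound over time.  The derivatives are chosen path by path, hence the statement
  offers them as functions of \<open>\<omega>\<close> first.\<close>

lemma smooth_process_derivative:
  fixes f :: "real \<Rightarrow> 'a \<Rightarrow> real"
  assumes sf: "sigma_finite_measure M"
    and meas: "\<And>t. c < t \<Longrightarrow> t < d \<Longrightarrow> f t \<in> borel_measurable M"
    and smooth: "\<And>\<omega>. \<omega> \<in> space M \<Longrightarrow> cont_diff_on m {c<..<d} (\<lambda>t. f t \<omega>)"
    and bound: "\<And>\<eta> u. 0 < \<eta> \<Longrightarrow> c < u \<Longrightarrow> u + real m * \<eta> < d \<Longrightarrow>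
      (\<integral>\<^sup>+\<omega>. ennreal ((fdiff m \<eta> (\<lambda>t. f t \<omega>) u)\<^sup>2) \<partial>M) \<le> ennreal (\<eta> ^ (2 * m) * C)"
    and C: "C \<ge> 0"
  obtains D :: "'a \<Rightarrow> nat \<Rightarrow> real \<Rightarrow> real" where
    "\<And>\<omega>. \<omega> \<in> space M \<Longrightarrow> D \<omega> 0 = (\<lambda>t. f t \<omega>)"
    "\<And>\<omega> k w. \<omega> \<in> space M \<Longrightarrow> k < m \<Longrightarrow> c < w \<Longrightarrow> w < d \<Longrightarrow> (D \<omega> k has_real_derivative D \<omega> (Suc k) w) (at w)"
    "\<And>\<omega> k. \<omega> \<in> space M \<Longrightarrow> k \<le> m \<Longrightarrow> continuous_on {c<..<d} (D \<omega> k)"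
    "\<And>I. I \<in> sets borel \<Longrightarrow> (\<lambda>\<omega>. \<integral>\<^sup>+u. ennreal ((D \<omega> m u)\<^sup>2) * indicator (I \<inter> {c<..<d}) u \<partial>lborel) \<in> borel_measurable M"
    "\<And>I. I \<in> sets borel \<Longrightarrow> (\<integral>\<^sup>+\<omega>. (\<integral>\<^sup>+u. ennreal ((D \<omega> m u)\<^sup>2) * indicator (I \<inter> {c<..<d}) u \<partial>lborel) \<partial>M)
      \<le> ennreal C * emeasure lborel I"
proof -
  interpret sigma_finite_measure M by fact
  interpret P: pair_sigma_finite lborel M ..
  have "\<exists>D. D 0 = (\<lambda>t. f t \<omega>) \<and>
    (\<forall>k w. k < m \<longrightarrow> c < w \<longrightarrow> w < d \<longrightarrow> (D k has_real_derivative D (Suc k) w) (at w)) \<and>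
    (\<forall>k. k \<le> m \<longrightarrow> continuous_on {c<..<d} (D k))" if "\<omega> \<in> space M" for \<omega>
    by (rule cont_diff_on_interiorD[OF smooth[OF that] order_refl])
  then have "\<forall>\<omega>\<in>space M. \<exists>D. D 0 = (\<lambda>t. f t \<omega>) \<and>
    (\<forall>k w. k < m \<longrightarrow> c < w \<longrightarrow> w < d \<longrightarrow> (D k has_real_derivative D (Suc k) w) (at w)) \<and>
    (\<forall>k. k \<le> m \<longrightarrow> continuous_on {c<..<d} (D k))" by (intro ballI)
  from bchoice[OF this] obtain D where D': "\<forall>\<omega>\<in>space M. D \<omega> 0 = (\<lambda>t. f t \<omega>) \<and>
    (\<forall>k w. k < m \<longrightarrow> c < w \<longrightarrow> w < d \<longrightarrow> (D \<omega> k has_real_derivative D \<omega> (Suc k) w) (at w)) \<and>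
    (\<forall>k. k \<le> m \<longrightarrow> continuous_on {c<..<d} (D \<omega> k))"
    by (elim exE)
  have D: "\<And>\<omega>. \<omega> \<in> space M \<Longrightarrow> D \<omega> 0 = (\<lambda>t. f t \<omega>)"
    "\<And>\<omega> k w. \<omega> \<in> space M \<Longrightarrow> k < m \<Longrightarrow> c < w \<Longrightarrow> w < d \<Longrightarrow> (D \<omega> k has_real_derivative D \<omega> (Suc k) w) (at w)"
    "\<And>\<omega> k. \<omega> \<in> space M \<Longrightarrow> k \<le> m \<Longrightarrow> continuous_on {c<..<d} (D \<omega> k)"
    using D' by simp_all
  obtain a where a: "\<And>\<eta> F u. fdiff m \<eta> F u = (\<Sum>k\<le>m. a k * F (u + real k * \<eta>))" using fdiff_sum by metis
  define f' where "f' z = (if fst z \<in> {c<..<d} then f (fst z) (snd z) else 0)" for z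
  have f' [measurable]: "f' \<in> borel_measurable (borel \<Otimes>\<^sub>M M)"
    unfolding f'_def[abs_def] using D(1,3) by (intro caratheodory_measurable meas) (metis le0)+
  (* Difference quotients of step 1 / (n + 1), written as finite sums of path values to see measurability. *)
  define Fn where "Fn n z = indicator {c<..<d} (fst z) * (real (Suc n) ^ m *
      (\<Sum>k\<le>m. a k * f' (fst z + real k * (1 / real (Suc n)), snd z)))" for n z
  have Fn [measurable]: "Fn n \<in> borel_measurable (borel \<Otimes>\<^sub>M M)" for n
    unfolding Fn_def[abs_def] by measurable
  define G where "G z = (if fst z \<in> {c<..<d} then D (snd z) m (fst z) else 0)" for z
  have Fne: "Fn n (u, \<omega>) = real (Suc n) ^ m * fdiff m (1 / real (Suc n)) (\<lambda>t. f t \<omega>) u"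
    if u: "c < u" "u < d" and n: "u + real m * (1 / real (Suc n)) < d" for n u \<omega>
  proof -
    have "f' (u + real k * (1 / real (Suc n)), \<omega>) = f (u + real k * (1 / real (Suc n))) \<omega>" if "k \<le> m" for k
    proof -
      have "real k * (1 / real (Suc n)) \<le> real m * (1 / real (Suc n))" using that by (intro mult_right_mono) auto
      moreover have "0 \<le> real k * (1 / real (Suc n))" by simp
      ultimately have "c < u + real k * (1 / real (Suc n))" "u + real k * (1 / real (Suc n)) < d"
        using n u by linarith+
      then show ?thesis unfolding f'_def by simp
    qed
    then show ?thesis unfolding Fn_def a using u by (auto intro!: sum.cong simp del: of_nat_Suc)
  qed
  have lim: "(\<lambda>n. Fn n (u, \<omega>)) \<longlonglongrightarrow> G (u, \<omega>)" if "\<omega> \<in> space M" for u \<omega>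
  proof (cases "c < u \<and> u < d")
    case True
    have "(\<lambda>n. real (Suc n) ^ m * fdiff m (1 / real (Suc n)) (D \<omega> 0) u) \<longlonglongrightarrow> D \<omega> m u"
      using D[OF that] True by (intro fdiff_LIMSEQ[where c = c and d = d]) auto
    moreover have "\<forall>\<^sub>F n in sequentially. real (Suc n) ^ m * fdiff m (1 / real (Suc n)) (D \<omega> 0) u = Fn n (u, \<omega>)"
      by (rule eventually_mono[OF shrinking_step(2)[OF conjunct2[OF True], of m]]) (use True Fne D(1)[OF that] in auto)
    ultimately have "(\<lambda>n. Fn n (u, \<omega>)) \<longlonglongrightarrow> D \<omega> m u" by (rule Lim_transform_eventually)
    then show ?thesis using True by (simp add: G_def)
  next
    case False
    then show ?thesis by (auto simp: Fn_def G_def)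
  qed
  have G [measurable]: "G \<in> borel_measurable (borel \<Otimes>\<^sub>M M)"
    by (rule borel_measurable_LIMSEQ_real[OF _ Fn]) (use lim in \<open>auto simp: space_pair_measure\<close>)
  have second: "(\<integral>\<^sup>+\<omega>. ennreal ((G (u, \<omega>))\<^sup>2) \<partial>M) \<le> ennreal C" for u
  proof (cases "c < u \<and> u < d")
    case False
    then have "G (u, \<omega>) = 0" for \<omega> by (auto simp: G_def)
    then show ?thesis by simp
  next
    case True
    have "(\<integral>\<^sup>+\<omega>. ennreal ((G (u, \<omega>))\<^sup>2) \<partial>M) = (\<integral>\<^sup>+\<omega>. liminf (\<lambda>n. ennreal ((Fn n (u, \<omega>))\<^sup>2)) \<partial>M)"
      by (intro nn_integral_cong lim_imp_Liminf[symmetric] tendsto_ennrealI tendsto_power lim) auto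
    also have "\<dots> \<le> liminf (\<lambda>n. \<integral>\<^sup>+\<omega>. ennreal ((Fn n (u, \<omega>))\<^sup>2) \<partial>M)"
      by (rule nn_integral_liminf) measurable
    also have "\<dots> \<le> liminf (\<lambda>n. ennreal C)"
    proof (rule Liminf_mono)
      show "\<forall>\<^sub>F n in sequentially. (\<integral>\<^sup>+\<omega>. ennreal ((Fn n (u, \<omega>))\<^sup>2) \<partial>M) \<le> ennreal C"
        using shrinking_step(2)[OF True[THEN conjunct2], of m]
      proof eventually_elim
        case (elim n)
        have Fne: "Fn n (u, \<omega>) = real (Suc n) ^ m * fdiff m (1 / real (Suc n)) (\<lambda>t. f t \<omega>) u" for \<omega>
          using Fne True elim by blast
        have [measurable]: "(\<lambda>\<omega>. fdiff m (1 / real (Suc n)) (\<lambda>t. f t \<omega>) u) \<in> borel_measurable M"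
        proof -
          have "(\<lambda>\<omega>. fdiff m (1 / real (Suc n)) (\<lambda>t. f t \<omega>) u) = (\<lambda>\<omega>. Fn n (u, \<omega>) / real (Suc n) ^ m)"
            by (simp add: Fne del: of_nat_Suc)
          also have "\<dots> \<in> borel_measurable M" by measurable
          finally show ?thesis .
        qed
        have "(\<integral>\<^sup>+\<omega>. ennreal ((Fn n (u, \<omega>))\<^sup>2) \<partial>M) =
            (\<integral>\<^sup>+\<omega>. ennreal (real (Suc n) ^ (2 * m)) * ennreal ((fdiff m (1 / real (Suc n)) (\<lambda>t. f t \<omega>) u)\<^sup>2) \<partial>M)"
          unfolding Fne
          by (intro nn_integral_cong) (simp add: ennreal_mult'[symmetric] power_mult_distrib power_mult[symmetric] mult.commute del: of_nat_Suc)
        also have "\<dots> = ennreal (real (Suc n) ^ (2 * m)) * (\<integral>\<^sup>+\<omega>. ennreal ((fdiff m (1 / real (Suc n)) (\<lambda>t. f t \<omega>) u)\<^sup>2) \<partial>M)"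
          by (rule nn_integral_cmult) measurable
        also have "\<dots> \<le> ennreal (real (Suc n) ^ (2 * m)) * ennreal ((1 / real (Suc n)) ^ (2 * m) * C)"
          using True elim by (intro mult_left_mono bound) auto
        also have "\<dots> = ennreal C"
          by (subst ennreal_mult'[symmetric]) (auto simp: power_divide simp del: of_nat_Suc)
        finally show ?case .
      qed
    qed
    also have "\<dots> = ennreal C" by (simp add: Liminf_const)
    finally show ?thesis .
  qed
  have GI: "ennreal ((D \<omega> m u)\<^sup>2) * indicator (I \<inter> {c<..<d}) u = ennreal ((G (u, \<omega>))\<^sup>2) * indicator I u"
    for u \<omega> I by (auto simp: G_def split: split_indicator)
  show ?thesis
  proof (rule that[OF D])
    fix I :: "real set" assume I [measurable]: "I \<in> sets borel"
    have "(\<lambda>(u, \<omega>). ennreal ((G (u, \<omega>))\<^sup>2) * indicator I u) \<in> borel_measurable (lborel \<Otimes>\<^sub>M M)"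
      by measurable
    then have m1: "(\<lambda>z. ennreal ((G z)\<^sup>2) * indicator I (fst z)) \<in> borel_measurable (lborel \<Otimes>\<^sub>M M)"
      by (simp add: case_prod_beta)
    have m2: "(\<lambda>(\<omega>, u). ennreal ((G (u, \<omega>))\<^sup>2) * indicator I u) \<in> borel_measurable (M \<Otimes>\<^sub>M lborel)"
      by measurable
    show "(\<lambda>\<omega>. \<integral>\<^sup>+u. ennreal ((D \<omega> m u)\<^sup>2) * indicator (I \<inter> {c<..<d}) u \<partial>lborel) \<in> borel_measurable M"
      unfolding GI using lborel.borel_measurable_nn_integral[OF m2] by simp
    have "(\<integral>\<^sup>+\<omega>. (\<integral>\<^sup>+u. ennreal ((D \<omega> m u)\<^sup>2) * indicator (I \<inter> {c<..<d}) u \<partial>lborel) \<partial>M) =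
        (\<integral>\<^sup>+u. (\<integral>\<^sup>+\<omega>. ennreal ((G (u, \<omega>))\<^sup>2) * indicator I u \<partial>M) \<partial>lborel)"
      unfolding GI using P.Fubini[OF m1] by simp
    also have "\<dots> = (\<integral>\<^sup>+u. (\<integral>\<^sup>+\<omega>. ennreal ((G (u, \<omega>))\<^sup>2) \<partial>M) * indicator I u \<partial>lborel)"
      by (intro nn_integral_cong nn_integral_multc) measurable
    also have "\<dots> \<le> (\<integral>\<^sup>+u. ennreal C * indicator I u \<partial>lborel)"
      by (intro nn_integral_mono mult_right_mono second) auto
    also have "\<dots> = ennreal C * emeasure lborel I" by (simp add: nn_integral_cmult_indicator)
    finally show "(\<integral>\<^sup>+\<omega>. (\<integral>\<^sup>+u. ennreal ((D \<omega> m u)\<^sup>2) * indicator (I \<inter> {c<..<d}) u \<partial>lborel) \<partial>M)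
      \<le> ennreal C * emeasure lborel I" .
  qed
qed

section \<open>A weak law of large numbers\<close>

lemma equal_distr_transfer:
  fixes g :: "'b::topological_space \<Rightarrow> real"
  assumes "X \<in> borel_measurable M" "Y \<in> borel_measurable N" "distr M borel X = distr N borel Y" "g \<in> borel_measurable borel"
  shows "integrable M (\<lambda>\<omega>. g (X \<omega>)) \<longleftrightarrow> integrable N (\<lambda>\<omega>. g (Y \<omega>))"
    "(\<integral>\<omega>. g (X \<omega>) \<partial>M) = (\<integral>\<omega>. g (Y \<omega>) \<partial>N)"
  using integrable_distr_eq[OF assms(1,4)] integrable_distr_eq[OF assms(2,4)]
    integral_distr[OF assms(1,4)] integral_distr[OF assms(2,4)] assms(3) by simp_all

text \<open>Truncation at a level \<open>c\<close>: the bounded parts concentrate by Hoeffding's inequality, and the tails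
  have a mean that dominated convergence makes small, so that Markov's inequality applies.  A finite first
  moment suffices; products of covariates have no more.\<close>

lemma (in prob_space) weak_law_of_large_numbers:
  fixes X :: "nat \<Rightarrow> 'a \<Rightarrow> real"
  assumes ind: "indep_vars (\<lambda>_. borel) X UNIV"
    and distr: "\<And>i. distr M borel (X i) = distr M borel (X 0)"
    and int: "integrable M (X 0)" and eta: "\<eta> > 0"
  shows "(\<lambda>n. prob {\<omega> \<in> space M. \<eta> \<le> \<bar>(\<Sum>i<n. X i \<omega>) / real n - expectation (X 0)\<bar>}) \<longlonglongrightarrow> 0"
proof (rule LIMSEQ_I)
  fix \<epsilon> :: real assume \<epsilon>: "\<epsilon> > 0"
  have Xm [measurable]: "X i \<in> borel_measurable M" for i
    using ind by (auto simp: indep_vars_def)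
  define \<kappa> where "\<kappa> = min (\<eta> / 4) (\<epsilon> * \<eta> / 8)"
  have kap: "\<kappa> > 0" "\<kappa> \<le> \<eta> / 4" "\<kappa> \<le> \<epsilon> * \<eta> / 8" using \<epsilon> eta by (auto simp: \<kappa>_def)
  (* Truncation of a variable at level c and its tail. *)
  define lo hi where "lo c u = (if \<bar>u\<bar> \<le> c then u else 0)" and "hi c u = (if \<bar>u\<bar> \<le> c then 0 else \<bar>u\<bar>)" for c u :: real
  have lhm [measurable]: "lo c \<in> borel_measurable borel" "hi c \<in> borel_measurable borel" for c
    unfolding lo_def hi_def by measurable
  have "(\<lambda>n. expectation (\<lambda>\<omega>. hi (real n) (X 0 \<omega>))) \<longlonglongrightarrow> expectation (\<lambda>\<omega>. 0)"
  proof (rule integral_dominated_convergence[where w = "\<lambda>\<omega>. \<bar>X 0 \<omega>\<bar>"])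
    show "AE \<omega> in M. (\<lambda>n. hi (real n) (X 0 \<omega>)) \<longlonglongrightarrow> 0"
    proof (rule AE_I2)
      fix \<omega>
      have "\<forall>\<^sub>F n in sequentially. hi (real n) (X 0 \<omega>) = 0"
        using eventually_ge_at_top[of "nat \<lceil>\<bar>X 0 \<omega>\<bar>\<rceil>"] by eventually_elim (auto simp: hi_def; linarith)
      then show "(\<lambda>n. hi (real n) (X 0 \<omega>)) \<longlonglongrightarrow> 0" by (rule tendsto_eventually)
    qed
  qed (use int in \<open>auto simp: hi_def\<close>)
  then have "\<forall>\<^sub>F n in sequentially. expectation (\<lambda>\<omega>. hi (real n) (X 0 \<omega>)) < \<kappa>"
    using kap by (intro order_tendstoD(2)) auto
  then obtain n0 where n0: "\<And>n. n \<ge> n0 \<Longrightarrow> expectation (\<lambda>\<omega>. hi (real n) (X 0 \<omega>)) < \<kappa>"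
    by (auto simp: eventually_sequentially)
  define c where "c = real (Suc n0)"
  have c: "c > 0" "expectation (\<lambda>\<omega>. hi c (X 0 \<omega>)) < \<kappa>"
    using n0[of "Suc n0"] by (auto simp: c_def)
  have intL: "integrable M (\<lambda>\<omega>. lo c (X i \<omega>))" for i
    using c by (intro integrable_const_bound[where B = c]) (auto simp: lo_def)
  have intH0: "integrable M (\<lambda>\<omega>. hi c (X 0 \<omega>))"
    using int by (rule Bochner_Integration.integrable_bound) (auto simp: hi_def)
  have Hexp: "integrable M (\<lambda>\<omega>. hi c (X i \<omega>))"
    "expectation (\<lambda>\<omega>. hi c (X i \<omega>)) = expectation (\<lambda>\<omega>. hi c (X 0 \<omega>))" for i
    using equal_distr_transfer[OF _ _ distr[of i] lhm(2)[of c]] intH0 by auto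
  have mu: "\<bar>expectation (X 0) - expectation (\<lambda>\<omega>. lo c (X 0 \<omega>))\<bar> \<le> \<kappa>"
  proof -
    have "expectation (X 0) - expectation (\<lambda>\<omega>. lo c (X 0 \<omega>)) = expectation (\<lambda>\<omega>. X 0 \<omega> - lo c (X 0 \<omega>))"
      using int intL by simp
    also have "\<bar>\<dots>\<bar> \<le> expectation (\<lambda>\<omega>. \<bar>X 0 \<omega> - lo c (X 0 \<omega>)\<bar>)" by (rule integral_abs_bound)
    also have "\<dots> = expectation (\<lambda>\<omega>. hi c (X 0 \<omega>))"
      by (intro Bochner_Integration.integral_cong) (auto simp: lo_def hi_def)
    finally show ?thesis using c(2) by simp
  qed
  have step: "prob {\<omega> \<in> space M. \<eta> \<le> \<bar>(\<Sum>i<n. X i \<omega>) / real n - expectation (X 0)\<bar>}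
      \<le> 2 * exp (- 2 * real n * (\<eta> / 4)\<^sup>2 / (c - - c)\<^sup>2) + \<epsilon> / 4" if n: "n > 0" for n
  proof -
    interpret H: Hoeffding_ineq_iid M "{..<n}" "\<lambda>i \<omega>. lo c (X i \<omega>)" "\<lambda>\<omega>. lo c (X 0 \<omega>)" "- c" c
      "expectation (\<lambda>\<omega>. lo c (X 0 \<omega>))"
    proof unfold_locales
      show "indep_vars (\<lambda>_. borel) (\<lambda>i \<omega>. lo c (X i \<omega>)) {..<n}"
        by (rule indep_vars_compose2[OF indep_vars_subset[OF ind]]) auto
      show "distr M borel (\<lambda>\<omega>. lo c (X i \<omega>)) = distr M borel (\<lambda>\<omega>. lo c (X 0 \<omega>))" for i
        using distr_distr[of "lo c" borel borel "X i" M] distr_distr[of "lo c" borel borel "X 0" M] distr[of i]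
        by (simp add: comp_def)
      show "AE x in M. lo c (X 0 x) \<in> {- c..c}" using c by (auto simp: lo_def)
    qed auto
    define P1 where "P1 = {\<omega> \<in> space M. \<eta> / 4 \<le> \<bar>(\<Sum>i<n. lo c (X i \<omega>)) / real n - expectation (\<lambda>\<omega>. lo c (X 0 \<omega>))\<bar>}"
    define P2 where "P2 = {\<omega> \<in> space M. \<eta> / 2 \<le> (\<Sum>i<n. hi c (X i \<omega>)) / real n}"
    have m: "P1 \<in> events" "P2 \<in> events" unfolding P1_def P2_def by measurable
    have p1: "prob P1 \<le> 2 * exp (- 2 * real n * (\<eta> / 4)\<^sup>2 / (c - - c)\<^sup>2)"
    proof -
      have "0 \<le> \<eta> / 4" "- c < c" "{..<n} \<noteq> {}" using eta c n by (auto simp: lessThan_empty_iff)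
      from H.Hoeffding_ineq_abs_ge'[OF this] show ?thesis unfolding P1_def by simp
    qed
    have p2: "prob P2 \<le> \<epsilon> / 4"
    proof -
      have "prob P2 \<le> expectation (\<lambda>\<omega>. (\<Sum>i<n. hi c (X i \<omega>)) / real n) / (\<eta> / 2)"
        unfolding P2_def
        by (rule integral_Markov_inequality_measure[where A = "{}"])
          (use eta Hexp in \<open>auto intro!: divide_nonneg_nonneg sum_nonneg simp: hi_def\<close>)
      also have "expectation (\<lambda>\<omega>. (\<Sum>i<n. hi c (X i \<omega>)) / real n) = expectation (\<lambda>\<omega>. hi c (X 0 \<omega>))"
      proof -
        have "expectation (\<lambda>\<omega>. (\<Sum>i<n. hi c (X i \<omega>)) / real n) = (\<Sum>i<n. expectation (\<lambda>\<omega>. hi c (X i \<omega>))) / real n"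
          using Hexp(1) by simp
        also have "(\<Sum>i<n. expectation (\<lambda>\<omega>. hi c (X i \<omega>))) = (\<Sum>i<n. expectation (\<lambda>\<omega>. hi c (X 0 \<omega>)))"
          by (intro sum.cong refl Hexp(2))
        finally show ?thesis using n by simp
      qed
      also have "\<dots> / (\<eta> / 2) \<le> (\<epsilon> * \<eta> / 8) / (\<eta> / 2)"
        using c(2) kap eta by (intro divide_right_mono) auto
      also have "\<dots> = \<epsilon> / 4" using eta by simp
      finally show ?thesis .
    qed
    have "{\<omega> \<in> space M. \<eta> \<le> \<bar>(\<Sum>i<n. X i \<omega>) / real n - expectation (X 0)\<bar>} \<subseteq> P1 \<union> P2"
    proof
      fix \<omega> assume "\<omega> \<in> {\<omega> \<in> space M. \<eta> \<le> \<bar>(\<Sum>i<n. X i \<omega>) / real n - expectation (X 0)\<bar>}"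
      then have \<omega>: "\<omega> \<in> space M" "\<eta> \<le> \<bar>(\<Sum>i<n. X i \<omega>) / real n - expectation (X 0)\<bar>" by auto
      have "\<bar>(\<Sum>i<n. X i \<omega>) - (\<Sum>i<n. lo c (X i \<omega>))\<bar> \<le> (\<Sum>i<n. hi c (X i \<omega>))"
        unfolding sum_subtractf[symmetric] by (rule sum_abs[THEN order_trans]) (auto intro!: sum_mono simp: lo_def hi_def)
      then have "\<bar>(\<Sum>i<n. X i \<omega>) - (\<Sum>i<n. lo c (X i \<omega>))\<bar> / real n \<le> (\<Sum>i<n. hi c (X i \<omega>)) / real n"
        by (intro divide_right_mono) auto
      then have "\<bar>(\<Sum>i<n. X i \<omega>) / real n - (\<Sum>i<n. lo c (X i \<omega>)) / real n\<bar> \<le> (\<Sum>i<n. hi c (X i \<omega>)) / real n"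
        by (simp add: diff_divide_distrib[symmetric])
      then have "\<eta> / 4 \<le> \<bar>(\<Sum>i<n. lo c (X i \<omega>)) / real n - expectation (\<lambda>\<omega>. lo c (X 0 \<omega>))\<bar> \<or>
          \<eta> / 2 \<le> (\<Sum>i<n. hi c (X i \<omega>)) / real n"
        using mu kap \<omega>(2) by linarith
      then show "\<omega> \<in> P1 \<union> P2" using \<omega> by (auto simp: P1_def P2_def)
    qed
    then have "prob {\<omega> \<in> space M. \<eta> \<le> \<bar>(\<Sum>i<n. X i \<omega>) / real n - expectation (X 0)\<bar>} \<le> prob (P1 \<union> P2)"
      using m by (intro finite_measure_mono) auto
    also have "\<dots> \<le> prob P1 + prob P2" using m by (rule measure_Un_le)
    finally show ?thesis using p1 p2 by linarith
  qed
  define r where "r = 2 * (\<eta> / 4)\<^sup>2 / (c - - c)\<^sup>2"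
  have r: "r > 0" using eta c by (auto simp: r_def)
  have "(\<lambda>n. 2 * exp (- (r * real n))) \<longlonglongrightarrow> 2 * 0"
    using r by (intro tendsto_mult tendsto_const filterlim_compose[OF exp_at_bot]
        filterlim_uminus_at_top[THEN iffD1] filterlim_tendsto_pos_mult_at_top[OF tendsto_const] filterlim_real_sequentially)
  from order_tendstoD(2)[OF this, of "\<epsilon> / 4"]
  have "\<forall>\<^sub>F n in sequentially. 2 * exp (- (r * real n)) < \<epsilon> / 4"
    using \<epsilon> by simp
  then obtain n1 where n1: "\<And>n. n \<ge> n1 \<Longrightarrow> 2 * exp (- (r * real n)) < \<epsilon> / 4"
    by (auto simp: eventually_sequentially)
  show "\<exists>n1. \<forall>n\<ge>n1. norm (prob {\<omega> \<in> space M. \<eta> \<le> \<bar>(\<Sum>i<n. X i \<omega>) / real n - expectation (X 0)\<bar>} - 0) < \<epsilon>"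
  proof (intro exI[of _ "Suc n1"] allI impI)
    fix n assume n: "n \<ge> Suc n1"
    have "- 2 * real n * (\<eta> / 4)\<^sup>2 / (c - - c)\<^sup>2 = - (r * real n)" by (simp add: r_def)
    then show "norm (prob {\<omega> \<in> space M. \<eta> \<le> \<bar>(\<Sum>i<n. X i \<omega>) / real n - expectation (X 0)\<bar>} - 0) < \<epsilon>"
      using step[of n] n1[of n] n \<epsilon> by simp
  qed
qed

section \<open>Least squares\<close>

lemma matrix_inv_mult:
  fixes A :: "real^'q^'q"
  assumes "invertible A"
  shows "A ** matrix_inv A = Finite_Cartesian_Product.mat 1 \<and> matrix_inv A ** A = Finite_Cartesian_Product.mat 1"
  using assms unfolding invertible_def matrix_inv_def by (rule someI_ex)

lemma matrix_inv_bounded_below: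
  fixes A :: "real^'q^'q"
  assumes r: "r > 0" and low: "\<And>w. r * norm w \<le> norm (A *v w)"
  shows "invertible A" "norm (matrix_inv A *v y) \<le> norm y / r"
    "A *v (matrix_inv A *v y) = y" "matrix_inv A *v (A *v y) = y"
proof -
  have "w = 0" if "A *v w = 0" for w
    using low[of w] that r by (simp add: mult_le_0_iff)
  then show inv: "invertible A"
    using matrix_left_invertible_ker[of A] invertible_left_inverse[of A] by blast
  note AA = matrix_inv_mult[OF inv]
  then show e1: "A *v (matrix_inv A *v y) = y" and "matrix_inv A *v (A *v y) = y"
    by (simp_all add: matrix_vector_mul_assoc)
  have "r * norm (matrix_inv A *v y) \<le> norm y" using low[of "matrix_inv A *v y"] e1 by simp
  then show "norm (matrix_inv A *v y) \<le> norm y / r" using r by (simp add: field_simps)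
qed

lemma gram_mult: "gram n xs *v w = (\<Sum>i<n. inner (xs i) w *\<^sub>R xs i)"
proof -
  have "(gram n xs *v w) $ k = (\<Sum>i<n. inner (xs i) w *\<^sub>R xs i) $ k" for k
  proof -
    have "(gram n xs *v w) $ k = (\<Sum>l\<in>UNIV. (\<Sum>i<n. xs i $ k * xs i $ l) * w $ l)"
      by (simp add: matrix_vector_mult_def gram_def)
    also have "\<dots> = (\<Sum>i<n. \<Sum>l\<in>UNIV. xs i $ k * xs i $ l * w $ l)"
      unfolding sum_distrib_right by (rule sum.swap)
    also have "\<dots> = (\<Sum>i<n. inner (xs i) w * xs i $ k)"
      by (intro sum.cong refl) (simp add: inner_vec_def sum_distrib_right sum_distrib_left mult_ac)
    finally show ?thesis by simp
  qed
  then show ?thesis by (simp add: Finite_Cartesian_Product.vec_eq_iff)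
qed

text \<open>The ways in which the estimators use that \<open>gram n xs / n\<close> is close to \<open>\<Omega>\<close>: its inverse is a true
  inverse, bounded by \<open>\<kappa>\<close>, and within \<open>\<kappa> * \<eta>\<close> of \<open>matrix_inv \<Omega>\<close>.\<close>

definition inverse_near :: "real^'q^'q \<Rightarrow> real \<Rightarrow> real \<Rightarrow> nat \<Rightarrow> (nat \<Rightarrow> real^'q) \<Rightarrow> bool" where
  "inverse_near \<Omega> \<kappa> \<eta> n xs \<longleftrightarrow>
    (\<forall>y. gram n xs *v (matrix_inv (gram n xs) *v y) = y \<and> matrix_inv (gram n xs) *v (gram n xs *v y) = y \<and>
      real n * norm (matrix_inv (gram n xs) *v y) \<le> \<kappa> * norm y \<and>
      norm (real n *\<^sub>R (matrix_inv (gram n xs) *v y) - matrix_inv \<Omega> *v y) \<le> \<kappa> * \<eta> * norm y)"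

text \<open>\<open>\<Omega>\<close> is bounded below, hence so is every matrix close to it, and
  \<open>A\<^sup>-\<^sup>1 - \<Omega>\<^sup>-\<^sup>1 = \<Omega>\<^sup>-\<^sup>1 (\<Omega> - A) A\<^sup>-\<^sup>1\<close>.\<close>

lemma gram_inverse_perturbation:
  fixes \<Omega> :: "real^'q^'q"
  assumes inv: "invertible \<Omega>"
  shows "\<exists>\<kappa>>0. \<forall>\<eta>>0. \<exists>\<eta>'>0. \<forall>n>0. \<forall>xs. (\<forall>k l. \<bar>gram n xs $ k $ l / real n - \<Omega> $ k $ l\<bar> \<le> \<eta>') \<longrightarrow> inverse_near \<Omega> \<kappa> \<eta> n xs"
proof -
  note OO = matrix_inv_mult[OF inv]
  obtain \<kappa>0 where \<kappa>0: "\<kappa>0 > 0" "\<And>y. norm (matrix_inv \<Omega> *v y) \<le> norm y * \<kappa>0"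
    using bounded_linear.pos_bounded[OF matrix_vector_mul_bounded_linear[of "matrix_inv \<Omega>"]] by blast
  define q2 where "q2 = real CARD('q) * real CARD('q)"
  have q2: "q2 > 0" by (simp add: q2_def)
  define \<eta>0 where "\<eta>0 = 1 / (2 * \<kappa>0 * q2)"
  define \<kappa> where "\<kappa> = max (2 * \<kappa>0) (\<kappa>0 * q2 * (2 * \<kappa>0))"
  have pos: "\<kappa> > 0" "\<eta>0 > 0" using \<kappa>0 q2 by (auto simp: \<kappa>_def \<eta>0_def)
  have core: "inverse_near \<Omega> \<kappa> \<eta> n xs"
    if \<eta>: "\<eta> \<le> \<eta>0" and n: "n > 0" and close: "\<And>k l. \<bar>gram n xs $ k $ l / real n - \<Omega> $ k $ l\<bar> \<le> \<eta>"
    for \<eta> n and xs :: "nat \<Rightarrow> real^'q"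
  proof -
    have eta0: "\<eta> \<ge> 0" using close[of undefined undefined] by linarith
    have diff: "norm ((1 / real n) *\<^sub>R (gram n xs *v w) - \<Omega> *v w) \<le> \<eta> * q2 * norm w" for w
    proof -
      have comp: "\<bar>((1 / real n) *\<^sub>R (gram n xs *v w) - \<Omega> *v w) $ k\<bar> \<le> \<eta> * real CARD('q) * norm w" for k
      proof -
        have "((1 / real n) *\<^sub>R (gram n xs *v w) - \<Omega> *v w) $ k =
            (\<Sum>l\<in>UNIV. (gram n xs $ k $ l / real n - \<Omega> $ k $ l) * w $ l)"
          by (simp add: matrix_vector_mult_def sum_distrib_left left_diff_distrib sum_subtractf)
        also have "\<bar>\<dots>\<bar> \<le> (\<Sum>l\<in>UNIV. \<bar>(gram n xs $ k $ l / real n - \<Omega> $ k $ l) * w $ l\<bar>)"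
          by (rule sum_abs)
        also have "\<dots> \<le> (\<Sum>l\<in>(UNIV :: 'q set). \<eta> * norm w)"
          unfolding abs_mult by (intro sum_mono mult_mono close component_le_norm_cart) (auto simp: eta0)
        finally show ?thesis by (simp add: mult_ac)
      qed
      have "norm ((1 / real n) *\<^sub>R (gram n xs *v w) - \<Omega> *v w) \<le>
          (\<Sum>k\<in>UNIV. \<bar>((1 / real n) *\<^sub>R (gram n xs *v w) - \<Omega> *v w) $ k\<bar>)"
        by (rule norm_le_l1_cart)
      also have "\<dots> \<le> (\<Sum>k\<in>(UNIV :: 'q set). \<eta> * real CARD('q) * norm w)" by (intro sum_mono comp)
      finally show ?thesis by (simp add: q2_def mult_ac)
    qed
    have low0: "norm w \<le> \<kappa>0 * norm (\<Omega> *v w)" for w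
      using \<kappa>0(2)[of "\<Omega> *v w"] OO by (simp add: matrix_vector_mul_assoc mult.commute)
    have low: "real n / (2 * \<kappa>0) * norm w \<le> norm (gram n xs *v w)" for w
    proof -
      have "\<eta> * q2 \<le> 1 / (2 * \<kappa>0)"
        using mult_right_mono[OF \<eta>, of q2] q2 by (simp add: \<eta>0_def)
      then have "\<eta> * q2 * norm w \<le> 1 / (2 * \<kappa>0) * norm w" by (intro mult_right_mono) auto
      moreover have "1 / \<kappa>0 * norm w \<le> norm (\<Omega> *v w)" using low0[of w] \<kappa>0(1) by (simp add: field_simps)
      moreover have "norm (\<Omega> *v w) \<le> norm ((1 / real n) *\<^sub>R (gram n xs *v w)) + norm ((1 / real n) *\<^sub>R (gram n xs *v w) - \<Omega> *v w)"
        by (metis norm_triangle_sub norm_minus_commute)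
      ultimately have "1 / \<kappa>0 * norm w - 1 / (2 * \<kappa>0) * norm w \<le> norm ((1 / real n) *\<^sub>R (gram n xs *v w))"
        using diff[of w] by linarith
      moreover have "1 / \<kappa>0 * norm w - 1 / (2 * \<kappa>0) * norm w = 1 / (2 * \<kappa>0) * norm w" by (simp add: field_simps)
      ultimately have "1 / (2 * \<kappa>0) * norm w \<le> norm (gram n xs *v w) / real n" by simp
      then have "1 / (2 * \<kappa>0) * norm w * real n \<le> norm (gram n xs *v w)" using n by (simp add: pos_le_divide_eq)
      then show ?thesis by (simp add: mult_ac)
    qed
    have rp: "real n / (2 * \<kappa>0) > 0" using n \<kappa>0 by simp
    note mi = matrix_inv_bounded_below[OF rp low]
    show ?thesis
      unfolding inverse_near_def
    proof (intro conjI allI mi(3,4))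
      fix y
      define z where "z = real n *\<^sub>R (matrix_inv (gram n xs) *v y)"
      have "real n * norm (matrix_inv (gram n xs) *v y) \<le> real n * (norm y / (real n / (2 * \<kappa>0)))"
        by (intro mult_left_mono mi(2)) auto
      also have "\<dots> = 2 * \<kappa>0 * norm y" using n by simp
      finally have z: "real n * norm (matrix_inv (gram n xs) *v y) \<le> 2 * \<kappa>0 * norm y" .
      also have "\<dots> \<le> \<kappa> * norm y" by (intro mult_right_mono) (auto simp: \<kappa>_def)
      finally show "real n * norm (matrix_inv (gram n xs) *v y) \<le> \<kappa> * norm y" .
      have nz: "norm z \<le> 2 * \<kappa>0 * norm y" using z by (simp add: z_def)
      have Gz: "(1 / real n) *\<^sub>R (gram n xs *v z) = y"
        using n mi(3)[of y] unfolding z_def by (simp add: matrix_vector_mult_scaleR)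
      have "matrix_inv \<Omega> *v (\<Omega> *v z - y) = z - matrix_inv \<Omega> *v y"
        using OO by (simp add: matrix_vector_mult_diff_distrib matrix_vector_mul_assoc)
      then have "norm (z - matrix_inv \<Omega> *v y) \<le> norm (\<Omega> *v z - y) * \<kappa>0" using \<kappa>0(2)[of "\<Omega> *v z - y"] by simp
      also have "norm (\<Omega> *v z - y) = norm ((1 / real n) *\<^sub>R (gram n xs *v z) - \<Omega> *v z)"
        unfolding Gz by (rule norm_minus_commute)
      also have "\<dots> * \<kappa>0 \<le> (\<eta> * q2 * (2 * \<kappa>0 * norm y)) * \<kappa>0"
        using diff[of z] mult_left_mono[OF nz, of "\<eta> * q2"] eta0 q2 \<kappa>0(1) by (intro mult_right_mono) auto
      also have "\<dots> = (\<kappa>0 * q2 * (2 * \<kappa>0)) * (\<eta> * norm y)" by simp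
      also have "\<dots> \<le> \<kappa> * (\<eta> * norm y)" using eta0 by (intro mult_right_mono) (auto simp: \<kappa>_def)
      finally show "norm (real n *\<^sub>R (matrix_inv (gram n xs) *v y) - matrix_inv \<Omega> *v y) \<le> \<kappa> * \<eta> * norm y"
        by (simp add: z_def mult.assoc)
    qed
  qed
  have mono: "inverse_near \<Omega> \<kappa> \<eta> n xs" if "inverse_near \<Omega> \<kappa> \<eta>' n xs" "\<eta>' \<le> \<eta>" for \<eta>' \<eta> n and xs :: "nat \<Rightarrow> real^'q"
  proof -
    have "\<kappa> * \<eta>' * norm y \<le> \<kappa> * \<eta> * norm y" for y :: "real^'q"
      using that(2) pos(1) by (intro mult_right_mono mult_left_mono) auto
    then show ?thesis using that(1) unfolding inverse_near_def by (meson order_trans)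
  qed
  show ?thesis
  proof (rule exI[of _ \<kappa>], intro conjI allI impI pos)
    fix \<eta> :: real assume "\<eta> > 0"
    show "\<exists>\<eta>'>0. \<forall>n>0. \<forall>xs. (\<forall>k l. \<bar>gram n xs $ k $ l / real n - \<Omega> $ k $ l\<bar> \<le> \<eta>') \<longrightarrow> inverse_near \<Omega> \<kappa> \<eta> n xs"
    proof (rule exI[of _ "min \<eta> \<eta>0"], intro conjI allI impI)
      show "min \<eta> \<eta>0 > 0" using \<open>\<eta> > 0\<close> pos(2) by simp
      fix n :: nat and xs :: "nat \<Rightarrow> real^'q"
      assume "n > 0" "\<forall>k l. \<bar>gram n xs $ k $ l / real n - \<Omega> $ k $ l\<bar> \<le> min \<eta> \<eta>0"
      then have "inverse_near \<Omega> \<kappa> (min \<eta> \<eta>0) n xs" by (intro core[OF min.cobounded2]) blast+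
      then show "inverse_near \<Omega> \<kappa> \<eta> n xs" by (rule mono[OF _ min.cobounded1])
    qed
  qed
qed

definition rms :: "nat \<Rightarrow> (nat \<Rightarrow> real) \<Rightarrow> real" where
  "rms n y = sqrt ((\<Sum>i<n. (y i)\<^sup>2) / real n)"

lemma rms_eq_L2_set: "rms n y = L2_set y {..<n} / sqrt (real n)"
  by (simp add: rms_def L2_set_def real_sqrt_divide)

lemma rms_nonneg: "rms n y \<ge> 0"
  by (simp add: rms_def sum_nonneg)

lemma ls_coef_diff:
  "ls_coef n xs y - ls_coef n xs z = ls_coef n xs (\<lambda>i. y i - z i)"
  unfolding ls_coef_def
  by (simp add: matrix_vector_mult_diff_distrib[symmetric] sum_subtractf[symmetric] scaleR_diff_left)

lemma norm_sum_scaleR_le_L2: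
  fixes xs :: "nat \<Rightarrow> 'b::real_normed_vector"
  shows "norm (\<Sum>i\<in>I. y i *\<^sub>R xs i) \<le> L2_set y I * L2_set (\<lambda>i. norm (xs i)) I"
proof -
  have "norm (\<Sum>i\<in>I. y i *\<^sub>R xs i) \<le> (\<Sum>i\<in>I. \<bar>y i\<bar> * \<bar>norm (xs i)\<bar>)"
    by (rule norm_sum[THEN order_trans]) simp
  also have "\<dots> \<le> L2_set y I * L2_set (\<lambda>i. norm (xs i)) I" by (rule L2_set_mult_ineq)
  finally show ?thesis .
qed

lemma ls_coef_norm_le:
  assumes inv: "\<And>w. real n * norm (matrix_inv (gram n xs) *v w) \<le> \<kappa> * norm w" and n: "n > 0" and kap: "\<kappa> \<ge> 0"
  shows "norm (ls_coef n xs y) \<le> \<kappa> * rms n (\<lambda>i. norm (xs i)) * rms n y"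
proof -
  have "real n * norm (ls_coef n xs y) \<le> \<kappa> * (L2_set y {..<n} * L2_set (\<lambda>i. norm (xs i)) {..<n})"
    unfolding ls_coef_def by (rule inv[THEN order_trans]) (intro mult_left_mono norm_sum_scaleR_le_L2 kap)
  then have "norm (ls_coef n xs y) \<le> \<kappa> * (L2_set y {..<n} * L2_set (\<lambda>i. norm (xs i)) {..<n}) / real n"
    using n by (simp add: pos_le_divide_eq mult.commute)
  also have "\<dots> = \<kappa> * rms n (\<lambda>i. norm (xs i)) * rms n y"
    by (simp add: rms_eq_L2_set mult_ac)
  finally show ?thesis .
qed

lemma ls_coef_linear_model:
  assumes inv: "\<And>w. matrix_inv (gram n xs) *v (gram n xs *v w) = w"
  shows "ls_coef n xs (\<lambda>i. inner (xs i) b + v i) = b + matrix_inv (gram n xs) *v (\<Sum>i<n. v i *\<^sub>R xs i)"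
proof -
  have "(\<Sum>i<n. (inner (xs i) b + v i) *\<^sub>R xs i) = gram n xs *v b + (\<Sum>i<n. v i *\<^sub>R xs i)"
    by (simp add: gram_mult scaleR_add_left sum.distrib)
  then show ?thesis unfolding ls_coef_def by (simp add: matrix_vector_right_distrib inv)
qed

lemma residual_eq: "residual n xs y i = y i - inner (xs i) (ls_coef n xs y)"
proof -
  have "inner (xs i) (ls_coef n xs y) = (\<Sum>j<n. hat_matrix n xs i j * y j)"
    unfolding ls_coef_def hat_matrix_def
    by (simp add: linear_sum[OF matrix_vector_mul_linear] matrix_vector_mult_scaleR inner_sum_right mult.commute)
  then show ?thesis by (simp add: residual_def)
qed

lemma residual_diff: "residual n xs y i - residual n xs z i = residual n xs (\<lambda>i. y i - z i) i"
  unfolding residual_eq using ls_coef_diff[of n xs y z] by (simp add: inner_diff_right[symmetric] algebra_simps)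

text \<open>The residual is the component of \<open>y\<close> orthogonal to the fitted values.\<close>

lemma residual_L2_le:
  assumes inv: "\<And>w. gram n xs *v (matrix_inv (gram n xs) *v w) = w"
  shows "L2_set (residual n xs y) {..<n} \<le> L2_set y {..<n}"
proof -
  define b where "b = ls_coef n xs y"
  have Gb: "gram n xs *v b = (\<Sum>i<n. y i *\<^sub>R xs i)" unfolding b_def ls_coef_def by (rule inv)
  have "inner b (gram n xs *v b) = (\<Sum>i<n. (inner (xs i) b)\<^sup>2)"
    unfolding gram_mult by (simp add: inner_sum_right power2_eq_square inner_commute)
  moreover have "inner b (gram n xs *v b) = (\<Sum>i<n. y i * inner (xs i) b)"
    unfolding Gb by (simp add: inner_sum_right inner_commute)
  ultimately have "(\<Sum>i<n. (residual n xs y i)\<^sup>2) = (\<Sum>i<n. (y i)\<^sup>2) - (\<Sum>i<n. (inner (xs i) b)\<^sup>2)"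
    unfolding residual_eq b_def[symmetric]
    by (simp add: power2_diff sum.distrib sum_subtractf sum_distrib_left[symmetric] mult.assoc)
  then have "(\<Sum>i<n. (residual n xs y i)\<^sup>2) \<le> (\<Sum>i<n. (y i)\<^sup>2)" by (simp add: sum_nonneg)
  then show ?thesis by (simp add: L2_set_def)
qed

text \<open>The estimate is a bilinear form in the residuals, bounded by Cauchy--Schwarz; \<open>n \<ge> 2 q\<close> makes the
  denominator \<open>n - q\<close> at least \<open>n / 2\<close>.\<close>

lemma cov_estimate_error:
  fixes xs :: "nat \<Rightarrow> real^'q"
  assumes inv: "\<And>w. gram n xs *v (matrix_inv (gram n xs) *v w) = w" and n: "n \<ge> 2 * CARD('q)"
  shows "\<bar>cov_estimate n xs y z - cov_estimate n xs y' z'\<bar> \<le>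
    2 * (rms n (\<lambda>i. y i - y' i) * (rms n z' + rms n (\<lambda>i. z i - z' i)) + rms n y' * rms n (\<lambda>i. z i - z' i))"
proof -
  let ?L = "\<lambda>u. L2_set u {..<n}"
  define R where "R = residual n xs"
  have npos: "real n > 0" using n zero_less_card_finite[where 'a = 'q] by (simp del: zero_less_card_finite)
  have nq: "real n - real CARD('q) \<ge> real n / 2" using n by (simp add: field_simps)
  have RL: "?L (R u) \<le> ?L u" for u unfolding R_def by (rule residual_L2_le[OF inv])
  have CS: "\<bar>\<Sum>i<n. R u i * R w i\<bar> \<le> ?L u * ?L w" for u w
  proof -
    have "\<bar>\<Sum>i<n. R u i * R w i\<bar> \<le> (\<Sum>i<n. \<bar>R u i\<bar> * \<bar>R w i\<bar>)"
      using sum_abs[of "\<lambda>i. R u i * R w i" "{..<n}"] by (simp add: abs_mult)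
    also have "\<dots> \<le> ?L (R u) * ?L (R w)" by (rule L2_set_mult_ineq)
    also have "\<dots> \<le> ?L u * ?L w" by (intro mult_mono RL) auto
    finally show ?thesis .
  qed
  have z: "?L z \<le> ?L z' + ?L (\<lambda>i. z i - z' i)"
    using L2_set_triangle_ineq[of z' "\<lambda>i. z i - z' i" "{..<n}"] by simp
  have eq: "(\<Sum>i<n. R y i * R z i) - (\<Sum>i<n. R y' i * R z' i) =
      (\<Sum>i<n. R (\<lambda>i. y i - y' i) i * R z i) + (\<Sum>i<n. R y' i * R (\<lambda>i. z i - z' i) i)"
    unfolding R_def residual_diff[symmetric] sum_subtractf[symmetric] sum.distrib[symmetric]
    by (intro sum.cong refl) (simp add: algebra_simps)
  have "\<bar>(\<Sum>i<n. R y i * R z i) - (\<Sum>i<n. R y' i * R z' i)\<bar> \<le>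
      ?L (\<lambda>i. y i - y' i) * ?L z + ?L y' * ?L (\<lambda>i. z i - z' i)"
    unfolding eq using CS[of "\<lambda>i. y i - y' i" z] CS[of y' "\<lambda>i. z i - z' i"] by linarith
  also have "\<dots> \<le> ?L (\<lambda>i. y i - y' i) * (?L z' + ?L (\<lambda>i. z i - z' i)) + ?L y' * ?L (\<lambda>i. z i - z' i)"
    by (intro add_mono mult_left_mono z) auto
  finally have num: "\<bar>(\<Sum>i<n. R y i * R z i) - (\<Sum>i<n. R y' i * R z' i)\<bar> \<le> \<dots>" .
  have "\<bar>cov_estimate n xs y z - cov_estimate n xs y' z'\<bar> =
      \<bar>(\<Sum>i<n. R y i * R z i) - (\<Sum>i<n. R y' i * R z' i)\<bar> / (real n - real CARD('q))"
    unfolding cov_estimate_def R_def diff_divide_distrib[symmetric] abs_divide using nq npos by simp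
  also have "\<dots> \<le> (?L (\<lambda>i. y i - y' i) * (?L z' + ?L (\<lambda>i. z i - z' i)) + ?L y' * ?L (\<lambda>i. z i - z' i)) / (real n / 2)"
    using nq npos by (intro frac_le num) auto
  also have "\<dots> = 2 * (rms n (\<lambda>i. y i - y' i) * (rms n z' + rms n (\<lambda>i. z i - z' i)) + rms n y' * rms n (\<lambda>i. z i - z' i))"
    using npos by (simp add: rms_eq_L2_set field_simps)
  finally show ?thesis .
qed

section \<open>Gaussian laws\<close>

lemma borel_measurable_vec_nth [measurable (raw)]:
  "(\<lambda>x :: real^'q. x $ i) \<in> borel_measurable borel"
  by (intro borel_measurable_continuous_onI continuous_intros)

lemma borel_measurable_vec_lambda:
  fixes f :: "'a \<Rightarrow> 'q::finite \<Rightarrow> real"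
  assumes "\<And>i. (\<lambda>\<omega>. f \<omega> i) \<in> borel_measurable M"
  shows "(\<lambda>\<omega>. \<chi> i. f \<omega> i) \<in> borel_measurable M"
  unfolding borel_measurable_euclidean_space[where 'c = "real^'q"]
  using assms by (auto simp: Basis_vec_def inner_axis)

text \<open>Cholesky factorization by elimination of one index \<open>x\<close>: if \<open>G x x > 0\<close>, the Schur complement
  \<open>G i j - G i x * G j x / G x x\<close> is again positive semidefinite; if \<open>G x x = 0\<close>, the whole row of \<open>x\<close> vanishes.\<close>

lemma psd_factorization:
  fixes G :: "'i \<Rightarrow> 'i \<Rightarrow> real"
  assumes "finite I"
    and "\<And>i j. i \<in> I \<Longrightarrow> j \<in> I \<Longrightarrow> G i j = G j i"
    and "\<And>c. (\<Sum>i\<in>I. \<Sum>j\<in>I. c i * c j * G i j) \<ge> 0"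
  shows "\<exists>A. \<forall>i\<in>I. \<forall>j\<in>I. G i j = (\<Sum>r\<in>I. A i r * A j r)"
  using assms
proof (induction I arbitrary: G rule: finite_induct)
  case empty
  then show ?case by simp
next
  case (insert x F)
  have sym: "G i j = G j i" if "i \<in> insert x F" "j \<in> insert x F" for i j using insert.prems(1) that by blast
  have expand: "(\<Sum>i\<in>insert x F. \<Sum>j\<in>insert x F. c i * c j * G i j) =
      (\<Sum>i\<in>F. \<Sum>j\<in>F. c i * c j * G i j) + 2 * c x * (\<Sum>j\<in>F. c j * G j x) + (c x)\<^sup>2 * G x x" for c
  proof -
    have "(\<Sum>j\<in>F. c x * c j * G x j) = c x * (\<Sum>j\<in>F. c j * G j x)"
      unfolding sum_distrib_left by (intro sum.cong refl) (use sym in auto)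
    moreover have "(\<Sum>i\<in>F. c i * c x * G i x) = c x * (\<Sum>j\<in>F. c j * G j x)"
      unfolding sum_distrib_left by (intro sum.cong refl) auto
    ultimately show ?thesis
      using insert.hyps by (simp add: sum.distrib power2_eq_square)
  qed
  have Gxx: "G x x \<ge> 0"
    using insert.prems(2)[of "\<lambda>i. if i = x then 1 else 0"] insert.hyps unfolding expand
    by (simp add: sum.neutral)
  show ?case
  proof (cases "G x x = 0")
    case True
    have zero: "G j x = 0" if j: "j \<in> F" for j
    proof (rule ccontr)
      assume ne: "G j x \<noteq> 0"
      (* With weight s on x and weight 1 on j the quadratic form would be G j j + 2 s G j x = -1. *)
      define s where "s = - (G j j + 1) / (2 * G j x)"
      define c where "c i = (if i = x then s else if i = j then 1 else 0)" for i
      have cF: "c i = (if i = j then 1 else 0)" if "i \<in> F" for i using that insert.hyps by (auto simp: c_def)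
      have "(\<Sum>i\<in>F. \<Sum>k\<in>F. c i * c k * G i k) = (\<Sum>i\<in>F. if i = j then \<Sum>k\<in>F. if k = j then G j j else 0 else 0)"
        by (intro sum.cong refl) (auto simp: cF intro!: sum.cong)
      then have 1: "(\<Sum>i\<in>F. \<Sum>k\<in>F. c i * c k * G i k) = G j j" using j insert.hyps by simp
      have "(\<Sum>k\<in>F. c k * G k x) = (\<Sum>k\<in>F. if k = j then G j x else 0)"
        by (intro sum.cong refl) (auto simp: cF)
      then have 2: "(\<Sum>k\<in>F. c k * G k x) = G j x" using j insert.hyps by simp
      have "0 \<le> G j j + 2 * s * G j x"
        using insert.prems(2)[of c] unfolding expand 1 2 using True by (simp add: c_def)
      moreover have "2 * s * G j x = - (G j j + 1)" using ne by (simp add: s_def)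
      ultimately show False by simp
    qed
    have "\<exists>A. \<forall>i\<in>F. \<forall>j\<in>F. G i j = (\<Sum>r\<in>F. A i r * A j r)"
    proof (rule insert.IH)
      show "0 \<le> (\<Sum>i\<in>F. \<Sum>j\<in>F. c i * c j * G i j)" for c
      proof -
        have "(\<Sum>i\<in>F. \<Sum>j\<in>F. (if i = x then 0 else c i) * (if j = x then 0 else c j) * G i j) =
            (\<Sum>i\<in>F. \<Sum>j\<in>F. c i * c j * G i j)"
          using insert.hyps by (intro sum.cong refl) auto
        then show ?thesis using insert.prems(2)[of "\<lambda>i. if i = x then 0 else c i"] unfolding expand by simp
      qed
    qed (use sym in auto)
    then obtain A where A: "\<And>i j. i \<in> F \<Longrightarrow> j \<in> F \<Longrightarrow> G i j = (\<Sum>r\<in>F. A i r * A j r)" by blast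
    define A' where "A' i r = (if i = x \<or> r = x then 0 else A i r)" for i r
    have A'F: "(\<Sum>r\<in>F. A' i r * A' j r) = (if i = x \<or> j = x then 0 else (\<Sum>r\<in>F. A i r * A j r))" for i j
      using insert.hyps by (auto simp: A'_def intro!: sum.cong)
    have "\<forall>i\<in>insert x F. \<forall>j\<in>insert x F. G i j = (\<Sum>r\<in>insert x F. A' i r * A' j r)"
    proof (intro ballI)
      fix i j assume ij: "i \<in> insert x F" "j \<in> insert x F"
      have "(\<Sum>r\<in>insert x F. A' i r * A' j r) = (if i = x \<or> j = x then 0 else (\<Sum>r\<in>F. A i r * A j r))"
        using insert.hyps A'F by (simp add: A'_def)
      also have "\<dots> = G i j" using ij A[of i j] zero sym[of i j] True by (cases "i = x"; cases "j = x") auto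
      finally show "G i j = (\<Sum>r\<in>insert x F. A' i r * A' j r)" by simp
    qed
    then show ?thesis by blast
  next
    case False
    define g where "g = G x x"
    have g: "g > 0" using Gxx False by (simp add: g_def)
    define G' where "G' i j = G i j - G i x * G j x / g" for i j
    have "\<exists>A. \<forall>i\<in>F. \<forall>j\<in>F. G' i j = (\<Sum>r\<in>F. A i r * A j r)"
    proof (rule insert.IH)
      show "G' i j = G' j i" if "i \<in> F" "j \<in> F" for i j using sym that by (simp add: G'_def mult.commute)
      show "0 \<le> (\<Sum>i\<in>F. \<Sum>j\<in>F. c i * c j * G' i j)" for c
      proof -
        define S where "S = (\<Sum>j\<in>F. c j * G j x)"
        define c' where "c' i = (if i = x then - S / g else c i)" for i
        have c'F: "c' i = c i" if "i \<in> F" for i using that insert.hyps by (auto simp: c'_def)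
        have "(\<Sum>i\<in>insert x F. \<Sum>j\<in>insert x F. c' i * c' j * G i j) =
            (\<Sum>i\<in>F. \<Sum>j\<in>F. c i * c j * G i j) + 2 * (- S / g) * S + (- S / g)\<^sup>2 * g"
          unfolding expand by (simp add: c'F S_def g_def) (simp add: c'_def S_def g_def)
        also have "\<dots> = (\<Sum>i\<in>F. \<Sum>j\<in>F. c i * c j * G i j) - S * S / g"
          using g by (simp add: power2_eq_square field_simps)
        also have "S * S / g = (\<Sum>i\<in>F. \<Sum>j\<in>F. c i * c j * (G i x * G j x / g))"
          unfolding S_def sum_product sum_divide_distrib by (intro sum.cong refl) simp
        also have "(\<Sum>i\<in>F. \<Sum>j\<in>F. c i * c j * G i j) - \<dots> = (\<Sum>i\<in>F. \<Sum>j\<in>F. c i * c j * G' i j)"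
          unfolding G'_def sum_subtractf[symmetric] by (intro sum.cong refl) (simp add: right_diff_distrib)
        finally show ?thesis using insert.prems(2)[of c'] by simp
      qed
    qed
    then obtain A where A: "\<And>i j. i \<in> F \<Longrightarrow> j \<in> F \<Longrightarrow> G' i j = (\<Sum>r\<in>F. A i r * A j r)" by blast
    define A' where "A' i r = (if r = x then G i x / sqrt g else if i = x then 0 else A i r)" for i r
    have A'F: "(\<Sum>r\<in>F. A' i r * A' j r) = (if i = x \<or> j = x then 0 else (\<Sum>r\<in>F. A i r * A j r))" for i j
    proof -
      have "A' i r * A' j r = (if i = x \<or> j = x then 0 else A i r * A j r)" if "r \<in> F" for r
        using that insert.hyps by (auto simp: A'_def)
      then show ?thesis by simp
    qed
    have gg: "u / sqrt g * (w / sqrt g) = u * w / g" for u w using g by simp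
    have "\<forall>i\<in>insert x F. \<forall>j\<in>insert x F. G i j = (\<Sum>r\<in>insert x F. A' i r * A' j r)"
    proof (intro ballI)
      fix i j assume ij: "i \<in> insert x F" "j \<in> insert x F"
      have "(\<Sum>r\<in>insert x F. A' i r * A' j r) = G i x * G j x / g + (if i = x \<or> j = x then 0 else (\<Sum>r\<in>F. A i r * A j r))"
        unfolding sum.insert[OF insert.hyps] A'F by (simp add: A'_def gg del: times_divide_eq_left times_divide_eq_right)
      also have "\<dots> = G i j"
      proof (cases "i = x \<or> j = x")
        case True
        then show ?thesis using sym[OF ij] g by (auto simp: g_def)
      next
        case False
        then have "i \<in> F" "j \<in> F" using ij by auto
        then show ?thesis using False A[of i j] by (simp add: G'_def)
      qed
      finally show "G i j = (\<Sum>r\<in>insert x F. A' i r * A' j r)" by simp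
    qed
    then show ?thesis by blast
  qed
qed

lemma distr_linear_standard_normals:
  fixes b :: "'i \<Rightarrow> real"
  assumes I: "finite I"
  shows "distr (Pi\<^sub>M I (\<lambda>_. std_normal_distribution)) borel (\<lambda>\<omega>. \<Sum>r\<in>I. b r * \<omega> r) =
    distr std_normal_distribution borel (\<lambda>u. sqrt (\<Sum>r\<in>I. (b r)\<^sup>2) * u)"
proof -
  interpret N: prob_space std_normal_distribution by (rule prob_space_normal_density) simp
  interpret P: product_prob_space "\<lambda>_. std_normal_distribution" I ..
  have pP: "prob_space (Pi\<^sub>M I (\<lambda>_. std_normal_distribution))" by (rule prob_space_PiM) (rule N.prob_space_axioms)
  have comp [measurable]: "(\<lambda>\<omega>. \<omega> r) \<in> borel_measurable (Pi\<^sub>M I (\<lambda>_. std_normal_distribution))" if "r \<in> I" for r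
    using measurable_component_singleton[OF that, of "\<lambda>_. std_normal_distribution"] by simp
  have lin [measurable]: "(\<lambda>\<omega>. \<Sum>r\<in>I. b r * \<omega> r) \<in> borel_measurable (Pi\<^sub>M I (\<lambda>_. std_normal_distribution))"
    by measurable
  show ?thesis
  proof (rule Levy_uniqueness)
    show "real_distribution (distr (Pi\<^sub>M I (\<lambda>_. std_normal_distribution)) borel (\<lambda>\<omega>. \<Sum>r\<in>I. b r * \<omega> r))"
      by (rule prob_space.real_distribution_distr[OF pP]) measurable
    show "real_distribution (distr std_normal_distribution borel (\<lambda>u. sqrt (\<Sum>r\<in>I. (b r)\<^sup>2) * u))"
      by (rule N.real_distribution_distr) simp
    have cN: "(\<integral>u. iexp (a * u) \<partial>std_normal_distribution) = complex_of_real (exp (- (a\<^sup>2) / 2))" for a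
      using fun_cong[OF char_std_normal_distribution, of a] unfolding char_def .
    show "char (distr (Pi\<^sub>M I (\<lambda>_. std_normal_distribution)) borel (\<lambda>\<omega>. \<Sum>r\<in>I. b r * \<omega> r)) =
      char (distr std_normal_distribution borel (\<lambda>u. sqrt (\<Sum>r\<in>I. (b r)\<^sup>2) * u))"
    proof
      fix t
      have "char (distr (Pi\<^sub>M I (\<lambda>_. std_normal_distribution)) borel (\<lambda>\<omega>. \<Sum>r\<in>I. b r * \<omega> r)) t =
          (\<integral>\<omega>. iexp (t * (\<Sum>r\<in>I. b r * \<omega> r)) \<partial>Pi\<^sub>M I (\<lambda>_. std_normal_distribution))"
        unfolding char_def by (rule integral_distr) auto
      also have "\<dots> = (\<integral>\<omega>. (\<Prod>r\<in>I. iexp (t * b r * \<omega> r)) \<partial>Pi\<^sub>M I (\<lambda>_. std_normal_distribution))"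
      proof (intro Bochner_Integration.integral_cong refl)
        fix \<omega> :: "'i \<Rightarrow> real"
        have "\<i> * complex_of_real (t * (\<Sum>r\<in>I. b r * \<omega> r)) = (\<Sum>r\<in>I. \<i> * complex_of_real (t * b r * \<omega> r))"
          by (simp add: sum_distrib_left mult_ac)
        then show "iexp (t * (\<Sum>r\<in>I. b r * \<omega> r)) = (\<Prod>r\<in>I. iexp (t * b r * \<omega> r))"
          using I by (simp only: exp_sum)
      qed
      also have "\<dots> = (\<Prod>r\<in>I. \<integral>u. iexp (t * b r * u) \<partial>std_normal_distribution)"
        by (rule P.product_integral_prod[OF I]) (rule N.integrable_iexp; simp)
      also have "\<dots> = (\<Prod>r\<in>I. complex_of_real (exp (- ((t * b r)\<^sup>2) / 2)))"
        by (simp only: cN)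
      also have "\<dots> = complex_of_real (exp (\<Sum>r\<in>I. - ((t * b r)\<^sup>2) / 2))"
        using I by (simp add: exp_sum)
      also have "(\<Sum>r\<in>I. - ((t * b r)\<^sup>2) / 2) = - ((t * sqrt (\<Sum>r\<in>I. (b r)\<^sup>2))\<^sup>2) / 2"
        by (simp add: power_mult_distrib sum_nonneg sum_negf sum_divide_distrib[symmetric] sum_distrib_left[symmetric])
      also have "complex_of_real (exp \<dots>) = (\<integral>u. iexp (t * sqrt (\<Sum>r\<in>I. (b r)\<^sup>2) * u) \<partial>std_normal_distribution)"
        by (simp only: cN)
      also have "\<dots> = (\<integral>u. iexp (t * (sqrt (\<Sum>r\<in>I. (b r)\<^sup>2) * u)) \<partial>std_normal_distribution)"
        by (simp only: mult.assoc)
      also have "\<dots> = char (distr std_normal_distribution borel (\<lambda>u. sqrt (\<Sum>r\<in>I. (b r)\<^sup>2) * u)) t"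
        unfolding char_def by (rule integral_distr[symmetric]) auto
      finally show "char (distr (Pi\<^sub>M I (\<lambda>_. std_normal_distribution)) borel (\<lambda>\<omega>. \<Sum>r\<in>I. b r * \<omega> r)) t =
        char (distr std_normal_distribution borel (\<lambda>u. sqrt (\<Sum>r\<in>I. (b r)\<^sup>2) * u)) t" .
    qed
  qed
qed

lemma linear_standard_normals_moments:
  fixes b b' :: "'i \<Rightarrow> real"
  assumes I: "finite I"
  shows "(\<integral>\<omega>. (\<Sum>r\<in>I. b r * \<omega> r) \<partial>Pi\<^sub>M I (\<lambda>_. std_normal_distribution)) = 0"
    "(\<integral>\<omega>. (\<Sum>r\<in>I. b r * \<omega> r) * (\<Sum>r\<in>I. b' r * \<omega> r) \<partial>Pi\<^sub>M I (\<lambda>_. std_normal_distribution)) = (\<Sum>r\<in>I. b r * b' r)"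
proof -
  let ?N = "std_normal_distribution" and ?P = "Pi\<^sub>M I (\<lambda>_. std_normal_distribution)"
  have comp: "(\<lambda>\<omega>. \<omega> r) \<in> borel_measurable ?P" if "r \<in> I" for r
    using measurable_component_singleton[OF that, of "\<lambda>_. std_normal_distribution"] by simp
  have lin [measurable]: "(\<lambda>\<omega>. \<Sum>r\<in>I. d r * \<omega> r) \<in> borel_measurable ?P" for d :: "'i \<Rightarrow> real"
    by (intro borel_measurable_sum borel_measurable_times borel_measurable_const comp)
  have m1: "integrable ?N (\<lambda>u. u)" "(\<integral>u. u \<partial>?N) = 0"
    using integrable_std_normal_distribution_moment[of 1] integral_std_normal_distribution_moment_odd[of 1] by auto
  have m2: "integrable ?N (\<lambda>u. u\<^sup>2)" "(\<integral>u. u\<^sup>2 \<partial>?N) = 1"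
    using integrable_std_normal_distribution_moment[of 2] std_normal_distribution_even_moments(1)[of 1] by (auto simp: fact_numeral)
  have tr: "integral\<^sup>L ?P (\<lambda>\<omega>. f (\<Sum>r\<in>I. d r * \<omega> r)) = (\<integral>u. f (sqrt (\<Sum>r\<in>I. (d r)\<^sup>2) * u) \<partial>?N)"
    and trI: "integrable ?P (\<lambda>\<omega>. f (\<Sum>r\<in>I. d r * \<omega> r)) \<longleftrightarrow> integrable ?N (\<lambda>u. f (sqrt (\<Sum>r\<in>I. (d r)\<^sup>2) * u))"
    if f: "f \<in> borel_measurable borel" for f :: "real \<Rightarrow> real" and d :: "'i \<Rightarrow> real"
    using equal_distr_transfer[OF lin _ distr_linear_standard_normals[OF I] f] by simp_all
  show "(\<integral>\<omega>. (\<Sum>r\<in>I. b r * \<omega> r) \<partial>?P) = 0"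
  proof -
    have "(\<integral>\<omega>. (\<Sum>r\<in>I. b r * \<omega> r) \<partial>?P) = (\<integral>u. sqrt (\<Sum>r\<in>I. (b r)\<^sup>2) * u \<partial>?N)"
      by (rule tr) simp
    then show ?thesis by (simp only: integral_mult_right_zero m1 mult_zero_right)
  qed
  have sq: "(\<integral>\<omega>. (\<Sum>r\<in>I. d r * \<omega> r)\<^sup>2 \<partial>?P) = (\<Sum>r\<in>I. (d r)\<^sup>2)" for d :: "'i \<Rightarrow> real"
    using tr[of "\<lambda>u. u\<^sup>2" d] m2 by (simp add: power_mult_distrib sum_nonneg)
  have sqI: "integrable ?P (\<lambda>\<omega>. (\<Sum>r\<in>I. d r * \<omega> r)\<^sup>2)" for d :: "'i \<Rightarrow> real"
    using trI[of "\<lambda>u. u\<^sup>2" d] m2 by (simp add: power_mult_distrib)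
  have "(\<integral>\<omega>. (\<Sum>r\<in>I. b r * \<omega> r) * (\<Sum>r\<in>I. b' r * \<omega> r) \<partial>?P) =
      (\<integral>\<omega>. ((\<Sum>r\<in>I. (b r + b' r) * \<omega> r)\<^sup>2 - (\<Sum>r\<in>I. (b r - b' r) * \<omega> r)\<^sup>2) / 4 \<partial>?P)"
    by (intro Bochner_Integration.integral_cong refl)
      (simp add: distrib_right left_diff_distrib sum.distrib sum_subtractf power2_eq_square field_simps)
  also have "\<dots> = ((\<Sum>r\<in>I. (b r + b' r)\<^sup>2) - (\<Sum>r\<in>I. (b r - b' r)\<^sup>2)) / 4"
    using sqI[of "\<lambda>r. b r + b' r"] sqI[of "\<lambda>r. b r - b' r"] sq[of "\<lambda>r. b r + b' r"] sq[of "\<lambda>r. b r - b' r"] by simp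
  also have "\<dots> = (\<Sum>r\<in>I. b r * b' r)"
    unfolding sum_subtractf[symmetric] sum_divide_distrib by (intro sum.cong refl) (simp add: power2_eq_square field_simps)
  finally show "(\<integral>\<omega>. (\<Sum>r\<in>I. b r * \<omega> r) * (\<Sum>r\<in>I. b' r * \<omega> r) \<partial>?P) = (\<Sum>r\<in>I. b r * b' r)" .
qed

text \<open>With \<open>\<Sigma> = A A\<^sup>T\<close>, the law of \<open>A \<zeta>\<close> for independent standard normal \<open>\<zeta>\<close>.  The index set of the
  coordinates is \<open>{..<m} \<times> UNIV\<close>, time points and vector components.\<close>

lemma gaussian_law_exists:
  fixes \<Sigma> :: "nat \<Rightarrow> nat \<Rightarrow> real^'q^'q" and m :: nat
  defines "Q \<equiv> \<lambda>c :: nat \<Rightarrow> real^'q. \<Sum>k<m. \<Sum>i\<in>UNIV. \<Sum>l<m. \<Sum>j\<in>UNIV.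
    c k $ i * c l $ j * \<Sigma> k l $ i $ j"
  assumes sym: "\<And>k l i j. k < m \<Longrightarrow> l < m \<Longrightarrow> \<Sigma> k l $ i $ j = \<Sigma> l k $ j $ i"
    and psd: "\<And>c. Q c \<ge> 0"
  shows "\<exists>L. gaussian_law m (\<lambda>_. 0) \<Sigma> L \<and>
    (\<forall>c. distr L borel (\<lambda>z. \<Sum>k<m. inner (c k) (z k)) = distr std_normal_distribution borel (\<lambda>u. sqrt (Q c) * u))"
proof -
  define I where "I = {..<m} \<times> (UNIV :: 'q set)"
  have I: "finite I" by (simp add: I_def)
  define G where "G a b = \<Sigma> (fst a) (fst b) $ (snd a) $ (snd b)" for a b :: "nat \<times> 'q"
  have "\<exists>A. \<forall>a\<in>I. \<forall>b\<in>I. G a b = (\<Sum>r\<in>I. A a r * A b r)"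
  proof (rule psd_factorization[OF I])
    show "G a b = G b a" if "a \<in> I" "b \<in> I" for a b
      unfolding G_def using that by (intro sym) (auto simp: I_def)
    show "0 \<le> (\<Sum>a\<in>I. \<Sum>b\<in>I. c a * c b * G a b)" for c
      using psd[of "\<lambda>k. \<chi> i. c (k, i)"]
      unfolding Q_def I_def G_def sum.cartesian_product' by simp
  qed
  then obtain A where A: "\<And>a b. a \<in> I \<Longrightarrow> b \<in> I \<Longrightarrow> G a b = (\<Sum>r\<in>I. A a r * A b r)" by blast
  let ?P = "Pi\<^sub>M I (\<lambda>_. std_normal_distribution)"
  interpret N: prob_space std_normal_distribution by (rule prob_space_normal_density) simp
  interpret P: product_prob_space "\<lambda>_ :: nat \<times> 'q. std_normal_distribution" I ..
  have pP: "prob_space ?P" by (rule prob_space_PiM) (rule N.prob_space_axioms)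
  define Z where "Z \<omega> k = (if k < m then (\<chi> i. \<Sum>r\<in>I. A (k, i) r * \<omega> r) else 0 :: real^'q)" for \<omega> k
  have comp: "(\<lambda>\<omega>. \<omega> r) \<in> borel_measurable ?P" if "r \<in> I" for r
    using measurable_component_singleton[OF that, of "\<lambda>_. std_normal_distribution"] by simp
  have Zm [measurable]: "Z \<in> borel_measurable ?P"
  proof (rule measurable_coordinatewise_then_product)
    fix k
    have "(\<lambda>\<omega>. \<Sum>r\<in>I. A (k, i) r * \<omega> r) \<in> borel_measurable ?P" for i
      by (intro borel_measurable_sum borel_measurable_times borel_measurable_const comp)
    then have "(\<lambda>\<omega>. \<chi> i. \<Sum>r\<in>I. A (k, i) r * \<omega> r) \<in> borel_measurable ?P"
      by (rule borel_measurable_vec_lambda)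
    then show "(\<lambda>\<omega>. Z \<omega> k) \<in> borel_measurable ?P"
      unfolding Z_def by (cases "k < m") auto
  qed
  define L where "L = distr ?P borel Z"
  define b where "b c r = (\<Sum>k<m. \<Sum>i\<in>UNIV. c k $ i * A (k, i) r)" for c :: "nat \<Rightarrow> real^'q" and r
  have lin: "(\<Sum>k<m. inner (c k) (Z \<omega> k)) = (\<Sum>r\<in>I. b c r * \<omega> r)" for c \<omega>
  proof -
    have "(\<Sum>k<m. inner (c k) (Z \<omega> k)) = (\<Sum>k<m. \<Sum>i\<in>UNIV. \<Sum>r\<in>I. c k $ i * A (k, i) r * \<omega> r)"
      by (intro sum.cong refl) (simp add: Z_def inner_vec_def sum_distrib_left mult.assoc)
    also have "\<dots> = (\<Sum>k<m. \<Sum>r\<in>I. \<Sum>i\<in>UNIV. c k $ i * A (k, i) r * \<omega> r)"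
      by (intro sum.cong refl sum.swap)
    also have "\<dots> = (\<Sum>r\<in>I. b c r * \<omega> r)"
      unfolding b_def sum_distrib_right by (rule sum.swap)
    finally show ?thesis .
  qed
  have bsq: "(\<Sum>r\<in>I. (b c r)\<^sup>2) = Q c" for c
  proof -
    have b': "b c r = (\<Sum>a\<in>I. c (fst a) $ (snd a) * A a r)" for r
      unfolding b_def I_def sum.cartesian_product' by simp
    have "(\<Sum>r\<in>I. (b c r)\<^sup>2) = (\<Sum>r\<in>I. \<Sum>a\<in>I. \<Sum>d\<in>I. c (fst a) $ (snd a) * c (fst d) $ (snd d) * (A a r * A d r))"
      unfolding b' power2_eq_square sum_product by (intro sum.cong refl) simp
    also have "\<dots> = (\<Sum>a\<in>I. \<Sum>r\<in>I. \<Sum>d\<in>I. c (fst a) $ (snd a) * c (fst d) $ (snd d) * (A a r * A d r))"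
      by (rule sum.swap)
    also have "\<dots> = (\<Sum>a\<in>I. \<Sum>d\<in>I. \<Sum>r\<in>I. c (fst a) $ (snd a) * c (fst d) $ (snd d) * (A a r * A d r))"
      by (intro sum.cong refl sum.swap)
    also have "\<dots> = (\<Sum>a\<in>I. \<Sum>d\<in>I. c (fst a) $ (snd a) * c (fst d) $ (snd d) * G a d)"
      by (intro sum.cong refl) (simp add: A sum_distrib_left)
    also have "\<dots> = Q c" unfolding Q_def I_def G_def sum.cartesian_product' by simp
    finally show ?thesis .
  qed
  have proj [measurable]: "(\<lambda>z :: nat \<Rightarrow> real^'q. z k) \<in> borel_measurable borel" for k
    by (rule measurable_product_coordinates)
  have linm [measurable]: "(\<lambda>z :: nat \<Rightarrow> real^'q. \<Sum>k<m. inner (c k) (z k)) \<in> borel_measurable borel" for c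
    by measurable
  have law: "distr L borel (\<lambda>z. \<Sum>k<m. inner (c k) (z k)) = distr std_normal_distribution borel (\<lambda>u. sqrt (Q c) * u)" for c
  proof -
    have "distr L borel (\<lambda>z. \<Sum>k<m. inner (c k) (z k)) = distr ?P borel (\<lambda>\<omega>. \<Sum>r\<in>I. b c r * \<omega> r)"
      unfolding L_def by (subst distr_distr) (auto simp: comp_def lin)
    then show ?thesis unfolding distr_linear_standard_normals[OF I] bsq .
  qed
  have entry: "Z \<omega> k $ i = (\<Sum>r\<in>I. A (k, i) r * \<omega> r)" if "k < m" for k i \<omega>
    using that by (simp add: Z_def)
  have vecm [measurable]: "(\<lambda>z :: nat \<Rightarrow> real^'q. z k $ i) \<in> borel_measurable borel" for k i
    by (rule measurable_compose[OF proj borel_measurable_vec_nth])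
  have "gaussian_law m (\<lambda>_. 0) \<Sigma> L"
    unfolding gaussian_law_def
  proof (intro conjI allI impI)
    show "prob_space L" unfolding L_def by (rule prob_space.prob_space_distr[OF pP]) measurable
    show "sets L = sets borel" by (simp add: L_def)
    show "AE z in L. \<forall>k\<ge>m. z k = 0"
      unfolding L_def by (subst AE_distr_iff) (auto simp: Z_def)
    show "\<exists>\<mu>' s. 0 \<le> s \<and> distr L borel (\<lambda>z. \<Sum>k<m. inner (c k) (z k)) =
        distr std_normal_distribution borel (\<lambda>u. \<mu>' + s * u)" for c
      by (intro exI[of _ 0] exI[of _ "sqrt (Q c)"]) (simp add: law psd)
    show "(\<integral>z. z k $ i \<partial>L) = 0 $ i" if "k < m" for k i
    proof -
      have "(\<integral>z. z k $ i \<partial>L) = (\<integral>\<omega>. Z \<omega> k $ i \<partial>?P)"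
        unfolding L_def by (rule integral_distr) measurable
      then show ?thesis using linear_standard_normals_moments(1)[OF I, of "A (k, i)"] that by (simp add: entry)
    qed
    show "(\<integral>z. (z k $ i - 0 $ i) * (z l $ j - 0 $ j) \<partial>L) = \<Sigma> k l $ i $ j"
      if "k < m" "l < m" for k l i j
    proof -
      have "(\<integral>z. z k $ i * z l $ j \<partial>L) = (\<integral>\<omega>. Z \<omega> k $ i * Z \<omega> l $ j \<partial>?P)"
        unfolding L_def by (rule integral_distr) measurable
      also have "\<dots> = (\<Sum>r\<in>I. A (k, i) r * A (l, j) r)"
        using linear_standard_normals_moments(2)[OF I, of "A (k, i)" "A (l, j)"] that by (simp add: entry)
      also have "\<dots> = G (k, i) (l, j)" using that by (intro A[symmetric]) (auto simp: I_def)
      finally show ?thesis by (simp add: G_def)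
    qed
  qed
  then show ?thesis using law by blast
qed

section \<open>The Cramer-Wold device\<close>

definition linear_functional :: "nat \<Rightarrow> (nat \<Rightarrow> real^'q) \<Rightarrow> (nat \<Rightarrow> real^'q) \<Rightarrow> real" where
  "linear_functional m c z = (\<Sum>k<m. inner (c k) (z k))"

text \<open>The functions whose expectations are determined by the laws of linear functionals.\<close>

inductive trig_poly :: "nat \<Rightarrow> ((nat \<Rightarrow> real^'q) \<Rightarrow> real) \<Rightarrow> bool" for m where
  base: "trig_poly m (\<lambda>z. a * cos (linear_functional m c z + \<theta>))"
| add: "trig_poly m \<phi> \<Longrightarrow> trig_poly m \<psi> \<Longrightarrow> trig_poly m (\<lambda>z. \<phi> z + \<psi> z)"

lemma linear_functional_add: "linear_functional m (\<lambda>k. c k + d k) z = linear_functional m c z + linear_functional m d z"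
  by (simp add: linear_functional_def inner_add_left sum.distrib)

lemma linear_functional_diff: "linear_functional m (\<lambda>k. c k - d k) z = linear_functional m c z - linear_functional m d z"
  by (simp add: linear_functional_def inner_diff_left sum_subtractf)

text \<open>Product-to-sum formula for cosines.\<close>

lemma trig_poly_mult_cos:
  "trig_poly m \<psi> \<Longrightarrow> trig_poly m (\<lambda>z. (a * cos (linear_functional m c z + \<theta>)) * \<psi> z)"
proof (induction rule: trig_poly.induct)
  case (base a' c' \<theta>')
  have eq: "(a * cos (linear_functional m c z + \<theta>)) * (a' * cos (linear_functional m c' z + \<theta>')) =
      (a * a' / 2) * cos (linear_functional m (\<lambda>k. c k - c' k) z + (\<theta> - \<theta>')) +
      (a * a' / 2) * cos (linear_functional m (\<lambda>k. c k + c' k) z + (\<theta> + \<theta>'))" for z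
  proof -
    have "(a * cos (linear_functional m c z + \<theta>)) * (a' * cos (linear_functional m c' z + \<theta>')) =
      a * a' * (cos (linear_functional m c z + \<theta>) * cos (linear_functional m c' z + \<theta>'))" by simp
    also have "\<dots> = a * a' * ((cos ((linear_functional m c z + \<theta>) - (linear_functional m c' z + \<theta>')) +
        cos ((linear_functional m c z + \<theta>) + (linear_functional m c' z + \<theta>'))) / 2)"
      by (simp only: cos_times_cos)
    finally show ?thesis by (simp add: linear_functional_add linear_functional_diff algebra_simps add_divide_distrib)
  qed
  show ?case unfolding eq by (intro trig_poly.intros)
next
  case (add \<phi> \<psi>)
  then show ?case unfolding distrib_left by (intro trig_poly.add)
qed

lemma trig_poly_mult: "trig_poly m \<phi> \<Longrightarrow> trig_poly m \<psi> \<Longrightarrow> trig_poly m (\<lambda>z. \<phi> z * \<psi> z)"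
proof (induction rule: trig_poly.induct)
  case (base a c \<theta>)
  then show ?case by (rule trig_poly_mult_cos)
next
  case (add \<phi> \<phi>')
  then show ?case unfolding distrib_right by (intro trig_poly.add) auto
qed

lemma trig_poly_const: "trig_poly m (\<lambda>z. a)"
  using trig_poly.base[of m a "\<lambda>_. 0" 0] by (simp add: linear_functional_def)

lemma trig_poly_sin_component:
  assumes "k < m"
  shows "trig_poly m (\<lambda>z. sin (z k $ i / r))"
proof -
  have lf: "linear_functional m (\<lambda>l. if l = k then axis i (1 / r) else 0) z = z k $ i / r" for z
  proof -
    have "linear_functional m (\<lambda>l. if l = k then axis i (1 / r) else 0) z = (\<Sum>l<m. if l = k then z k $ i / r else 0)"
      unfolding linear_functional_def by (intro sum.cong refl) (auto simp: inner_axis')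
    then show ?thesis using assms by simp
  qed
  have "1 * cos (linear_functional m (\<lambda>l. if l = k then axis i (1 / r) else 0) z + - (pi / 2)) = sin (z k $ i / r)" for z
    unfolding lf by (simp add: cos_diff)
  then show ?thesis using trig_poly.base[of m 1 "\<lambda>l. if l = k then axis i (1 / r) else 0" "- (pi / 2)"] by simp
qed

lemma linear_functional_measurable [measurable]:
  "linear_functional m c \<in> borel_measurable borel"
  unfolding linear_functional_def[abs_def]
  by (intro borel_measurable_sum borel_measurable_inner borel_measurable_const measurable_product_coordinates)

lemma trig_poly_measurable: "trig_poly m \<phi> \<Longrightarrow> \<phi> \<in> borel_measurable borel"
  by (induction rule: trig_poly.induct) auto

lemma trig_poly_bounded: "trig_poly m \<phi> \<Longrightarrow> \<exists>B. \<forall>z. \<bar>\<phi> z\<bar> \<le> B"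
proof (induction rule: trig_poly.induct)
  case (base a c \<theta>)
  then show ?case by (intro exI[of _ "\<bar>a\<bar>"]) (auto simp: abs_mult intro: mult_left_le)
next
  case (add \<phi> \<psi>)
  then obtain B C where "\<And>z. \<bar>\<phi> z\<bar> \<le> B" "\<And>z. \<bar>\<psi> z\<bar> \<le> C" by blast
  then show ?case by (intro exI[of _ "B + C"]) (meson abs_triangle_ineq add_mono order_trans)
qed

lemma trig_poly_expectation_limit:
  fixes Y :: "nat \<Rightarrow> 'a \<Rightarrow> nat \<Rightarrow> real^'q"
  assumes M: "prob_space M" and L: "prob_space L" "sets L = sets borel"
    and Y: "\<And>n. Y n \<in> borel_measurable M"
    and lim: "\<And>c \<theta>. (\<lambda>n. \<integral>\<omega>. cos (linear_functional m c (Y n \<omega>) + \<theta>) \<partial>M) \<longlonglongrightarrow>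
      (\<integral>z. cos (linear_functional m c z + \<theta>) \<partial>L)"
  shows "trig_poly m \<phi> \<Longrightarrow> (\<lambda>n. \<integral>\<omega>. \<phi> (Y n \<omega>) \<partial>M) \<longlonglongrightarrow> (\<integral>z. \<phi> z \<partial>L)"
proof (induction rule: trig_poly.induct)
  case (base a c \<theta>)
  show ?case using tendsto_mult[OF tendsto_const[of a] lim[of c \<theta>]] by simp
next
  case (add \<phi> \<psi>)
  interpret M: prob_space M by fact
  interpret L: prob_space L by fact
  have int: "integrable M (\<lambda>\<omega>. \<phi> (Y n \<omega>))" "integrable L \<phi>" if tp: "trig_poly m \<phi>" for \<phi> n
  proof -
    obtain B where B: "\<And>z. \<bar>\<phi> z\<bar> \<le> B" using trig_poly_bounded[OF tp] by blast
    note [measurable] = trig_poly_measurable[OF tp] Y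
    show "integrable M (\<lambda>\<omega>. \<phi> (Y n \<omega>))" by (rule M.integrable_const_bound[where B = B]) (use B in auto)
    have "\<phi> \<in> borel_measurable L" using trig_poly_measurable[OF tp] measurable_cong_sets[OF L(2) refl] by blast
    then show "integrable L \<phi>" by (intro L.integrable_const_bound[where B = B]) (use B in auto)
  qed
  show ?case
    using tendsto_add[OF add.IH] int[OF add.hyps(1)] int[OF add.hyps(2)] by simp
qed

text \<open>On the box \<open>[-r, r]\<close> the map \<open>z \<mapsto> sin (z / r)\<close> is invertible, so \<open>g\<close> is there a continuous function of the
  sines, which Stone--Weierstrass approximates uniformly on the compact cube of all values of the sines.  Outside the
  box the approximation is useless but, being a function on the same cube, still bounded by \<open>B + e\<close>,
  which is what a tightness argument needs.\<close>

lemma trig_approximation: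
  fixes g :: "(nat \<Rightarrow> real^'q) \<Rightarrow> real"
  assumes g: "continuous_on UNIV g" and B: "\<And>z. \<bar>g z\<bar> \<le> B" and r: "r > 0" and e: "e > 0"
  shows "\<exists>\<phi>. trig_poly m \<phi> \<and>
    (\<forall>z. (\<forall>k\<ge>m. z k = 0) \<longrightarrow> (\<forall>k<m. \<forall>i. \<bar>z k $ i\<bar> \<le> r) \<longrightarrow> \<bar>g z - \<phi> z\<bar> \<le> e) \<and>
    (\<forall>z. \<bar>\<phi> z\<bar> \<le> B + e)"
proof -
  define Q where "Q = {u :: nat \<Rightarrow> real^'q. \<forall>k. u k \<in> (if k < m then {x. \<forall>i. x $ i \<in> {-1..1}} else {0})}"
  have box: "{x :: real^'q. \<forall>i. x $ i \<in> {-1..1}} = cbox (\<chi> i. -1) (\<chi> i. 1)"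
    by (auto simp: cbox_def Basis_vec_def inner_axis)
  have Qc: "compact Q"
    unfolding Q_def
  proof (rule compact_Pi_UNIV)
    show "compact (if k < m then {x :: real^'q. \<forall>i. x $ i \<in> {-1..1}} else {0})" for k
      unfolding box by simp
  qed
  (* S maps the box into the cube Q of sines; S' is its inverse there. *)
  define S where "S z k = (if k < m then (\<chi> i. sin (z k $ i / r)) else 0)" for z :: "nat \<Rightarrow> real^'q" and k
  define S' where "S' u k = (if k < m then (\<chi> i. r * arcsin (u k $ i)) else 0)" for u :: "nat \<Rightarrow> real^'q" and k
  have SQ: "S z \<in> Q" for z by (auto simp: S_def Q_def)
  define R where "R = {F. continuous_on Q F \<and> trig_poly m (\<lambda>z. F (S z))}"
  have cc: "continuous_on A (\<lambda>u :: nat \<Rightarrow> real^'q. u k $ i)" for k i A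
    by (intro continuous_intros continuous_on_subset[OF continuous_on_product_coordinates]) auto
  interpret R: function_ring_on R Q
  proof
    show "compact Q" by (rule Qc)
    show "continuous_on Q f" if "f \<in> R" for f using that by (simp add: R_def)
    show "(\<lambda>x. f x + g x) \<in> R" if "f \<in> R" "g \<in> R" for f g
      using that by (auto simp: R_def intro: continuous_on_add trig_poly.add)
    show "(\<lambda>x. f x * g x) \<in> R" if "f \<in> R" "g \<in> R" for f g
      using that by (auto simp: R_def intro: continuous_on_mult trig_poly_mult)
    show "(\<lambda>_. c) \<in> R" for c by (auto simp: R_def trig_poly_const)
    show "\<exists>f\<in>R. f x \<noteq> f y" if xy: "x \<in> Q" "y \<in> Q" "x \<noteq> y" for x y
    proof -
      from xy obtain k where k: "x k \<noteq> y k" by auto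
      have km: "k < m" using k xy(1,2) by (auto simp: Q_def split: if_splits) (metis singletonD)
      from k obtain i where i: "x k $ i \<noteq> y k $ i"
        by (auto simp: Finite_Cartesian_Product.vec_eq_iff)
      have "trig_poly m (\<lambda>z. S z k $ i)"
        using trig_poly_sin_component[OF km, of i r] km by (simp add: S_def)
      then have "(\<lambda>u. u k $ i) \<in> R" using cc by (simp add: R_def)
      with i show ?thesis by (intro bexI[of _ "\<lambda>u. u k $ i"])
    qed
  qed
  have "continuous_on Q (\<lambda>u. g (S' u))"
  proof (rule continuous_on_compose2[OF g])
    show "continuous_on Q S'"
    proof (rule continuous_on_coordinatewise_then_product)
      fix k
      show "continuous_on Q (\<lambda>u. S' u k)"
      proof (cases "k < m")
        case True
        have "continuous_on Q (\<lambda>u. r * arcsin (u k $ i))" for i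
          by (intro continuous_intros cc) (use True in \<open>auto simp: Q_def dest!: spec[of _ k]\<close>)
        then have "continuous_on Q (\<lambda>u. \<chi> i. r * arcsin (u k $ i))"
          by (intro continuous_on_vec_lambda)
        then show ?thesis using True by (simp add: S'_def)
      next
        case False
        then show ?thesis by (simp add: S'_def)
      qed
    qed
  qed auto
  from R.Stone_Weierstrass_basic[OF this e] obtain F where F: "F \<in> R" "\<And>u. u \<in> Q \<Longrightarrow> \<bar>g (S' u) - F u\<bar> < e" by blast
  show ?thesis
  proof (intro exI[of _ "\<lambda>z. F (S z)"] conjI allI impI)
    show "trig_poly m (\<lambda>z. F (S z))" using F(1) by (simp add: R_def)
    show "\<bar>F (S z)\<bar> \<le> B + e" for z using F(2)[OF SQ[of z]] B[of "S' (S z)"] by linarith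
    show "\<bar>g z - F (S z)\<bar> \<le> e" if z: "\<forall>k\<ge>m. z k = 0" "\<forall>k<m. \<forall>i. \<bar>z k $ i\<bar> \<le> r" for z
    proof -
      have "S' (S z) k = z k" for k
      proof (cases "k < m")
        case True
        have "r * arcsin (sin (z k $ i / r)) = z k $ i" for i
        proof -
          have "\<bar>z k $ i / r\<bar> \<le> 1" using z(2) True r by (simp add: abs_divide)
          then have "- (pi / 2) \<le> z k $ i / r" "z k $ i / r \<le> pi / 2"
            using pi_gt3 by (simp_all only: abs_le_iff, linarith+)
          then show ?thesis using r by (simp add: arcsin_sin)
        qed
        then show ?thesis using True by (simp add: S_def S'_def Finite_Cartesian_Product.vec_eq_iff)
      next
        case False
        then show ?thesis using z(1) by (simp add: S'_def)
      qed
      then have "S' (S z) = z" by auto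
      then show ?thesis using F(2)[OF SQ[of z]] by simp
    qed
  qed
qed

lemma abs_diff_chain:
  fixes s u v w e d :: real
  assumes "\<bar>u - v\<bar> < e" "\<bar>s - u\<bar> \<le> d" "\<bar>w - v\<bar> \<le> d"
  shows "\<bar>s - w\<bar> < 2 * d + e"
  using assms by linarith

text \<open>Tightness confines the variables to a box, up to small probability; on the box \<open>g\<close> is approximated by a
  trigonometric polynomial, whose expectations converge by assumption.\<close>

theorem cramer_wold:
  fixes Y :: "nat \<Rightarrow> 'a \<Rightarrow> nat \<Rightarrow> real^'q" and g :: "(nat \<Rightarrow> real^'q) \<Rightarrow> real"
  assumes M: "prob_space M" and L: "prob_space L" "sets L = sets borel" and Lz: "AE z in L. \<forall>k\<ge>m. z k = 0"
    and Y: "\<And>n. Y n \<in> borel_measurable M" and Yz: "\<And>n \<omega> k. k \<ge> m \<Longrightarrow> Y n \<omega> k = 0"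
    and tight: "\<And>\<epsilon>. \<epsilon> > 0 \<Longrightarrow> \<exists>R. \<forall>\<^sub>F n in sequentially.
      measure M {\<omega> \<in> space M. \<exists>k<m. norm (Y n \<omega> k) > R} \<le> \<epsilon>"
    and lim: "\<And>c \<theta>. (\<lambda>n. \<integral>\<omega>. cos (linear_functional m c (Y n \<omega>) + \<theta>) \<partial>M) \<longlonglongrightarrow>
      (\<integral>z. cos (linear_functional m c z + \<theta>) \<partial>L)"
    and g: "continuous_on UNIV g" "bounded (range g)"
  shows "(\<lambda>n. \<integral>\<omega>. g (Y n \<omega>) \<partial>M) \<longlonglongrightarrow> (\<integral>z. g z \<partial>L)"
proof (rule LIMSEQ_I)
  fix e0 :: real assume e0: "e0 > 0"
  interpret M: prob_space M by fact
  interpret L: prob_space L by fact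
  obtain B0 where B0: "\<And>z. \<bar>g z\<bar> \<le> B0" using g(2) by (auto simp: bounded_iff)
  define B where "B = max B0 1"
  have B: "\<And>z. \<bar>g z\<bar> \<le> B" "B \<ge> 1"
    unfolding B_def by (rule max.coboundedI1[OF B0]) (rule max.cobounded2)
  define e where "e = min 1 (e0 / (6 * B + 8))"
  have e: "e > 0" "e \<le> 1" using e0 B(2) by (auto simp: e_def)
  have e3: "e * (6 * B + 8) \<le> e0"
  proof -
    have "e \<le> e0 / (6 * B + 8)" by (simp add: e_def)
    then show ?thesis using B(2) by (simp add: pos_le_divide_eq)
  qed
  obtain R1 where R1: "\<forall>\<^sub>F n in sequentially. measure M {\<omega> \<in> space M. \<exists>k<m. norm (Y n \<omega> k) > R1} \<le> e"
    using tight[OF e(1)] by blast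
  have coordB: "(\<lambda>z :: nat \<Rightarrow> real^'q. norm (z k)) \<in> borel_measurable borel" for k
    using measurable_compose[OF measurable_product_coordinates, of norm borel k] by simp
  have out_sets: "{z :: nat \<Rightarrow> real^'q. \<exists>k<m. norm (z k) > R} \<in> sets borel" for R
  proof -
    have "{z :: nat \<Rightarrow> real^'q. \<exists>k<m. norm (z k) > R} = (\<Union>k\<in>{..<m}. {z \<in> space borel. norm (z k) > R})" by auto
    also have "\<dots> \<in> sets borel"
      using coordB by (intro sets.finite_UN) (auto intro!: borel_measurable_less[of "\<lambda>_. R", simplified])
    finally show ?thesis .
  qed
  have "(\<lambda>j. measure L {z. \<exists>k<m. norm (z k) > real j}) \<longlonglongrightarrow> measure L (\<Inter>j. {z. \<exists>k<m. norm (z k) > real j})"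
  proof (rule L.finite_Lim_measure_decseq)
    show "range (\<lambda>j. {z. \<exists>k<m. norm (z k) > real j}) \<subseteq> sets L"
      unfolding L(2) by (intro image_subsetI out_sets)
    show "decseq (\<lambda>j. {z :: nat \<Rightarrow> real^'q. \<exists>k<m. norm (z k) > real j})"
    proof (rule decseq_SucI, rule subsetI)
      fix j and z :: "nat \<Rightarrow> real^'q" assume "z \<in> {z. \<exists>k<m. norm (z k) > real (Suc j)}"
      then obtain k where "k < m" "norm (z k) > real (Suc j)" by auto
      then show "z \<in> {z. \<exists>k<m. norm (z k) > real j}" by (auto intro!: exI[of _ k])
    qed
  qed
  moreover have "(\<Inter>j. {z :: nat \<Rightarrow> real^'q. \<exists>k<m. norm (z k) > real j}) = {}"
  proof -
    have False if "\<And>j. \<exists>k<m. norm (z k) > real j" for z :: "nat \<Rightarrow> real^'q"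
    proof -
      obtain j where j: "(\<Sum>k<m. norm (z k)) \<le> real j" using real_arch_simple by blast
      from that[of j] obtain k where k: "k < m" "norm (z k) > real j" by (elim exE conjE)
      have "norm (z k) \<le> (\<Sum>k<m. norm (z k))" using k by (intro member_le_sum) auto
      then show False using j k by linarith
    qed
    then show ?thesis by blast
  qed
  ultimately have "(\<lambda>j. measure L {z. \<exists>k<m. norm (z k) > real j}) \<longlonglongrightarrow> 0" by simp
  from order_tendstoD(2)[OF this e(1)] obtain j where j: "measure L {z. \<exists>k<m. norm (z k) > real j} < e"
    by (auto simp: eventually_sequentially)
  define r where "r = max 1 (max R1 (real j))"
  have r: "r > 0" "r \<ge> R1" "r \<ge> real j" by (auto simp: r_def)
  from trig_approximation[OF g(1) B(1) r(1) e(1), of m] obtain \<phi> where \<phi>': "trig_poly m \<phi> \<and>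
    (\<forall>z. (\<forall>k\<ge>m. z k = 0) \<longrightarrow> (\<forall>k<m. \<forall>i. \<bar>z k $ i\<bar> \<le> r) \<longrightarrow> \<bar>g z - \<phi> z\<bar> \<le> e) \<and>
    (\<forall>z. \<bar>\<phi> z\<bar> \<le> B + e)" by (elim exE)
  note \<phi> = conjunct1[OF \<phi>'] conjunct1[OF conjunct2[OF \<phi>'], rule_format] conjunct2[OF conjunct2[OF \<phi>'], rule_format]
  have gm: "g \<in> borel_measurable borel" using g(1) by (rule borel_measurable_continuous_onI)
  have \<phi>m: "\<phi> \<in> borel_measurable borel" by (rule trig_poly_measurable[OF \<phi>(1)])
  have key: "\<bar>g z - \<phi> z\<bar> \<le> e + (2 * B + e) * indicator {z. \<exists>k<m. norm (z k) > r} z" if "\<forall>k\<ge>m. z k = 0" for z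
  proof (cases "\<exists>k<m. norm (z k) > r")
    case True
    then have ind: "indicator {z. \<exists>k<m. norm (z k) > r} z = (1 :: real)" by simp
    show ?thesis unfolding ind using \<phi>(3)[of z] B(1)[of z] e by simp
  next
    case False
    have "\<bar>z k $ i\<bar> \<le> r" if "k < m" for k i
      using component_le_norm_cart[of "z k" i] False that by force
    then have "\<bar>g z - \<phi> z\<bar> \<le> e" using that by (intro \<phi>(2)) auto
    then show ?thesis using False by simp
  qed
  have general: "\<bar>(\<integral>\<omega>. g (X \<omega>) \<partial>N) - (\<integral>\<omega>. \<phi> (X \<omega>) \<partial>N)\<bar> \<le> e + (2 * B + e) * e"
    if N: "prob_space N" and X: "X \<in> measurable N borel" and Xz: "AE \<omega> in N. \<forall>k\<ge>m. X \<omega> k = 0"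
      and out: "measure N {\<omega> \<in> space N. \<exists>k<m. norm (X \<omega> k) > r} \<le> e"
    for N :: "'c measure" and X
  proof -
    interpret N: prob_space N by fact
    have m1 [measurable]: "(\<lambda>\<omega>. g (X \<omega>)) \<in> borel_measurable N" "(\<lambda>\<omega>. \<phi> (X \<omega>)) \<in> borel_measurable N"
      using measurable_compose[OF X gm] measurable_compose[OF X \<phi>m] by auto
    have i1: "integrable N (\<lambda>\<omega>. g (X \<omega>))" "integrable N (\<lambda>\<omega>. \<phi> (X \<omega>))"
      by (rule N.integrable_const_bound[where B = B]; use B in auto)
        (rule N.integrable_const_bound[where B = "B + e"]; use \<phi>(3) in auto)
    define U where "U = {\<omega> \<in> space N. \<exists>k<m. norm (X \<omega> k) > r}"
    have Um [measurable]: "U \<in> sets N"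
    proof -
      have "U = X -` {z. \<exists>k<m. norm (z k) > r} \<inter> space N" by (auto simp: U_def)
      then show ?thesis using measurable_sets[OF X out_sets[of r]] by (simp only:)
    qed
    have "\<bar>(\<integral>\<omega>. g (X \<omega>) \<partial>N) - (\<integral>\<omega>. \<phi> (X \<omega>) \<partial>N)\<bar> = \<bar>\<integral>\<omega>. g (X \<omega>) - \<phi> (X \<omega>) \<partial>N\<bar>" using i1 by simp
    also have "\<dots> \<le> (\<integral>\<omega>. \<bar>g (X \<omega>) - \<phi> (X \<omega>)\<bar> \<partial>N)" by (rule integral_abs_bound)
    also have "\<dots> \<le> (\<integral>\<omega>. e + (2 * B + e) * indicator U \<omega> \<partial>N)"
    proof (rule integral_mono_AE)
      show "AE \<omega> in N. \<bar>g (X \<omega>) - \<phi> (X \<omega>)\<bar> \<le> e + (2 * B + e) * indicator U \<omega>"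
        using Xz AE_space
      proof eventually_elim
        case (elim \<omega>)
        show ?case using key[OF elim(1)] elim(2) by (auto simp: U_def split: split_indicator_asm split_indicator)
      qed
    qed (use i1 in \<open>auto simp: less_top[symmetric]\<close>)
    also have "\<dots> = e + (2 * B + e) * measure N U"
      by (simp add: N.prob_space less_top[symmetric])
    also have "\<dots> \<le> e + (2 * B + e) * e"
      using out B e unfolding U_def by (intro add_left_mono mult_left_mono) auto
    finally show ?thesis .
  qed
  have Lg: "\<bar>(\<integral>z. g z \<partial>L) - (\<integral>z. \<phi> z \<partial>L)\<bar> \<le> e + (2 * B + e) * e"
  proof (rule general[OF L(1), of "\<lambda>z. z"])
    show "(\<lambda>z. z) \<in> measurable L borel" using measurable_ident_sets[OF L(2)] by simp
    have "measure L {z \<in> space L. \<exists>k<m. norm (z k) > r} \<le> measure L {z. \<exists>k<m. norm (z k) > real j}"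
      using r out_sets L(2) by (intro L.finite_measure_mono) (auto intro: le_less_trans)
    then show "measure L {z \<in> space L. \<exists>k<m. norm (z k) > r} \<le> e" using j by simp
  qed (use Lz in auto)
  have lim\<phi>: "(\<lambda>n. \<integral>\<omega>. \<phi> (Y n \<omega>) \<partial>M) \<longlonglongrightarrow> (\<integral>z. \<phi> z \<partial>L)"
    by (rule trig_poly_expectation_limit[OF M L Y lim \<phi>(1)])
  from LIMSEQ_D[OF this e(1)] obtain n1 where n1: "\<And>n. n \<ge> n1 \<Longrightarrow> \<bar>(\<integral>\<omega>. \<phi> (Y n \<omega>) \<partial>M) - (\<integral>z. \<phi> z \<partial>L)\<bar> < e"
    by auto
  obtain n2 where n2: "\<And>n. n \<ge> n2 \<Longrightarrow> measure M {\<omega> \<in> space M. \<exists>k<m. norm (Y n \<omega> k) > R1} \<le> e"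
    using R1 by (auto simp: eventually_sequentially)
  show "\<exists>n0. \<forall>n\<ge>n0. norm ((\<integral>\<omega>. g (Y n \<omega>) \<partial>M) - (\<integral>z. g z \<partial>L)) < e0"
  proof (intro exI[of _ "max n1 n2"] allI impI)
    fix n assume n: "n \<ge> max n1 n2"
    have Yn: "\<bar>(\<integral>\<omega>. g (Y n \<omega>) \<partial>M) - (\<integral>\<omega>. \<phi> (Y n \<omega>) \<partial>M)\<bar> \<le> e + (2 * B + e) * e"
    proof (rule general[OF M Y])
      have ms: "{\<omega> \<in> space M. \<exists>k<m. norm (Y n \<omega> k) > R1} \<in> sets M"
      proof -
        have "{\<omega> \<in> space M. \<exists>k<m. norm (Y n \<omega> k) > R1} = Y n -` {z. \<exists>k<m. norm (z k) > R1} \<inter> space M" by auto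
        then show ?thesis using measurable_sets[OF Y out_sets[of R1]] by (simp only:)
      qed
      have "measure M {\<omega> \<in> space M. \<exists>k<m. norm (Y n \<omega> k) > r} \<le> measure M {\<omega> \<in> space M. \<exists>k<m. norm (Y n \<omega> k) > R1}"
      proof (rule M.finite_measure_mono[OF _ ms], rule subsetI)
        fix \<omega> assume "\<omega> \<in> {\<omega> \<in> space M. \<exists>k<m. norm (Y n \<omega> k) > r}"
        then obtain k where "\<omega> \<in> space M" "k < m" "norm (Y n \<omega> k) > r" by auto
        then show "\<omega> \<in> {\<omega> \<in> space M. \<exists>k<m. norm (Y n \<omega> k) > R1}"
          using r(2) by (auto intro!: exI[of _ k])
      qed
      then show "measure M {\<omega> \<in> space M. \<exists>k<m. norm (Y n \<omega> k) > r} \<le> e" using n2[of n] n by simp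
    qed (use Yz in auto)
    have "\<bar>(\<integral>\<omega>. g (Y n \<omega>) \<partial>M) - (\<integral>z. g z \<partial>L)\<bar> < 2 * (e + (2 * B + e) * e) + e"
    proof -
      show ?thesis by (rule abs_diff_chain[OF n1 Yn Lg]) (use n in simp)
    qed
    also have "2 * (e + (2 * B + e) * e) + e = e * (4 * B + 2 * e + 3)" by (simp add: algebra_simps)
    also have "\<dots> \<le> e * (6 * B + 8)" using e B by (intro mult_left_mono) auto
    finally show "norm ((\<integral>\<omega>. g (Y n \<omega>) \<partial>M) - (\<integral>z. g z \<partial>L)) < e0" using e3 by simp
  qed
qed

section \<open>The multivariate central limit theorem\<close>

lemma (in prob_space) iid_sum_second_moment:
  fixes X :: "nat \<Rightarrow> 'a \<Rightarrow> real"
  assumes ind: "indep_vars (\<lambda>_. borel) X UNIV"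
    and int: "\<And>i. integrable M (X i)" and int2: "\<And>i. integrable M (\<lambda>\<omega>. (X i \<omega>)\<^sup>2)"
    and mean: "\<And>i. expectation (X i) = 0" and second: "\<And>i. expectation (\<lambda>\<omega>. (X i \<omega>)\<^sup>2) = V"
  shows "integrable M (\<lambda>\<omega>. (\<Sum>i<n. X i \<omega>)\<^sup>2) \<and> expectation (\<lambda>\<omega>. (\<Sum>i<n. X i \<omega>)\<^sup>2) = real n * V"
proof (induction n)
  case 0
  then show ?case by simp
next
  case (Suc n)
  define S where "S \<omega> = (\<Sum>i<n. X i \<omega>)" for \<omega>
  have iv: "indep_var borel (X n) borel S"
    unfolding S_def by (rule indep_vars_sum) (auto intro: indep_vars_subset[OF ind])
  have iS: "integrable M S" unfolding S_def using int by auto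
  have mS: "integrable M (\<lambda>\<omega>. X n \<omega> * S \<omega>)" "expectation (\<lambda>\<omega>. X n \<omega> * S \<omega>) = 0"
    using indep_var_integrable[OF iv int iS] indep_var_lebesgue_integral[OF iv int iS] mean by auto
  have eq: "(\<Sum>i<Suc n. X i \<omega>)\<^sup>2 = (S \<omega>)\<^sup>2 + (2 * (X n \<omega> * S \<omega>) + (X n \<omega>)\<^sup>2)" for \<omega>
    by (simp add: S_def power2_sum algebra_simps)
  have IH: "integrable M (\<lambda>\<omega>. (S \<omega>)\<^sup>2)" "expectation (\<lambda>\<omega>. (S \<omega>)\<^sup>2) = real n * V"
    using Suc by (auto simp: S_def)
  show ?case unfolding eq using IH mS int2[of n] second[of n] by (simp add: distrib_right)
qed

text \<open>For positive variance this is the central limit theorem tested with the bounded continuous function \<open>cos (sqrt V * u + \<theta>)\<close>; for variance 0 all terms vanish almost surely.\<close>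

lemma (in prob_space) central_limit_cos:
  fixes X :: "nat \<Rightarrow> 'a \<Rightarrow> real"
  assumes ind: "indep_vars (\<lambda>_. borel) X UNIV"
    and distr: "\<And>i. distr M borel (X i) = distr M borel (X 0)"
    and int2: "\<And>i. integrable M (\<lambda>\<omega>. (X i \<omega>)\<^sup>2)"
    and mean: "\<And>i. expectation (X i) = 0" and second: "\<And>i. expectation (\<lambda>\<omega>. (X i \<omega>)\<^sup>2) = V"
  shows "(\<lambda>n. expectation (\<lambda>\<omega>. cos ((\<Sum>i<n. X i \<omega>) / sqrt (real n) + \<theta>)))
    \<longlonglongrightarrow> (\<integral>u. cos (sqrt V * u + \<theta>) \<partial>std_normal_distribution)"
proof -
  interpret N: prob_space std_normal_distribution by (rule prob_space_normal_density) simp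
  have Xm [measurable]: "X i \<in> borel_measurable M" for i
    using ind by (auto simp: indep_vars_def)
  have V0: "V \<ge> 0" unfolding second[of 0, symmetric] by (rule integral_nonneg_AE) simp
  show ?thesis
  proof (cases "V = 0")
    case True
    have "AE \<omega> in M. X i \<omega> = 0" for i
    proof -
      have "AE \<omega> in M. (X i \<omega>)\<^sup>2 = 0"
        using integral_nonneg_eq_0_iff_AE[OF int2[of i]] second[of i] True by simp
      then show ?thesis by simp
    qed
    then have "AE \<omega> in M. \<forall>i. X i \<omega> = 0" by (simp add: AE_all_countable)
    then have "expectation (\<lambda>\<omega>. cos ((\<Sum>i<n. X i \<omega>) / sqrt (real n) + \<theta>)) = expectation (\<lambda>\<omega>. cos \<theta>)" for n
      by (intro integral_cong_AE) (auto elim!: eventually_mono)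
    then show ?thesis using True N.prob_space by (simp add: prob_space)
  next
    case False
    define \<sigma> where "\<sigma> = sqrt V"
    have \<sigma>: "\<sigma> > 0" "\<sigma>\<^sup>2 = V" using V0 False by (auto simp: \<sigma>_def)
    have wc: "weak_conv_m (\<lambda>n. distr M borel (\<lambda>x. (\<Sum>i<n. X i x) / sqrt (real n * \<sigma>\<^sup>2))) std_normal_distribution"
      by (rule central_limit_theorem_zero_mean[OF ind mean \<sigma>(1) int2 _ distr])
        (simp add: mean second \<sigma>(2))
    have rd: "real_distribution (distr M borel (\<lambda>x. (\<Sum>i<n. X i x) / sqrt (real n * \<sigma>\<^sup>2)))" for n
      by (rule real_distribution_distr) measurable
    have rdN: "real_distribution std_normal_distribution" by (rule real_dist_normal_dist)
    have "(\<lambda>n. integral\<^sup>L (distr M borel (\<lambda>x. (\<Sum>i<n. X i x) / sqrt (real n * \<sigma>\<^sup>2))) (\<lambda>u. cos (\<sigma> * u + \<theta>)))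
      \<longlonglongrightarrow> (\<integral>u. cos (\<sigma> * u + \<theta>) \<partial>std_normal_distribution)"
      by (rule weak_conv_imp_integral_bdd_continuous_conv[OF rd rdN wc, where B = 1]) auto
    moreover have "integral\<^sup>L (distr M borel (\<lambda>x. (\<Sum>i<n. X i x) / sqrt (real n * \<sigma>\<^sup>2))) (\<lambda>u. cos (\<sigma> * u + \<theta>)) =
        expectation (\<lambda>\<omega>. cos ((\<Sum>i<n. X i \<omega>) / sqrt (real n) + \<theta>))" for n
    proof -
      have "\<sigma> * (s / sqrt (real n * \<sigma>\<^sup>2)) = s / sqrt (real n)" for s
        using \<sigma>(1) by (simp add: real_sqrt_mult)
      then show ?thesis by (subst integral_distr) simp_all
    qed
    ultimately show ?thesis by (simp add: \<sigma>_def)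
  qed
qed

text \<open>The cosine is 1-Lipschitz and bounded.\<close>

lemma slutsky_cos:
  fixes X Y :: "nat \<Rightarrow> 'a \<Rightarrow> nat \<Rightarrow> real^'q"
  assumes M: "prob_space M"
    and X: "\<And>n. X n \<in> borel_measurable M" and Y: "\<And>n. Y n \<in> borel_measurable M"
    and close: "\<And>k \<delta>. k < m \<Longrightarrow> \<delta> > 0 \<Longrightarrow>
      (\<lambda>n. measure M {\<omega> \<in> space M. norm (X n \<omega> k - Y n \<omega> k) > \<delta>}) \<longlonglongrightarrow> 0"
    and lim: "(\<lambda>n. \<integral>\<omega>. cos (linear_functional m c (Y n \<omega>) + \<theta>) \<partial>M) \<longlonglongrightarrow> l"
  shows "(\<lambda>n. \<integral>\<omega>. cos (linear_functional m c (X n \<omega>) + \<theta>) \<partial>M) \<longlonglongrightarrow> l"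
proof -
  interpret prob_space M by fact
  define fX where "fX n \<omega> = cos (linear_functional m c (X n \<omega>) + \<theta>)" for n \<omega>
  define fY where "fY n \<omega> = cos (linear_functional m c (Y n \<omega>) + \<theta>)" for n \<omega>
  have fm [measurable]: "fX n \<in> borel_measurable M" "fY n \<in> borel_measurable M" for n
    unfolding fX_def[abs_def] fY_def[abs_def]
    using measurable_compose[OF X linear_functional_measurable] measurable_compose[OF Y linear_functional_measurable]
    by auto
  have fi: "integrable M (fX n)" "integrable M (fY n)" for n
    by (rule integrable_const_bound[where B = 1]; simp add: fX_def)
      (rule integrable_const_bound[where B = 1]; simp add: fY_def)
  define C where "C = (\<Sum>k<m. norm (c k))"
  have C: "C \<ge> 0" by (simp add: C_def sum_nonneg)
  have cosdiff: "\<bar>cos x - cos y\<bar> \<le> \<bar>x - y\<bar>" for x y :: real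
  proof -
    have "cos x - cos y = 2 * sin ((x + y) / 2) * sin ((y - x) / 2)" by (rule cos_diff_cos)
    then have "\<bar>cos x - cos y\<bar> = 2 * (\<bar>sin ((x + y) / 2)\<bar> * \<bar>sin ((y - x) / 2)\<bar>)" by (simp add: abs_mult)
    also have "\<dots> \<le> 2 * (1 * \<bar>(y - x) / 2\<bar>)"
      by (intro mult_left_mono mult_mono abs_sin_le_one abs_sin_x_le_abs_x) auto
    finally show ?thesis by (simp add: abs_minus_commute)
  qed
  have "(\<lambda>n. expectation (fX n) - expectation (fY n)) \<longlonglongrightarrow> 0"
  proof (rule LIMSEQ_I)
    fix e :: real assume e: "e > 0"
    define \<delta> where "\<delta> = e / (2 * (C + 1))"
    have \<delta>: "\<delta> > 0" "C * \<delta> < e / 2 + e / 4"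
    proof -
      show "\<delta> > 0" using e C by (simp add: \<delta>_def)
      have "C * \<delta> \<le> (C + 1) * \<delta>" using \<open>\<delta> > 0\<close> by (intro mult_right_mono) auto
      also have "\<dots> = e / 2" using C by (simp add: \<delta>_def field_simps)
      finally show "C * \<delta> < e / 2 + e / 4" using e by simp
    qed
    define A where "A n k = {\<omega> \<in> space M. norm (X n \<omega> k - Y n \<omega> k) > \<delta>}" for n k
    have Xk: "(\<lambda>\<omega>. X n \<omega> k) \<in> borel_measurable M" and Yk: "(\<lambda>\<omega>. Y n \<omega> k) \<in> borel_measurable M" for n k
      using measurable_product_then_coordinatewise[OF X] measurable_product_then_coordinatewise[OF Y] by auto
    have Am [measurable]: "A n k \<in> sets M" for n k
      unfolding A_def using Xk[of n k] Yk[of n k] by measurable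
    have bound: "\<bar>expectation (fX n) - expectation (fY n)\<bar> \<le> C * \<delta> + 2 * (\<Sum>k<m. measure M (A n k))" for n
    proof -
      have "\<bar>expectation (fX n) - expectation (fY n)\<bar> = \<bar>expectation (\<lambda>\<omega>. fX n \<omega> - fY n \<omega>)\<bar>" using fi by simp
      also have "\<dots> \<le> expectation (\<lambda>\<omega>. \<bar>fX n \<omega> - fY n \<omega>\<bar>)" by (rule integral_abs_bound)
      also have "\<dots> \<le> expectation (\<lambda>\<omega>. C * \<delta> + 2 * (\<Sum>k<m. indicator (A n k) \<omega>))"
      proof (rule integral_mono)
        fix \<omega> assume \<omega>: "\<omega> \<in> space M"
        show "\<bar>fX n \<omega> - fY n \<omega>\<bar> \<le> C * \<delta> + 2 * (\<Sum>k<m. indicator (A n k) \<omega>)"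
        proof (cases "\<exists>k<m. \<omega> \<in> A n k")
          case True
          then obtain k where k: "k < m" "\<omega> \<in> A n k" by blast
          have "indicator (A n k) \<omega> \<le> (\<Sum>k<m. indicator (A n k) \<omega> :: real)"
            using k by (intro member_le_sum) auto
          then have "(\<Sum>k<m. indicator (A n k) \<omega> :: real) \<ge> 1" using k by simp
          moreover have "\<bar>fX n \<omega>\<bar> \<le> 1" "\<bar>fY n \<omega>\<bar> \<le> 1" by (auto simp: fX_def fY_def)
          moreover have "C * \<delta> \<ge> 0" using C \<delta> by simp
          ultimately show ?thesis by linarith
        next
          case False
          then have small: "norm (X n \<omega> k - Y n \<omega> k) \<le> \<delta>" if "k < m" for k
            using that \<omega> by (force simp: A_def)
          have "\<bar>fX n \<omega> - fY n \<omega>\<bar> \<le> \<bar>linear_functional m c (X n \<omega>) - linear_functional m c (Y n \<omega>)\<bar>"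
            unfolding fX_def fY_def using cosdiff[of "linear_functional m c (X n \<omega>) + \<theta>" "linear_functional m c (Y n \<omega>) + \<theta>"] by simp
          also have "\<dots> = \<bar>\<Sum>k<m. inner (c k) (X n \<omega> k - Y n \<omega> k)\<bar>"
            by (simp add: linear_functional_def inner_diff_right sum_subtractf)
          also have "\<dots> \<le> (\<Sum>k<m. norm (c k) * norm (X n \<omega> k - Y n \<omega> k))"
            by (rule sum_abs[THEN order_trans]) (intro sum_mono Cauchy_Schwarz_ineq2)
          also have "\<dots> \<le> (\<Sum>k<m. norm (c k) * \<delta>)" by (intro sum_mono mult_left_mono small) auto
          also have "\<dots> = C * \<delta>" by (simp add: C_def sum_distrib_right)
          also have "\<dots> \<le> C * \<delta> + 2 * (\<Sum>k<m. indicator (A n k) \<omega>)" by (simp add: sum_nonneg)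
          finally show ?thesis .
        qed
      qed (use fi in \<open>auto simp: less_top[symmetric]\<close>)
      also have "\<dots> = C * \<delta> + 2 * (\<Sum>k<m. measure M (A n k))"
        by (simp add: prob_space less_top[symmetric])
      finally show ?thesis .
    qed
    have "(\<lambda>n. 2 * (\<Sum>k<m. measure M (A n k))) \<longlonglongrightarrow> 2 * (\<Sum>k<m. 0)"
      unfolding A_def by (intro tendsto_intros close \<delta>(1)) auto
    from order_tendstoD(2)[OF this, of "e / 4"] e
    obtain n0 where n0: "\<And>n. n \<ge> n0 \<Longrightarrow> 2 * (\<Sum>k<m. measure M (A n k)) < e / 4"
      by (auto simp: eventually_sequentially)
    show "\<exists>n0. \<forall>n\<ge>n0. norm (expectation (fX n) - expectation (fY n) - 0) < e"
    proof (intro exI[of _ n0] allI impI)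
      fix n assume "n \<ge> n0"
      then show "norm (expectation (fX n) - expectation (fY n) - 0) < e"
        using bound[of n] n0[of n] \<delta>(2) by simp
    qed
  qed
  from tendsto_add[OF this lim[folded fY_def]] have "(\<lambda>n. expectation (fX n)) \<longlonglongrightarrow> l" by simp
  then show ?thesis unfolding fX_def[abs_def] .
qed

text \<open>The one-dimensional theorem gives the limits of all linear functionals of the normalized
  sums, Slutsky's lemma transfers them to the perturbed vectors \<open>X n\<close>, and Chebyshev's inequality gives the
  tightness that the Cramer-Wold device asks for.\<close>

theorem multivariate_central_limit:
  fixes w :: "nat \<Rightarrow> nat \<Rightarrow> 'a \<Rightarrow> real^'q" and X :: "nat \<Rightarrow> 'a \<Rightarrow> nat \<Rightarrow> real^'q"
    and \<Sigma> :: "nat \<Rightarrow> nat \<Rightarrow> real^'q^'q"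
  assumes M: "prob_space M"
    and w: "\<And>i k. k < m \<Longrightarrow> w i k \<in> borel_measurable M"
    and ind: "\<And>c. prob_space.indep_vars M (\<lambda>_. borel) (\<lambda>i \<omega>. \<Sum>k<m. inner (c k) (w i k \<omega>)) UNIV"
    and distr: "\<And>c i. distr M borel (\<lambda>\<omega>. \<Sum>k<m. inner (c k) (w i k \<omega>)) = distr M borel (\<lambda>\<omega>. \<Sum>k<m. inner (c k) (w 0 k \<omega>))"
    and mean: "\<And>k j. k < m \<Longrightarrow> integrable M (\<lambda>\<omega>. w 0 k \<omega> $ j) \<and> (\<integral>\<omega>. w 0 k \<omega> $ j \<partial>M) = 0"
    and second: "\<And>k l i j. k < m \<Longrightarrow> l < m \<Longrightarrow> integrable M (\<lambda>\<omega>. w 0 k \<omega> $ i * w 0 l \<omega> $ j) \<and>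
      (\<integral>\<omega>. w 0 k \<omega> $ i * w 0 l \<omega> $ j \<partial>M) = \<Sigma> k l $ i $ j"
    and X: "\<And>n. X n \<in> borel_measurable M" and Xz: "\<And>n \<omega> k. k \<ge> m \<Longrightarrow> X n \<omega> k = 0"
    and close: "\<And>k \<delta>. k < m \<Longrightarrow> \<delta> > 0 \<Longrightarrow>
      (\<lambda>n. measure M {\<omega> \<in> space M. norm (X n \<omega> k - (1 / sqrt (real n)) *\<^sub>R (\<Sum>i<n. w i k \<omega>)) > \<delta>}) \<longlonglongrightarrow> 0"
  shows "\<exists>L. gaussian_law m (\<lambda>_. 0) \<Sigma> L \<and>
    (\<forall>g :: (nat \<Rightarrow> real^'q) \<Rightarrow> real. continuous_on UNIV g \<longrightarrow> bounded (range g) \<longrightarrow> (\<lambda>n. \<integral>\<omega>. g (X n \<omega>) \<partial>M) \<longlonglongrightarrow> (\<integral>z. g z \<partial>L))"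
proof -
  interpret prob_space M by fact
  define \<xi> where "\<xi> c i \<omega> = (\<Sum>k<m. inner (c k) (w i k \<omega>))" for c :: "nat \<Rightarrow> real^'q" and i \<omega>
  define Q where "Q c = (\<Sum>k<m. \<Sum>i\<in>UNIV. \<Sum>l<m. \<Sum>j\<in>UNIV.
    c k $ i * c l $ j * \<Sigma> k l $ i $ j)" for c :: "nat \<Rightarrow> real^'q"
  have \<xi>m [measurable]: "\<xi> c i \<in> borel_measurable M" for c i
    unfolding \<xi>_def[abs_def] by (intro borel_measurable_sum borel_measurable_inner borel_measurable_const w) auto
  have \<xi>0: "\<xi> c 0 \<omega> = (\<Sum>k<m. \<Sum>i\<in>UNIV. c k $ i * w 0 k \<omega> $ i)" for c \<omega>
    by (simp add: \<xi>_def inner_vec_def)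
  have \<xi>sq: "(\<xi> c 0 \<omega>)\<^sup>2 = (\<Sum>k<m. \<Sum>i\<in>UNIV. \<Sum>l<m. \<Sum>j\<in>UNIV.
      c k $ i * c l $ j * (w 0 k \<omega> $ i * w 0 l \<omega> $ j))" for c \<omega>
    unfolding \<xi>0 power2_eq_square sum_distrib_left sum_distrib_right
    by (intro sum.cong refl) (simp add: mult_ac)
  have int0: "integrable M (\<xi> c 0)" "expectation (\<xi> c 0) = 0" for c
  proof -
    have i: "integrable M (\<lambda>\<omega>. c k $ i * w 0 k \<omega> $ i)" if "k < m" for k i
      using mean[OF that] by simp
    show "integrable M (\<xi> c 0)" unfolding \<xi>0[abs_def] by (intro Bochner_Integration.integrable_sum i) auto
    have "expectation (\<xi> c 0) = (\<Sum>k<m. \<Sum>i\<in>UNIV. expectation (\<lambda>\<omega>. c k $ i * w 0 k \<omega> $ i))"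
      unfolding \<xi>0[abs_def]
      by (subst Bochner_Integration.integral_sum, (intro Bochner_Integration.integrable_sum i; simp))
        (intro sum.cong refl Bochner_Integration.integral_sum i; simp)
    then show "expectation (\<xi> c 0) = 0" using mean by simp
  qed
  have sec0: "integrable M (\<lambda>\<omega>. (\<xi> c 0 \<omega>)\<^sup>2)" "expectation (\<lambda>\<omega>. (\<xi> c 0 \<omega>)\<^sup>2) = Q c" for c
  proof -
    have i: "integrable M (\<lambda>\<omega>. c k $ i * c l $ j * (w 0 k \<omega> $ i * w 0 l \<omega> $ j))"
      if "k < m" "l < m" for k l i j
      using second[OF that] by simp
    have e: "expectation (\<lambda>\<omega>. c k $ i * c l $ j * (w 0 k \<omega> $ i * w 0 l \<omega> $ j)) =
        c k $ i * c l $ j * \<Sigma> k l $ i $ j"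
      if "k < m" "l < m" for k l i j
      using second[OF that] by simp
    have hs: "has_bochner_integral M (\<lambda>\<omega>. (\<xi> c 0 \<omega>)\<^sup>2) (Q c)"
      unfolding \<xi>sq Q_def
    proof (intro has_bochner_integral_sum)
      fix k i l j assume "k \<in> {..<m}" "l \<in> {..<m}"
      then show "has_bochner_integral M (\<lambda>\<omega>. c k $ i * c l $ j * (w 0 k \<omega> $ i * w 0 l \<omega> $ j))
        (c k $ i * c l $ j * \<Sigma> k l $ i $ j)"
        using i e by (auto simp: has_bochner_integral_iff)
    qed
    show "integrable M (\<lambda>\<omega>. (\<xi> c 0 \<omega>)\<^sup>2)" "expectation (\<lambda>\<omega>. (\<xi> c 0 \<omega>)\<^sup>2) = Q c"
      using hs by (auto simp: has_bochner_integral_iff)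
  qed
  have tr: "distr M borel (\<xi> c i) = distr M borel (\<xi> c 0)" for c i unfolding \<xi>_def by (rule distr)
  note tr' = equal_distr_transfer[OF \<xi>m \<xi>m tr]
  have mom: "integrable M (\<xi> c i)" "expectation (\<xi> c i) = 0"
    "integrable M (\<lambda>\<omega>. (\<xi> c i \<omega>)\<^sup>2)" "expectation (\<lambda>\<omega>. (\<xi> c i \<omega>)\<^sup>2) = Q c" for c i
    using tr'(1)[of "\<lambda>u. u" c i] tr'(2)[of "\<lambda>u. u" c i] tr'(1)[of "\<lambda>u. u\<^sup>2" c i] tr'(2)[of "\<lambda>u. u\<^sup>2" c i] int0[of c] sec0[of c]
    by simp_all
  have ind': "indep_vars (\<lambda>_. borel) (\<xi> c) UNIV" for c using ind[of c] unfolding \<xi>_def[abs_def] .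
  have Q0: "Q c \<ge> 0" for c unfolding sec0(2)[symmetric] by (rule integral_nonneg_AE) simp
  have "\<exists>L. gaussian_law m (\<lambda>_. 0) \<Sigma> L \<and>
    (\<forall>c. distr L borel (\<lambda>z. \<Sum>k<m. inner (c k) (z k)) = distr std_normal_distribution borel (\<lambda>u. sqrt (Q c) * u))"
    unfolding Q_def
  proof (rule gaussian_law_exists)
    fix k l i j assume kl: "k < m" "l < m"
    have "\<Sigma> k l $ i $ j = (\<integral>\<omega>. w 0 k \<omega> $ i * w 0 l \<omega> $ j \<partial>M)"
      using second[OF kl] by simp
    also have "\<dots> = \<Sigma> l k $ j $ i"
      using second[OF kl(2,1), of j i] by (simp add: mult.commute)
    finally show "\<Sigma> k l $ i $ j = \<Sigma> l k $ j $ i" .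
  qed (use Q0 in \<open>simp add: Q_def\<close>)
  then obtain L where L: "gaussian_law m (\<lambda>_. 0) \<Sigma> L"
    "\<And>c. distr L borel (linear_functional m c) = distr std_normal_distribution borel (\<lambda>u. sqrt (Q c) * u)"
    unfolding linear_functional_def[abs_def] by blast
  have Lp: "prob_space L" "sets L = sets borel" "AE z in L. \<forall>k\<ge>m. z k = 0"
    using L(1) by (auto simp: gaussian_law_def)
  define Y where "Y n \<omega> k = (if k < m then (1 / sqrt (real n)) *\<^sub>R (\<Sum>i<n. w i k \<omega>) else 0)" for n \<omega> k
  have Ym: "Y n \<in> borel_measurable M" for n
  proof (rule measurable_coordinatewise_then_product)
    fix k
    show "(\<lambda>\<omega>. Y n \<omega> k) \<in> borel_measurable M"
      unfolding Y_def using w by (cases "k < m") auto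
  qed
  have lfY: "linear_functional m c (Y n \<omega>) = (\<Sum>i<n. \<xi> c i \<omega>) / sqrt (real n)" for c n \<omega>
  proof -
    have "linear_functional m c (Y n \<omega>) = (\<Sum>k<m. \<Sum>i<n. inner (c k) (w i k \<omega>) / sqrt (real n))"
      unfolding linear_functional_def by (intro sum.cong refl) (simp add: Y_def inner_sum_right sum_divide_distrib)
    also have "\<dots> = (\<Sum>i<n. \<Sum>k<m. inner (c k) (w i k \<omega>) / sqrt (real n))" by (rule sum.swap)
    finally show ?thesis by (simp add: \<xi>_def sum_divide_distrib)
  qed
  have lmL: "linear_functional m c \<in> borel_measurable L" for c
    using linear_functional_measurable measurable_cong_sets[OF Lp(2) refl] by blast
  have limY: "(\<lambda>n. expectation (\<lambda>\<omega>. cos (linear_functional m c (Y n \<omega>) + \<theta>))) \<longlonglongrightarrow> (\<integral>z. cos (linear_functional m c z + \<theta>) \<partial>L)" for c \<theta>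
  proof -
    have "(\<integral>z. cos (linear_functional m c z + \<theta>) \<partial>L) = integral\<^sup>L (distr L borel (linear_functional m c)) (\<lambda>u. cos (u + \<theta>))"
      by (rule integral_distr[OF lmL, symmetric]) simp
    also have "\<dots> = (\<integral>u. cos (sqrt (Q c) * u + \<theta>) \<partial>std_normal_distribution)"
      unfolding L(2) by (rule integral_distr) auto
    finally show ?thesis
      unfolding lfY using central_limit_cos[OF ind' tr mom(3,2,4), of c \<theta>] by simp
  qed
  have close': "(\<lambda>n. measure M {\<omega> \<in> space M. norm (X n \<omega> k - Y n \<omega> k) > \<delta>}) \<longlonglongrightarrow> 0" if "k < m" "\<delta> > 0" for k \<delta>
    using close[OF that] that by (simp add: Y_def)
  have limX: "(\<lambda>n. expectation (\<lambda>\<omega>. cos (linear_functional m c (X n \<omega>) + \<theta>))) \<longlonglongrightarrow> (\<integral>z. cos (linear_functional m c z + \<theta>) \<partial>L)" for c \<theta>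
    by (rule slutsky_cos[OF M X Ym close' limY])
  have Xk: "(\<lambda>\<omega>. X n \<omega> k) \<in> borel_measurable M" and Yk: "(\<lambda>\<omega>. Y n \<omega> k) \<in> borel_measurable M" for n k
    using measurable_product_then_coordinatewise[OF X] measurable_product_then_coordinatewise[OF Ym] by auto
  (* Testing with unit vectors expresses the second moment of the norm through the form Q. *)
  have normY: "measure M {\<omega> \<in> space M. norm (Y n \<omega> k) \<ge> R} \<le> (\<Sum>j\<in>UNIV. Q (\<lambda>l. if l = k then axis j 1 else 0)) / R\<^sup>2"
    if k: "k < m" and R: "R > 0" and n: "n > 0" for n k R
  proof -
    let ?c = "\<lambda>j l. if l = k then axis j 1 else (0 :: real^'q)"
    have \<xi>c: "\<xi> (?c j) i \<omega> = w i k \<omega> $ j" for i j \<omega>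
    proof -
      have "\<xi> (?c j) i \<omega> = (\<Sum>l<m. if l = k then w i k \<omega> $ j else 0)"
        unfolding \<xi>_def by (intro sum.cong refl) (auto simp: inner_axis')
      then show ?thesis using k by simp
    qed
    have comp: "Y n \<omega> k $ j = (\<Sum>i<n. \<xi> (?c j) i \<omega>) / sqrt (real n)" for \<omega> j
      using k unfolding \<xi>c by (simp add: Y_def)
    have sq: "(norm (Y n \<omega> k))\<^sup>2 = (\<Sum>j\<in>UNIV. (\<Sum>i<n. \<xi> (?c j) i \<omega>)\<^sup>2 / real n)" for \<omega>
      by (simp add: norm_vec_def L2_set_def sum_nonneg comp power_divide)
    note sm = iid_sum_second_moment[OF ind' mom(1,3,2,4), of _ n]
    have i: "integrable M (\<lambda>\<omega>. (norm (Y n \<omega> k))\<^sup>2)"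
      unfolding sq using sm by (intro Bochner_Integration.integrable_sum integrable_divide) blast
    have E: "expectation (\<lambda>\<omega>. (norm (Y n \<omega> k))\<^sup>2) = (\<Sum>j\<in>UNIV. Q (?c j))"
      unfolding sq using sm n by (subst Bochner_Integration.integral_sum) auto
    have "measure M {\<omega> \<in> space M. (norm (Y n \<omega> k))\<^sup>2 \<ge> R\<^sup>2} \<le> expectation (\<lambda>\<omega>. (norm (Y n \<omega> k))\<^sup>2) / R\<^sup>2"
      by (rule integral_Markov_inequality_measure[where A = "{}"]) (use i R in auto)
    moreover have "{\<omega> \<in> space M. (norm (Y n \<omega> k))\<^sup>2 \<ge> R\<^sup>2} = {\<omega> \<in> space M. norm (Y n \<omega> k) \<ge> R}"
      using R by (auto simp: abs_le_square_iff[symmetric])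
    ultimately show ?thesis using E by simp
  qed
  have tight: "\<exists>R. \<forall>\<^sub>F n in sequentially. measure M {\<omega> \<in> space M. \<exists>k<m. norm (X n \<omega> k) > R} \<le> \<epsilon>" if \<epsilon>: "\<epsilon> > 0" for \<epsilon>
  proof -
    define H where "H = (\<Sum>k<m. \<Sum>j\<in>UNIV. Q (\<lambda>l. if l = k then axis j 1 else 0))"
    have H: "H \<ge> 0" unfolding H_def by (intro sum_nonneg Q0)
    define R where "R = sqrt (2 * H / \<epsilon>) + 1"
    have R: "R > 0" "H / R\<^sup>2 \<le> \<epsilon> / 2"
    proof -
      show "R > 0" using H \<epsilon> by (simp add: R_def add_nonneg_pos)
      have "2 * H / \<epsilon> = (sqrt (2 * H / \<epsilon>))\<^sup>2" using H \<epsilon> by simp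
      also have "\<dots> \<le> R\<^sup>2" using H \<epsilon> by (intro power_mono) (auto simp: R_def)
      finally show "H / R\<^sup>2 \<le> \<epsilon> / 2" using \<open>R > 0\<close> \<epsilon> by (simp add: field_simps)
    qed
    have "(\<lambda>n. \<Sum>k<m. measure M {\<omega> \<in> space M. norm (X n \<omega> k - Y n \<omega> k) > 1}) \<longlonglongrightarrow> (\<Sum>k<m. 0)"
      by (intro tendsto_sum close') auto
    then have "\<forall>\<^sub>F n in sequentially. (\<Sum>k<m. measure M {\<omega> \<in> space M. norm (X n \<omega> k - Y n \<omega> k) > 1}) < \<epsilon> / 2"
      using \<epsilon> by (intro order_tendstoD(2)) auto
    then have "\<forall>\<^sub>F n in sequentially. measure M {\<omega> \<in> space M. \<exists>k<m. norm (X n \<omega> k) > R + 1} \<le> \<epsilon>"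
      using eventually_gt_at_top[of 0]
    proof eventually_elim
      case (elim n)
      define A where "A k = {\<omega> \<in> space M. norm (X n \<omega> k - Y n \<omega> k) > 1}" for k
      define D where "D k = {\<omega> \<in> space M. norm (Y n \<omega> k) \<ge> R}" for k
      have m: "A k \<in> sets M" "D k \<in> sets M" for k
        unfolding A_def D_def using Xk[of n k] Yk[of n k] by measurable
      have "measure M {\<omega> \<in> space M. \<exists>k<m. norm (X n \<omega> k) > R + 1} \<le> measure M (\<Union>k<m. A k \<union> D k)"
      proof (rule finite_measure_mono)
        show "{\<omega> \<in> space M. \<exists>k<m. norm (X n \<omega> k) > R + 1} \<subseteq> (\<Union>k<m. A k \<union> D k)"
        proof
          fix \<omega> assume "\<omega> \<in> {\<omega> \<in> space M. \<exists>k<m. norm (X n \<omega> k) > R + 1}"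
          then obtain k where k: "\<omega> \<in> space M" "k < m" "norm (X n \<omega> k) > R + 1" by auto
          have "norm (X n \<omega> k) \<le> norm (Y n \<omega> k) + norm (X n \<omega> k - Y n \<omega> k)" by (rule norm_triangle_sub)
          then have "\<omega> \<in> A k \<union> D k" using k by (auto simp: A_def D_def)
          then show "\<omega> \<in> (\<Union>k<m. A k \<union> D k)" using k(2) by blast
        qed
      qed (use m in auto)
      also have "\<dots> \<le> (\<Sum>k<m. measure M (A k \<union> D k))"
        by (rule finite_measure_subadditive_finite) (use m in auto)
      also have "\<dots> \<le> (\<Sum>k<m. measure M (A k) + measure M (D k))"
        by (intro sum_mono measure_Un_le m)
      also have "\<dots> \<le> (\<Sum>k<m. measure M (A k)) + (\<Sum>k<m. (\<Sum>j\<in>UNIV. Q (\<lambda>l. if l = k then axis j 1 else 0)) / R\<^sup>2)"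
        unfolding sum.distrib D_def using normY R(1) elim(2) by (intro add_left_mono sum_mono) auto
      also have "\<dots> \<le> \<epsilon> / 2 + H / R\<^sup>2"
        using elim(1) unfolding A_def H_def by (simp add: sum_divide_distrib)
      finally show ?case using R(2) by linarith
    qed
    then show ?thesis by blast
  qed
  show ?thesis
  proof (intro exI[of _ L] conjI allI impI L(1))
    fix g :: "(nat \<Rightarrow> real^'q) \<Rightarrow> real" assume g: "continuous_on UNIV g" "bounded (range g)"
    show "(\<lambda>n. \<integral>\<omega>. g (X n \<omega>) \<partial>M) \<longlonglongrightarrow> (\<integral>z. g z \<partial>L)"
      by (rule cramer_wold[OF M Lp X Xz tight limX g])
  qed
qed

section \<open>The sampling model\<close>

lemma (in prob_space) indep_sets_reindex:
  assumes ind: "indep_sets F I" and f: "inj_on f J" "f ` J \<subseteq> I"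
  shows "indep_sets (\<lambda>j. F (f j)) J"
proof (rule indep_setsI)
  show "F (f i) \<subseteq> events" if "i \<in> J" for i
    using ind f that unfolding indep_sets_def by auto
  fix A K assume K: "K \<noteq> {}" "K \<subseteq> J" "finite K" and A: "\<forall>j\<in>K. A j \<in> F (f j)"
  define A' where "A' s = A (the_inv_into J f s)" for s
  have A': "A' (f j) = A j" if "j \<in> K" for j
    using that K(2) f(1) by (auto simp: A'_def the_inv_into_f_f)
  have inj: "inj_on f K" using f(1) K(2) by (rule inj_on_subset)
  have "prob (\<Inter>s\<in>f ` K. A' s) = (\<Prod>s\<in>f ` K. prob (A' s))"
  proof (rule indep_setsD[OF ind])
    show "f ` K \<subseteq> I" using f(2) K(2) by blast
    show "\<forall>j\<in>f ` K. A' j \<in> F j" using A A' by auto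
  qed (use K in auto)
  moreover have "(\<Inter>s\<in>f ` K. A' s) = (\<Inter>j\<in>K. A j)" using A' by auto
  moreover have "(\<Prod>s\<in>f ` K. prob (A' s)) = (\<Prod>j\<in>K. prob (A j))"
    by (subst prod.reindex[OF inj]) (auto simp: A' intro!: prod.cong)
  ultimately show "prob (\<Inter>j\<in>K. A j) = (\<Prod>j\<in>K. prob (A j))" by simp
qed

lemma (in prob_space) indep_vars_vimage_algebra:
  assumes rv: "\<And>i. i \<in> I \<Longrightarrow> X i \<in> measurable M (N i)"
    and ind: "indep_sets (\<lambda>i. sets (vimage_algebra (space M) (X i) (N i))) I"
  shows "indep_vars N X I"
  unfolding indep_vars_def2
proof (intro conjI ballI rv)
  have "{X i -` A \<inter> space M |A. A \<in> sets (N i)} = sets (vimage_algebra (space M) (X i) (N i))" if "i \<in> I" for i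
    using rv[OF that] by (intro sets_vimage_algebra2[symmetric]) (auto dest: measurable_space)
  then show "indep_sets (\<lambda>i. {X i -` A \<inter> space M |A. A \<in> sets (N i)}) I"
    using ind by (simp cong: indep_sets_cong)
qed

locale functional_data =
  fixes M :: "'a measure" and E :: "'e measure"
    and a b \<delta> :: real and p :: nat
    and x :: "nat \<Rightarrow> 'a \<Rightarrow> real^'q" and \<beta> :: "real \<Rightarrow> real^'q"
    and v :: "nat \<Rightarrow> real \<Rightarrow> 'a \<Rightarrow> real" and \<gamma> :: "real \<Rightarrow> real \<Rightarrow> real"
    and \<epsilon> :: "real \<Rightarrow> 'e \<Rightarrow> real" and \<sigma>2 :: "real \<Rightarrow> real"
    and N :: "nat \<Rightarrow> nat \<Rightarrow> nat" and T e :: "nat \<Rightarrow> nat \<Rightarrow> nat \<Rightarrow> 'a \<Rightarrow> real"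
    and \<pi> K :: "real \<Rightarrow> real" and h :: "nat \<Rightarrow> real" and \<Omega> :: "real^'q^'q"
  assumes ab: "a < b" and p_odd: "odd p"
    and model: "functional_linear_model M E a b x v \<gamma> \<epsilon> \<sigma>2 N T e"
    and condA: "condition_A M a b p x \<beta> v \<gamma> \<sigma>2 N T \<pi> K h \<delta>"
    and condB: "condition_B M a b x v \<Omega>"
    and bandwidth: "h \<in> \<Theta>(\<lambda>n. real n powr (- \<delta> / (2 * real p + 3)))"
begin

sublocale prob_space M
  using model by (simp add: functional_linear_model_def)

abbreviation path where "path i \<omega> \<equiv> \<lambda>t\<in>{a..b}. v i t \<omega>"
abbreviation path_space where "path_space \<equiv> PiM {a..b} (\<lambda>_. borel :: real measure)"
abbreviation f where "f \<equiv> individual_fun x \<beta> v"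
abbreviation f_hat where "f_hat \<equiv> reconstruction p K h N T (observation x \<beta> v T e)"

lemma x_measurable [measurable]: "x i \<in> borel_measurable M"
  using model by (simp add: functional_linear_model_def)

lemma x_component_measurable [measurable]: "(\<lambda>\<omega>. x i \<omega> $ k) \<in> borel_measurable M"
  by (rule measurable_compose[OF x_measurable borel_measurable_vec_nth])

lemma effects: "subject_effects M a b v \<gamma>"
  using model by (simp add: functional_linear_model_def)

lemma path_measurable [measurable]: "path i \<in> measurable M path_space"
  using effects by (simp add: subject_effects_def)

lemma path_distr: "distr M path_space (path i) = distr M path_space (path 0)"
  using effects unfolding subject_effects_def by blast

lemma v_mean: "t \<in> {a..b} \<Longrightarrow> integrable M (v i t)" "t \<in> {a..b} \<Longrightarrow> expectation (v i t) = 0"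
  using effects unfolding subject_effects_def by blast+

lemma v_second: "s \<in> {a..b} \<Longrightarrow> t \<in> {a..b} \<Longrightarrow> integrable M (\<lambda>\<omega>. v i s \<omega> * v i t \<omega>)"
  "s \<in> {a..b} \<Longrightarrow> t \<in> {a..b} \<Longrightarrow> expectation (\<lambda>\<omega>. v i s \<omega> * v i t \<omega>) = \<gamma> s t"
  using effects unfolding subject_effects_def by blast+

lemma v_measurable: "t \<in> {a..b} \<Longrightarrow> v i t \<in> borel_measurable M"
  using v_mean(1) by (rule borel_measurable_integrable)

lemma f_measurable: "t \<in> {a..b} \<Longrightarrow> f i t \<in> borel_measurable M"
  unfolding individual_fun_def[abs_def] using v_measurable by measurable

lemma T_measurable: "i < n \<Longrightarrow> j < N n i \<Longrightarrow> T n i j \<in> borel_measurable M"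
  using model by (simp add: functional_linear_model_def)

lemma sources_indep: "indep_sets (source_events M a b x v (T n)) (sources n (N n))"
  using model by (simp add: functional_linear_model_def)

lemma noise: "white_noise E a b \<epsilon> \<sigma>2"
  using model by (simp add: functional_linear_model_def)

lemma errors: "measurement_errors M E a b x v \<epsilon> N T e"
  using model by (simp add: functional_linear_model_def)

lemma e_measurable: "i < n \<Longrightarrow> j < N n i \<Longrightarrow> e n i j \<in> borel_measurable M"
  using errors by (simp add: measurement_errors_def)

lemma design: "design_density a b \<pi>"
  using condA by (simp add: condition_A_def)

lemma T_range: "i < n \<Longrightarrow> j < N n i \<Longrightarrow> \<omega> \<in> space M \<Longrightarrow> T n i j \<omega> \<in> {a..b}"
  using condA unfolding condition_A_def by blast

lemma T_distributed: "i < n \<Longrightarrow> j < N n i \<Longrightarrow> distributed M lborel (T n i j) (\<lambda>t. ennreal (\<pi> t))"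
  using condA unfolding condition_A_def by blast

lemma smooth_interior: "smooth_model_on {a<..<b} p M x \<beta> v \<gamma> \<sigma>2"
  using condA by (simp add: condition_A_def)

lemma kernel: "kernel_density K"
  using condA by (simp add: condition_A_def)

lemma delta_pos: "\<delta> > 0"
  using condA by (simp add: condition_A_def)

lemma h_pos: "h n > 0"
  using condA by (simp add: condition_A_def)

lemma h_limit: "h \<longlonglongrightarrow> 0"
  using condA by (simp add: condition_A_def)

lemma p_pos: "p > 0"
  using p_odd by (cases p) auto

lemma x_distr: "distr M borel (x i) = distr M borel (x 0)"
  using condB unfolding condition_B_def by blast

lemma x0_second: "integrable M (\<lambda>\<omega>. x 0 \<omega> $ k * x 0 \<omega> $ l)"
  "expectation (\<lambda>\<omega>. x 0 \<omega> $ k * x 0 \<omega> $ l) = \<Omega> $ k $ l"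
  using condB unfolding condition_B_def by blast+

lemma Omega_invertible: "invertible \<Omega>"
  using condB by (simp add: condition_B_def)

lemmas x_transfer = equal_distr_transfer[OF x_measurable x_measurable x_distr]

lemma x_second: "integrable M (\<lambda>\<omega>. x i \<omega> $ k * x i \<omega> $ l)"
  "expectation (\<lambda>\<omega>. x i \<omega> $ k * x i \<omega> $ l) = \<Omega> $ k $ l"
proof -
  have m: "(\<lambda>y :: real^'q. y $ k * y $ l) \<in> borel_measurable borel" by measurable
  show "integrable M (\<lambda>\<omega>. x i \<omega> $ k * x i \<omega> $ l)"
    using x_transfer(1)[OF m, of i] x0_second(1) by simp
  show "expectation (\<lambda>\<omega>. x i \<omega> $ k * x i \<omega> $ l) = \<Omega> $ k $ l"
    using x_transfer(2)[OF m, of i] x0_second(2) by simp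
qed

definition x_power :: real where "x_power = expectation (\<lambda>\<omega>. (norm (x 0 \<omega>))\<^sup>2)"

lemma x_norm_square: "(norm (x i \<omega>))\<^sup>2 = (\<Sum>k\<in>UNIV. x i \<omega> $ k * x i \<omega> $ k)"
  by (simp add: norm_vec_def L2_set_def sum_nonneg power2_eq_square)

lemma x_norm_second: "integrable M (\<lambda>\<omega>. (norm (x i \<omega>))\<^sup>2)" "expectation (\<lambda>\<omega>. (norm (x i \<omega>))\<^sup>2) = x_power"
proof -
  show "integrable M (\<lambda>\<omega>. (norm (x i \<omega>))\<^sup>2)"
    unfolding x_norm_square by (intro Bochner_Integration.integrable_sum x_second)
  have "(\<lambda>y :: real^'q. (norm y)\<^sup>2) \<in> borel_measurable borel" by measurable
  from x_transfer(2)[OF this, of i] show "expectation (\<lambda>\<omega>. (norm (x i \<omega>))\<^sup>2) = x_power"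
    by (simp add: x_power_def)
qed

lemma x_power_nonneg: "x_power \<ge> 0"
  unfolding x_power_def by (rule integral_nonneg_AE) simp

lemma covariates_indep: "indep_vars (\<lambda>_. borel) x UNIV"
proof (rule indep_vars_vimage_algebra)
  have "indep_sets (\<lambda>i. source_events M a b x v (T 0) (Covariate i)) UNIV"
    by (rule indep_sets_reindex[OF sources_indep[of 0]]) (auto simp: inj_on_def sources_def)
  then show "indep_sets (\<lambda>i. sets (vimage_algebra (space M) (x i) borel)) UNIV" by simp
qed measurable

lemma design_indep: "i < n \<Longrightarrow> indep_vars (\<lambda>_. borel) (T n i) {..<N n i}"
proof (rule indep_vars_vimage_algebra)
  assume i: "i < n"
  show "T n i j \<in> borel_measurable M" if "j \<in> {..<N n i}" for j using T_measurable i that by simp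
  have "indep_sets (\<lambda>j. source_events M a b x v (T n) (Design i j)) {..<N n i}"
    by (rule indep_sets_reindex[OF sources_indep[of n]]) (use i in \<open>auto simp: inj_on_def sources_def\<close>)
  then show "indep_sets (\<lambda>j. sets (vimage_algebra (space M) (T n i j) borel)) {..<N n i}" by simp
qed

lemma covariate_effect_indep:
  "indep_set (sets (vimage_algebra (space M) (x i) borel)) (sets (vimage_algebra (space M) (path i) path_space))"
proof -
  have "indep_sets (\<lambda>b'. source_events M a b x v (T 0) (if b' then Covariate i else Effect i)) UNIV"
    by (rule indep_sets_reindex[OF sources_indep[of 0]]) (auto simp: inj_on_def sources_def)
  moreover have "source_events M a b x v (T 0) (if b' then Covariate i else Effect i) =
      (case b' of True \<Rightarrow> sets (vimage_algebra (space M) (x i) borel)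
        | False \<Rightarrow> sets (vimage_algebra (space M) (path i) path_space))" for b'
    by (cases b') auto
  ultimately show ?thesis unfolding indep_set_def by simp
qed

lemma covariate_effect_distr:
  "distr M (borel \<Otimes>\<^sub>M path_space) (\<lambda>\<omega>. (x i \<omega>, path i \<omega>)) =
   distr M (borel \<Otimes>\<^sub>M path_space) (\<lambda>\<omega>. (x 0 \<omega>, path 0 \<omega>))"
proof -
  have pr: "distr M borel (x i) \<Otimes>\<^sub>M distr M path_space (path i) =
      distr M (borel \<Otimes>\<^sub>M path_space) (\<lambda>\<omega>. (x i \<omega>, path i \<omega>))" for i
  proof (rule pair_measure_eqI)
    interpret X: prob_space "distr M borel (x i)" by (rule prob_space_distr) measurable
    interpret P: prob_space "distr M path_space (path i)" by (rule prob_space_distr) measurable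
    show "sigma_finite_measure (distr M borel (x i))" "sigma_finite_measure (distr M path_space (path i))"
      by unfold_locales
    show "sets (distr M borel (x i) \<Otimes>\<^sub>M distr M path_space (path i)) =
        sets (distr M (borel \<Otimes>\<^sub>M path_space) (\<lambda>\<omega>. (x i \<omega>, path i \<omega>)))"
      by (simp cong: sets_pair_measure_cong)
    fix A B assume "A \<in> sets (distr M borel (x i))" "B \<in> sets (distr M path_space (path i))"
    then have AB: "A \<in> sets borel" "B \<in> sets path_space" by auto
    have pm: "(\<lambda>\<omega>. (x i \<omega>, path i \<omega>)) \<in> measurable M (borel \<Otimes>\<^sub>M path_space)" by measurable
    have AxB: "A \<times> B \<in> sets (borel \<Otimes>\<^sub>M path_space)" using AB by (rule pair_measureI)
    have "prob (x i -` A \<inter> space M \<inter> (path i -` B \<inter> space M)) =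
        prob (x i -` A \<inter> space M) * prob (path i -` B \<inter> space M)"
      using covariate_effect_indep[of i, unfolded indep_sets2_eq]
        in_vimage_algebra[OF AB(1), of "x i" "space M"] in_vimage_algebra[OF AB(2), of "path i" "space M"]
      by (elim conjE) (drule bspec, assumption, drule bspec, assumption, assumption)
    moreover have "(\<lambda>\<omega>. (x i \<omega>, path i \<omega>)) -` (A \<times> B) \<inter> space M =
        x i -` A \<inter> space M \<inter> (path i -` B \<inter> space M)" by auto
    ultimately show "emeasure (distr M borel (x i)) A * emeasure (distr M path_space (path i)) B =
        emeasure (distr M (borel \<Otimes>\<^sub>M path_space) (\<lambda>\<omega>. (x i \<omega>, path i \<omega>))) (A \<times> B)"
      unfolding emeasure_distr[OF x_measurable AB(1)] emeasure_distr[OF path_measurable AB(2)] emeasure_distr[OF pm AxB]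
      by (simp add: emeasure_eq_measure ennreal_mult')
  qed
  show ?thesis unfolding pr[symmetric] x_distr[of i] path_distr[of i] ..
qed

text \<open>The pairs of covariate and effect path are independent across subjects, because they generate
  disjoint groups of the independent sources.\<close>

lemma subject_functional_iid:
  fixes \<Phi> :: "(real^'q) \<times> (real \<Rightarrow> real) \<Rightarrow> real"
  assumes \<Phi>: "\<Phi> \<in> borel_measurable (borel \<Otimes>\<^sub>M path_space)"
  shows "indep_vars (\<lambda>_. borel) (\<lambda>i \<omega>. \<Phi> (x i \<omega>, path i \<omega>)) UNIV"
    "distr M borel (\<lambda>\<omega>. \<Phi> (x i \<omega>, path i \<omega>)) = distr M borel (\<lambda>\<omega>. \<Phi> (x 0 \<omega>, path 0 \<omega>))"
proof -
  have pm: "(\<lambda>\<omega>. (x i \<omega>, path i \<omega>)) \<in> measurable M (borel \<Otimes>\<^sub>M path_space)" for i by measurable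
  have dd: "distr M borel (\<lambda>\<omega>. \<Phi> (x i \<omega>, path i \<omega>)) =
      distr (distr M (borel \<Otimes>\<^sub>M path_space) (\<lambda>\<omega>. (x i \<omega>, path i \<omega>))) borel \<Phi>" for i
    by (subst distr_distr[OF \<Phi> pm]) (simp add: comp_def)
  show "distr M borel (\<lambda>\<omega>. \<Phi> (x i \<omega>, path i \<omega>)) = distr M borel (\<lambda>\<omega>. \<Phi> (x 0 \<omega>, path 0 \<omega>))"
    unfolding dd covariate_effect_distr[of i] ..
  define F where "F = source_events M a b x v (T 0)"
  define I where "I i = {Covariate i, Effect i}" for i
  have ev: "F s \<subseteq> Pow (space M)" if s: "s \<in> (\<Union>i. I i)" for s
  proof -
    obtain i where "s = Covariate i \<or> s = Effect i" using s by (auto simp: I_def)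
    then show ?thesis
      using sets.space_closed[of "vimage_algebra (space M) (x i) borel"]
        sets.space_closed[of "vimage_algebra (space M) (path i) path_space"]
      by (elim disjE) (simp_all add: F_def)
  qed
  have "indep_sets F (\<Union>i\<in>UNIV. I i)"
    unfolding F_def by (rule indep_sets_mono_index[OF _ sources_indep[of 0]]) (auto simp: I_def sources_def)
  then have coll: "indep_sets (\<lambda>i. sigma_sets (space M) (\<Union>s\<in>I i. F s)) UNIV"
  proof (rule indep_sets_collect_sigma)
    show "Int_stable (F s)" if "i \<in> UNIV" "s \<in> I i" for i s
      using that sets.Int_stable by (auto simp: F_def I_def)
    show "disjoint_family_on I UNIV" by (auto simp: disjoint_family_on_def I_def)
  qed
  show "indep_vars (\<lambda>_. borel) (\<lambda>i \<omega>. \<Phi> (x i \<omega>, path i \<omega>)) UNIV"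
    unfolding indep_vars_def2
  proof (intro conjI ballI)
    show "(\<lambda>\<omega>. \<Phi> (x i \<omega>, path i \<omega>)) \<in> borel_measurable M" for i
      by (rule measurable_compose[OF pm \<Phi>])
    show "indep_sets (\<lambda>i. {(\<lambda>\<omega>. \<Phi> (x i \<omega>, path i \<omega>)) -` A \<inter> space M |A. A \<in> sets borel}) UNIV"
    proof (rule indep_sets_mono_sets[OF coll])
      fix i :: nat
      define R where "R = sigma (space M) (\<Union>s\<in>I i. F s)"
      have sub: "(\<Union>s\<in>I i. F s) \<subseteq> Pow (space M)" using ev by blast
      have Rs: "sets R = sigma_sets (space M) (\<Union>s\<in>I i. F s)" and Rsp: "space R = space M"
        unfolding R_def using sub by (auto simp: sets_measure_of space_measure_of_conv)
      have xR: "x i \<in> measurable R borel"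
      proof (rule measurableI)
        fix B :: "(real^'q) set" assume "B \<in> sets borel"
        then have "x i -` B \<inter> space M \<in> F (Covariate i)" by (simp add: F_def in_vimage_algebra)
        then show "x i -` B \<inter> space R \<in> sets R" unfolding Rs Rsp by (intro sigma_sets.Basic) (auto simp: I_def)
      qed simp
      have pR: "path i \<in> measurable R path_space"
      proof (rule measurableI)
        fix B assume "B \<in> sets path_space"
        then have "path i -` B \<inter> space M \<in> F (Effect i)" by (simp add: F_def in_vimage_algebra)
        then show "path i -` B \<inter> space R \<in> sets R" unfolding Rs Rsp by (intro sigma_sets.Basic) (auto simp: I_def)
      qed (use Rsp measurable_space[OF path_measurable] in auto)
      have "(\<lambda>\<omega>. \<Phi> (x i \<omega>, path i \<omega>)) \<in> measurable R borel"
        by (rule measurable_compose[OF measurable_Pair[OF xR pR] \<Phi>])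
      then show "{(\<lambda>\<omega>. \<Phi> (x i \<omega>, path i \<omega>)) -` A \<inter> space M |A. A \<in> sets borel} \<subseteq> sigma_sets (space M) (\<Union>s\<in>I i. F s)"
        unfolding Rs[symmetric] using measurable_sets[of _ R borel] Rsp by auto
    qed
  qed
qed

lemma covariate_effect_product:
  fixes g :: "real^'q \<Rightarrow> real" and r :: "(real \<Rightarrow> real) \<Rightarrow> real"
  assumes g: "g \<in> borel_measurable borel" and r: "r \<in> borel_measurable path_space"
    and int: "integrable M (\<lambda>\<omega>. g (x i \<omega>))" "integrable M (\<lambda>\<omega>. r (path i \<omega>))"
  shows "integrable M (\<lambda>\<omega>. g (x i \<omega>) * r (path i \<omega>))"
    "expectation (\<lambda>\<omega>. g (x i \<omega>) * r (path i \<omega>)) = expectation (\<lambda>\<omega>. g (x i \<omega>)) * expectation (\<lambda>\<omega>. r (path i \<omega>))"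
proof -
  have iv: "indep_var borel (\<lambda>\<omega>. g (x i \<omega>)) borel (\<lambda>\<omega>. r (path i \<omega>))"
    unfolding indep_var_eq
  proof (intro conjI)
    show "(\<lambda>\<omega>. g (x i \<omega>)) \<in> borel_measurable M" by (rule measurable_compose[OF x_measurable g])
    show "(\<lambda>\<omega>. r (path i \<omega>)) \<in> borel_measurable M" by (rule measurable_compose[OF path_measurable r])
    have 1: "sigma_sets (space M) {(\<lambda>\<omega>. g (x i \<omega>)) -` A \<inter> space M |A. A \<in> sets borel} \<subseteq>
        sets (vimage_algebra (space M) (x i) borel)"
    proof -
      have "(\<lambda>\<omega>. g (x i \<omega>)) -` A \<inter> space M \<in> sets (vimage_algebra (space M) (x i) borel)" if "A \<in> sets borel" for A
      proof -
        have "(\<lambda>\<omega>. g (x i \<omega>)) -` A \<inter> space M = x i -` (g -` A) \<inter> space M" by auto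
        then show ?thesis using measurable_sets[OF g that] by (simp add: in_vimage_algebra)
      qed
      then show ?thesis
        using sets.sigma_sets_subset[of "{(\<lambda>\<omega>. g (x i \<omega>)) -` A \<inter> space M |A. A \<in> sets borel}" "vimage_algebra (space M) (x i) borel"]
        by auto
    qed
    have 2: "sigma_sets (space M) {(\<lambda>\<omega>. r (path i \<omega>)) -` A \<inter> space M |A. A \<in> sets borel} \<subseteq>
        sets (vimage_algebra (space M) (path i) path_space)"
    proof -
      have "(\<lambda>\<omega>. r (path i \<omega>)) -` A \<inter> space M \<in> sets (vimage_algebra (space M) (path i) path_space)" if "A \<in> sets borel" for A
      proof -
        have "(\<lambda>\<omega>. r (path i \<omega>)) -` A \<inter> space M = path i -` (r -` A \<inter> space path_space) \<inter> space M"
          using measurable_space[OF path_measurable] by auto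
        then show ?thesis using in_vimage_algebra[OF measurable_sets[OF r that], of "path i" "space M"] by (simp only:)
      qed
      then show ?thesis
        using sets.sigma_sets_subset[of "{(\<lambda>\<omega>. r (path i \<omega>)) -` A \<inter> space M |A. A \<in> sets borel}" "vimage_algebra (space M) (path i) path_space"]
        by auto
    qed
    show "indep_set (sigma_sets (space M) {(\<lambda>\<omega>. g (x i \<omega>)) -` A \<inter> space M |A. A \<in> sets borel})
        (sigma_sets (space M) {(\<lambda>\<omega>. r (path i \<omega>)) -` A \<inter> space M |A. A \<in> sets borel})"
      using covariate_effect_indep[of i] 1 2 unfolding indep_sets2_eq by blast
  qed
  show "integrable M (\<lambda>\<omega>. g (x i \<omega>) * r (path i \<omega>))" by (rule indep_var_integrable[OF iv int])
  show "expectation (\<lambda>\<omega>. g (x i \<omega>) * r (path i \<omega>)) = expectation (\<lambda>\<omega>. g (x i \<omega>)) * expectation (\<lambda>\<omega>. r (path i \<omega>))"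
    by (rule indep_var_lebesgue_integral[OF iv int])
qed

text \<open>The weak law of large numbers, entry by entry.\<close>

lemma gram_LLN:
  assumes eta: "\<eta> > 0"
  shows "(\<lambda>n. prob {\<omega> \<in> space M. \<not> (\<forall>k l. \<bar>gram n (\<lambda>i. x i \<omega>) $ k $ l / real n - \<Omega> $ k $ l\<bar> \<le> \<eta>)}) \<longlonglongrightarrow> 0"
proof -
  have gram: "gram n (\<lambda>i. x i \<omega>) $ k $ l = (\<Sum>i<n. x i \<omega> $ k * x i \<omega> $ l)" for n \<omega> k l
    by (simp add: gram_def)
  define P where "P n k l = {\<omega> \<in> space M. \<eta> \<le> \<bar>(\<Sum>i<n. x i \<omega> $ k * x i \<omega> $ l) / real n - \<Omega> $ k $ l\<bar>}" for n k l
  have Pm [measurable]: "P n k l \<in> events" for n k l unfolding P_def by measurable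
  have lim: "(\<lambda>n. prob (P n k l)) \<longlonglongrightarrow> 0" for k l
  proof -
    define g where "g y = y $ k * y $ l" for y :: "real^'q"
    have gm [measurable]: "g \<in> borel_measurable borel" unfolding g_def[abs_def] by measurable
    have ind: "indep_vars (\<lambda>_. borel) (\<lambda>i \<omega>. g (x i \<omega>)) UNIV"
      by (rule indep_vars_compose2[OF covariates_indep]) measurable
    have dist: "distr M borel (\<lambda>\<omega>. g (x i \<omega>)) = distr M borel (\<lambda>\<omega>. g (x 0 \<omega>))" for i
    proof -
      have "distr M borel (\<lambda>\<omega>. g (x i \<omega>)) = distr (distr M borel (x i)) borel g" for i
        by (subst distr_distr[OF gm x_measurable]) (simp add: comp_def)
      then show ?thesis using x_distr[of i] by simp
    qed
    have "(\<lambda>n. prob {\<omega> \<in> space M. \<eta> \<le> \<bar>(\<Sum>i<n. g (x i \<omega>)) / real n - expectation (\<lambda>\<omega>. g (x 0 \<omega>))\<bar>}) \<longlonglongrightarrow> 0"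
      by (rule weak_law_of_large_numbers[OF ind dist _ eta]) (simp add: g_def x0_second)
    then show ?thesis by (simp add: P_def g_def x0_second)
  qed
  have le: "prob {\<omega> \<in> space M. \<not> (\<forall>k l. \<bar>gram n (\<lambda>i. x i \<omega>) $ k $ l / real n - \<Omega> $ k $ l\<bar> \<le> \<eta>)}
      \<le> (\<Sum>kl\<in>UNIV. prob (P n (fst kl) (snd kl)))" for n
  proof -
    have "prob {\<omega> \<in> space M. \<not> (\<forall>k l. \<bar>gram n (\<lambda>i. x i \<omega>) $ k $ l / real n - \<Omega> $ k $ l\<bar> \<le> \<eta>)}
        \<le> prob (\<Union>kl\<in>UNIV. P n (fst kl) (snd kl))"
    proof (rule finite_measure_mono)
      show "{\<omega> \<in> space M. \<not> (\<forall>k l. \<bar>gram n (\<lambda>i. x i \<omega>) $ k $ l / real n - \<Omega> $ k $ l\<bar> \<le> \<eta>)}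
        \<subseteq> (\<Union>kl\<in>UNIV. P n (fst kl) (snd kl))"
      proof
        fix \<omega> assume "\<omega> \<in> {\<omega> \<in> space M. \<not> (\<forall>k l. \<bar>gram n (\<lambda>i. x i \<omega>) $ k $ l / real n - \<Omega> $ k $ l\<bar> \<le> \<eta>)}"
        then obtain k l where "\<omega> \<in> space M" "\<not> \<bar>gram n (\<lambda>i. x i \<omega>) $ k $ l / real n - \<Omega> $ k $ l\<bar> \<le> \<eta>"
          by auto
        then have "\<omega> \<in> P n (fst (k, l)) (snd (k, l))" unfolding gram P_def by simp
        then show "\<omega> \<in> (\<Union>kl\<in>UNIV. P n (fst kl) (snd kl))" by blast
      qed
    qed measurable
    also have "\<dots> \<le> (\<Sum>kl\<in>UNIV. prob (P n (fst kl) (snd kl)))"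
      by (rule finite_measure_subadditive_finite) auto
    finally show ?thesis .
  qed
  have "(\<lambda>n. \<Sum>kl\<in>(UNIV :: ('q \<times> 'q) set). prob (P n (fst kl) (snd kl))) \<longlonglongrightarrow> (\<Sum>kl\<in>(UNIV :: ('q \<times> 'q) set). 0)"
    by (intro tendsto_sum lim)
  then have "(\<lambda>n. \<Sum>kl\<in>(UNIV :: ('q \<times> 'q) set). prob (P n (fst kl) (snd kl))) \<longlonglongrightarrow> 0" by simp
  then show ?thesis
    by (rule tendsto_sandwich[OF always_eventually[OF allI] always_eventually[OF allI] tendsto_const, rotated 2])
      (rule measure_nonneg le)+
qed

end

section \<open>Well-spread designs\<close>

text \<open>The polynomial factor of the weights is at most \<open>(p + 1) / lam\<close> on the support of the kernel; the
  remaining sums are dominated by the moment of order 0.\<close>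

lemma lpk_weight_bounds:
  assumes K: "kernel_density K" "\<And>u. K u \<le> BK" and h: "h > 0" and m: "m > 0" and lam: "lam > 0"
    and coer: "\<And>c :: nat \<Rightarrow> real. lam * (\<Sum>k\<le>p. (c k)\<^sup>2) \<le>
      (\<Sum>k\<le>p. \<Sum>l\<le>p. c k * c l * design_moment K h m ts t (k + l))"
    and S0: "design_moment K h m ts t 0 \<le> S0"
  defines "A \<equiv> (real p + 1) / lam"
  shows "j < m \<Longrightarrow> \<bar>lpk_weight p K h m ts t j\<bar> \<le> A * (K ((ts j - t) / h) / (real m * h))"
    "(\<Sum>j<m. \<bar>lpk_weight p K h m ts t j\<bar>) \<le> A * S0"
    "(\<Sum>j<m. (lpk_weight p K h m ts t j)\<^sup>2) \<le> A\<^sup>2 * BK * S0 / (real m * h)"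
    "l \<le> p \<Longrightarrow> (\<Sum>j<m. lpk_weight p K h m ts t j * (ts j - t) ^ l) = (if l = 0 then 1 else 0)"
proof -
  define u where "u j = (ts j - t) / h" for j
  define w where "w = lpk_weight p K h m ts t"
  have K0: "K y \<ge> 0" for y by (rule kernel_densityD(4)[OF K(1)])
  have mh: "real m * h > 0" using m h by simp
  have A0: "A \<ge> 0" using lam by (simp add: A_def)
  have BK0: "BK \<ge> 0" using K0[of 0] K(2)[of 0] by linarith
  from lpk_weight_coercive[OF h m lam coer] obtain c where c': "(\<Sum>k\<le>p. (c k)\<^sup>2) \<le> (1 / lam)\<^sup>2 \<and>
    (\<forall>j<m. w j = K (u j) / (real m * h) * (\<Sum>k\<le>p. c k * u j ^ k)) \<and>
    (\<forall>l\<le>p. (\<Sum>j<m. w j * (ts j - t) ^ l) = (if l = 0 then 1 else 0))"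
    unfolding w_def u_def by (elim exE)
  note c = conjunct1[OF c'] conjunct1[OF conjunct2[OF c'], rule_format] conjunct2[OF conjunct2[OF c'], rule_format]
  have ck: "\<bar>c k\<bar> \<le> 1 / lam" if "k \<le> p" for k
  proof -
    have "(c k)\<^sup>2 \<le> (\<Sum>k\<le>p. (c k)\<^sup>2)" using that by (intro member_le_sum) auto
    then have "(c k)\<^sup>2 \<le> (1 / lam)\<^sup>2" using c(1) by linarith
    then show ?thesis using lam by (simp add: abs_le_square_iff[symmetric] del: power_one_over)
  qed
  have wb: "\<bar>w j\<bar> \<le> A * (K (u j) / (real m * h))" if j: "j < m" for j
  proof (cases "\<bar>u j\<bar> > 1")
    case True
    then show ?thesis using c(2)[OF j] kernel_densityD(6)[OF K(1)] by simp
  next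
    case False
    have "\<bar>\<Sum>k\<le>p. c k * u j ^ k\<bar> \<le> (\<Sum>k\<le>p. 1 / lam * 1)"
    proof (rule sum_abs[THEN order_trans], rule sum_mono)
      fix k assume "k \<in> {..p}"
      moreover have "\<bar>u j\<bar> ^ k \<le> 1" using False by (intro power_le_one) auto
      ultimately have "\<bar>c k\<bar> * \<bar>u j\<bar> ^ k \<le> 1 / lam * 1" using ck lam by (intro mult_mono) auto
      then show "\<bar>c k * u j ^ k\<bar> \<le> 1 / lam * 1" by (simp add: abs_mult power_abs)
    qed
    also have "\<dots> = A" by (simp add: A_def)
    finally have "K (u j) / (real m * h) * \<bar>\<Sum>k\<le>p. c k * u j ^ k\<bar> \<le> K (u j) / (real m * h) * A"
      using K0 mh by (intro mult_left_mono) auto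
    moreover have "\<bar>h\<bar> = h" using h by simp
    ultimately show ?thesis using c(2)[OF j] K0 mh by (simp add: abs_mult mult.commute)
  qed
  then show "j < m \<Longrightarrow> \<bar>lpk_weight p K h m ts t j\<bar> \<le> A * (K ((ts j - t) / h) / (real m * h))"
    unfolding w_def u_def .
  have Ksum: "(\<Sum>j<m. K (u j) / (real m * h)) = design_moment K h m ts t 0"
    unfolding design_moment_def u_def by (simp add: sum_divide_distrib)
  have "(\<Sum>j<m. \<bar>w j\<bar>) \<le> (\<Sum>j<m. A * (K (u j) / (real m * h)))" by (intro sum_mono wb) auto
  also have "\<dots> = A * design_moment K h m ts t 0" by (simp only: sum_distrib_left[symmetric] Ksum)
  also have "\<dots> \<le> A * S0" using S0 A0 by (rule mult_left_mono)
  finally show l1: "(\<Sum>j<m. \<bar>lpk_weight p K h m ts t j\<bar>) \<le> A * S0" unfolding w_def .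
  have "(\<Sum>j<m. (w j)\<^sup>2) \<le> (\<Sum>j<m. (A\<^sup>2 * BK / (real m * h)) * (K (u j) / (real m * h)))"
  proof (intro sum_mono)
    fix j assume "j \<in> {..<m}"
    then have "\<bar>w j\<bar> \<le> A * (K (u j) / (real m * h))" by (intro wb) auto
    then have "\<bar>w j\<bar>\<^sup>2 \<le> (A * (K (u j) / (real m * h)))\<^sup>2" by (intro power_mono) auto
    also have "\<dots> = A\<^sup>2 / (real m * h) * (K (u j) / (real m * h)) * K (u j)" by (simp add: power2_eq_square)
    also have "\<dots> \<le> A\<^sup>2 / (real m * h) * (K (u j) / (real m * h)) * BK"
      using K0 mh K(2) by (intro mult_left_mono) auto
    finally show "(w j)\<^sup>2 \<le> (A\<^sup>2 * BK / (real m * h)) * (K (u j) / (real m * h))" by (simp add: mult_ac)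
  qed
  also have "\<dots> = (A\<^sup>2 * BK / (real m * h)) * design_moment K h m ts t 0" by (simp only: sum_distrib_left[symmetric] Ksum)
  also have "\<dots> \<le> (A\<^sup>2 * BK / (real m * h)) * S0" using S0 BK0 mh by (intro mult_left_mono) auto
  finally show "(\<Sum>j<m. (lpk_weight p K h m ts t j)\<^sup>2) \<le> A\<^sup>2 * BK * S0 / (real m * h)" unfolding w_def by simp
  show "l \<le> p \<Longrightarrow> (\<Sum>j<m. lpk_weight p K h m ts t j * (ts j - t) ^ l) = (if l = 0 then 1 else 0)"
    using c(3) unfolding w_def .
qed

text \<open>Reproduction of polynomials removes the Taylor polynomial with coefficients \<open>d\<close> except for its
  value \<open>d 0\<close> at \<open>t\<close>.\<close>

lemma lpk_error_decomposition:
  assumes repr: "\<And>l. l \<le> p \<Longrightarrow> (\<Sum>j<m. lpk_weight p K h m ts t j * (ts j - t) ^ l) = (if l = 0 then 1 else 0)"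
  shows "lpk p K h m ts (\<lambda>j. F j + e j) t - d 0 =
    (\<Sum>j<m. lpk_weight p K h m ts t j * (F j - (\<Sum>k\<le>p. d k * (ts j - t) ^ k))) +
    (\<Sum>j<m. lpk_weight p K h m ts t j * e j)"
proof -
  let ?w = "lpk_weight p K h m ts t"
  have "(\<Sum>j<m. ?w j * (\<Sum>k\<le>p. d k * (ts j - t) ^ k)) = (\<Sum>k\<le>p. d k * (\<Sum>j<m. ?w j * (ts j - t) ^ k))"
    unfolding sum_distrib_left by (subst sum.swap) (simp add: mult_ac)
  also have "\<dots> = (\<Sum>k\<le>p. if k = 0 then d 0 else 0)" by (intro sum.cong refl) (auto simp: repr)
  also have "\<dots> = d 0" by simp
  finally have "(\<Sum>j<m. ?w j * (\<Sum>k\<le>p. d k * (ts j - t) ^ k)) = d 0" .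
  then show ?thesis
    unfolding lpk_linear[of p K h m ts "\<lambda>j. F j + e j"]
    by (simp add: right_diff_distrib distrib_left sum.distrib sum_subtractf)
qed

context functional_data
begin

lemma pi_nonneg: "\<pi> y \<ge> 0"
  using design by (simp add: design_density_def)

lemma sample_size_bound: "\<exists>C>0. \<forall>n. \<forall>i<n. real (N n i) \<ge> C * real n powr \<delta>"
  using condA by (simp add: condition_A_def)

lemma pi_integrable: "integrable lborel \<pi>"
proof -
  obtain C where C: "C > 0" "\<And>n i. i < n \<Longrightarrow> real (N n i) \<ge> C * real n powr \<delta>" using sample_size_bound by blast
  have "N 1 0 > 0" using C(2)[of 0 1] C(1) by (cases "N 1 0") auto
  then have dist: "distributed M lborel (T 1 0 0) (\<lambda>t. ennreal (\<pi> t))" by (intro T_distributed) auto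
  have m: "(\<lambda>t. ennreal (\<pi> t)) \<in> borel_measurable lborel" using dist by (simp add: distributed_def)
  have "(\<lambda>t. enn2real (ennreal (\<pi> t))) \<in> borel_measurable lborel" using m by measurable
  then have pm: "\<pi> \<in> borel_measurable lborel" using pi_nonneg by simp
  have "(\<integral>\<^sup>+t. ennreal (\<pi> t) * 1 \<partial>lborel) = (\<integral>\<^sup>+\<omega>. 1 \<partial>M)"
    by (rule distributed_nn_integral[OF dist]) simp
  then have "(\<integral>\<^sup>+t. ennreal (\<pi> t) \<partial>lborel) < \<infinity>" by (simp add: emeasure_space_1)
  then show ?thesis using pm pi_nonneg by (intro integrableI_nonneg) auto
qed

text \<open>The uniformity that the estimates need near the points of \<open>J\<close>: the design points within distance
  \<open>h0\<close> of \<open>J\<close> lie in \<open>{c<..<d}\<close>, on at least one side of each point of \<open>J\<close> the density is at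
  least \<open>c1\<close>, and it is at most \<open>C1\<close> except for its meaningless values at the end points \<open>a\<close> and \<open>b\<close>.\<close>

definition window :: "real \<Rightarrow> real \<Rightarrow> real \<Rightarrow> real \<Rightarrow> real \<Rightarrow> real set \<Rightarrow> bool" where
  "window c d c1 C1 h0 J \<longleftrightarrow> a \<le> c \<and> c < d \<and> d \<le> b \<and> 0 < c1 \<and> 0 < h0 \<and>
    (\<forall>t\<in>J. c < t \<and> t < d) \<and>
    (\<forall>t\<in>J. \<forall>y. \<bar>y - t\<bar> \<le> h0 \<longrightarrow> a < y \<longrightarrow> y < b \<longrightarrow> c < y \<and> y < d) \<and>
    (\<forall>t\<in>J. \<forall>r. 0 < r \<longrightarrow> r \<le> h0 \<longrightarrow> (\<exists>sg. (sg = 1 \<or> sg = - 1) \<and> (\<forall>u. 0 < u \<longrightarrow> u < 1 \<longrightarrow> c1 \<le> \<pi> (t + sg * r * u)))) \<and>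
    (\<forall>t\<in>J. \<forall>y. \<bar>y - t\<bar> \<le> h0 \<longrightarrow> y \<noteq> a \<longrightarrow> y \<noteq> b \<longrightarrow> \<pi> y \<le> C1)"

lemma pi_outside: "y < a \<or> b < y \<Longrightarrow> \<pi> y = 0"
  using design unfolding design_density_def by (metis atLeastAtMost_iff not_le)

lemma pi_derivative:
  "\<exists>\<pi>'. continuous_on {a..b} \<pi>' \<and> (\<forall>t. a < t \<longrightarrow> t < b \<longrightarrow> (\<pi> has_real_derivative \<pi>' t) (at t))"
  using design unfolding design_density_def by auto

text \<open>A compact subset of the open interval keeps a positive distance from the end points, and on a slightly
  larger compact interval the continuous density is bounded from both sides.\<close>

lemma window_compact:
  assumes J: "J \<subseteq> {a<..<b}" "compact J"
  shows "\<exists>c d c1 C1 h0. window c d c1 C1 h0 J \<and> {c..d} \<subseteq> {a<..<b}"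
proof -
  define J' where "J' = insert ((a + b) / 2) J"
  have J': "J' \<subseteq> {a<..<b}" "compact J'" "J' \<noteq> {}" using J ab by (auto simp: J'_def)
  obtain lo where lo: "lo \<in> J'" "\<And>t. t \<in> J' \<Longrightarrow> lo \<le> t" using compact_attains_inf[OF J'(2,3)] by blast
  obtain hi where hi: "hi \<in> J'" "\<And>t. t \<in> J' \<Longrightarrow> t \<le> hi" using compact_attains_sup[OF J'(2,3)] by blast
  have lh: "a < lo" "lo \<le> hi" "hi < b" using lo hi J'(1) by auto
  define c where "c = (a + lo) / 2"
  define d where "d = (hi + b) / 2"
  define h0 where "h0 = min (lo - c) (d - hi) / 2"
  have cd: "a < c" "c < lo" "hi < d" "d < b" "h0 > 0" "h0 < lo - c" "h0 < d - hi"
    using lh by (auto simp: c_def d_def h0_def min_def field_simps)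
  obtain \<pi>' where d\<pi>: "continuous_on {a..b} \<pi>' \<and> (\<forall>t. a < t \<longrightarrow> t < b \<longrightarrow> (\<pi> has_real_derivative \<pi>' t) (at t))"
    using pi_derivative by (elim exE)
  note \<pi>' = conjunct2[OF d\<pi>, rule_format]
  have cont: "continuous_on {c..d} \<pi>"
    using \<pi>' cd by (intro continuous_at_imp_continuous_on ballI DERIV_isCont[OF \<pi>']) auto
  obtain y1 where y1: "y1 \<in> {c..d}" "\<And>y. y \<in> {c..d} \<Longrightarrow> \<pi> y1 \<le> \<pi> y"
    using continuous_attains_inf[OF compact_Icc _ cont] lh cd by force
  obtain y2 where y2: "y2 \<in> {c..d}" "\<And>y. y \<in> {c..d} \<Longrightarrow> \<pi> y \<le> \<pi> y2"
    using continuous_attains_sup[OF compact_Icc _ cont] lh cd by force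
  have "\<pi> y1 > 0" using design y1(1) cd unfolding design_density_def by auto
  have near: "y \<in> {c..d}" if "t \<in> J" "\<bar>y - t\<bar> \<le> h0" for t y
    using lo(2)[of t] hi(2)[of t] that cd by (auto simp: J'_def)
  have "window c d (\<pi> y1) (\<pi> y2) h0 J"
    unfolding window_def
  proof (intro conjI ballI allI impI)
    show "c < t" "t < d" if "t \<in> J" for t using lo(2)[of t] hi(2)[of t] that cd by (auto simp: J'_def)
    show "c < y" "y < d" if "t \<in> J" "\<bar>y - t\<bar> \<le> h0" for t y
      using lo(2)[of t] hi(2)[of t] that cd by (auto simp: J'_def)
    show "\<exists>sg. (sg = 1 \<or> sg = - 1) \<and> (\<forall>u. 0 < u \<longrightarrow> u < 1 \<longrightarrow> \<pi> y1 \<le> \<pi> (t + sg * r * u))"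
      if "t \<in> J" "0 < r" "r \<le> h0" for t r
    proof (intro exI[of _ 1] conjI allI impI)
      fix u :: real assume u: "0 < u" "u < 1"
      have "r * u \<le> r * 1" using u that by (intro mult_left_mono) auto
      moreover have "0 \<le> r * u" using u that by simp
      ultimately have "\<bar>(t + 1 * r * u) - t\<bar> \<le> h0" using that(3) by simp
      then show "\<pi> y1 \<le> \<pi> (t + 1 * r * u)" by (intro y1(2) near[OF that(1)])
    qed simp
    show "\<pi> y \<le> \<pi> y2" if "t \<in> J" "\<bar>y - t\<bar> \<le> h0" for t y by (intro y2(2) near[OF that])
  qed (use cd lh \<open>\<pi> y1 > 0\<close> in auto)
  moreover have "{c..d} \<subseteq> {a<..<b}" using cd by auto
  ultimately show ?thesis by blast
qed

text \<open>A point close to one end point is far from the other one, so at least one side is free.\<close>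

lemma window_regular:
  assumes J: "J \<subseteq> {a<..<b}" and reg: "regular_up_to_boundary M a b p x \<beta> v \<gamma> \<sigma>2 \<pi>"
  shows "\<exists>c1 C1 h0. window a b c1 C1 h0 J"
proof -
  obtain c1 where c1: "c1 > 0" "\<And>t. a < t \<Longrightarrow> t < b \<Longrightarrow> c1 \<le> \<pi> t"
    using reg unfolding regular_up_to_boundary_def by auto
  obtain \<pi>' where d\<pi>: "continuous_on {a..b} \<pi>' \<and> (\<forall>t. a < t \<longrightarrow> t < b \<longrightarrow> (\<pi> has_real_derivative \<pi>' t) (at t))"
    using pi_derivative by (elim exE)
  note \<pi>' = conjunct1[OF d\<pi>] conjunct2[OF d\<pi>, rule_format]
  have "bounded (\<pi>' ` {a..b})" by (intro compact_imp_bounded compact_continuous_image \<pi>'(1)) simp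
  then obtain B where "\<forall>y\<in>\<pi>' ` {a..b}. norm y \<le> B" unfolding bounded_iff by (elim exE)
  then have B: "\<And>t. t \<in> {a..b} \<Longrightarrow> \<bar>\<pi>' t\<bar> \<le> B" by simp
  define mid where "mid = (a + b) / 2"
  have mid: "a < mid" "mid < b" using ab by (auto simp: mid_def)
  have B0: "B \<ge> 0" using B[of a] ab by auto
  have upper: "\<pi> y \<le> \<pi> mid + B * (b - a)" if y: "a < y" "y < b" for y
  proof -
    have "norm (\<pi> y - \<pi> mid) \<le> B * norm (y - mid)"
    proof (rule field_differentiable_bound[of "{a<..<b}"])
      show "(\<pi> has_field_derivative \<pi>' z) (at z within {a<..<b})" if "z \<in> {a<..<b}" for z
        using \<pi>'(2)[of z] that by (auto intro: has_field_derivative_at_within)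
      show "norm (\<pi>' z) \<le> B" if "z \<in> {a<..<b}" for z using B[of z] that by auto
    qed (use y mid in auto)
    also have "\<dots> \<le> B * (b - a)" using y mid B0 by (intro mult_left_mono) auto
    finally show ?thesis by simp
  qed
  define h0 where "h0 = (b - a) / 4"
  have h0: "h0 > 0" using ab by (simp add: h0_def)
  have "window a b c1 (\<pi> mid + B * (b - a)) h0 J"
    unfolding window_def
  proof (intro conjI ballI allI impI)
    show "\<exists>sg. (sg = 1 \<or> sg = - 1) \<and> (\<forall>u. 0 < u \<longrightarrow> u < 1 \<longrightarrow> c1 \<le> \<pi> (t + sg * r * u))"
      if t: "t \<in> J" and r: "0 < r" "r \<le> h0" for t r
    proof -
      have tab: "a < t" "t < b" using t J by auto
      have ru: "0 < r * u \<and> r * u < h0" if "0 < u" "u < 1" for u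
      proof -
        have "r * u < r * 1" using that r by (intro mult_strict_left_mono) auto
        then have "r * u < h0" using r(2) by simp
        then show ?thesis using that r by simp
      qed
      show ?thesis
      proof (cases "t \<le> mid")
        case True
        have "c1 \<le> \<pi> (t + 1 * r * u)" if "0 < u" "u < 1" for u
          using ru[OF that] True tab by (intro c1(2)) (auto simp: h0_def mid_def)
        then show ?thesis by blast
      next
        case False
        have "c1 \<le> \<pi> (t + (- 1) * r * u)" if "0 < u" "u < 1" for u
          using ru[OF that] False tab by (intro c1(2)) (auto simp: h0_def mid_def)
        then show ?thesis by blast
      qed
    qed
    show "\<pi> y \<le> \<pi> mid + B * (b - a)" if "y \<noteq> a" "y \<noteq> b" for y
    proof (cases "a < y \<and> y < b")
      case True
      then show ?thesis using upper by blast
    next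
      case False
      then have "\<pi> y = 0" using that by (intro pi_outside) auto
      then show ?thesis using pi_nonneg[of mid] B0 ab by simp
    qed
  qed (use ab c1 h0 J in auto)
  then show ?thesis by blast
qed

lemma window_exists:
  assumes J: "J \<subseteq> {a<..<b}" and "compact J \<or> regular_up_to_boundary M a b p x \<beta> v \<gamma> \<sigma>2 \<pi>"
  shows "\<exists>S c d c1 C1 h0. window c d c1 C1 h0 J \<and> {c..d} \<subseteq> S \<and> S \<subseteq> {a..b} \<and> smooth_model_on S p M x \<beta> v \<gamma> \<sigma>2"
proof (cases "compact J")
  case True
  from window_compact[OF J True] obtain c d c1 C1 h0 where "window c d c1 C1 h0 J" "{c..d} \<subseteq> {a<..<b}" by blast
  moreover have "{a<..<b} \<subseteq> {a..b}" by auto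
  ultimately show ?thesis using smooth_interior by blast
next
  case False
  then have reg: "regular_up_to_boundary M a b p x \<beta> v \<gamma> \<sigma>2 \<pi>" using assms by blast
  from window_regular[OF J reg] obtain c1 C1 h0 where "window a b c1 C1 h0 J" by blast
  moreover have "smooth_model_on {a..b} p M x \<beta> v \<gamma> \<sigma>2" using reg by (simp add: regular_up_to_boundary_def)
  ultimately show ?thesis by blast
qed

text \<open>Moments of order up to \<open>2 * p\<close> are the entries of the local moment matrix.  Design points at the end
  points, an event of probability 0, are excluded because the paths are smooth in the interior only.\<close>

definition good_design :: "nat \<Rightarrow> nat \<Rightarrow> real \<Rightarrow> real \<Rightarrow> 'a set" where
  "good_design n i t \<eta> = {\<omega> \<in> space M. (\<forall>j<N n i. a < T n i j \<omega> \<and> T n i j \<omega> < b) \<and>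
    (\<forall>l\<le>2 * p. \<bar>design_moment K (h n) (N n i) (\<lambda>j. T n i j \<omega>) t l - expected_moment K \<pi> (h n) t l\<bar> < \<eta>)}"

abbreviation source_field where
  "source_field n \<equiv> source_algebra M a b x v (T n) n (N n)"

lemma source_subalgebra: "subalgebra M (source_field n)"
  by (rule subalgebra_source_algebra[OF prob_space_axioms sources_indep])

lemma T_source_measurable: "i < n \<Longrightarrow> j < N n i \<Longrightarrow> T n i j \<in> borel_measurable (source_field n)"
  by (rule design_point_source_measurable[OF prob_space_axioms sources_indep])

lemma good_design_source:
  assumes i: "i < n"
  shows "good_design n i t \<eta> \<in> sets (source_field n)"
proof -
  note kernel_densityD(1)[OF kernel, measurable]
  have [measurable]: "\<And>j. j < N n i \<Longrightarrow> T n i j \<in> borel_measurable (source_field n)"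
    using T_source_measurable[OF i] .
  have sp: "space (source_field n) = space M" using source_subalgebra[of n] by (simp add: subalgebra_def)
  have [measurable]: "(\<lambda>\<omega>. design_moment K (h n) (N n i) (\<lambda>j. T n i j \<omega>) t l) \<in> borel_measurable (source_field n)" for l
    unfolding design_moment_def by measurable
  have eq: "good_design n i t \<eta> =
      {\<omega> \<in> space (source_field n). (\<forall>j\<in>{..<N n i}. a < T n i j \<omega> \<and> T n i j \<omega> < b) \<and>
    (\<forall>l\<in>{..2 * p}. \<bar>design_moment K (h n) (N n i) (\<lambda>j. T n i j \<omega>) t l - expected_moment K \<pi> (h n) t l\<bar> < \<eta>)}"
    by (auto simp: good_design_def sp)
  have 1: "{\<omega> \<in> space (source_field n). \<forall>j\<in>{..<N n i}. a < T n i j \<omega> \<and> T n i j \<omega> < b} \<in> sets (source_field n)"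
    by (intro sets.sets_Collect_finite_All sets.sets_Collect_conj) (auto intro!: borel_measurable_less)
  have 2: "{\<omega> \<in> space (source_field n). \<forall>l\<in>{..2 * p}. \<bar>design_moment K (h n) (N n i) (\<lambda>j. T n i j \<omega>) t l - expected_moment K \<pi> (h n) t l\<bar> < \<eta>} \<in> sets (source_field n)"
    by (intro sets.sets_Collect_finite_All) (auto intro!: borel_measurable_less)
  show ?thesis unfolding eq by (rule sets.sets_Collect_conj[OF 2 1])
qed

lemma good_design_sets: "i < n \<Longrightarrow> good_design n i t \<eta> \<in> sets M"
  using good_design_source source_subalgebra unfolding subalgebra_def by blast

lemma T_interior: "i < n \<Longrightarrow> j < N n i \<Longrightarrow> AE \<omega> in M. a < T n i j \<omega> \<and> T n i j \<omega> < b"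
proof -
  assume ij: "i < n" "j < N n i"
  have "AE y in lborel. y \<notin> {a, b}" by (intro AE_not_in finite_imp_null_set_lborel) simp
  then have "AE y in density lborel (\<lambda>t. ennreal (\<pi> t)). y \<notin> {a, b}"
    using T_distributed[OF ij] by (subst AE_density) (auto simp: distributed_def)
  then have ae: "AE y in density lborel (\<lambda>t. ennreal (\<pi> t)). y \<notin> {a, b}" .
  have eq: "distr M lborel (T n i j) = density lborel (\<lambda>t. ennreal (\<pi> t))"
    using T_distributed[OF ij] by (simp add: distributed_def)
  have "AE y in distr M lborel (T n i j). y \<notin> {a, b}"
    using ae by (simp only: eq)
  then have "AE \<omega> in M. T n i j \<omega> \<notin> {a, b}"
    using T_measurable[OF ij] by (subst (asm) AE_distr_iff) auto
  then show ?thesis using AE_space by eventually_elim (use T_range[OF ij] in force)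
qed

lemma good_design_prob:
  assumes i: "i < n" and N: "N n i > 0" and eta: "\<eta> > 0" and BK: "BK > 0" "\<And>u. K u \<le> BK"
  shows "prob (space M - good_design n i t \<eta>) \<le>
    (2 * real p + 1) * (2 * exp (- (real (N n i) * (h n)\<^sup>2 * \<eta>\<^sup>2 / (2 * BK\<^sup>2))))"
proof -
  note [measurable] = kernel_densityD(1)[OF kernel]
  have [measurable]: "\<And>j. j < N n i \<Longrightarrow> T n i j \<in> borel_measurable M" using T_measurable[OF i] .
  define P where "P l = {\<omega> \<in> space M. \<eta> \<le> \<bar>(\<Sum>j<N n i. K ((T n i j \<omega> - t) / h n) * ((T n i j \<omega> - t) / h n) ^ l) / (real (N n i) * h n)
      - (\<integral>u. K u * u ^ l * \<pi> (t + h n * u) \<partial>lborel)\<bar>}" for l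
  have Pm: "P l \<in> events" for l unfolding P_def by measurable
  have Pb: "prob (P l) \<le> 2 * exp (- (real (N n i) * (h n)\<^sup>2 * \<eta>\<^sup>2 / (2 * BK\<^sup>2)))" for l
    unfolding P_def
  proof (rule kernel_average_concentration[OF design_indep[OF i] T_distributed[OF i] pi_nonneg, of "\<lambda>u. K u * u ^ l"])
    show "\<bar>K u * u ^ l\<bar> \<le> BK" for u
    proof (cases "\<bar>u\<bar> > 1")
      case True
      then show ?thesis using kernel_densityD(6)[OF kernel] BK by simp
    next
      case False
      then have "\<bar>u\<bar> ^ l \<le> 1" by (intro power_le_one) auto
      then have "K u * \<bar>u\<bar> ^ l \<le> BK * 1" using BK kernel_densityD(4)[OF kernel]
        by (intro mult_mono) auto
      then show ?thesis using kernel_densityD(4)[OF kernel] by (simp add: abs_mult power_abs)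
    qed
  qed (use h_pos eta N BK in auto)
  define Z where "Z = {\<omega> \<in> space M. \<not> (\<forall>j\<in>{..<N n i}. a < T n i j \<omega> \<and> T n i j \<omega> < b)}"
  have "AE \<omega> in M. \<forall>j\<in>{..<N n i}. a < T n i j \<omega> \<and> T n i j \<omega> < b"
    by (intro AE_finite_allI) (use T_interior[OF i] in auto)
  then have "AE \<omega> in M. \<omega> \<notin> Z" by eventually_elim (simp add: Z_def)
  moreover have Zm: "Z \<in> events"
  proof -
    have "{\<omega> \<in> space M. \<forall>j\<in>{..<N n i}. a < T n i j \<omega> \<and> T n i j \<omega> < b} \<in> events"
      by (intro sets.sets_Collect_finite_All sets.sets_Collect_conj) (auto intro!: borel_measurable_less)
    then show ?thesis unfolding Z_def by (rule sets.sets_Collect_neg)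
  qed
  ultimately have Z0: "prob Z = 0" by (subst prob_eq_0) auto
  have "space M - good_design n i t \<eta> \<subseteq> Z \<union> (\<Union>l\<in>{..2 * p}. P l)"
    unfolding good_design_def Z_def P_def design_moment_def expected_moment_def by (auto simp: not_less)
  then have "prob (space M - good_design n i t \<eta>) \<le> prob (Z \<union> (\<Union>l\<in>{..2 * p}. P l))"
    using Zm Pm by (intro finite_measure_mono) auto
  also have "\<dots> \<le> prob Z + prob (\<Union>l\<in>{..2 * p}. P l)" using Zm Pm by (intro measure_Un_le) auto
  also have "\<dots> \<le> 0 + (\<Sum>l\<in>{..2 * p}. prob (P l))"
    unfolding Z0 using Pm by (intro add_left_mono finite_measure_subadditive_finite) auto
  also have "\<dots> \<le> 0 + (\<Sum>l\<in>{..2 * p}. 2 * exp (- (real (N n i) * (h n)\<^sup>2 * \<eta>\<^sup>2 / (2 * BK\<^sup>2))))"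
    by (intro add_left_mono sum_mono Pb)
  finally show ?thesis by (simp add: add.commute)
qed

text \<open>The threshold \<open>\<eta>\<close> is chosen such that a deviation of the moments by \<open>\<eta>\<close> costs at most half of
  the lower bound \<open>c1 * lam\<close> of the expected moment matrix.\<close>

lemma design_event:
  assumes win: "window c d c1 C1 h0 J"
  shows "\<exists>\<eta> B \<kappa>. B > 0 \<and> \<kappa> > 0 \<and> (\<forall>n i t. t \<in> J \<longrightarrow> i < n \<longrightarrow> 0 < N n i \<longrightarrow> h n \<le> h0 \<longrightarrow>
    prob (space M - good_design n i t \<eta>) \<le> B * exp (- (\<kappa> * (real (N n i) * (h n)\<^sup>2))) \<and>
    (\<forall>\<omega>\<in>good_design n i t \<eta>. let w = lpk_weight p K (h n) (N n i) (\<lambda>j. T n i j \<omega>) t in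
      (\<forall>j<N n i. w j \<noteq> 0 \<longrightarrow> \<bar>T n i j \<omega> - t\<bar> \<le> h n) \<and>
      (\<forall>j<N n i. \<bar>w j\<bar> \<le> B / (real (N n i) * h n)) \<and>
      (\<Sum>j<N n i. \<bar>w j\<bar>) \<le> B \<and>
      (\<Sum>j<N n i. (w j)\<^sup>2) \<le> B / (real (N n i) * h n) \<and>
      (\<forall>l\<le>p. (\<Sum>j<N n i. w j * (T n i j \<omega> - t) ^ l) = (if l = 0 then 1 else 0))))"
proof -
  have W: "a \<le> c" "c < d" "d \<le> b" "0 < c1" "0 < h0"
    "\<And>t r. t \<in> J \<Longrightarrow> 0 < r \<Longrightarrow> r \<le> h0 \<Longrightarrow> \<exists>sg. (sg = 1 \<or> sg = - 1) \<and> (\<forall>u. 0 < u \<longrightarrow> u < 1 \<longrightarrow> c1 \<le> \<pi> (t + sg * r * u))"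
    "\<And>t y. t \<in> J \<Longrightarrow> \<bar>y - t\<bar> \<le> h0 \<Longrightarrow> y \<noteq> a \<Longrightarrow> y \<noteq> b \<Longrightarrow> \<pi> y \<le> C1"
    using win unfolding window_def by simp_all
  from kernel_energy_half_line[OF kernel, of p] obtain lam where lam': "lam > 0 \<and>
    (\<forall>c. lam * (\<Sum>k\<le>p. (c k)\<^sup>2) \<le> (\<integral>u. indicator {0..1} u * K u * (\<Sum>k\<le>p. c k * u ^ k)\<^sup>2 \<partial>lborel))"
    by (elim exE)
  note lam = conjunct1[OF lam'] conjunct2[OF lam', rule_format]
  obtain BK0 where BK0: "\<And>u. K u \<le> BK0" using kernel by (auto simp: kernel_density_def)
  define BK where "BK = max 1 BK0"
  have BK: "BK > 0" "\<And>u. K u \<le> BK" using BK0 by (auto simp: BK_def le_max_iff_disj)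
  (* By coercive_perturbation the coercivity constant drops from c1 * lam to half of it. *)
  define \<eta> where "\<eta> = c1 * lam / (2 * (real p + 1))"
  have eta: "\<eta> > 0" using W(4) lam(1) by (simp add: \<eta>_def)
  define lam' where "lam' = c1 * lam / 2"
  have lam': "lam' > 0" "c1 * lam - \<eta> * (real p + 1) = lam'" using W(4) lam(1) by (auto simp: lam'_def \<eta>_def field_simps)
  define A where "A = (real p + 1) / lam'"
  define S0 where "S0 = \<bar>C1\<bar> + \<eta>"
  have A0: "A > 0" "S0 > 0" using lam' eta by (auto simp: A_def S0_def)
  define B where "B = max (2 * (2 * real p + 1)) (max (A * BK) (max (A * S0) (A\<^sup>2 * BK * S0)))"
  define \<kappa> where "\<kappa> = \<eta>\<^sup>2 / (2 * BK\<^sup>2)"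
  have B: "B > 0" "2 * (2 * real p + 1) \<le> B" "A * BK \<le> B" "A * S0 \<le> B" "A\<^sup>2 * BK * S0 \<le> B"
    by (auto simp: B_def less_max_iff_disj le_max_iff_disj)
  have kap: "\<kappa> > 0" using eta BK by (simp add: \<kappa>_def)
  show ?thesis
  proof (rule exI[of _ \<eta>], rule exI[of _ B], rule exI[of _ \<kappa>], intro conjI allI impI ballI B(1) kap)
    fix n i t assume t: "t \<in> J" and i: "i < n" and Ni: "0 < N n i" and hn: "h n \<le> h0"
    have "prob (space M - good_design n i t \<eta>) \<le>
      (2 * real p + 1) * (2 * exp (- (real (N n i) * (h n)\<^sup>2 * \<eta>\<^sup>2 / (2 * BK\<^sup>2))))"
      by (rule good_design_prob[OF i Ni eta BK])
    also have "\<dots> = (2 * (2 * real p + 1)) * exp (- (\<kappa> * (real (N n i) * (h n)\<^sup>2)))"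
      by (simp add: \<kappa>_def mult_ac)
    also have "\<dots> \<le> B * exp (- (\<kappa> * (real (N n i) * (h n)\<^sup>2)))"
      by (intro mult_right_mono B) auto
    finally show "prob (space M - good_design n i t \<eta>) \<le> B * exp (- (\<kappa> * (real (N n i) * (h n)\<^sup>2)))" .
    fix \<omega> assume \<omega>: "\<omega> \<in> good_design n i t \<eta>"
    define ts where "ts j = T n i j \<omega>" for j
    define w where "w = lpk_weight p K (h n) (N n i) ts t"
    obtain sg where sg: "sg = 1 \<or> sg = - 1" "\<And>u. 0 < u \<Longrightarrow> u < 1 \<Longrightarrow> c1 \<le> \<pi> (t + sg * h n * u)"
      using W(6)[OF t h_pos hn] by blast
    have close: "\<bar>design_moment K (h n) (N n i) ts t l - expected_moment K \<pi> (h n) t l\<bar> < \<eta>" if "l \<le> 2 * p" for l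
      using \<omega> that unfolding good_design_def ts_def by blast
    have coer: "lam' * (\<Sum>k\<le>p. (q k)\<^sup>2) \<le> (\<Sum>k\<le>p. \<Sum>l\<le>p. q k * q l * design_moment K (h n) (N n i) ts t (k + l))" for q
    proof -
      have "c1 * lam * (\<Sum>k\<le>p. (q k)\<^sup>2) \<le> (\<Sum>k\<le>p. \<Sum>l\<le>p. q k * q l * expected_moment K \<pi> (h n) t (k + l))"
        by (rule expected_moment_coercive[OF kernel pi_integrable pi_nonneg h_pos lam(2) sg(1) sg(2)]) (use W(4) in auto)
      from coercive_perturbation[OF this, of "design_moment K (h n) (N n i) ts t" \<eta>] close
      show ?thesis unfolding lam'(2) by (meson less_imp_le)
    qed
    have "expected_moment K \<pi> (h n) t 0 \<le> C1"
      by (rule expected_moment_0_le[OF kernel pi_integrable h_pos, of t n a b]) (use W(7)[OF t] hn in auto)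
    then have S0: "design_moment K (h n) (N n i) ts t 0 \<le> S0" using close[of 0] by (auto simp: S0_def)
    note wb = lpk_weight_bounds[OF kernel BK(2) h_pos Ni lam'(1) coer S0, folded A_def w_def]
    have Nh: "real (N n i) * h n > 0" using Ni h_pos by simp
    have "(\<forall>j<N n i. w j \<noteq> 0 \<longrightarrow> \<bar>ts j - t\<bar> \<le> h n) \<and>
      (\<forall>j<N n i. \<bar>w j\<bar> \<le> B / (real (N n i) * h n)) \<and>
      (\<Sum>j<N n i. \<bar>w j\<bar>) \<le> B \<and>
      (\<Sum>j<N n i. (w j)\<^sup>2) \<le> B / (real (N n i) * h n) \<and>
      (\<forall>l\<le>p. (\<Sum>j<N n i. w j * (ts j - t) ^ l) = (if l = 0 then 1 else 0))"
    proof (intro conjI allI impI)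
      fix j assume j: "j < N n i"
      show "\<bar>ts j - t\<bar> \<le> h n" if nz: "w j \<noteq> 0"
      proof (rule ccontr)
        assume "\<not> \<bar>ts j - t\<bar> \<le> h n"
        then have "\<bar>(ts j - t) / h n\<bar> > 1" using h_pos[of n] by (simp add: abs_divide)
        then have "K ((ts j - t) / h n) = 0" by (rule kernel_densityD(6)[OF kernel])
        then show False using wb(1)[OF j] nz by simp
      qed
      have "A * (K ((ts j - t) / h n) / (real (N n i) * h n)) \<le> A * (BK / (real (N n i) * h n))"
        using A0 Nh BK(2) by (intro mult_left_mono divide_right_mono) auto
      also have "\<dots> \<le> B / (real (N n i) * h n)"
        using divide_right_mono[OF B(3), of "real (N n i) * h n"] Nh by simp
      finally show "\<bar>w j\<bar> \<le> B / (real (N n i) * h n)" using wb(1)[OF j] by linarith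
    next
      show "(\<Sum>j<N n i. \<bar>w j\<bar>) \<le> B" using wb(2) B(4) by linarith
      have "A\<^sup>2 * BK * S0 / (real (N n i) * h n) \<le> B / (real (N n i) * h n)"
        using Nh by (intro divide_right_mono B) auto
      then show "(\<Sum>j<N n i. (w j)\<^sup>2) \<le> B / (real (N n i) * h n)" using wb(3) by linarith
      show "(\<Sum>j<N n i. w j * (ts j - t) ^ l) = (if l = 0 then 1 else 0)" if "l \<le> p" for l
        by (rule wb(4)[OF that])
    qed
    then show "let w = lpk_weight p K (h n) (N n i) (\<lambda>j. T n i j \<omega>) t in
      (\<forall>j<N n i. w j \<noteq> 0 \<longrightarrow> \<bar>T n i j \<omega> - t\<bar> \<le> h n) \<and>
      (\<forall>j<N n i. \<bar>w j\<bar> \<le> B / (real (N n i) * h n)) \<and>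
      (\<Sum>j<N n i. \<bar>w j\<bar>) \<le> B \<and>
      (\<Sum>j<N n i. (w j)\<^sup>2) \<le> B / (real (N n i) * h n) \<and>
      (\<forall>l\<le>p. (\<Sum>j<N n i. w j * (T n i j \<omega> - t) ^ l) = (if l = 0 then 1 else 0))"
      unfolding Let_def w_def ts_def .
  qed
qed

section \<open>The error of a single reconstruction\<close>

lemma beta_smooth:
  assumes "smooth_model_on S p M x \<beta> v \<gamma> \<sigma>2"
  shows "cont_diff_on (p + 1) S (\<lambda>t. inner w (\<beta> t))"
proof (rule invertible_second_moment_smooth_coefficients[OF x0_second Omega_invertible])
  show "cont_diff_on (p + 1) S (\<lambda>t. inner (x 0 \<omega>) (\<beta> t))" if "\<omega> \<in> space M" for \<omega>
    using assms that unfolding smooth_model_on_def by blast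
qed

lemma f_decompose: "f i t \<omega> = inner (x i \<omega>) (\<beta> t) + v i t \<omega>"
  by (simp add: individual_fun_def)

lemma square_sum_le: "((r::real) + s)\<^sup>2 \<le> 2 * r\<^sup>2 + 2 * s\<^sup>2"
  using sum_squares_bound[of r s] by (simp add: power2_sum)

text \<open>The difference of the mean part is controlled by the derivatives of the coefficient
  functions, and the second moment of the difference of the effect is the iterated difference of the covariance function.\<close>

lemma fdiff_second_moment:
  assumes smooth: "smooth_model_on S p M x \<beta> v \<gamma> \<sigma>2" and sub: "{c..d} \<subseteq> S" "S \<subseteq> {a..b}"
  shows "\<exists>C\<ge>0. \<forall>i \<eta> u. 0 < \<eta> \<longrightarrow> c < u \<longrightarrow> u + real (p + 1) * \<eta> < d \<longrightarrow>
    (\<integral>\<^sup>+\<omega>. ennreal ((fdiff (p + 1) \<eta> (\<lambda>t. f i t \<omega>) u)\<^sup>2) \<partial>M) \<le> ennreal (\<eta> ^ (2 * (p + 1)) * C)"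
proof -
  define m where "m = p + 1"
  obtain A where A: "\<And>\<eta> F u. fdiff m \<eta> F u = (\<Sum>k\<le>m. A k * F (u + real k * \<eta>))" using fdiff_sum by metis
  have "\<forall>j. \<exists>C\<ge>0. \<forall>\<eta> u. 0 < \<eta> \<longrightarrow> c < u \<longrightarrow> u + real m * \<eta> < d \<longrightarrow>
      \<bar>fdiff m \<eta> (\<lambda>t. \<beta> t $ j) u\<bar> \<le> \<eta> ^ m * C"
  proof
    fix j
    have "cont_diff_on m S (\<lambda>t. inner (axis j 1) (\<beta> t))" unfolding m_def by (rule beta_smooth[OF smooth])
    then have "cont_diff_on m S (\<lambda>t. \<beta> t $ j)" by (simp add: inner_axis')
    then show "\<exists>C\<ge>0. \<forall>\<eta> u. 0 < \<eta> \<longrightarrow> c < u \<longrightarrow> u + real m * \<eta> < d \<longrightarrow>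
      \<bar>fdiff m \<eta> (\<lambda>t. \<beta> t $ j) u\<bar> \<le> \<eta> ^ m * C"
      by (rule fdiff_cont_diff_bound[OF _ sub(1)])
  qed
  from choice[OF this] obtain CB where CB: "\<forall>j. 0 \<le> CB j \<and> (\<forall>\<eta> u. 0 < \<eta> \<longrightarrow> c < u \<longrightarrow> u + real m * \<eta> < d \<longrightarrow>
      \<bar>fdiff m \<eta> (\<lambda>t. \<beta> t $ j) u\<bar> \<le> \<eta> ^ m * CB j)"
    by (elim exE)
  define Cb where "Cb = (\<Sum>j\<in>UNIV. CB j)"
  have "cont_diff2_on m S \<gamma>" using smooth by (simp add: smooth_model_on_def m_def)
  from fdiff2_cont_diff2_bound[OF this sub(1)] obtain Cg where Cg: "0 \<le> Cg \<and> (\<forall>\<eta> u. 0 < \<eta> \<longrightarrow> c < u \<longrightarrow> u + real m * \<eta> < d \<longrightarrow>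
    fdiff m \<eta> (\<lambda>s. fdiff m \<eta> (\<lambda>t. \<gamma> s t) u) u \<le> \<eta> ^ (2 * m) * Cg)"
    by (elim exE)
  define C where "C = 2 * (Cb\<^sup>2 * x_power + Cg)"
  have C0: "C \<ge> 0" using Cg x_power_nonneg by (simp add: C_def)
  have main: "(\<integral>\<^sup>+\<omega>. ennreal ((fdiff m \<eta> (\<lambda>t. f i t \<omega>) u)\<^sup>2) \<partial>M) \<le> ennreal (\<eta> ^ (2 * m) * C)"
    if *: "0 < \<eta>" "c < u" "u + real m * \<eta> < d" for i \<eta> u
  proof -
    define \<tau> where "\<tau> k = u + real k * \<eta>" for k :: nat
    have \<tau>: "\<tau> k \<in> {a..b}" if "k \<le> m" for k
    proof -
      have "real k * \<eta> \<le> real m * \<eta>" using that * by (intro mult_right_mono) auto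
      moreover have "0 \<le> real k * \<eta>" using * by simp
      ultimately have "c \<le> u + real k * \<eta>" "u + real k * \<eta> \<le> d" using * by linarith+
      then have "\<tau> k \<in> {c..d}" by (simp add: \<tau>_def)
      then show ?thesis using sub by blast
    qed
    define b' where "b' = (\<chi> j. fdiff m \<eta> (\<lambda>t. \<beta> t $ j) u)"
    have b'_eq: "b' = (\<Sum>k\<le>m. A k *\<^sub>R \<beta> (\<tau> k))"
      by (simp add: b'_def A \<tau>_def Finite_Cartesian_Product.vec_eq_iff)
    have nb: "norm b' \<le> \<eta> ^ m * Cb"
    proof -
      have "norm b' \<le> (\<Sum>j\<in>UNIV. \<bar>b' $ j\<bar>)" by (rule norm_le_l1_cart)
      also have "\<dots> \<le> (\<Sum>j\<in>UNIV. \<eta> ^ m * CB j)"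
        unfolding b'_def using CB * by (intro sum_mono) simp
      finally show ?thesis by (simp add: Cb_def sum_distrib_left)
    qed
    define vd where "vd \<omega> = (\<Sum>k\<le>m. A k * v i (\<tau> k) \<omega>)" for \<omega>
    have fd: "fdiff m \<eta> (\<lambda>t. f i t \<omega>) u = inner (x i \<omega>) b' + vd \<omega>" for \<omega>
      unfolding A f_decompose \<tau>_def[symmetric] vd_def b'_eq
      by (simp add: inner_sum_right distrib_left sum.distrib)
    have vd2: "(vd \<omega>)\<^sup>2 = (\<Sum>k\<le>m. \<Sum>l\<le>m. A k * A l * (v i (\<tau> k) \<omega> * v i (\<tau> l) \<omega>))" for \<omega>
      unfolding vd_def power2_eq_square sum_product by (intro sum.cong refl) simp
    have hb: "has_bochner_integral M (\<lambda>\<omega>. (vd \<omega>)\<^sup>2) (\<Sum>k\<le>m. \<Sum>l\<le>m. A k * A l * \<gamma> (\<tau> k) (\<tau> l))"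
      unfolding vd2
    proof (intro has_bochner_integral_sum has_bochner_integral_mult_right)
      fix k l assume "k \<in> {..m}" "l \<in> {..m}"
      then show "has_bochner_integral M (\<lambda>\<omega>. v i (\<tau> k) \<omega> * v i (\<tau> l) \<omega>) (\<gamma> (\<tau> k) (\<tau> l))"
        using v_second[OF \<tau> \<tau>] by (auto simp: has_bochner_integral_iff)
    qed
    have "(\<Sum>k\<le>m. \<Sum>l\<le>m. A k * A l * \<gamma> (\<tau> k) (\<tau> l)) = fdiff m \<eta> (\<lambda>s. fdiff m \<eta> (\<lambda>t. \<gamma> s t) u) u"
      unfolding A \<tau>_def by (simp add: sum_distrib_left mult.assoc)
    also have "\<dots> \<le> \<eta> ^ (2 * m) * Cg" using Cg * by simp
    finally have vdE: "expectation (\<lambda>\<omega>. (vd \<omega>)\<^sup>2) \<le> \<eta> ^ (2 * m) * Cg" and vdI: "integrable M (\<lambda>\<omega>. (vd \<omega>)\<^sup>2)"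
      using hb by (auto simp: has_bochner_integral_iff)
    have pt: "(fdiff m \<eta> (\<lambda>t. f i t \<omega>) u)\<^sup>2 \<le> 2 * (\<eta> ^ (2 * m) * Cb\<^sup>2 * (norm (x i \<omega>))\<^sup>2) + 2 * (vd \<omega>)\<^sup>2" for \<omega>
    proof -
      have "\<bar>inner (x i \<omega>) b'\<bar> \<le> norm (x i \<omega>) * (\<eta> ^ m * Cb)"
        by (rule order_trans[OF Cauchy_Schwarz_ineq2]) (intro mult_left_mono nb norm_ge_zero)
      then have "\<bar>inner (x i \<omega>) b'\<bar>\<^sup>2 \<le> (norm (x i \<omega>) * (\<eta> ^ m * Cb))\<^sup>2" by (intro power_mono) auto
      also have "\<dots> = \<eta> ^ (2 * m) * Cb\<^sup>2 * (norm (x i \<omega>))\<^sup>2"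
        by (simp add: power_mult_distrib power_mult[symmetric] mult_ac)
      finally show ?thesis unfolding fd using square_sum_le[of "inner (x i \<omega>) b'" "vd \<omega>"] by simp
    qed
    have "(\<integral>\<^sup>+\<omega>. ennreal ((fdiff m \<eta> (\<lambda>t. f i t \<omega>) u)\<^sup>2) \<partial>M) \<le>
        (\<integral>\<^sup>+\<omega>. ennreal (2 * (\<eta> ^ (2 * m) * Cb\<^sup>2 * (norm (x i \<omega>))\<^sup>2) + 2 * (vd \<omega>)\<^sup>2) \<partial>M)"
      by (intro nn_integral_mono ennreal_leI pt)
    also have "\<dots> = ennreal (expectation (\<lambda>\<omega>. 2 * (\<eta> ^ (2 * m) * Cb\<^sup>2 * (norm (x i \<omega>))\<^sup>2) + 2 * (vd \<omega>)\<^sup>2))"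
      by (rule nn_integral_eq_integral) (use x_norm_second(1) vdI * in auto)
    also have "expectation (\<lambda>\<omega>. 2 * (\<eta> ^ (2 * m) * Cb\<^sup>2 * (norm (x i \<omega>))\<^sup>2) + 2 * (vd \<omega>)\<^sup>2) =
        2 * (\<eta> ^ (2 * m) * Cb\<^sup>2 * x_power) + 2 * expectation (\<lambda>\<omega>. (vd \<omega>)\<^sup>2)"
      using x_norm_second[of i] vdI by simp
    also have "\<dots> \<le> \<eta> ^ (2 * m) * C" using vdE by (simp add: C_def algebra_simps)
    finally show ?thesis by (simp add: ennreal_leI)
  qed
  show ?thesis
    using C0 main unfolding m_def by blast
qed

lemma f_second_moment:
  assumes smooth: "smooth_model_on S p M x \<beta> v \<gamma> \<sigma>2" and sub: "{c..d} \<subseteq> S" "S \<subseteq> {a..b}"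
  shows "\<exists>C\<ge>0. \<forall>i. \<forall>t\<in>{c..d}. (\<integral>\<^sup>+\<omega>. ennreal ((f i t \<omega>)\<^sup>2) \<partial>M) \<le> ennreal C"
proof -
  have "continuous_on {c..d} (\<lambda>t. \<beta> t $ j)" for j
  proof -
    have "cont_diff_on (p + 1) S (\<lambda>t. inner (axis j 1) (\<beta> t))" by (rule beta_smooth[OF smooth])
    then have "cont_diff_on (p + 1) S (\<lambda>t. \<beta> t $ j)" by (simp add: inner_axis')
    then show ?thesis by (rule continuous_on_subset[OF cont_diff_on_continuous sub(1)])
  qed
  then have "continuous_on {c..d} (\<lambda>t. \<chi> j. \<beta> t $ j)" by (intro continuous_on_vec_lambda)
  then have "continuous_on {c..d} \<beta>" by simp
  then have "compact (\<beta> ` {c..d})" by (intro compact_continuous_image) auto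
  then have "bounded (\<beta> ` {c..d})" by (rule compact_imp_bounded)
  from this[unfolded bounded_iff] obtain B where "\<forall>y\<in>\<beta> ` {c..d}. norm y \<le> B" by (elim exE)
  then have B: "\<And>t. t \<in> {c..d} \<Longrightarrow> norm (\<beta> t) \<le> B" by simp
  have cg: "continuous_on (S \<times> S) (\<lambda>(s, t). \<gamma> s t)"
  proof -
    have "cont_diff2_on (p + 1) S \<gamma>" using smooth by (simp add: smooth_model_on_def)
    from this[unfolded cont_diff2_on_def] obtain D where "D 0 0 = \<gamma> \<and>
      (\<forall>k<p+1. \<forall>l\<le>p+1. \<forall>s\<in>S. \<forall>t\<in>S.
        ((\<lambda>u. D k l u t) has_real_derivative D (Suc k) l s t) (at s within S)) \<and>
      (\<forall>k\<le>p+1. \<forall>l<p+1. \<forall>s\<in>S. \<forall>t\<in>S.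
        ((\<lambda>u. D k l s u) has_real_derivative D k (Suc l) s t) (at t within S)) \<and>
      (\<forall>k\<le>p+1. \<forall>l\<le>p+1. continuous_on (S \<times> S) (\<lambda>(s, t). D k l s t))"
      by (elim exE)
    then have "D 0 0 = \<gamma>" "\<forall>k\<le>p+1. \<forall>l\<le>p+1. continuous_on (S \<times> S) (\<lambda>(s, t). D k l s t)" by simp_all
    then show ?thesis by (metis le0)
  qed
  have "continuous_on {c..d} (\<lambda>t. (\<lambda>(s, t). \<gamma> s t) (t, t))"
    using sub by (intro continuous_on_compose2[OF cg] continuous_intros) auto
  then have "compact ((\<lambda>t. \<gamma> t t) ` {c..d})" by (intro compact_continuous_image) auto
  then have "bounded ((\<lambda>t. \<gamma> t t) ` {c..d})" by (rule compact_imp_bounded)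
  from this[unfolded bounded_iff] obtain G where "\<forall>y\<in>(\<lambda>t. \<gamma> t t) ` {c..d}. norm y \<le> G" by (elim exE)
  then have G: "\<And>t. t \<in> {c..d} \<Longrightarrow> \<bar>\<gamma> t t\<bar> \<le> G" by simp
  define C where "C = 2 * (B\<^sup>2 * x_power) + 2 * \<bar>G\<bar>"
  have main: "(\<integral>\<^sup>+\<omega>. ennreal ((f i t \<omega>)\<^sup>2) \<partial>M) \<le> ennreal C" if t: "t \<in> {c..d}" for i t
  proof -
    have tab: "t \<in> {a..b}" using t sub by blast
    have pt: "(f i t \<omega>)\<^sup>2 \<le> 2 * (B\<^sup>2 * (norm (x i \<omega>))\<^sup>2) + 2 * (v i t \<omega> * v i t \<omega>)" for \<omega>
    proof -
      have "\<bar>inner (x i \<omega>) (\<beta> t)\<bar> \<le> norm (x i \<omega>) * B"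
        by (rule order_trans[OF Cauchy_Schwarz_ineq2]) (intro mult_left_mono B[OF t] norm_ge_zero)
      then have "\<bar>inner (x i \<omega>) (\<beta> t)\<bar>\<^sup>2 \<le> (norm (x i \<omega>) * B)\<^sup>2" by (intro power_mono) auto
      then show ?thesis unfolding f_decompose using square_sum_le[of "inner (x i \<omega>) (\<beta> t)" "v i t \<omega>"]
        by (simp add: power_mult_distrib mult_ac power2_eq_square)
    qed
    have "(\<integral>\<^sup>+\<omega>. ennreal ((f i t \<omega>)\<^sup>2) \<partial>M) \<le> (\<integral>\<^sup>+\<omega>. ennreal (2 * (B\<^sup>2 * (norm (x i \<omega>))\<^sup>2) + 2 * (v i t \<omega> * v i t \<omega>)) \<partial>M)"
      by (intro nn_integral_mono ennreal_leI pt)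
    also have "\<dots> = ennreal (expectation (\<lambda>\<omega>. 2 * (B\<^sup>2 * (norm (x i \<omega>))\<^sup>2) + 2 * (v i t \<omega> * v i t \<omega>)))"
      by (rule nn_integral_eq_integral) (use x_norm_second(1) v_second(1)[OF tab tab] in auto)
    also have "expectation (\<lambda>\<omega>. 2 * (B\<^sup>2 * (norm (x i \<omega>))\<^sup>2) + 2 * (v i t \<omega> * v i t \<omega>)) = 2 * (B\<^sup>2 * x_power) + 2 * \<gamma> t t"
      using x_norm_second[of i] v_second[OF tab tab, of i] by simp
    also have "\<dots> \<le> C" using G[OF t] by (auto simp: C_def)
    finally show ?thesis by (simp add: ennreal_leI)
  qed
  have "C \<ge> 0" using x_power_nonneg by (simp add: C_def)
  then show ?thesis using main by blast
qed

lemma T_distinct: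
  assumes i: "i < n" and jk: "j < N n i" "k < N n i" "j \<noteq> k"
  shows "AE \<omega> in M. T n i j \<omega> \<noteq> T n i k \<omega>"
proof (rule indep_density_AE_neq[OF _ T_distributed[OF i jk(2)]])
  have "indep_sets (\<lambda>b'. source_events M a b x v (T n) (if b' then Design i j else Design i k)) UNIV"
    by (rule indep_sets_reindex[OF sources_indep[of n]]) (use i jk in \<open>auto simp: inj_on_def sources_def\<close>)
  moreover have "source_events M a b x v (T n) (if b' then Design i j else Design i k) =
      sets (vimage_algebra (space M) (case_bool (T n i j) (T n i k) b') (case_bool borel borel b'))" for b'
    by (cases b') auto
  ultimately have "indep_sets (\<lambda>b'. sets (vimage_algebra (space M) (case_bool (T n i j) (T n i k) b') (case_bool borel borel b'))) UNIV"
    by simp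
  then show "indep_var borel (T n i j) borel (T n i k)"
    unfolding indep_var_def
    by (rule indep_vars_vimage_algebra[rotated]) (use T_measurable[OF i] jk in \<open>auto split: bool.split\<close>)
qed

lemma smooth_processes:
  assumes "smooth_model_on S p M x \<beta> v \<gamma> \<sigma>2" "\<omega> \<in> space M"
  shows "cont_diff_on (p + 1) S (\<lambda>t. f i t \<omega>)"
  using assms unfolding smooth_model_on_def by blast

text \<open>The weights are functions of the design, hence measurable with respect to the sources.\<close>

lemma weighted_noise_second_moment:
  assumes i: "i < n"
    and W: "\<And>j. j < N n i \<Longrightarrow> W j \<in> borel_measurable (source_field n)"
    and Wb: "\<And>j \<omega>. j < N n i \<Longrightarrow> \<omega> \<in> space M \<Longrightarrow> \<bar>W j \<omega>\<bar> \<le> Cw"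
    and Ws: "\<And>j \<omega>. j < N n i \<Longrightarrow> \<omega> \<in> space M \<Longrightarrow> W j \<omega> \<noteq> 0 \<Longrightarrow> \<sigma>2 (T n i j \<omega>) \<le> Cs"
    and Cs: "Cs \<ge> 0"
    and kap: "\<And>\<omega>. \<omega> \<in> space M \<Longrightarrow> (\<Sum>j<N n i. (W j \<omega>)\<^sup>2) \<le> \<kappa>"
  shows "(\<integral>\<^sup>+\<omega>. ennreal ((\<Sum>j<N n i. W j \<omega> * e n i j \<omega>)\<^sup>2) \<partial>M) \<le> ennreal (4 * Cs * \<kappa>)"
proof -
  have En: "prob_space E" using noise by (simp add: white_noise_def)
  show ?thesis
  proof (rule conditional_noise_second_moment[where S = "{a..b}" and ?\<sigma>2.0 = \<sigma>2 and T = "T n i",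
        OF prob_space_axioms source_subalgebra En e_measurable[OF i] measurement_errors_pair[OF errors En i]])
    show "\<epsilon> t \<in> borel_measurable E" if "t \<in> {a..b}" for t
      using noise that unfolding white_noise_def by (auto dest: borel_measurable_integrable)
    show "integrable E (\<lambda>w. \<epsilon> s w * \<epsilon> t w)" if "s \<in> {a..b}" "t \<in> {a..b}" for s t
      using noise that unfolding white_noise_def by blast
    show "(\<integral>w. \<epsilon> s w * \<epsilon> t w \<partial>E) = (if s = t then \<sigma>2 t else 0)" if "s \<in> {a..b}" "t \<in> {a..b}" for s t
      using noise that unfolding white_noise_def by blast
  qed (use T_range[OF i] T_distinct[OF i] W Wb Ws Cs kap in auto)
qed

text \<open>Bias: Taylor remainders averaged with weights of bounded absolute sum.  Noise: the square sum of the
  weights is of order \<open>1 / (N h)\<close>.  The bound \<open>V\<close> on the squared error is stated as a measurable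
  majorant on the good event only, because on bad designs the reconstruction is unspecified.\<close>

theorem one_subject_error:
  assumes win: "window c d c1 C1 h0 J" and sub: "{c..d} \<subseteq> S" "S \<subseteq> {a..b}"
    and smooth: "smooth_model_on S p M x \<beta> v \<gamma> \<sigma>2"
  shows "\<exists>\<eta> B \<kappa> C. B > 0 \<and> \<kappa> > 0 \<and> C \<ge> 0 \<and>
    (\<forall>n i t. t \<in> J \<longrightarrow> i < n \<longrightarrow> 0 < N n i \<longrightarrow> h n \<le> h0 \<longrightarrow>
      prob (space M - good_design n i t \<eta>) \<le> B * exp (- (\<kappa> * (real (N n i) * (h n)\<^sup>2))) \<and>
      (\<exists>V. V \<in> borel_measurable M \<and>
        (\<integral>\<^sup>+\<omega>. V \<omega> \<partial>M) \<le> ennreal (C * (h n ^ (2 * p + 2) + 1 / (real (N n i) * h n))) \<and>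
        (\<forall>\<omega>\<in>good_design n i t \<eta>. ennreal ((f_hat n i t \<omega> - f i t \<omega>)\<^sup>2) \<le> V \<omega>)))"
proof -
  have W: "a \<le> c" "c < d" "d \<le> b" "0 < c1" "0 < h0" "\<And>t. t \<in> J \<Longrightarrow> c < t" "\<And>t. t \<in> J \<Longrightarrow> t < d"
    "\<And>t y. t \<in> J \<Longrightarrow> \<bar>y - t\<bar> \<le> h0 \<Longrightarrow> a < y \<Longrightarrow> y < b \<Longrightarrow> c < y \<and> y < d"
    using win unfolding window_def by simp_all
  note [measurable] = kernel_densityD(1)[OF kernel]
  from design_event[OF win] obtain \<eta> B \<kappa> where DE: "B > 0 \<and> \<kappa> > 0 \<and> (\<forall>n i t. t \<in> J \<longrightarrow> i < n \<longrightarrow> 0 < N n i \<longrightarrow> h n \<le> h0 \<longrightarrow>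
    prob (space M - good_design n i t \<eta>) \<le> B * exp (- (\<kappa> * (real (N n i) * (h n)\<^sup>2))) \<and>
    (\<forall>\<omega>\<in>good_design n i t \<eta>. let w = lpk_weight p K (h n) (N n i) (\<lambda>j. T n i j \<omega>) t in
      (\<forall>j<N n i. w j \<noteq> 0 \<longrightarrow> \<bar>T n i j \<omega> - t\<bar> \<le> h n) \<and>
      (\<forall>j<N n i. \<bar>w j\<bar> \<le> B / (real (N n i) * h n)) \<and>
      (\<Sum>j<N n i. \<bar>w j\<bar>) \<le> B \<and>
      (\<Sum>j<N n i. (w j)\<^sup>2) \<le> B / (real (N n i) * h n) \<and>
      (\<forall>l\<le>p. (\<Sum>j<N n i. w j * (T n i j \<omega> - t) ^ l) = (if l = 0 then 1 else 0))))"
    by (elim exE)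
  have B: "B > 0" "\<kappa> > 0" using DE by simp_all
  from fdiff_second_moment[OF smooth sub] obtain CD where CD: "0 \<le> CD \<and> (\<forall>i \<eta> u. 0 < \<eta> \<longrightarrow> c < u \<longrightarrow> u + real (p + 1) * \<eta> < d \<longrightarrow>
    (\<integral>\<^sup>+\<omega>. ennreal ((fdiff (p + 1) \<eta> (\<lambda>t. f i t \<omega>) u)\<^sup>2) \<partial>M) \<le> ennreal (\<eta> ^ (2 * (p + 1)) * CD))"
    by (elim exE)
  have cs: "continuous_on S \<sigma>2" using smooth by (simp add: smooth_model_on_def)
  have "compact (\<sigma>2 ` {c..d})" using cs sub by (intro compact_continuous_image continuous_on_subset[OF cs]) auto
  then have "bounded (\<sigma>2 ` {c..d})" by (rule compact_imp_bounded)
  from this[unfolded bounded_iff] obtain Cs0 where "\<forall>y\<in>\<sigma>2 ` {c..d}. norm y \<le> Cs0" by (elim exE)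
  then have Cs0: "\<And>t. t \<in> {c..d} \<Longrightarrow> \<bar>\<sigma>2 t\<bar> \<le> Cs0" by simp
  have Cs0_nonneg: "Cs0 \<ge> 0" using Cs0[of c] W(2) by auto
  have cd_sub: "{c<..<d} \<subseteq> S" using sub by auto
  define C where "C = 4 * B\<^sup>2 * CD + 8 * Cs0 * B"
  have C0: "C \<ge> 0" using CD Cs0_nonneg B by (simp add: C_def)
  have main: "\<exists>V. V \<in> borel_measurable M \<and>
        (\<integral>\<^sup>+\<omega>. V \<omega> \<partial>M) \<le> ennreal (C * (h n ^ (2 * p + 2) + 1 / (real (N n i) * h n))) \<and>
        (\<forall>\<omega>\<in>good_design n i t \<eta>. ennreal ((f_hat n i t \<omega> - f i t \<omega>)\<^sup>2) \<le> V \<omega>)"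
    if t: "t \<in> J" and i: "i < n" and Ni: "0 < N n i" and hn: "h n \<le> h0" for n i t
  proof -
    define w where "w j \<omega> = lpk_weight p K (h n) (N n i) (\<lambda>j. T n i j \<omega>) t j" for j \<omega>
    define G where "G = good_design n i t \<eta>"
    have Nh: "real (N n i) * h n > 0" using Ni h_pos by simp
    have wG: "(\<forall>j<N n i. w j \<omega> \<noteq> 0 \<longrightarrow> \<bar>T n i j \<omega> - t\<bar> \<le> h n) \<and>
      (\<forall>j<N n i. \<bar>w j \<omega>\<bar> \<le> B / (real (N n i) * h n)) \<and>
      (\<Sum>j<N n i. \<bar>w j \<omega>\<bar>) \<le> B \<and>
      (\<Sum>j<N n i. (w j \<omega>)\<^sup>2) \<le> B / (real (N n i) * h n) \<and>
      (\<forall>l\<le>p. (\<Sum>j<N n i. w j \<omega> * (T n i j \<omega> - t) ^ l) = (if l = 0 then 1 else 0))"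
      if "\<omega> \<in> G" for \<omega>
      using DE t i Ni hn that unfolding w_def G_def Let_def by blast
    have Gspace: "\<omega> \<in> space M" if "\<omega> \<in> G" for \<omega> using that by (simp add: G_def good_design_def)
    have Gint: "a < T n i j \<omega> \<and> T n i j \<omega> < b" if "\<omega> \<in> G" "j < N n i" for \<omega> j
      using that by (simp add: G_def good_design_def)
    have Tcd: "c < T n i j \<omega> \<and> T n i j \<omega> < d" if "\<omega> \<in> G" "j < N n i" "w j \<omega> \<noteq> 0" for \<omega> j
      using W(8)[OF t, of "T n i j \<omega>"] wG[OF that(1)] Gint[OF that(1,2)] that hn by force
    define Wt where "Wt j \<omega> = (if \<omega> \<in> G then w j \<omega> else 0)" for j \<omega>
    have wm: "w j \<in> borel_measurable (source_field n)" for j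
      unfolding w_def[abs_def] lpk_weight_def
      by (rule borel_measurable_lpk) (use T_source_measurable[OF i] in auto)
    have Wm: "Wt j \<in> borel_measurable (source_field n)" for j
      unfolding Wt_def[abs_def] G_def by (intro measurable_If_set wm borel_measurable_const) (use good_design_source[OF i] in auto)
    have Wb: "\<bar>Wt j \<omega>\<bar> \<le> B / (real (N n i) * h n)" if "j < N n i" for j \<omega>
      using wG[of \<omega>] that Nh B by (auto simp: Wt_def)
    have Wsq: "(\<Sum>j<N n i. (Wt j \<omega>)\<^sup>2) \<le> B / (real (N n i) * h n)" for \<omega>
    proof (cases "\<omega> \<in> G")
      case True
      then show ?thesis using wG[OF True] by (simp add: Wt_def)
    qed (use Nh B in \<open>simp add: Wt_def\<close>)
    define noise_part where "noise_part \<omega> = (\<Sum>j<N n i. Wt j \<omega> * e n i j \<omega>)" for \<omega>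
    have nm [measurable]: "noise_part \<in> borel_measurable M"
      unfolding noise_part_def[abs_def] using e_measurable[OF i] measurable_from_subalg[OF source_subalgebra Wm] by measurable
    have noise2: "(\<integral>\<^sup>+\<omega>. ennreal ((noise_part \<omega>)\<^sup>2) \<partial>M) \<le> ennreal (4 * Cs0 * (B / (real (N n i) * h n)))"
      unfolding noise_part_def
    proof (rule weighted_noise_second_moment[OF i Wm Wb _ Cs0_nonneg Wsq])
      fix j \<omega> assume j: "j < N n i" and nz: "Wt j \<omega> \<noteq> 0"
      then have "\<omega> \<in> G" "w j \<omega> \<noteq> 0" by (auto simp: Wt_def split: if_splits)
      then have "T n i j \<omega> \<in> {c..d}" using Tcd[of \<omega> j] j by auto
      then show "\<sigma>2 (T n i j \<omega>) \<le> Cs0" using Cs0 by (metis abs_ge_self order_trans)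
    qed
    have fm: "f i u \<in> borel_measurable M" if "c < u" "u < d" for u
      using that W(1,3) by (intro f_measurable) auto
    have fs: "cont_diff_on (Suc p) {c<..<d} (\<lambda>u. f i u \<omega>)" if "\<omega> \<in> space M" for \<omega>
    proof -
      have g: "cont_diff_on (p + 1) S (\<lambda>u. f i u \<omega>)" by (rule smooth_processes[OF smooth that])
      from cont_diff_on_interiorD[OF g cd_sub] obtain D where D: "D 0 = (\<lambda>u. f i u \<omega>) \<and>
        (\<forall>k w. k < p + 1 \<longrightarrow> c < w \<longrightarrow> w < d \<longrightarrow> (D k has_real_derivative D (Suc k) w) (at w)) \<and>
        (\<forall>k. k \<le> p + 1 \<longrightarrow> continuous_on S (D k))" by (elim exE)
      show ?thesis
        unfolding cont_diff_on_def
      proof (rule exI[of _ D], intro conjI allI impI ballI)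
        show "D 0 = (\<lambda>u. f i u \<omega>)" using D by simp
        show "(D k has_real_derivative D (Suc k) u) (at u within {c<..<d})" if "k < Suc p" "u \<in> {c<..<d}" for k u
        proof -
          have "(D k has_real_derivative D (Suc k) u) (at u)" using D that by simp
          then show ?thesis by (rule has_field_derivative_at_within)
        qed
        show "continuous_on {c<..<d} (D k)" if "k \<le> Suc p" for k
          by (rule continuous_on_subset[OF _ cd_sub]) (use D that in simp)
      qed
    qed
    have fb: "(\<integral>\<^sup>+\<omega>. ennreal ((fdiff (Suc p) r (\<lambda>t. f i t \<omega>) u)\<^sup>2) \<partial>M) \<le> ennreal (r ^ (2 * Suc p) * CD)"
      if "0 < r" "c < u" "u + real (Suc p) * r < d" for r u
      using CD that by simp
    have CD0: "CD \<ge> 0" using CD by simp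
    show ?thesis
    proof (rule smooth_process_derivative[OF sigma_finite_measure_axioms fm fs fb CD0])
      fix D :: "'a \<Rightarrow> nat \<Rightarrow> real \<Rightarrow> real"
      assume D: "\<And>\<omega>. \<omega> \<in> space M \<Longrightarrow> D \<omega> 0 = (\<lambda>t. f i t \<omega>)"
        "\<And>\<omega> k w. \<omega> \<in> space M \<Longrightarrow> k < Suc p \<Longrightarrow> c < w \<Longrightarrow> w < d \<Longrightarrow> (D \<omega> k has_real_derivative D \<omega> (Suc k) w) (at w)"
        "\<And>\<omega> k. \<omega> \<in> space M \<Longrightarrow> k \<le> Suc p \<Longrightarrow> continuous_on {c<..<d} (D \<omega> k)"
        "\<And>I. I \<in> sets borel \<Longrightarrow> (\<lambda>\<omega>. \<integral>\<^sup>+u. ennreal ((D \<omega> (Suc p) u)\<^sup>2) * indicator (I \<inter> {c<..<d}) u \<partial>lborel) \<in> borel_measurable M"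
        "\<And>I. I \<in> sets borel \<Longrightarrow> (\<integral>\<^sup>+\<omega>. (\<integral>\<^sup>+u. ennreal ((D \<omega> (Suc p) u)\<^sup>2) * indicator (I \<inter> {c<..<d}) u \<partial>lborel) \<partial>M)
          \<le> ennreal CD * emeasure lborel I"
      define I where "I = {t - h n..t + h n}"
      define X where "X \<omega> = ennreal (h n ^ (2 * p + 1)) * (\<integral>\<^sup>+u. ennreal ((D \<omega> (Suc p) u)\<^sup>2) * indicator (I \<inter> {c<..<d}) u \<partial>lborel)" for \<omega>
      have Ib: "I \<in> sets borel" by (simp add: I_def)
      have Xm [measurable]: "X \<in> borel_measurable M"
        unfolding X_def[abs_def] using D(4)[OF Ib] by measurable
      have XE: "(\<integral>\<^sup>+\<omega>. X \<omega> \<partial>M) \<le> ennreal (2 * CD * h n ^ (2 * p + 2))"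
      proof -
        have "(\<integral>\<^sup>+\<omega>. X \<omega> \<partial>M) = ennreal (h n ^ (2 * p + 1)) * (\<integral>\<^sup>+\<omega>. (\<integral>\<^sup>+u. ennreal ((D \<omega> (Suc p) u)\<^sup>2) * indicator (I \<inter> {c<..<d}) u \<partial>lborel) \<partial>M)"
          unfolding X_def by (rule nn_integral_cmult[OF D(4)[OF Ib]])
        also have "\<dots> \<le> ennreal (h n ^ (2 * p + 1)) * (ennreal CD * emeasure lborel I)"
          by (intro mult_left_mono D(5)[OF Ib]) auto
        also have "emeasure lborel I = ennreal (2 * h n)"
          using h_pos[of n] by (simp add: I_def)
        also have "ennreal (h n ^ (2 * p + 1)) * (ennreal CD * ennreal (2 * h n)) = ennreal (2 * CD * h n ^ (2 * p + 2))"
          using h_pos[of n] CD0 by (simp add: ennreal_mult'[symmetric] mult_ac)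
        finally show ?thesis .
      qed
      define V where "V \<omega> = ennreal (2 * B\<^sup>2) * X \<omega> + 2 * ennreal ((noise_part \<omega>)\<^sup>2)" for \<omega>
      have Vm: "V \<in> borel_measurable M" unfolding V_def[abs_def] by measurable
      have VE: "(\<integral>\<^sup>+\<omega>. V \<omega> \<partial>M) \<le> ennreal (C * (h n ^ (2 * p + 2) + 1 / (real (N n i) * h n)))"
      proof -
        have "(\<integral>\<^sup>+\<omega>. V \<omega> \<partial>M) = ennreal (2 * B\<^sup>2) * (\<integral>\<^sup>+\<omega>. X \<omega> \<partial>M) + 2 * (\<integral>\<^sup>+\<omega>. ennreal ((noise_part \<omega>)\<^sup>2) \<partial>M)"
          unfolding V_def by (simp add: nn_integral_add nn_integral_cmult)
        also have "\<dots> \<le> ennreal (2 * B\<^sup>2) * ennreal (2 * CD * h n ^ (2 * p + 2)) + 2 * ennreal (4 * Cs0 * (B / (real (N n i) * h n)))"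
          by (intro add_mono mult_left_mono XE noise2) auto
        also have "\<dots> = ennreal (2 * B\<^sup>2 * (2 * CD * h n ^ (2 * p + 2)) + 2 * (4 * Cs0 * (B / (real (N n i) * h n))))"
        proof -
          have 1: "ennreal (2 * B\<^sup>2) * ennreal (2 * CD * h n ^ (2 * p + 2)) = ennreal (2 * B\<^sup>2 * (2 * CD * h n ^ (2 * p + 2)))"
            by (rule ennreal_mult'[symmetric]) simp
          have "2 * ennreal (4 * Cs0 * (B / (real (N n i) * h n))) = ennreal 2 * ennreal (4 * Cs0 * (B / (real (N n i) * h n)))" by simp
          also have "\<dots> = ennreal (2 * (4 * Cs0 * (B / (real (N n i) * h n))))" by (rule ennreal_mult'[symmetric]) simp
          finally show ?thesis unfolding 1 using h_pos[of n] CD0 Cs0_nonneg B Nh by (subst ennreal_plus) auto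
        qed
        also have "\<dots> \<le> ennreal (C * (h n ^ (2 * p + 2) + 1 / (real (N n i) * h n)))"
        proof (rule ennreal_leI)
          define u where "u = h n ^ (2 * p + 2)"
          define z where "z = 1 / (real (N n i) * h n)"
          have uz: "u \<ge> 0" "z \<ge> 0" using h_pos[of n] by (auto simp: u_def z_def)
          have "2 * B\<^sup>2 * (2 * CD * u) + 2 * (4 * Cs0 * (B * z)) \<le> C * (u + z)"
            using uz CD0 Cs0_nonneg B by (simp add: C_def algebra_simps)
          then show "2 * B\<^sup>2 * (2 * CD * h n ^ (2 * p + 2)) + 2 * (4 * Cs0 * (B / (real (N n i) * h n)))
            \<le> C * (h n ^ (2 * p + 2) + 1 / (real (N n i) * h n))" by (simp add: u_def z_def)
        qed
        finally show ?thesis .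
      qed
      have Vb: "ennreal ((f_hat n i t \<omega> - f i t \<omega>)\<^sup>2) \<le> V \<omega>" if \<omega>: "\<omega> \<in> G" for \<omega>
      proof -
        note wp = wG[OF \<omega>] and sp = Gspace[OF \<omega>]
        define R where "R j = f i (T n i j \<omega>) \<omega> - (\<Sum>k\<le>p. D \<omega> k t / fact k * (T n i j \<omega> - t) ^ k)" for j
        have repr: "(\<Sum>j<N n i. lpk_weight p K (h n) (N n i) (\<lambda>j. T n i j \<omega>) t j * (T n i j \<omega> - t) ^ l) = (if l = 0 then 1 else 0)"
          if "l \<le> p" for l using wp that unfolding w_def by blast
        have dec: "f_hat n i t \<omega> - f i t \<omega> = (\<Sum>j<N n i. w j \<omega> * R j) + noise_part \<omega>"
          using lpk_error_decomposition[OF repr, of "\<lambda>j. f i (T n i j \<omega>) \<omega>" "\<lambda>j. e n i j \<omega>" "\<lambda>k. D \<omega> k t / fact k"] \<omega> D(1)[OF sp]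
          unfolding reconstruction_def observation_def R_def noise_part_def Wt_def w_def by simp
        have Rb: "ennreal ((R j)\<^sup>2) \<le> X \<omega>" if j: "j < N n i" "w j \<omega> \<noteq> 0" for j
        proof -
          have "ennreal ((D \<omega> 0 (T n i j \<omega>) - (\<Sum>k\<le>p. D \<omega> k t / fact k * (T n i j \<omega> - t) ^ k))\<^sup>2) \<le>
            ennreal (h n ^ (2 * p + 1)) * (\<integral>\<^sup>+u. ennreal ((D \<omega> (Suc p) u)\<^sup>2) * indicator ({t - h n..t + h n} \<inter> {c<..<d}) u \<partial>lborel)"
            by (rule taylor_remainder_sq) (use D(2,3)[OF sp] p_pos W(6,7)[OF t] Tcd[OF \<omega> j] wp j in auto)
          then show ?thesis unfolding R_def X_def I_def D(1)[OF sp] .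
        qed
        have bias: "ennreal ((\<Sum>j<N n i. w j \<omega> * R j)\<^sup>2) \<le> ennreal (B\<^sup>2) * X \<omega>"
        proof (cases "X \<omega> = \<infinity>")
          case True
          then show ?thesis using B by (simp add: ennreal_mult_top)
        next
          case False
          then obtain z where z: "X \<omega> = ennreal z" "z \<ge> 0" by (cases "X \<omega>") auto
          have Rj: "\<bar>w j \<omega> * R j\<bar> \<le> \<bar>w j \<omega>\<bar> * sqrt z" if "j < N n i" for j
          proof (cases "w j \<omega> = 0")
            case False
            then have "(R j)\<^sup>2 \<le> z" using Rb[OF that] z by simp
            then have "\<bar>R j\<bar> \<le> sqrt z" by (simp add: real_le_rsqrt)
            then show ?thesis by (simp add: abs_mult mult_left_mono)
          qed simp
          have "\<bar>\<Sum>j<N n i. w j \<omega> * R j\<bar> \<le> (\<Sum>j<N n i. \<bar>w j \<omega>\<bar> * sqrt z)"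
            by (rule sum_abs[THEN order_trans]) (intro sum_mono Rj, simp)
          also have "\<dots> \<le> B * sqrt z"
            unfolding sum_distrib_right[symmetric] using wp z(2) by (intro mult_right_mono) auto
          finally have "\<bar>\<Sum>j<N n i. w j \<omega> * R j\<bar>\<^sup>2 \<le> (B * sqrt z)\<^sup>2" by (intro power_mono) auto
          then have "(\<Sum>j<N n i. w j \<omega> * R j)\<^sup>2 \<le> B\<^sup>2 * z" using z(2) by (simp add: power_mult_distrib)
          then show ?thesis unfolding z(1) by (simp add: ennreal_mult'[symmetric] ennreal_leI)
        qed
        have "ennreal ((f_hat n i t \<omega> - f i t \<omega>)\<^sup>2) \<le> ennreal (2 * (\<Sum>j<N n i. w j \<omega> * R j)\<^sup>2 + 2 * (noise_part \<omega>)\<^sup>2)"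
          unfolding dec by (intro ennreal_leI square_sum_le)
        also have "\<dots> = 2 * ennreal ((\<Sum>j<N n i. w j \<omega> * R j)\<^sup>2) + 2 * ennreal ((noise_part \<omega>)\<^sup>2)"
          by (simp add: ennreal_mult')
        also have "\<dots> \<le> 2 * (ennreal (B\<^sup>2) * X \<omega>) + 2 * ennreal ((noise_part \<omega>)\<^sup>2)"
          by (intro add_right_mono mult_left_mono bias) auto
        also have "\<dots> = V \<omega>" by (simp add: V_def ennreal_mult' mult.assoc)
        finally show ?thesis .
      qed
      show ?thesis using Vm VE Vb unfolding G_def by blast
    qed
  qed
  show ?thesis
  proof (rule exI[of _ \<eta>], rule exI[of _ B], rule exI[of _ \<kappa>], rule exI[of _ C], intro conjI allI impI)
    show "prob (space M - good_design n i t \<eta>) \<le> B * exp (- (\<kappa> * (real (N n i) * (h n)\<^sup>2)))"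
      if "t \<in> J" "i < n" "0 < N n i" "h n \<le> h0" for n i t
      using DE that by blast
  qed (use B C0 main in auto)
qed

end

section \<open>Rates of the estimators\<close>

text \<open>A version of \<open>prob {\<omega> \<in> space M. P \<omega>} \<ge> 1 - \<epsilon>\<close> that is monotone in \<open>P\<close> and closed under
  conjunction without any measurability of \<open>P\<close>.\<close>

definition (in prob_space) likely :: "real \<Rightarrow> ('a \<Rightarrow> bool) \<Rightarrow> bool" where
  "likely \<epsilon> P \<longleftrightarrow> (\<exists>A\<in>events. prob (space M - A) \<le> \<epsilon> \<and> (\<forall>\<omega>\<in>A. P \<omega>))"

lemma (in prob_space) likely_event: "A \<in> events \<Longrightarrow> prob (space M - A) \<le> \<epsilon> \<Longrightarrow> likely \<epsilon> (\<lambda>\<omega>. \<omega> \<in> A)"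
  unfolding likely_def by blast

lemma (in prob_space) likely_mono:
  assumes "likely \<epsilon> P" "\<And>\<omega>. P \<omega> \<Longrightarrow> Q \<omega>" "\<epsilon> \<le> \<epsilon>'"
  shows "likely \<epsilon>' Q"
  using assms unfolding likely_def by (meson order_trans)

lemma (in prob_space) likely_conj:
  assumes "likely \<epsilon> P" "likely \<epsilon>' Q"
  shows "likely (\<epsilon> + \<epsilon>') (\<lambda>\<omega>. P \<omega> \<and> Q \<omega>)"
proof -
  from assms(1)[unfolded likely_def] obtain A where A: "A \<in> events" "prob (space M - A) \<le> \<epsilon>" "\<forall>\<omega>\<in>A. P \<omega>"
    by (elim bexE conjE)
  from assms(2)[unfolded likely_def] obtain B where B: "B \<in> events" "prob (space M - B) \<le> \<epsilon>'" "\<forall>\<omega>\<in>B. Q \<omega>"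
    by (elim bexE conjE)
  have "prob (space M - A \<inter> B) \<le> prob (space M - A) + prob (space M - B)"
    unfolding Diff_Int using A B by (intro measure_Un_le) auto
  then show ?thesis unfolding likely_def using A B by (intro bexI[of _ "A \<inter> B"]) auto
qed

lemma (in prob_space) likely_prob_le:
  assumes "likely \<epsilon> P" "\<And>\<omega>. P \<omega> \<Longrightarrow> \<not> Q \<omega>"
  shows "prob {\<omega> \<in> space M. Q \<omega>} \<le> \<epsilon>"
proof -
  from assms(1)[unfolded likely_def] obtain A where A: "A \<in> events" "prob (space M - A) \<le> \<epsilon>" "\<forall>\<omega>\<in>A. P \<omega>"
    by (elim bexE conjE)
  have "prob {\<omega> \<in> space M. Q \<omega>} \<le> prob (space M - A)"
    using A(1,3) assms(2) by (intro finite_measure_mono) auto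
  then show ?thesis using A(2) by simp
qed

text \<open>Markov's inequality for the average of the majorants \<open>V\<close>; one event serves all sequences \<open>y\<close>
  below the majorants.\<close>

lemma (in prob_space) mean_square_Markov:
  assumes V: "\<And>i. i < n \<Longrightarrow> V i \<in> borel_measurable M" "\<And>i. i < n \<Longrightarrow> (\<integral>\<^sup>+\<omega>. V i \<omega> \<partial>M) \<le> ennreal c"
    and c: "c > 0" and eps: "\<epsilon> > 0" and n: "n > 0"
  shows "likely \<epsilon> (\<lambda>\<omega>. \<forall>y. (\<forall>i<n. ennreal ((y i)\<^sup>2) \<le> V i \<omega>) \<longrightarrow> rms n y \<le> sqrt (c / \<epsilon>))"
proof -
  define U where "U \<omega> = ennreal (1 / real n) * (\<Sum>i<n. V i \<omega>)" for \<omega>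
  define A where "A = {\<omega> \<in> space M. U \<omega> \<le> ennreal (c / \<epsilon>)}"
  have Um [measurable]: "U \<in> borel_measurable M" unfolding U_def[abs_def] using V(1) by measurable
  have A: "A \<in> events" unfolding A_def by measurable
  have "(\<integral>\<^sup>+\<omega>. U \<omega> \<partial>M) = ennreal (1 / real n) * (\<Sum>i<n. \<integral>\<^sup>+\<omega>. V i \<omega> \<partial>M)"
    unfolding U_def using nn_integral_sum[of "{..<n}" V M] V(1) by (simp add: nn_integral_cmult)
  also have "\<dots> \<le> ennreal (1 / real n) * (\<Sum>i<n. ennreal c)"
    using V(2) by (intro mult_left_mono sum_mono) auto
  also have "\<dots> = ennreal c"
    using n c by (simp add: ennreal_mult'[symmetric] ennreal_of_nat_eq_real_of_nat)
  finally have UE: "(\<integral>\<^sup>+\<omega>. U \<omega> \<partial>M) \<le> ennreal c" .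
  have "emeasure M (space M - A) \<le> emeasure M {\<omega> \<in> space M. 1 \<le> ennreal (\<epsilon> / c) * U \<omega>}"
  proof (rule emeasure_mono)
    show "space M - A \<subseteq> {\<omega> \<in> space M. 1 \<le> ennreal (\<epsilon> / c) * U \<omega>}"
    proof
      fix \<omega> assume "\<omega> \<in> space M - A"
      then have \<omega>: "\<omega> \<in> space M" "ennreal (c / \<epsilon>) < U \<omega>" by (auto simp: A_def)
      have "1 = ennreal (\<epsilon> / c) * ennreal (c / \<epsilon>)" using c eps by (simp add: ennreal_mult'[symmetric])
      also have "\<dots> \<le> ennreal (\<epsilon> / c) * U \<omega>" using \<omega>(2) by (intro mult_left_mono) auto
      finally show "\<omega> \<in> {\<omega> \<in> space M. 1 \<le> ennreal (\<epsilon> / c) * U \<omega>}" using \<omega>(1) by simp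
    qed
  qed measurable
  also have "\<dots> \<le> ennreal (\<epsilon> / c) * (\<integral>\<^sup>+\<omega>. U \<omega> * indicator (space M) \<omega> \<partial>M)"
    by (rule nn_integral_Markov_inequality) auto
  also have "(\<integral>\<^sup>+\<omega>. U \<omega> * indicator (space M) \<omega> \<partial>M) = (\<integral>\<^sup>+\<omega>. U \<omega> \<partial>M)"
    by (intro nn_integral_cong) simp
  also have "ennreal (\<epsilon> / c) * \<dots> \<le> ennreal (\<epsilon> / c) * ennreal c" by (intro mult_left_mono UE) simp
  also have "\<dots> = ennreal \<epsilon>" using c eps by (simp add: ennreal_mult'[symmetric])
  finally have p: "prob (space M - A) \<le> \<epsilon>" using eps by (simp add: emeasure_eq_measure)
  have "rms n y \<le> sqrt (c / \<epsilon>)"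
    if \<omega>: "\<omega> \<in> A" and y: "\<forall>i<n. ennreal ((y i)\<^sup>2) \<le> V i \<omega>" for \<omega> y
  proof -
    have "ennreal ((\<Sum>i<n. (y i)\<^sup>2) / real n) = ennreal (1 / real n) * (\<Sum>i<n. ennreal ((y i)\<^sup>2))"
      by (simp add: ennreal_mult'[symmetric] sum_nonneg)
    also have "\<dots> \<le> U \<omega>" unfolding U_def using y by (intro mult_left_mono sum_mono) auto
    also have "\<dots> \<le> ennreal (c / \<epsilon>)" using \<omega> by (simp add: A_def)
    finally show ?thesis using c eps by (simp add: ennreal_le_iff rms_def)
  qed
  then show ?thesis using A p unfolding likely_def by blast
qed

lemma (in prob_space) O_UP_I:
  assumes "\<And>\<epsilon>. \<epsilon> > 0 \<Longrightarrow> \<exists>B. \<forall>\<^sub>F n in sequentially. \<forall>i\<in>I n. likely \<epsilon> (\<lambda>\<omega>. norm (Z n i \<omega>) \<le> B)"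
  shows "O_UP M I Z"
  unfolding O_UP_def
proof (intro allI impI)
  fix \<epsilon> :: real assume "\<epsilon> > 0"
  from assms[OF this] obtain B where B: "\<forall>\<^sub>F n in sequentially. \<forall>i\<in>I n. likely \<epsilon> (\<lambda>\<omega>. norm (Z n i \<omega>) \<le> B)"
    by (elim exE)
  show "\<exists>B. \<forall>\<^sub>F n in sequentially. \<forall>i\<in>I n. prob {\<omega> \<in> space M. norm (Z n i \<omega>) > B} \<le> \<epsilon>"
    by (rule exI[of _ B], rule eventually_mono[OF B], rule ballI, rule likely_prob_le, erule bspec) auto
qed

context functional_data
begin

definition rate :: "nat \<Rightarrow> real" where
  "rate n = real n powr (- (real p + 1) * \<delta> / (2 * real p + 3))"

lemma rate_pos: "n > 0 \<Longrightarrow> rate n > 0" and rate_le_1: "n > 0 \<Longrightarrow> rate n \<le> 1"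
proof -
  assume n: "n > 0"
  then show "rate n > 0" by (simp add: rate_def)
  have "- (real p + 1) * \<delta> / (2 * real p + 3) \<le> 0"
    using delta_pos by (intro divide_nonpos_pos mult_nonpos_nonneg) auto
  then have "real n powr (- (real p + 1) * \<delta> / (2 * real p + 3)) \<le> real n powr 0" using n by (intro powr_mono) auto
  then show "rate n \<le> 1" using n by (simp add: rate_def)
qed

text \<open>The bandwidth balances squared bias \<open>h^(2p + 2)\<close> and variance \<open>1 / (N h)\<close>.  With \<open>R = n powr (- \<delta> / (2p + 3))\<close>
  everything is a power of \<open>R\<close>, since \<open>n powr \<delta> = R^(- (2p + 3))\<close>; the last bound makes the
  sum of the exceptional probabilities over the subjects negligible.\<close>

lemma bandwidth_rate:
  "\<exists>C k. C > 0 \<and> k > 0 \<and> (\<forall>\<^sub>F n in sequentially. \<forall>i<n. 0 < N n i \<and>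
    h n ^ (2 * p + 2) + 1 / (real (N n i) * h n) \<le> C * (rate n)\<^sup>2 \<and>
    k * real n powr ((2 * real p + 1) * \<delta> / (2 * real p + 3)) \<le> real (N n i) * (h n)\<^sup>2)"
proof -
  define r where "r n = real n powr (- \<delta> / (2 * real p + 3))" for n :: nat
  from sample_size_bound obtain Cn where Cn: "Cn > 0 \<and> (\<forall>n. \<forall>i<n. real (N n i) \<ge> Cn * real n powr \<delta>)" by (elim exE)
  obtain c2 where c2: "c2 > 0" "\<forall>\<^sub>F n in sequentially. norm (h n) \<le> c2 * norm (r n)"
    using landau_o.bigE[OF bigthetaD1[OF bandwidth]] unfolding r_def by blast
  obtain c1 where c1: "c1 > 0" "\<forall>\<^sub>F n in sequentially. norm (h n) \<ge> c1 * norm (r n)"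
    using landau_omega.bigE[OF bigthetaD2[OF bandwidth]] unfolding r_def by blast
  define C where "C = c2 ^ (2 * p + 2) + 1 / (Cn * c1)"
  define k where "k = Cn * c1\<^sup>2"
  have main: "0 < N n i \<and> h n ^ (2 * p + 2) + 1 / (real (N n i) * h n) \<le> C * (rate n)\<^sup>2 \<and>
      k * real n powr ((2 * real p + 1) * \<delta> / (2 * real p + 3)) \<le> real (N n i) * (h n)\<^sup>2"
    if h2: "norm (h n) \<le> c2 * norm (r n)" and h1: "norm (h n) \<ge> c1 * norm (r n)" and n: "n > 0" and i: "i < n" for n i
  proof -
    define R where "R = r n"
    have R: "R > 0" using n by (simp add: R_def r_def)
    have hR: "h n \<le> c2 * R" "c1 * R \<le> h n" using h1 h2 h_pos[of n] R by (auto simp: R_def)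
    have Rp: "R ^ j = real n powr (real j * (- \<delta> / (2 * real p + 3)))" for j
      unfolding R_def r_def using n by (simp add: powr_power mult.commute)
    have e1: "R ^ (2 * p + 2) = (rate n)\<^sup>2"
    proof -
      have "(rate n)\<^sup>2 = real n powr (2 * (- (real p + 1) * \<delta> / (2 * real p + 3)))"
        unfolding rate_def using n by (simp add: powr_power mult.commute)
      also have "2 * (- (real p + 1) * \<delta> / (2 * real p + 3)) = real (2 * p + 2) * (- \<delta> / (2 * real p + 3))"
      proof -
        have "2 * (- (real p + 1) * \<delta>) = real (2 * p + 2) * (- \<delta>)" by (simp add: algebra_simps)
        then show ?thesis by (simp only: times_divide_eq_right)
      qed
      finally show ?thesis by (simp only: Rp)
    qed
    have e2: "R ^ (2 * p + 3) * real n powr \<delta> = 1"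
    proof -
      have eq: "real (2 * p + 3) * (- \<delta> / (2 * real p + 3)) = - \<delta>" by simp
      show ?thesis unfolding Rp eq powr_minus using n by simp
    qed
    have e3: "R ^ (2 * p + 1) * real n powr ((2 * real p + 1) * \<delta> / (2 * real p + 3)) = 1"
    proof -
      have eq: "real (2 * p + 1) * (- \<delta> / (2 * real p + 3)) = - ((2 * real p + 1) * \<delta> / (2 * real p + 3))" by simp
      show ?thesis unfolding Rp eq powr_minus using n by simp
    qed
    have Nn: "Cn * real n powr \<delta> \<le> real (N n i)" using Cn i by blast
    have nd: "real n powr \<delta> > 0" using n by simp
    then have N0: "0 < real (N n i)" using Nn Cn mult_pos_pos[of Cn "real n powr \<delta>"] by linarith
    have "h n ^ (2 * p + 2) \<le> (c2 * R) ^ (2 * p + 2)" using hR h_pos[of n] by (intro power_mono) auto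
    then have b1: "h n ^ (2 * p + 2) \<le> c2 ^ (2 * p + 2) * (rate n)\<^sup>2" unfolding power_mult_distrib e1 .
    have "(Cn * real n powr \<delta>) * (c1 * R) \<le> real (N n i) * h n"
      using Nn hR R c1 Cn h_pos[of n] by (intro mult_mono) auto
    then have "(Cn * real n powr \<delta>) * (c1 * R) * R ^ (2 * p + 2) \<le> real (N n i) * h n * R ^ (2 * p + 2)"
      by (rule mult_right_mono) (use R in simp)
    moreover have "(Cn * real n powr \<delta>) * (c1 * R) * R ^ (2 * p + 2) = Cn * c1 * (R ^ (2 * p + 3) * real n powr \<delta>)"
      by (simp add: eval_nat_numeral mult_ac)
    ultimately have "Cn * c1 \<le> real (N n i) * h n * R ^ (2 * p + 2)" by (simp only: e2 mult_1_right)
    then have b2: "1 / (real (N n i) * h n) \<le> 1 / (Cn * c1) * (rate n)\<^sup>2"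
      unfolding e1[symmetric] using Cn c1 N0 h_pos[of n] by (simp add: field_simps)
    have "(Cn * real n powr \<delta>) * (c1 * R)\<^sup>2 \<le> real (N n i) * (h n)\<^sup>2"
      using Nn hR R c1 Cn h_pos[of n] by (intro mult_mono power_mono) auto
    moreover have "(Cn * real n powr \<delta>) * (c1 * R)\<^sup>2 = k * real n powr ((2 * real p + 1) * \<delta> / (2 * real p + 3))"
    proof -
      have "(Cn * real n powr \<delta>) * (c1 * R)\<^sup>2 * R ^ (2 * p + 1) = k * (R ^ (2 * p + 3) * real n powr \<delta>)"
        by (simp add: k_def eval_nat_numeral mult_ac)
      also have "\<dots> = k * real n powr ((2 * real p + 1) * \<delta> / (2 * real p + 3)) * R ^ (2 * p + 1)"
        unfolding e2 using e3 by (simp add: mult_ac)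
      finally show ?thesis using R by simp
    qed
    ultimately show ?thesis using N0 b1 b2 by (simp add: C_def distrib_right)
  qed
  have "\<forall>\<^sub>F n in sequentially. \<forall>i<n. 0 < N n i \<and>
    h n ^ (2 * p + 2) + 1 / (real (N n i) * h n) \<le> C * (rate n)\<^sup>2 \<and>
    k * real n powr ((2 * real p + 1) * \<delta> / (2 * real p + 3)) \<le> real (N n i) * (h n)\<^sup>2"
    using c1(2) c2(2) eventually_gt_at_top[of 0] by eventually_elim (use main in blast)
  moreover have "C > 0" "k > 0" using Cn c1 c2 by (auto simp: C_def k_def intro!: add_pos_pos)
  ultimately show ?thesis by blast
qed

lemma linear_times_stretched_exponential:
  assumes "k > 0" "s > 0"
  shows "(\<lambda>n. real n * (B * exp (- (k * real n powr s)))) \<longlonglongrightarrow> 0"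
  using assms by real_asymp

definition close_fit :: "real \<Rightarrow> nat \<Rightarrow> real \<Rightarrow> 'a \<Rightarrow> bool" where
  "close_fit B n t \<omega> \<longleftrightarrow> rms n (\<lambda>i. f_hat n i t \<omega> - f i t \<omega>) \<le> B * rate n \<and>
    rms n (\<lambda>i. f i t \<omega>) \<le> B \<and> rms n (\<lambda>i. norm (x i \<omega>)) \<le> B"

text \<open>The bad designs of all \<open>n\<close> subjects together have probability at most
  \<open>n * B * exp (- \<kappa> k n powr s)\<close> with \<open>s > 0\<close>, which tends to 0.  Off this event Markov's
  inequality applies to the averages of the squared errors, curves and covariates.\<close>

theorem reconstructions_likely_close:
  assumes J: "J \<subseteq> {a<..<b}" "compact J \<or> regular_up_to_boundary M a b p x \<beta> v \<gamma> \<sigma>2 \<pi>" and eps: "\<epsilon>' > 0"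
  shows "\<exists>B\<ge>0. \<forall>\<^sub>F n in sequentially. \<forall>t\<in>J. likely \<epsilon>' (close_fit B n t)"
proof -
  from window_exists[OF J] obtain S c d c1 C1 h0 where W: "window c d c1 C1 h0 J \<and> {c..d} \<subseteq> S \<and> S \<subseteq> {a..b} \<and>
    smooth_model_on S p M x \<beta> v \<gamma> \<sigma>2" by (elim exE)
  then have win: "window c d c1 C1 h0 J" and sub: "{c..d} \<subseteq> S" "S \<subseteq> {a..b}" and smooth: "smooth_model_on S p M x \<beta> v \<gamma> \<sigma>2"
    by simp_all
  have win': "0 < h0" "\<And>t. t \<in> J \<Longrightarrow> t \<in> {c..d}" using win unfolding window_def by (simp, force)
  from one_subject_error[OF win sub smooth] obtain \<eta> Bd \<kappa> Ce where OS': "Bd > 0 \<and> \<kappa> > 0 \<and> Ce \<ge> 0 \<and>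
    (\<forall>n i t. t \<in> J \<longrightarrow> i < n \<longrightarrow> 0 < N n i \<longrightarrow> h n \<le> h0 \<longrightarrow>
      prob (space M - good_design n i t \<eta>) \<le> Bd * exp (- (\<kappa> * (real (N n i) * (h n)\<^sup>2))) \<and>
      (\<exists>V. V \<in> borel_measurable M \<and>
        (\<integral>\<^sup>+\<omega>. V \<omega> \<partial>M) \<le> ennreal (Ce * (h n ^ (2 * p + 2) + 1 / (real (N n i) * h n))) \<and>
        (\<forall>\<omega>\<in>good_design n i t \<eta>. ennreal ((f_hat n i t \<omega> - f i t \<omega>)\<^sup>2) \<le> V \<omega>)))" by (elim exE)
  note OS = conjunct1[OF OS'] conjunct1[OF conjunct2[OF OS']] conjunct1[OF conjunct2[OF conjunct2[OF OS']]]
    conjunct2[OF conjunct2[OF conjunct2[OF OS']], rule_format]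
  from bandwidth_rate obtain Cr k where R': "Cr > 0 \<and> k > 0 \<and> (\<forall>\<^sub>F n in sequentially. \<forall>i<n. 0 < N n i \<and>
    h n ^ (2 * p + 2) + 1 / (real (N n i) * h n) \<le> Cr * (rate n)\<^sup>2 \<and>
    k * real n powr ((2 * real p + 1) * \<delta> / (2 * real p + 3)) \<le> real (N n i) * (h n)\<^sup>2)" by (elim exE)
  note R = conjunct1[OF R'] conjunct1[OF conjunct2[OF R']] conjunct2[OF conjunct2[OF R']]
  from f_second_moment[OF smooth sub] obtain Cf where Cf: "Cf \<ge> 0 \<and>
    (\<forall>i. \<forall>t\<in>{c..d}. (\<integral>\<^sup>+\<omega>. ennreal ((f i t \<omega>)\<^sup>2) \<partial>M) \<le> ennreal Cf)" by (elim exE)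
  define s where "s = (2 * real p + 1) * \<delta> / (2 * real p + 3)"
  have s: "s > 0" using delta_pos by (simp add: s_def)
  (* Four exceptional events: bad designs and one use of Markov's inequality for each of three averages. *)
  define e4 where "e4 = \<epsilon>' / 4"
  have e4: "e4 > 0" using eps by (simp add: e4_def)
  define B where "B = sqrt ((Ce * Cr + 1) / e4) + sqrt ((Cf + 1) / e4) + sqrt ((x_power + 1) / e4)"
  have B0: "0 \<le> sqrt ((Ce * Cr + 1) / e4)" "0 \<le> sqrt ((Cf + 1) / e4)" "0 \<le> sqrt ((x_power + 1) / e4)"
    using OS R Cf x_power_nonneg e4 by auto
  have "(\<lambda>n. real n * (Bd * exp (- (\<kappa> * k * real n powr s)))) \<longlonglongrightarrow> 0"
    using OS R s by (intro linear_times_stretched_exponential) auto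
  from order_tendstoD(2)[OF this e4] have ev1: "\<forall>\<^sub>F n in sequentially. real n * (Bd * exp (- (\<kappa> * k * real n powr s))) < e4" .
  have ev2: "\<forall>\<^sub>F n in sequentially. h n < h0" by (rule order_tendstoD(2)[OF h_limit win'(1)])
  have step: "likely \<epsilon>' (close_fit B n t)"
    if t: "t \<in> J" and n: "n > 0" and small: "real n * (Bd * exp (- (\<kappa> * k * real n powr s))) < e4" and hn: "h n \<le> h0"
      and rt: "\<forall>i<n. 0 < N n i \<and> h n ^ (2 * p + 2) + 1 / (real (N n i) * h n) \<le> Cr * (rate n)\<^sup>2 \<and>
        k * real n powr s \<le> real (N n i) * (h n)\<^sup>2" for n t
  proof -
    have tab: "t \<in> {a..b}" using win'(2)[OF t] sub by blast
    have Ni: "0 < N n i" if "i < n" for i using rt that by simp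
    define G where "G = {\<omega> \<in> space M. \<forall>i<n. \<omega> \<in> good_design n i t \<eta>}"
    have Gc: "space M - G = (\<Union>i<n. space M - good_design n i t \<eta>)" by (auto simp: G_def)
    have gm: "space M - good_design n i t \<eta> \<in> events" if "i < n" for i using good_design_sets[OF that] by auto
    have U: "(\<Union>i<n. space M - good_design n i t \<eta>) \<in> events" by (rule sets.finite_UN) (use gm in auto)
    have "G = space M - (\<Union>i<n. space M - good_design n i t \<eta>)" by (auto simp: G_def)
    then have G: "G \<in> events" using U by (simp only: sets.compl_sets)
    have "prob (space M - G) \<le> (\<Sum>i<n. prob (space M - good_design n i t \<eta>))"
      unfolding Gc by (rule finite_measure_subadditive_finite) (use gm in auto)
    also have "\<dots> \<le> (\<Sum>i<n. Bd * exp (- (\<kappa> * k * real n powr s)))"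
    proof (rule sum_mono)
      fix i assume "i \<in> {..<n}"
      then have i: "i < n" by simp
      have "prob (space M - good_design n i t \<eta>) \<le> Bd * exp (- (\<kappa> * (real (N n i) * (h n)\<^sup>2)))"
        by (rule conjunct1[OF OS(4)[OF t i Ni[OF i] hn]])
      also have "\<dots> \<le> Bd * exp (- (\<kappa> * k * real n powr s))"
      proof -
        have "\<kappa> * (k * real n powr s) \<le> \<kappa> * (real (N n i) * (h n)\<^sup>2)" using rt i OS(2) by (intro mult_left_mono) auto
        then show ?thesis using OS(1) by (simp add: mult.assoc)
      qed
      finally show "prob (space M - good_design n i t \<eta>) \<le> Bd * exp (- (\<kappa> * k * real n powr s))" .
    qed
    also have "\<dots> \<le> e4" using small by simp
    finally have pG: "prob (space M - G) \<le> e4" .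
    have "\<forall>i\<in>{..<n}. \<exists>V. V \<in> borel_measurable M \<and>
        (\<integral>\<^sup>+\<omega>. V \<omega> \<partial>M) \<le> ennreal (Ce * (h n ^ (2 * p + 2) + 1 / (real (N n i) * h n))) \<and>
        (\<forall>\<omega>\<in>good_design n i t \<eta>. ennreal ((f_hat n i t \<omega> - f i t \<omega>)\<^sup>2) \<le> V \<omega>)"
    proof
      fix i assume "i \<in> {..<n}"
      then have i: "i < n" by simp
      show "\<exists>V. V \<in> borel_measurable M \<and>
        (\<integral>\<^sup>+\<omega>. V \<omega> \<partial>M) \<le> ennreal (Ce * (h n ^ (2 * p + 2) + 1 / (real (N n i) * h n))) \<and>
        (\<forall>\<omega>\<in>good_design n i t \<eta>. ennreal ((f_hat n i t \<omega> - f i t \<omega>)\<^sup>2) \<le> V \<omega>)"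
        by (rule conjunct2[OF OS(4)[OF t i Ni[OF i] hn]])
    qed
    from bchoice[OF this] obtain V where V: "\<forall>i\<in>{..<n}. V i \<in> borel_measurable M \<and>
        (\<integral>\<^sup>+\<omega>. V i \<omega> \<partial>M) \<le> ennreal (Ce * (h n ^ (2 * p + 2) + 1 / (real (N n i) * h n))) \<and>
        (\<forall>\<omega>\<in>good_design n i t \<eta>. ennreal ((f_hat n i t \<omega> - f i t \<omega>)\<^sup>2) \<le> V i \<omega>)" by (elim exE)
    have r0: "rate n > 0" by (rule rate_pos[OF n])
    have VE: "(\<integral>\<^sup>+\<omega>. V i \<omega> \<partial>M) \<le> ennreal ((Ce * Cr + 1) * (rate n)\<^sup>2)" if i: "i < n" for i
    proof -
      have "Ce * (h n ^ (2 * p + 2) + 1 / (real (N n i) * h n)) \<le> Ce * (Cr * (rate n)\<^sup>2)"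
        using rt i OS(3) by (intro mult_left_mono) auto
      also have "\<dots> \<le> (Ce * Cr + 1) * (rate n)\<^sup>2" by (simp add: algebra_simps)
      finally show ?thesis using V i by (meson ennreal_leI lessThan_iff order_trans)
    qed
    have A1: "likely e4 (\<lambda>\<omega>. \<forall>y. (\<forall>i<n. ennreal ((y i)\<^sup>2) \<le> V i \<omega>) \<longrightarrow> rms n y \<le> sqrt ((Ce * Cr + 1) * (rate n)\<^sup>2 / e4))"
    proof (rule mean_square_Markov[OF _ VE _ e4 n])
      show "0 < (Ce * Cr + 1) * (rate n)\<^sup>2" using OS(3) R(1) r0 by (intro mult_pos_pos add_nonneg_pos mult_nonneg_nonneg) auto
    qed (use V in auto)
    have A2: "likely e4 (\<lambda>\<omega>. \<forall>y. (\<forall>i<n. ennreal ((y i)\<^sup>2) \<le> ennreal ((f i t \<omega>)\<^sup>2)) \<longrightarrow> rms n y \<le> sqrt ((Cf + 1) / e4))"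
    proof (rule mean_square_Markov[OF _ _ _ e4 n])
      show "(\<lambda>\<omega>. ennreal ((f i t \<omega>)\<^sup>2)) \<in> borel_measurable M" for i using f_measurable[OF tab] by measurable
      show "(\<integral>\<^sup>+\<omega>. ennreal ((f i t \<omega>)\<^sup>2) \<partial>M) \<le> ennreal (Cf + 1)" for i
        using Cf win'(2)[OF t] by (meson ennreal_leI less_add_one less_imp_le order_trans)
    qed (use Cf in auto)
    have A3: "likely e4 (\<lambda>\<omega>. \<forall>y. (\<forall>i<n. ennreal ((y i)\<^sup>2) \<le> ennreal ((norm (x i \<omega>))\<^sup>2)) \<longrightarrow> rms n y \<le> sqrt ((x_power + 1) / e4))"
    proof (rule mean_square_Markov[OF _ _ _ e4 n])
      show "(\<integral>\<^sup>+\<omega>. ennreal ((norm (x i \<omega>))\<^sup>2) \<partial>M) \<le> ennreal (x_power + 1)" for i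
        using x_norm_second[of i] by (subst nn_integral_eq_integral) (auto intro!: ennreal_leI)
    qed (use x_power_nonneg in auto)
    show ?thesis
    proof (rule likely_mono[OF likely_conj[OF likely_conj[OF likely_event[OF G pG] A1] likely_conj[OF A2 A3]]], elim conjE)
      fix \<omega> assume g: "\<omega> \<in> G"
        and a1: "\<forall>y. (\<forall>i<n. ennreal ((y i)\<^sup>2) \<le> V i \<omega>) \<longrightarrow> rms n y \<le> sqrt ((Ce * Cr + 1) * (rate n)\<^sup>2 / e4)"
        and a2: "\<forall>y. (\<forall>i<n. ennreal ((y i)\<^sup>2) \<le> ennreal ((f i t \<omega>)\<^sup>2)) \<longrightarrow> rms n y \<le> sqrt ((Cf + 1) / e4)"
        and a3: "\<forall>y. (\<forall>i<n. ennreal ((y i)\<^sup>2) \<le> ennreal ((norm (x i \<omega>))\<^sup>2)) \<longrightarrow> rms n y \<le> sqrt ((x_power + 1) / e4)"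
      have "rms n (\<lambda>i. f_hat n i t \<omega> - f i t \<omega>) \<le> sqrt ((Ce * Cr + 1) * (rate n)\<^sup>2 / e4)"
        by (rule a1[rule_format]) (use g V in \<open>auto simp: G_def\<close>)
      also have "\<dots> = sqrt ((Ce * Cr + 1) / e4) * rate n"
        using r0 by (simp add: real_sqrt_mult real_sqrt_divide)
      also have "\<dots> \<le> B * rate n" using r0 B0 by (intro mult_right_mono) (auto simp: B_def)
      finally have 1: "rms n (\<lambda>i. f_hat n i t \<omega> - f i t \<omega>) \<le> B * rate n" .
      have "rms n (\<lambda>i. f i t \<omega>) \<le> sqrt ((Cf + 1) / e4)" by (rule a2[rule_format]) simp
      then have 2: "rms n (\<lambda>i. f i t \<omega>) \<le> B" using B0 unfolding B_def by linarith
      have "rms n (\<lambda>i. norm (x i \<omega>)) \<le> sqrt ((x_power + 1) / e4)" by (rule a3[rule_format]) simp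
      then show "close_fit B n t \<omega>" using 1 2 B0 unfolding close_fit_def B_def by linarith
    qed (simp add: e4_def)
  qed
  have "B \<ge> 0" using B0 by (simp add: B_def)
  moreover have "\<forall>\<^sub>F n in sequentially. \<forall>t\<in>J. likely \<epsilon>' (close_fit B n t)"
    using ev1 ev2 R(3) eventually_gt_at_top[of 0]
  proof eventually_elim
    case (elim n)
    show ?case by (intro ballI step) (use elim in \<open>simp_all add: s_def\<close>)
  qed
  ultimately show ?thesis by blast
qed

lemma gram_component_measurable [measurable]:
  "(\<lambda>\<omega>. gram n (\<lambda>i. x i \<omega>) $ k $ l) \<in> borel_measurable M"
  unfolding gram_def by simp

lemma gram_inverse_likely:
  "\<exists>\<kappa>>0. \<forall>\<eta>>0. \<forall>\<epsilon>'>0. \<forall>\<^sub>F n in sequentially. likely \<epsilon>' (\<lambda>\<omega>. inverse_near \<Omega> \<kappa> \<eta> n (\<lambda>i. x i \<omega>))"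
proof -
  from gram_inverse_perturbation[OF Omega_invertible] obtain \<kappa> where \<kappa>: "\<kappa> > 0 \<and> (\<forall>\<eta>>0. \<exists>\<eta>'>0. \<forall>n>0. \<forall>xs.
    (\<forall>k l. \<bar>gram n xs $ k $ l / real n - \<Omega> $ k $ l\<bar> \<le> \<eta>') \<longrightarrow> inverse_near \<Omega> \<kappa> \<eta> n xs)" by (elim exE)
  show ?thesis
  proof (rule exI[of _ \<kappa>], intro conjI allI impI)
    fix \<eta> \<epsilon>' :: real assume eta: "\<eta> > 0" and eps: "\<epsilon>' > 0"
    from conjunct2[OF \<kappa>, rule_format, OF eta] obtain \<eta>' where \<eta>': "\<eta>' > 0 \<and> (\<forall>n>0. \<forall>xs.
      (\<forall>k l. \<bar>gram n xs $ k $ l / real n - \<Omega> $ k $ l\<bar> \<le> \<eta>') \<longrightarrow> inverse_near \<Omega> \<kappa> \<eta> n xs)" by (elim exE)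
    define A where "A n = {\<omega> \<in> space M. \<forall>k l. \<bar>gram n (\<lambda>i. x i \<omega>) $ k $ l / real n - \<Omega> $ k $ l\<bar> \<le> \<eta>'}" for n
    have A: "A n \<in> events" for n unfolding A_def by measurable
    have eq: "space M - A n = {\<omega> \<in> space M. \<not> (\<forall>k l. \<bar>gram n (\<lambda>i. x i \<omega>) $ k $ l / real n - \<Omega> $ k $ l\<bar> \<le> \<eta>')}" for n
      unfolding A_def by blast
    have "\<forall>\<^sub>F n in sequentially. prob (space M - A n) < \<epsilon>'"
      unfolding eq by (rule order_tendstoD(2)[OF gram_LLN[OF conjunct1[OF \<eta>']] eps])
    then show "\<forall>\<^sub>F n in sequentially. likely \<epsilon>' (\<lambda>\<omega>. inverse_near \<Omega> \<kappa> \<eta> n (\<lambda>i. x i \<omega>))"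
      using eventually_gt_at_top[of 0]
    proof eventually_elim
      case (elim n)
      show ?case
        by (rule likely_mono[OF likely_event[OF A less_imp_le[OF elim(1)]] _ order_refl])
          (use \<eta>' elim(2) in \<open>auto simp: A_def\<close>)
    qed
  qed (use \<kappa> in simp)
qed

lemma beta_estimator_error:
  assumes inv: "inverse_near \<Omega> \<kappa> \<eta> n (\<lambda>i. x i \<omega>)" and n: "n > 0" and kap: "\<kappa> > 0" and fit: "close_fit B n t \<omega>"
  shows "norm (beta_estimator x f_hat n t \<omega> - beta_estimator x (\<lambda>n. f) n t \<omega>) \<le> \<kappa> * B\<^sup>2 * rate n"
proof -
  have B0: "0 \<le> B" using fit rms_nonneg[of n "\<lambda>i. norm (x i \<omega>)"] unfolding close_fit_def by linarith
  have "norm (beta_estimator x f_hat n t \<omega> - beta_estimator x (\<lambda>n. f) n t \<omega>) \<le>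
      \<kappa> * rms n (\<lambda>i. norm (x i \<omega>)) * rms n (\<lambda>i. f_hat n i t \<omega> - f i t \<omega>)"
    unfolding beta_estimator_def ls_coef_diff
    by (rule ls_coef_norm_le) (use inv n kap in \<open>auto simp: inverse_near_def\<close>)
  also have "\<dots> \<le> \<kappa> * B * (B * rate n)"
    using fit kap B0 rms_nonneg by (intro mult_mono mult_nonneg_nonneg) (auto simp: close_fit_def)
  finally show ?thesis by (simp add: power2_eq_square mult_ac)
qed

lemma gamma_estimator_error:
  assumes inv: "inverse_near \<Omega> \<kappa> \<eta> n (\<lambda>i. x i \<omega>)" and n: "n > 0" "n \<ge> 2 * CARD('q)"
    and fit: "close_fit B n s \<omega>" "close_fit B n t \<omega>"
  shows "\<bar>gamma_estimator x f_hat n s t \<omega> - gamma_estimator x (\<lambda>n. f) n s t \<omega>\<bar> \<le> 6 * B\<^sup>2 * rate n"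
proof -
  define D where "D t = rms n (\<lambda>i. f_hat n i t \<omega> - f i t \<omega>)" for t
  define F where "F t = rms n (\<lambda>i. f i t \<omega>)" for t
  have pos: "0 \<le> D u" "0 \<le> F u" for u by (simp_all add: D_def F_def rms_nonneg)
  have le: "D s \<le> B * rate n" "D t \<le> B * rate n" "F s \<le> B" "F t \<le> B"
    using fit by (simp_all add: close_fit_def D_def F_def)
  have B0: "0 \<le> B" using le(4) pos(2)[of t] by linarith
  then have "B * rate n \<le> B" using rate_pos[OF n(1)] rate_le_1[OF n(1)] by (simp add: mult_left_le)
  then have "D s * (F t + D t) \<le> (B * rate n) * (B + B)" "F s * D t \<le> B * (B * rate n)"
    using le pos[of s] pos[of t] B0 by (intro mult_mono add_mono; linarith)+
  moreover have "\<bar>gamma_estimator x f_hat n s t \<omega> - gamma_estimator x (\<lambda>n. f) n s t \<omega>\<bar> \<le> 2 * (D s * (F t + D t) + F s * D t)"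
    unfolding gamma_estimator_def D_def F_def
    by (rule cov_estimate_error[OF _ n(2)]) (use inv in \<open>simp add: inverse_near_def\<close>)
  ultimately show ?thesis by (simp add: power2_eq_square algebra_simps)
qed

theorem beta_estimator_rate:
  assumes J: "J \<subseteq> {a<..<b}" "compact J \<or> regular_up_to_boundary M a b p x \<beta> v \<gamma> \<sigma>2 \<pi>"
  shows "\<exists>Z. O_UP M (\<lambda>n. J) Z \<and> (\<forall>n\<ge>1. \<forall>t\<in>J. \<forall>\<omega>\<in>space M.
    beta_estimator x f_hat n t \<omega> = beta_estimator x (\<lambda>n. f) n t \<omega> + rate n *\<^sub>R Z n t \<omega>)"
proof -
  from gram_inverse_likely obtain \<kappa> where \<kappa>: "\<kappa> > 0 \<and> (\<forall>\<eta>>0. \<forall>\<epsilon>'>0. \<forall>\<^sub>F n in sequentially.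
    likely \<epsilon>' (\<lambda>\<omega>. inverse_near \<Omega> \<kappa> \<eta> n (\<lambda>i. x i \<omega>)))" by (elim exE)
  define Z where "Z n t \<omega> = (1 / rate n) *\<^sub>R (beta_estimator x f_hat n t \<omega> - beta_estimator x (\<lambda>n. f) n t \<omega>)" for n t \<omega>
  have "O_UP M (\<lambda>n. J) Z"
  proof (rule O_UP_I)
    fix e :: real assume "e > 0"
    then have e2: "e / 2 > 0" by simp
    have one: "(0 :: real) < 1" by simp
    from reconstructions_likely_close[OF J e2] obtain B where
      B: "B \<ge> 0 \<and> (\<forall>\<^sub>F n in sequentially. \<forall>t\<in>J. likely (e / 2) (close_fit B n t))" by (elim exE)
    show "\<exists>B. \<forall>\<^sub>F n in sequentially. \<forall>t\<in>J. likely e (\<lambda>\<omega>. norm (Z n t \<omega>) \<le> B)"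
    proof (rule exI[of _ "\<kappa> * B\<^sup>2"])
      show "\<forall>\<^sub>F n in sequentially. \<forall>t\<in>J. likely e (\<lambda>\<omega>. norm (Z n t \<omega>) \<le> \<kappa> * B\<^sup>2)"
        using conjunct2[OF B] conjunct2[OF \<kappa>, rule_format, OF one e2] eventually_gt_at_top[of 0]
      proof eventually_elim
        case (elim n)
        show ?case
        proof
          fix t assume "t \<in> J"
          show "likely e (\<lambda>\<omega>. norm (Z n t \<omega>) \<le> \<kappa> * B\<^sup>2)"
          proof (rule likely_mono[OF likely_conj[OF bspec[OF elim(1) \<open>t \<in> J\<close>] elim(2)]], elim conjE)
            fix \<omega> assume "close_fit B n t \<omega>" "inverse_near \<Omega> \<kappa> 1 n (\<lambda>i. x i \<omega>)"
            from beta_estimator_error[OF this(2) elim(3) conjunct1[OF \<kappa>] this(1)]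
            show "norm (Z n t \<omega>) \<le> \<kappa> * B\<^sup>2"
              using rate_pos[OF elim(3)] unfolding Z_def norm_scaleR by (simp add: field_simps)
          qed simp
        qed
      qed
    qed
  qed
  moreover have "beta_estimator x f_hat n t \<omega> = beta_estimator x (\<lambda>n. f) n t \<omega> + rate n *\<^sub>R Z n t \<omega>" if "n \<ge> 1" for n t \<omega>
    using rate_pos[of n] that by (simp add: Z_def)
  ultimately show ?thesis by blast
qed

theorem gamma_estimator_rate:
  assumes J: "J \<subseteq> {a<..<b}" "compact J \<or> regular_up_to_boundary M a b p x \<beta> v \<gamma> \<sigma>2 \<pi>"
  shows "\<exists>Z. O_UP M (\<lambda>n. J \<times> J) Z \<and> (\<forall>n\<ge>1. \<forall>s\<in>J. \<forall>t\<in>J. \<forall>\<omega>\<in>space M.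
    gamma_estimator x f_hat n s t \<omega> = gamma_estimator x (\<lambda>n. f) n s t \<omega> + rate n * Z n (s, t) \<omega>)"
proof -
  from gram_inverse_likely obtain \<kappa> where \<kappa>: "\<kappa> > 0 \<and> (\<forall>\<eta>>0. \<forall>\<epsilon>'>0. \<forall>\<^sub>F n in sequentially.
    likely \<epsilon>' (\<lambda>\<omega>. inverse_near \<Omega> \<kappa> \<eta> n (\<lambda>i. x i \<omega>)))" by (elim exE)
  define Z where "Z n st \<omega> = (gamma_estimator x f_hat n (fst st) (snd st) \<omega> - gamma_estimator x (\<lambda>n. f) n (fst st) (snd st) \<omega>) / rate n" for n st \<omega>
  have "O_UP M (\<lambda>n. J \<times> J) Z"
  proof (rule O_UP_I)
    fix e :: real assume "e > 0"
    then have e3: "e / 3 > 0" by simp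
    have one: "(0 :: real) < 1" by simp
    from reconstructions_likely_close[OF J e3] obtain B where
      B: "B \<ge> 0 \<and> (\<forall>\<^sub>F n in sequentially. \<forall>t\<in>J. likely (e / 3) (close_fit B n t))" by (elim exE)
    show "\<exists>B. \<forall>\<^sub>F n in sequentially. \<forall>st\<in>J \<times> J. likely e (\<lambda>\<omega>. norm (Z n st \<omega>) \<le> B)"
    proof (rule exI[of _ "6 * B\<^sup>2"])
      show "\<forall>\<^sub>F n in sequentially. \<forall>st\<in>J \<times> J. likely e (\<lambda>\<omega>. norm (Z n st \<omega>) \<le> 6 * B\<^sup>2)"
        using conjunct2[OF B] conjunct2[OF \<kappa>, rule_format, OF one e3] eventually_gt_at_top[of 0]
          eventually_ge_at_top[of "2 * CARD('q)"]
      proof eventually_elim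
        case (elim n)
        show ?case
        proof
          fix st assume "st \<in> J \<times> J"
          then obtain s t where st: "st = (s, t)" "s \<in> J" "t \<in> J" by auto
          show "likely e (\<lambda>\<omega>. norm (Z n st \<omega>) \<le> 6 * B\<^sup>2)"
          proof (rule likely_mono[OF likely_conj[OF likely_conj[OF bspec[OF elim(1) st(2)] bspec[OF elim(1) st(3)]] elim(2)]], elim conjE)
            fix \<omega> assume "close_fit B n s \<omega>" "close_fit B n t \<omega>" "inverse_near \<Omega> \<kappa> 1 n (\<lambda>i. x i \<omega>)"
            from gamma_estimator_error[OF this(3) elim(3,4) this(1,2)] show "norm (Z n st \<omega>) \<le> 6 * B\<^sup>2"
              using rate_pos[OF elim(3)] by (simp add: Z_def st field_simps)
          qed simp
        qed
      qed
    qed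
  qed
  moreover have "gamma_estimator x f_hat n s t \<omega> = gamma_estimator x (\<lambda>n. f) n s t \<omega> + rate n * Z n (s, t) \<omega>" if "n \<ge> 1" for n s t \<omega>
    using rate_pos[of n] that by (simp add: Z_def)
  ultimately show ?thesis by blast
qed

end

section \<open>Asymptotic normality\<close>

text \<open>Cramer's rule for invertible matrices; all other matrices have the same, unspecified, value of
  \<open>matrix_inv\<close>.\<close>

lemma borel_measurable_matrix_inv_mult:
  fixes A :: "'a \<Rightarrow> real^'q^'q" and y :: "'a \<Rightarrow> real^'q"
  assumes A [measurable]: "\<And>k l. (\<lambda>\<omega>. A \<omega> $ k $ l) \<in> borel_measurable M"
    and y [measurable]: "\<And>k. (\<lambda>\<omega>. y \<omega> $ k) \<in> borel_measurable M"
  shows "(\<lambda>\<omega>. matrix_inv (A \<omega>) *v y \<omega>) \<in> borel_measurable M"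
proof -
  define D :: "real^'q^'q \<Rightarrow> real" where "D = Determinants.det"
  have D [measurable]: "(\<lambda>\<omega>. D (F \<omega>)) \<in> borel_measurable M"
    if [measurable]: "\<And>k l. (\<lambda>\<omega>. F \<omega> $ k $ l) \<in> borel_measurable M" for F
    unfolding D_def Determinants.det_def by measurable
  define C :: "real^'q^'q" where "C = (SOME A'. False)"
  have eq: "matrix_inv (A \<omega>) *v y \<omega> = (\<chi> k. if D (A \<omega>) \<noteq> 0
      then D (\<chi> i j. if j = k then y \<omega> $ i else A \<omega> $ i $ j) / D (A \<omega>)
      else \<Sum>j\<in>UNIV. C $ k $ j * y \<omega> $ j)" for \<omega>
  proof (cases "D (A \<omega>) = 0")
    case True
    then have "\<not> invertible (A \<omega>)" by (simp add: D_def invertible_det_nz)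
    then have "matrix_inv (A \<omega>) = C" unfolding matrix_inv_def invertible_def C_def by metis
    then show ?thesis using True by (simp add: matrix_vector_mult_def)
  next
    case False
    then have "invertible (A \<omega>)" by (simp add: D_def invertible_det_nz)
    then have "A \<omega> *v (matrix_inv (A \<omega>) *v y \<omega>) = y \<omega>"
      by (simp add: matrix_vector_mul_assoc matrix_inv_mult)
    then show ?thesis using False cramer[of "A \<omega>"] unfolding D_def by simp
  qed
  show ?thesis
    unfolding eq
  proof (rule borel_measurable_vec_lambda)
    fix k
    have [measurable]: "(\<lambda>\<omega>. D (\<chi> i j. if j = k then y \<omega> $ i else A \<omega> $ i $ j)) \<in> borel_measurable M"
    proof (rule D)
      fix i j show "(\<lambda>\<omega>. (\<chi> i j. if j = k then y \<omega> $ i else A \<omega> $ i $ j) $ i $ j) \<in> borel_measurable M"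
        by (cases "j = k") simp_all
    qed
    show "(\<lambda>\<omega>. if D (A \<omega>) \<noteq> 0
        then D (\<chi> i j. if j = k then y \<omega> $ i else A \<omega> $ i $ j) / D (A \<omega>)
        else \<Sum>j\<in>UNIV. C $ k $ j * y \<omega> $ j) \<in> borel_measurable M"
      by measurable
  qed
qed

lemma tendsto_0_if_eventually_le:
  fixes g :: "nat \<Rightarrow> real"
  assumes "\<And>n. g n \<ge> 0" "\<And>e. e > 0 \<Longrightarrow> \<forall>\<^sub>F n in sequentially. g n \<le> e"
  shows "g \<longlonglongrightarrow> 0"
proof (rule order_tendstoI)
  show "\<forall>\<^sub>F n in sequentially. y < g n" if "y < 0" for y
    using that assms(1) by (auto intro!: always_eventually intro: less_le_trans)
  show "\<forall>\<^sub>F n in sequentially. g n < y" if "y > 0" for y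
    using assms(2)[of "y / 2"] that by (auto elim!: eventually_mono)
qed

context functional_data
begin

text \<open>Evaluating a path at a random time is measurable by continuity of the paths.\<close>

lemma f_hat_measurable: "i < n \<Longrightarrow> f_hat n i t \<in> borel_measurable M"
proof -
  assume i: "i < n"
  have cont: "continuous_on {a<..<b} (\<lambda>t. f i t \<omega>)" if "\<omega> \<in> space M" for \<omega>
    by (rule cont_diff_on_continuous[OF smooth_processes[OF smooth_interior that]])
  have "(\<lambda>\<omega>. f i (T n i j \<omega>) \<omega>) \<in> borel_measurable M" if "j < N n i" for j
    by (rule random_time_measurable[where a = a and b = b])
      (use f_measurable cont T_measurable[OF i that] T_range[OF i that] ab in auto)
  then have "(\<lambda>\<omega>. observation x \<beta> v T e n i j \<omega>) \<in> borel_measurable M" if "j < N n i" for j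
    unfolding observation_def using that e_measurable[OF i that] by (intro borel_measurable_add) auto
  then show ?thesis
    unfolding reconstruction_def[abs_def]
    by (intro borel_measurable_lpk kernel_densityD(1)[OF kernel] T_measurable[OF i])
qed

lemma beta_hat_measurable: "beta_estimator x f_hat n t \<in> borel_measurable M"
  unfolding beta_estimator_def[abs_def] ls_coef_def
proof (rule borel_measurable_matrix_inv_mult)
  fix k
  have "(\<lambda>\<omega>. \<Sum>i<n. f_hat n i t \<omega> * x i \<omega> $ k) \<in> borel_measurable M"
    using f_hat_measurable by (intro borel_measurable_sum borel_measurable_times) auto
  then show "(\<lambda>\<omega>. (\<Sum>i<n. f_hat n i t \<omega> *\<^sub>R x i \<omega>) $ k) \<in> borel_measurable M" by simp
qed measurable

lemma path_eval_measurable: "t \<in> {a..b} \<Longrightarrow> (\<lambda>q. q t) \<in> borel_measurable path_space"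
  by (rule measurable_component_singleton)

lemma x_component_integrable: "integrable M (\<lambda>\<omega>. x i \<omega> $ k)"
  by (rule square_integrable_imp_integrable) (use x_second(1)[of i k k] in \<open>auto simp: power2_eq_square\<close>)

lemma Omega_sym: "\<Omega> $ k $ l = \<Omega> $ l $ k"
  unfolding x0_second(2)[symmetric] by (simp add: mult.commute)

text \<open>\<open>\<Omega>\<^sup>-\<^sup>1 \<Omega> \<Omega>\<^sup>-\<^sup>1 = \<Omega>\<^sup>-\<^sup>1\<close> for the symmetric matrix \<open>\<Omega>\<close>: the covariance of
  \<open>\<Omega>\<^sup>-\<^sup>1 x\<close>.\<close>

lemma Omega_inverse_sandwich:
  "(\<Sum>k\<in>UNIV. \<Sum>l\<in>UNIV. matrix_inv \<Omega> $ i $ k * matrix_inv \<Omega> $ j $ l * \<Omega> $ k $ l)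
    = matrix_inv \<Omega> $ i $ j"
proof -
  have "(\<Sum>l\<in>UNIV. matrix_inv \<Omega> $ j $ l * \<Omega> $ k $ l) = (if j = k then 1 else 0)" for k
  proof -
    have "(matrix_inv \<Omega> ** \<Omega>) $ j $ k = (if j = k then 1 else 0)"
      using matrix_inv_mult[OF Omega_invertible] by (simp add: Finite_Cartesian_Product.mat_def)
    then show ?thesis unfolding matrix_matrix_mult_def Omega_sym[of k] by simp
  qed
  then show ?thesis
    by (simp only: mult.assoc sum_distrib_left[symmetric]) (simp add: if_distrib cong: if_cong)
qed

text \<open>Covariate and effect of one subject are independent, so the expectations factor.\<close>

lemma effect_score_moments:
  assumes s: "s \<in> {a..b}" and t: "t \<in> {a..b}"
  shows "integrable M (\<lambda>\<omega>. v i t \<omega> * x i \<omega> $ k)" "expectation (\<lambda>\<omega>. v i t \<omega> * x i \<omega> $ k) = 0"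
    "integrable M (\<lambda>\<omega>. (v i s \<omega> * v i t \<omega>) * (x i \<omega> $ k * x i \<omega> $ l))"
    "expectation (\<lambda>\<omega>. (v i s \<omega> * v i t \<omega>) * (x i \<omega> $ k * x i \<omega> $ l)) = \<gamma> s t * \<Omega> $ k $ l"
proof -
  have g: "(\<lambda>y :: real^'q. y $ k) \<in> borel_measurable borel" by measurable
  note m1 = covariate_effect_product[OF g path_eval_measurable[OF t], of i]
  show "integrable M (\<lambda>\<omega>. v i t \<omega> * x i \<omega> $ k)" "expectation (\<lambda>\<omega>. v i t \<omega> * x i \<omega> $ k) = 0"
    using m1 x_component_integrable[of i k] v_mean[OF t, of i] t by (simp_all add: mult.commute)
  have g2: "(\<lambda>y :: real^'q. y $ k * y $ l) \<in> borel_measurable borel" by measurable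
  have r2: "(\<lambda>q. q s * q t) \<in> borel_measurable path_space"
    using path_eval_measurable[OF s] path_eval_measurable[OF t] by (rule borel_measurable_times)
  note m2 = covariate_effect_product[OF g2 r2, of i]
  show "integrable M (\<lambda>\<omega>. (v i s \<omega> * v i t \<omega>) * (x i \<omega> $ k * x i \<omega> $ l))"
    "expectation (\<lambda>\<omega>. (v i s \<omega> * v i t \<omega>) * (x i \<omega> $ k * x i \<omega> $ l)) = \<gamma> s t * \<Omega> $ k $ l"
    using m2 x_second[of i k l] v_second[OF s t, of i] s t by (simp_all add: mult.commute)
qed

text \<open>The exponent \<open>1 / 2 - (p + 1) * \<delta> / (2 * p + 3)\<close> is negative exactly under the assumption on \<open>\<delta>\<close>.\<close>

lemma sqrt_n_rate:
  assumes "\<delta> > 1 + 1 / (2 * (real p + 1))"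
  shows "(\<lambda>n. sqrt (real n) * rate n) \<longlonglongrightarrow> 0"
proof -
  define r where "r = 1 / 2 + - (real p + 1) * \<delta> / (2 * real p + 3)"
  have "(real p + 1) * (1 + 1 / (2 * (real p + 1))) < (real p + 1) * \<delta>"
    using assms by (intro mult_strict_left_mono) auto
  moreover have "(real p + 1) * (1 + 1 / (2 * (real p + 1))) = (2 * real p + 3) / 2"
    by (simp add: field_simps)
  ultimately have "(2 * real p + 3) / 2 < (real p + 1) * \<delta>" by (simp only:)
  then have "r < 0" by (simp add: r_def field_simps)
  then have "(\<lambda>n. real n powr r) \<longlonglongrightarrow> 0" by (rule tendsto_neg_powr[OF _ filterlim_real_sequentially])
  moreover have "sqrt (real n) * rate n = real n powr r" for n
    unfolding rate_def r_def powr_add by (simp add: powr_half_sqrt)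
  ultimately show ?thesis by simp
qed

lemma score_second_moment:
  assumes t: "t \<in> {a..b}"
  shows "(\<integral>\<^sup>+\<omega>. ennreal ((norm ((1 / sqrt (real n)) *\<^sub>R (\<Sum>i<n. v i t \<omega> *\<^sub>R x i \<omega>)))\<^sup>2) \<partial>M)
    \<le> ennreal (\<Sum>k\<in>UNIV. \<gamma> t t * \<Omega> $ k $ k)"
proof -
  define Y where "Y k i \<omega> = v i t \<omega> * x i \<omega> $ k" for k i \<omega>
  have Y: "integrable M (\<lambda>\<omega>. (\<Sum>i<n. Y k i \<omega>)\<^sup>2) \<and> expectation (\<lambda>\<omega>. (\<Sum>i<n. Y k i \<omega>)\<^sup>2) = real n * (\<gamma> t t * \<Omega> $ k $ k)" for k
  proof (rule iid_sum_second_moment)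
    have "(\<lambda>z. snd z t * fst z $ k) \<in> borel_measurable (borel \<Otimes>\<^sub>M path_space)"
      using measurable_compose[OF measurable_snd path_eval_measurable[OF t]] measurable_compose[OF measurable_fst borel_measurable_vec_nth]
      by (rule borel_measurable_times)
    from subject_functional_iid(1)[OF this] show "indep_vars (\<lambda>_. borel) (Y k) UNIV" using t by (simp add: Y_def[abs_def])
    show "integrable M (Y k i)" "expectation (Y k i) = 0" for i
      unfolding Y_def[abs_def] using effect_score_moments(1,2)[OF t t] by auto
    have "(Y k i \<omega>)\<^sup>2 = (v i t \<omega> * v i t \<omega>) * (x i \<omega> $ k * x i \<omega> $ k)" for i \<omega>
      by (simp add: Y_def power2_eq_square mult_ac)
    then show "integrable M (\<lambda>\<omega>. (Y k i \<omega>)\<^sup>2)" "expectation (\<lambda>\<omega>. (Y k i \<omega>)\<^sup>2) = \<gamma> t t * \<Omega> $ k $ k" for i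
      using effect_score_moments(3,4)[OF t t] by simp_all
  qed
  have sq: "(norm ((1 / sqrt (real n)) *\<^sub>R (\<Sum>i<n. v i t \<omega> *\<^sub>R x i \<omega>)))\<^sup>2 = (\<Sum>k\<in>UNIV. (\<Sum>i<n. Y k i \<omega>)\<^sup>2 / real n)" for \<omega>
  proof -
    have "(norm (y :: real^'q))\<^sup>2 = (\<Sum>k\<in>UNIV. (y $ k)\<^sup>2)" for y
      by (simp add: norm_vec_def L2_set_def sum_nonneg)
    then show ?thesis by (simp add: Y_def power_mult_distrib power_divide sum_divide_distrib)
  qed
  have "(\<integral>\<^sup>+\<omega>. ennreal ((norm ((1 / sqrt (real n)) *\<^sub>R (\<Sum>i<n. v i t \<omega> *\<^sub>R x i \<omega>)))\<^sup>2) \<partial>M) =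
      ennreal (expectation (\<lambda>\<omega>. \<Sum>k\<in>UNIV. (\<Sum>i<n. Y k i \<omega>)\<^sup>2 / real n))"
    unfolding sq by (rule nn_integral_eq_integral) (use Y in \<open>auto intro!: sum_nonneg\<close>)
  also have "expectation (\<lambda>\<omega>. \<Sum>k\<in>UNIV. (\<Sum>i<n. Y k i \<omega>)\<^sup>2 / real n) = (\<Sum>k\<in>UNIV. real n * (\<gamma> t t * \<Omega> $ k $ k) / real n)"
    using Y by simp
  also have "\<dots> \<le> (\<Sum>k\<in>UNIV. \<gamma> t t * \<Omega> $ k $ k)"
  proof (rule sum_mono)
    fix k
    have "\<gamma> t t * \<Omega> $ k $ k = expectation (\<lambda>\<omega>. (v 0 t \<omega> * v 0 t \<omega>) * (x 0 \<omega> $ k * x 0 \<omega> $ k))"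
      by (rule effect_score_moments(4)[OF t t, symmetric])
    also have "\<dots> \<ge> 0" by (rule integral_nonneg_AE) simp
    finally show "real n * (\<gamma> t t * \<Omega> $ k $ k) / real n \<le> \<gamma> t t * \<Omega> $ k $ k"
      by (cases "n = 0") simp_all
  qed
  finally show ?thesis by (simp add: ennreal_leI)
qed

text \<open>The ideal estimator satisfies \<open>sqrt n (\<beta>_tilde - \<beta>) = n G\<^sup>-\<^sup>1 S\<close> for the Gram matrix \<open>G\<close> and the normalized score \<open>S\<close>.
  Since \<open>S\<close> is bounded in probability, \<open>n G\<^sup>-\<^sup>1\<close> may be replaced by \<open>\<Omega>\<^sup>-\<^sup>1\<close>; replacing the
  reconstructed by the true curves costs \<open>sqrt n * rate n\<close>.\<close>

lemma linearization:
  assumes t: "t \<in> {a<..<b}" and del: "\<delta> > 1 + 1 / (2 * (real p + 1))" and r: "r > 0"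
  shows "(\<lambda>n. prob {\<omega> \<in> space M. norm (sqrt (real n) *\<^sub>R (beta_estimator x f_hat n t \<omega> - \<beta> t) -
    matrix_inv \<Omega> *v ((1 / sqrt (real n)) *\<^sub>R (\<Sum>i<n. v i t \<omega> *\<^sub>R x i \<omega>))) > r}) \<longlonglongrightarrow> 0"
proof (rule tendsto_0_if_eventually_le)
  fix e :: real assume e: "e > 0"
  then have e3: "e / 3 > 0" by simp
  have tab: "t \<in> {a..b}" using t by simp
  have J: "{t} \<subseteq> {a<..<b}" "compact {t} \<or> regular_up_to_boundary M a b p x \<beta> v \<gamma> \<sigma>2 \<pi>" using t by auto
  from gram_inverse_likely obtain \<kappa> where \<kappa>: "\<kappa> > 0 \<and> (\<forall>\<eta>>0. \<forall>\<epsilon>'>0. \<forall>\<^sub>F n in sequentially.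
    likely \<epsilon>' (\<lambda>\<omega>. inverse_near \<Omega> \<kappa> \<eta> n (\<lambda>i. x i \<omega>)))" by (elim exE)
  then have kap: "\<kappa> > 0" by simp
  from reconstructions_likely_close[OF J e3] obtain B where
    B: "B \<ge> 0 \<and> (\<forall>\<^sub>F n in sequentially. \<forall>t\<in>{t}. likely (e / 3) (close_fit B n t))" by (elim exE)
  define S where "S n \<omega> = (1 / sqrt (real n)) *\<^sub>R (\<Sum>i<n. v i t \<omega> *\<^sub>R x i \<omega>)" for n \<omega>
  define c where "c = \<bar>\<Sum>k\<in>UNIV. \<gamma> t t * \<Omega> $ k $ k\<bar> + 1"
  have c: "c > 0" by (simp add: c_def)
  define Q where "Q = sqrt (c / (e / 3))"
  have Q: "Q \<ge> 0" using c e by (simp add: Q_def)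
  have Sm: "S n \<in> borel_measurable M" for n
    unfolding S_def[abs_def] using v_measurable[OF tab] by measurable
  have SE: "likely (e / 3) (\<lambda>\<omega>. norm (S n \<omega>) \<le> Q)" for n
  proof -
    have "likely (e / 3) (\<lambda>\<omega>. \<forall>y. (\<forall>i<1. ennreal ((y i)\<^sup>2) \<le> ennreal ((norm (S n \<omega>))\<^sup>2)) \<longrightarrow> rms 1 y \<le> sqrt (c / (e / 3)))"
    proof (rule mean_square_Markov[OF _ _ c e3])
      show "(\<lambda>\<omega>. ennreal ((norm (S n \<omega>))\<^sup>2)) \<in> borel_measurable M" using Sm[of n] by measurable
      show "(\<integral>\<^sup>+\<omega>. ennreal ((norm (S n \<omega>))\<^sup>2) \<partial>M) \<le> ennreal c"
        unfolding S_def by (rule order_trans[OF score_second_moment[OF tab] ennreal_leI]) (simp add: c_def)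
    qed simp
    then show ?thesis
    proof (rule likely_mono[OF _ _ order_refl])
      fix \<omega> assume y: "\<forall>y. (\<forall>i<1. ennreal ((y i)\<^sup>2) \<le> ennreal ((norm (S n \<omega>))\<^sup>2)) \<longrightarrow> rms 1 y \<le> sqrt (c / (e / 3))"
      have "rms 1 (\<lambda>i. norm (S n \<omega>)) \<le> sqrt (c / (e / 3))" by (rule y[rule_format]) simp
      then show "norm (S n \<omega>) \<le> Q" by (simp add: Q_def rms_def)
    qed
  qed
  define \<eta> where "\<eta> = r / (2 * \<kappa> * (Q + 1))"
  have eta: "\<eta> > 0" using kap Q r by (simp add: \<eta>_def)
  have etaQ: "\<kappa> * \<eta> * Q \<le> r / 2"
  proof -
    have "\<kappa> * \<eta> * Q \<le> \<kappa> * (r / (2 * \<kappa> * (Q + 1))) * (Q + 1)"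
      using kap Q r unfolding \<eta>_def by (intro mult_left_mono) auto
    also have "\<dots> = r / 2"
    proof -
      have "\<kappa> * (r / (2 * \<kappa> * Q')) * Q' = r / 2" if "Q' > 0" for Q' using kap that by simp
      then show ?thesis by this (use Q in simp)
    qed
    finally show ?thesis .
  qed
  have "(\<lambda>n. \<kappa> * B\<^sup>2 * (sqrt (real n) * rate n)) \<longlonglongrightarrow> \<kappa> * B\<^sup>2 * 0"
    by (intro tendsto_mult tendsto_const sqrt_n_rate[OF del])
  then have "(\<lambda>n. \<kappa> * B\<^sup>2 * (sqrt (real n) * rate n)) \<longlonglongrightarrow> 0" by simp
  from order_tendstoD(2)[OF this, of "r / 2"] r
  have ev: "\<forall>\<^sub>F n in sequentially. \<kappa> * B\<^sup>2 * (sqrt (real n) * rate n) < r / 2" by simp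
  show "\<forall>\<^sub>F n in sequentially. prob {\<omega> \<in> space M. norm (sqrt (real n) *\<^sub>R (beta_estimator x f_hat n t \<omega> - \<beta> t) -
      matrix_inv \<Omega> *v ((1 / sqrt (real n)) *\<^sub>R (\<Sum>i<n. v i t \<omega> *\<^sub>R x i \<omega>))) > r} \<le> e"
    using conjunct2[OF B] conjunct2[OF \<kappa>, rule_format, OF eta e3] eventually_gt_at_top[of 0] ev
  proof eventually_elim
    case (elim n)
    note good = likely_conj[OF likely_conj[OF bspec[OF elim(1) singletonI] SE[of n]] elim(2)]
    show ?case
      unfolding S_def[symmetric]
    proof (rule likely_prob_le[OF likely_mono[OF good]], elim conjE, unfold not_less)
      fix \<omega> assume fit: "close_fit B n t \<omega>" and SQ: "norm (S n \<omega>) \<le> Q" and inv: "inverse_near \<Omega> \<kappa> \<eta> n (\<lambda>i. x i \<omega>)"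
      (* Split at the ideal estimator bt. *)
      define bt where "bt = beta_estimator x (\<lambda>n. f) n t \<omega>"
      have "norm (beta_estimator x f_hat n t \<omega> - bt) \<le> \<kappa> * B\<^sup>2 * rate n"
        unfolding bt_def by (rule beta_estimator_error[OF inv elim(3) kap fit])
      then have "sqrt (real n) * norm (beta_estimator x f_hat n t \<omega> - bt) \<le> sqrt (real n) * (\<kappa> * B\<^sup>2 * rate n)"
        by (intro mult_left_mono) auto
      then have 1: "norm (sqrt (real n) *\<^sub>R (beta_estimator x f_hat n t \<omega> - bt)) \<le> r / 2"
        using elim(4) by (simp add: mult_ac)
      have "bt = \<beta> t + matrix_inv (gram n (\<lambda>i. x i \<omega>)) *v (\<Sum>i<n. v i t \<omega> *\<^sub>R x i \<omega>)"
        unfolding bt_def beta_estimator_def individual_fun_def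
        by (rule ls_coef_linear_model) (use inv in \<open>simp add: inverse_near_def\<close>)
      also have "(\<Sum>i<n. v i t \<omega> *\<^sub>R x i \<omega>) = sqrt (real n) *\<^sub>R S n \<omega>" using elim(3) by (simp add: S_def)
      finally have "sqrt (real n) *\<^sub>R (bt - \<beta> t) = real n *\<^sub>R (matrix_inv (gram n (\<lambda>i. x i \<omega>)) *v S n \<omega>)"
        by (simp add: matrix_vector_mult_scaleR)
      then have "norm (sqrt (real n) *\<^sub>R (bt - \<beta> t) - matrix_inv \<Omega> *v S n \<omega>) \<le> \<kappa> * \<eta> * norm (S n \<omega>)"
        using inv by (simp add: inverse_near_def)
      also have "\<dots> \<le> \<kappa> * \<eta> * Q" using SQ kap eta by (intro mult_left_mono) auto
      finally have 2: "norm (sqrt (real n) *\<^sub>R (bt - \<beta> t) - matrix_inv \<Omega> *v S n \<omega>) \<le> r / 2" using etaQ by simp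
      have eq: "sqrt (real n) *\<^sub>R (beta_estimator x f_hat n t \<omega> - \<beta> t) - matrix_inv \<Omega> *v S n \<omega> =
          sqrt (real n) *\<^sub>R (beta_estimator x f_hat n t \<omega> - bt) + (sqrt (real n) *\<^sub>R (bt - \<beta> t) - matrix_inv \<Omega> *v S n \<omega>)"
        by (simp add: scaleR_diff_right)
      show "norm (sqrt (real n) *\<^sub>R (beta_estimator x f_hat n t \<omega> - \<beta> t) - matrix_inv \<Omega> *v S n \<omega>) \<le> r"
        unfolding eq by (rule order_trans[OF norm_triangle_mono[OF 1 2]]) simp
    qed simp
  qed
qed simp

text \<open>The multivariate central limit theorem for the vectors \<open>w i k = v i (\<tau> k) *\<^sub>R (\<Omega>\<^sup>-\<^sup>1 *v x i)\<close>; by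
  independence of covariates and effects their covariances factor into \<open>\<gamma> (\<tau> k) (\<tau> l)\<close> and \<open>\<Omega>\<^sup>-\<^sup>1\<close>.\<close>

theorem asymptotic_normality:
  assumes del: "\<delta> > 1 + 1 / (2 * (real p + 1))"
  shows "AGP M {a<..<b} (\<lambda>n t \<omega>. sqrt (real n) *\<^sub>R (beta_estimator x f_hat n t \<omega> - \<beta> t))
    (\<lambda>t. 0) (\<lambda>s t. \<gamma> s t *\<^sub>R matrix_inv \<Omega>)"
  unfolding AGP_def
proof (intro allI impI)
  fix m and \<tau> :: "nat \<Rightarrow> real" assume \<tau>': "\<forall>k<m. \<tau> k \<in> {a<..<b}"
  then have \<tau>: "\<tau> k \<in> {a..b}" if "k < m" for k using that by force
  define P where "P = matrix_inv \<Omega>"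
  define w where "w i k \<omega> = v i (\<tau> k) \<omega> *\<^sub>R (P *v x i \<omega>)" for i k \<omega>
  define X where "X = (\<lambda>n \<omega> k. if k < m then sqrt (real n) *\<^sub>R (beta_estimator x f_hat n (\<tau> k) \<omega> - \<beta> (\<tau> k)) else 0)"
  have Pm [measurable]: "(\<lambda>y. P *v y) \<in> borel_measurable borel"
    by (intro borel_measurable_continuous_onI linear_continuous_on matrix_vector_mul_bounded_linear)
  have wj: "w i k \<omega> $ j = (\<Sum>l\<in>UNIV. P $ j $ l * (v i (\<tau> k) \<omega> * x i \<omega> $ l))" for i k j \<omega>
    by (simp add: w_def matrix_vector_mult_def sum_distrib_left mult_ac)
  have \<Phi>: "(\<lambda>z. \<Sum>k<m. inner (c k) (snd z (\<tau> k) *\<^sub>R (P *v fst z))) \<in> borel_measurable (borel \<Otimes>\<^sub>M path_space)" for c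
  proof (rule borel_measurable_sum)
    fix k assume "k \<in> {..<m}"
    then have [measurable]: "(\<lambda>z. snd z (\<tau> k)) \<in> borel_measurable (borel \<Otimes>\<^sub>M path_space)"
      by (intro measurable_compose[OF measurable_snd path_eval_measurable] \<tau>) simp
    have [measurable]: "(\<lambda>z. P *v fst z) \<in> borel_measurable (borel \<Otimes>\<^sub>M path_space)"
      by (rule measurable_compose[OF measurable_fst Pm])
    show "(\<lambda>z. inner (c k) (snd z (\<tau> k) *\<^sub>R (P *v fst z))) \<in> borel_measurable (borel \<Otimes>\<^sub>M path_space)" by measurable
  qed
  have \<Phi>_eq: "(\<Sum>k<m. inner (c k) (snd (x i \<omega>, path i \<omega>) (\<tau> k) *\<^sub>R (P *v fst (x i \<omega>, path i \<omega>)))) = (\<Sum>k<m. inner (c k) (w i k \<omega>))" for c i \<omega>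
    using \<tau> by (intro sum.cong) (auto simp: w_def)
  have "\<exists>L. gaussian_law m (\<lambda>_. 0) (\<lambda>k l. \<gamma> (\<tau> k) (\<tau> l) *\<^sub>R P) L \<and>
    (\<forall>g :: (nat \<Rightarrow> real^'q) \<Rightarrow> real. continuous_on UNIV g \<longrightarrow> bounded (range g) \<longrightarrow> (\<lambda>n. \<integral>\<omega>. g (X n \<omega>) \<partial>M) \<longlonglongrightarrow> (\<integral>z. g z \<partial>L))"
  proof (rule multivariate_central_limit[where w = w])
    show "prob_space M" by (rule prob_space_axioms)
    show "w i k \<in> borel_measurable M" if "k < m" for i k
      unfolding w_def[abs_def] using v_measurable[OF \<tau>[OF that]] by measurable
    show "indep_vars (\<lambda>_. borel) (\<lambda>i \<omega>. \<Sum>k<m. inner (c k) (w i k \<omega>)) UNIV" for c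
      using subject_functional_iid(1)[OF \<Phi>] unfolding \<Phi>_eq .
    show "distr M borel (\<lambda>\<omega>. \<Sum>k<m. inner (c k) (w i k \<omega>)) = distr M borel (\<lambda>\<omega>. \<Sum>k<m. inner (c k) (w 0 k \<omega>))" for c i
      using subject_functional_iid(2)[OF \<Phi>] unfolding \<Phi>_eq .
    show "integrable M (\<lambda>\<omega>. w 0 k \<omega> $ j) \<and> (\<integral>\<omega>. w 0 k \<omega> $ j \<partial>M) = 0" if "k < m" for k j
      unfolding wj using effect_score_moments(1,2)[OF \<tau>[OF that] \<tau>[OF that], of 0] by simp
    show "integrable M (\<lambda>\<omega>. w 0 k \<omega> $ i * w 0 l \<omega> $ j) \<and>
      (\<integral>\<omega>. w 0 k \<omega> $ i * w 0 l \<omega> $ j \<partial>M) = (\<gamma> (\<tau> k) (\<tau> l) *\<^sub>R P) $ i $ j"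
      if kl: "k < m" "l < m" for k l i j
    proof -
      note mom = effect_score_moments(3,4)[OF \<tau>[OF kl(1)] \<tau>[OF kl(2)], of 0]
      have eq: "w 0 k \<omega> $ i * w 0 l \<omega> $ j = (\<Sum>r\<in>UNIV. \<Sum>q\<in>UNIV. P $ i $ r * P $ j $ q *
          ((v 0 (\<tau> k) \<omega> * v 0 (\<tau> l) \<omega>) * (x 0 \<omega> $ r * x 0 \<omega> $ q)))" for \<omega>
        unfolding wj sum_product by (intro sum.cong refl) (simp add: mult_ac)
      have "(\<integral>\<omega>. w 0 k \<omega> $ i * w 0 l \<omega> $ j \<partial>M) =
          (\<Sum>r\<in>UNIV. \<Sum>q\<in>UNIV. P $ i $ r * P $ j $ q * (\<gamma> (\<tau> k) (\<tau> l) * \<Omega> $ r $ q))"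
        unfolding eq using mom by simp
      also have "\<dots> = \<gamma> (\<tau> k) (\<tau> l) * (\<Sum>r\<in>UNIV. \<Sum>q\<in>UNIV. P $ i $ r * P $ j $ q * \<Omega> $ r $ q)"
        by (simp add: sum_distrib_left mult_ac)
      also have "\<dots> = (\<gamma> (\<tau> k) (\<tau> l) *\<^sub>R P) $ i $ j"
        unfolding P_def Omega_inverse_sandwich by simp
      finally show ?thesis unfolding eq using mom by simp
    qed
    show "X n \<in> borel_measurable M" for n
    proof (rule measurable_coordinatewise_then_product)
      show "(\<lambda>\<omega>. X n \<omega> k) \<in> borel_measurable M" for k
        unfolding X_def using beta_hat_measurable by (cases "k < m") simp_all
    qed
    show "X n \<omega> k = 0" if "k \<ge> m" for n \<omega> k using that by (simp add: X_def)
    show "(\<lambda>n. measure M {\<omega> \<in> space M. norm (X n \<omega> k - (1 / sqrt (real n)) *\<^sub>R (\<Sum>i<n. w i k \<omega>)) > r}) \<longlonglongrightarrow> 0"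
      if k: "k < m" and r: "r > 0" for k r
    proof -
      have "(1 / sqrt (real n)) *\<^sub>R (\<Sum>i<n. w i k \<omega>) = matrix_inv \<Omega> *v ((1 / sqrt (real n)) *\<^sub>R (\<Sum>i<n. v i (\<tau> k) \<omega> *\<^sub>R x i \<omega>))" for n \<omega>
        unfolding w_def P_def
        by (simp add: matrix_vector_mult_scaleR linear_sum[OF matrix_vector_mul_linear])
      then show ?thesis using linearization[OF _ del r, of "\<tau> k"] \<tau>' k by (simp add: X_def)
    qed
  qed
  then show "\<exists>L. gaussian_law m (\<lambda>k. 0) (\<lambda>k l. \<gamma> (\<tau> k) (\<tau> l) *\<^sub>R matrix_inv \<Omega>) L \<and>
      (\<forall>g :: (nat \<Rightarrow> real^'q) \<Rightarrow> real. continuous_on UNIV g \<longrightarrow> bounded (range g) \<longrightarrow>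
        (\<lambda>n. \<integral>\<omega>. g (\<lambda>k. if k < m then sqrt (real n) *\<^sub>R (beta_estimator x f_hat n (\<tau> k) \<omega> - \<beta> (\<tau> k)) else 0) \<partial>M)
          \<longlonglongrightarrow> (\<integral>z. g z \<partial>L))"
    unfolding X_def P_def .
qed

end

theorem theorem6:
  fixes M :: "'a measure" and E :: "'e measure"
    and a b \<delta> :: real and p :: nat
    and x :: "nat \<Rightarrow> 'a \<Rightarrow> real^'q" and \<beta> :: "real \<Rightarrow> real^'q"
    and v :: "nat \<Rightarrow> real \<Rightarrow> 'a \<Rightarrow> real" and \<gamma> :: "real \<Rightarrow> real \<Rightarrow> real"
    and \<epsilon> :: "real \<Rightarrow> 'e \<Rightarrow> real" and \<sigma>2 :: "real \<Rightarrow> real"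
    and N :: "nat \<Rightarrow> nat \<Rightarrow> nat" and T e :: "nat \<Rightarrow> nat \<Rightarrow> nat \<Rightarrow> 'a \<Rightarrow> real"
    and \<pi> K :: "real \<Rightarrow> real" and h :: "nat \<Rightarrow> real" and \<Omega> :: "real^'q^'q"
  assumes "a < b" and "odd p"
    and "functional_linear_model M E a b x v \<gamma> \<epsilon> \<sigma>2 N T e"
    and "condition_A M a b p x \<beta> v \<gamma> \<sigma>2 N T \<pi> K h \<delta>"
    and "condition_B M a b x v \<Omega>"
    and "h \<in> \<Theta>(\<lambda>n. real n powr (- \<delta> / (2 * real p + 3)))"
  shows
    "let f = (\<lambda>n. individual_fun x \<beta> v);
         f_hat = reconstruction p K h N T (observation x \<beta> v T e);
         \<beta>_hat = beta_estimator x f_hat; \<beta>_tilde = beta_estimator x f;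
         \<gamma>_hat = gamma_estimator x f_hat; \<gamma>_tilde = gamma_estimator x f;
         rate = (\<lambda>n. real n powr (- (real p + 1) * \<delta> / (2 * real p + 3)))
     in (\<forall>J \<subseteq> {a<..<b}. compact J \<or> regular_up_to_boundary M a b p x \<beta> v \<gamma> \<sigma>2 \<pi> \<longrightarrow>
           (\<exists>Z. O_UP M (\<lambda>n. J) Z \<and>
             (\<forall>n\<ge>1. \<forall>t\<in>J. \<forall>\<omega>\<in>space M. \<beta>_hat n t \<omega> = \<beta>_tilde n t \<omega> + rate n *\<^sub>R Z n t \<omega>)) \<and>
           (\<exists>Z. O_UP M (\<lambda>n. J \<times> J) Z \<and>
             (\<forall>n\<ge>1. \<forall>s\<in>J. \<forall>t\<in>J. \<forall>\<omega>\<in>space M.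
               \<gamma>_hat n s t \<omega> = \<gamma>_tilde n s t \<omega> + rate n * Z n (s, t) \<omega>))) \<and>
        (\<delta> > 1 + 1 / (2 * (real p + 1)) \<longrightarrow>
           AGP M {a<..<b} (\<lambda>n t \<omega>. sqrt (real n) *\<^sub>R (\<beta>_hat n t \<omega> - \<beta> t))
             (\<lambda>t. 0) (\<lambda>s t. \<gamma> s t *\<^sub>R matrix_inv \<Omega>))"
proof -
  interpret functional_data M E a b \<delta> p x \<beta> v \<gamma> \<epsilon> \<sigma>2 N T e \<pi> K h \<Omega>
    using assms by unfold_locales
  show ?thesis
    unfolding Let_def rate_def[symmetric]
    by (intro conjI allI impI beta_estimator_rate gamma_estimator_rate asymptotic_normality)
qed

end
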